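(* Let $p>1$, $q>p-1$ and $q>1$, and let $l\ge\frac{2qp^2}{q-p+1}$. There exists a constant $\gamma>0$ depending only on the data ($K_1,K_2,p,q,N$) and $l$ such that the following holds. Let $u$ be a locally bounded, local, weak solution in $\Omega_T$ to $\partial_t(|u|^{q-1}u)-\operatorname{div}\mathbf{A}(x,t,u,Du)=0$, with $\mathbf{A}$ as in the context. Let $Q_{r,t-s}(y,t):=B_r(y)\times(s,t)\subset\Omega_T$, and let $\mu^-,\mu^+\in\mathbb R$ satisfy $\mu^-\le u\le\mu^+$ in $Q_{r,t-s}(y,t)$. Then for all $\delta,\sigma\in(0,1)$ and every $\zeta\in C^1_0(B_r(y))$ such that $\zeta=1$ in $B_{r(1-\sigma)}(y)$, $0\le\zeta\le1$, $|D\zeta|\le\frac1{\sigma r}$, both for the upper choice of signs and for the lower choice of signs, $$\sup_{s\le\tau\le t}\frac{1}{|B_r(y)|}\int_{B_r(y)\times\{\tau\}}\pm\big(|\mu^{\pm}|^{q-1}\mu^{\pm}-|u|^{q-1}u\big)\zeta^l\,dx$$ $$\le\frac1{1-\delta}\inf_{s\le\tau\le t}\frac{1}{|B_r(y)|}\int_{B_r(y)\times\{\tau\}}\pm\big(|\mu^{\pm}|^{q-1}\mu^{\pm}-|u|^{q-1}u\big)\zeta^l\,dx+\frac{\gamma}{(1-\delta)\delta^\gamma\sigma^\gamma}\Big(\frac{t-s}{r^p}\Big)^{\frac q{q-p+1}}.$$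
   Context: $\Omega\subset\mathbb{R}^N$ is open, $T>0$, $\Omega_T:=\Omega\times(0,T)$. The function $\mathbf{A}:\Omega_T\times\mathbb{R}^{N+1}\to\mathbb{R}^N$ is such that $\mathbf{A}(\cdot,\cdot,u,\xi)$ is Lebesgue measurable for all $u\in\mathbb{R}$, $\xi\in\mathbb{R}^N$, $\mathbf{A}(x,t,\cdot,\cdot)$ is continuous for almost all $(x,t)\in\Omega_T$, and for all $u\in\mathbb R$, $\xi\in\mathbb R^N$ and a.e. $(x,t)$ $$\mathbf{A}(x,t,u,\xi)\cdot\xi\ge K_1|\xi|^p,\qquad |\mathbf{A}(x,t,u,\xi)|\le K_2|\xi|^{p-1},$$ with positive constants $K_1,K_2$. The numbers $K_1,K_2,p,q,N$ are called the data. A function $u\in C_{loc}(0,T;L^{q+1}_{loc}(\Omega))\cap L^p_{loc}(0,T;W^{1,p}_{loc}(\Omega))$ is a local, weak sub(super)-solution of the equation in $\Omega_T$ if for every compact $E\subset\Omega$ and every sub-interval $[t_1,t_2]\subset(0,T]$ $$\int_E|u|^{q-1}u\,\zeta\,dx\Big|_{t_1}^{t_2}+\int_{t_1}^{t_2}\int_E\big\{-|u|^{q-1}u\,\zeta_t+\mathbf{A}(x,\tau,u,Du)\cdot D\zeta\big\}\,dx\,d\tau\le(\ge)\,0$$ for all non-negative test functions $\zeta\in W^{1,q+1}_{loc}(0,T;L^{q+1}(E))\cap L^p_{loc}(0,T;W^{1,p}_0(E))$. A local weak solution is a function that is both a local weak sub-solution and a local weak super-solution.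
   Formalization: No C^1_0 cut-off with ζ=1 in B_{r(1-σ)} can satisfy |Dζ| ≤ 1/(σr); the formal statement assumes |Dζ| ≤ c/(σr) for any fixed c>0, with γ depending also on c. Sup and inf omit the times 0 or T where u has no slice. *)

theory Defs
  imports "HOL-Analysis.Analysis"
begin

section \<open>Classical differentiability\<close>

definition grad :: "('a::euclidean_space \<Rightarrow> real) \<Rightarrow> 'a \<Rightarrow> 'a" where
  "grad f x = (\<Sum>b\<in>Basis. frechet_derivative f (at x) b *\<^sub>R b)"

primrec C_k :: "nat \<Rightarrow> ('a::euclidean_space \<Rightarrow> real) \<Rightarrow> bool" where
  "C_k 0 f \<longleftrightarrow> continuous_on UNIV f"
| "C_k (Suc k) f \<longleftrightarrow> f differentiable_on UNIV \<and>
     (\<forall>b\<in>Basis. C_k k (\<lambda>x. frechet_derivative f (at x) b))"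

definition compact_support_in :: "('a::euclidean_space \<Rightarrow> real) \<Rightarrow> 'a set \<Rightarrow> bool" where
  "compact_support_in f U \<longleftrightarrow> compact (closure {x. f x \<noteq> 0}) \<and> closure {x. f x \<noteq> 0} \<subseteq> U"

text \<open>Functions with compact support in an open set are identified with their extension by zero.\<close>

definition C1_0 :: "'a::euclidean_space set \<Rightarrow> ('a \<Rightarrow> real) set" where
  "C1_0 U = {f. C_k 1 f \<and> compact_support_in f U}"

definition Cinf_0 :: "'a::euclidean_space set \<Rightarrow> ('a \<Rightarrow> real) set" where
  "Cinf_0 U = {f. (\<forall>k. C_k k f) \<and> compact_support_in f U}"

section \<open>Lebesgue and Sobolev spaces\<close>

definition in_Lp :: "real \<Rightarrow> 'a::euclidean_space set \<Rightarrow> ('a \<Rightarrow> 'b::euclidean_space) \<Rightarrow> bool" where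
  "in_Lp p E f \<longleftrightarrow> f \<in> borel_measurable (lebesgue_on E) \<and>
     integrable (lebesgue_on E) (\<lambda>x. norm (f x) powr p)"

text \<open>\<open>weak_gradient \<Omega> f g\<close>: the function \<open>g\<close> is the distributional gradient of \<open>f\<close> in \<open>\<Omega>\<close>.\<close>

definition weak_gradient :: "'a::euclidean_space set \<Rightarrow> ('a \<Rightarrow> real) \<Rightarrow> ('a \<Rightarrow> 'a) \<Rightarrow> bool" where
  "weak_gradient \<Omega> f g \<longleftrightarrow>
     (\<forall>E. compact E \<and> E \<subseteq> \<Omega> \<longrightarrow> integrable (lebesgue_on E) f \<and> integrable (lebesgue_on E) g) \<and>
     (\<forall>\<phi>\<in>Cinf_0 \<Omega>. \<forall>b\<in>Basis.
        (LINT x|lebesgue_on \<Omega>. f x * (grad \<phi> x \<bullet> b)) = - (LINT x|lebesgue_on \<Omega>. (g x \<bullet> b) * \<phi> x))"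

text \<open>In the following predicates the last argument is the weak derivative of the preceding one;
  it is unique up to null sets.\<close>

definition W1p_loc :: "real \<Rightarrow> 'a::euclidean_space set \<Rightarrow> ('a \<Rightarrow> real) \<Rightarrow> ('a \<Rightarrow> 'a) \<Rightarrow> bool" where
  "W1p_loc p \<Omega> f g \<longleftrightarrow>
     (\<forall>E. compact E \<and> E \<subseteq> \<Omega> \<longrightarrow> in_Lp p E f \<and> in_Lp p E g) \<and> weak_gradient \<Omega> f g"

text \<open>For compact \<open>E\<close>, \<open>W\<^sup>1\<^sup>,\<^sup>p\<^sub>0(E)\<close> is the closure, in the \<open>W\<^sup>1\<^sup>,\<^sup>p\<close>-norm, of the smooth functions with
  compact support in the interior of \<open>E\<close>. The norm is taken over all of \<open>E\<close>, so that \<open>f\<close> and \<open>g\<close>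
  vanish almost everywhere on the boundary of \<open>E\<close>, even if the boundary has positive measure.\<close>

definition W1p_0 :: "real \<Rightarrow> 'a::euclidean_space set \<Rightarrow> ('a \<Rightarrow> real) \<Rightarrow> ('a \<Rightarrow> 'a) \<Rightarrow> bool" where
  "W1p_0 p E f g \<longleftrightarrow> in_Lp p E f \<and> in_Lp p E g \<and>
     (\<exists>\<phi>::nat \<Rightarrow> 'a \<Rightarrow> real. (\<forall>n. \<phi> n \<in> Cinf_0 (interior E)) \<and>
        (\<lambda>n. LINT x|lebesgue_on E. \<bar>\<phi> n x - f x\<bar> powr p) \<longlonglongrightarrow> 0 \<and>
        (\<lambda>n. LINT x|lebesgue_on E. norm (grad (\<phi> n) x - g x) powr p) \<longlonglongrightarrow> 0)"

section \<open>Spaces of time-dependent functions\<close>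

text \<open>Functions of space and time are functions on pairs \<open>(x, t)\<close>, and \<open>J\<close> is an interval of times.
  The subscript \<open>loc\<close> in time refers to the compact intervals \<open>[t1, t2]\<close> contained in \<open>J\<close>. On a
  cylinder over \<open>(0, T)\<close>, \<open>J\<close> is \<open>(0, T)\<close>, or \<open>(0, T]\<close> for functions that are also defined and regular
  at the time \<open>T\<close>. An element of a Bochner space is represented by a jointly measurable function.\<close>

definition C_loc_Lp :: "real \<Rightarrow> real set \<Rightarrow> 'a::euclidean_space set \<Rightarrow> ('a \<times> real \<Rightarrow> real) \<Rightarrow> bool" where
  "C_loc_Lp m J E f \<longleftrightarrow> (\<forall>t\<in>J. in_Lp m E (\<lambda>x. f (x, t))) \<and>
     (\<forall>t0\<in>J. ((\<lambda>t. LINT x|lebesgue_on E. \<bar>f (x, t) - f (x, t0)\<bar> powr m) \<longlongrightarrow> 0) (at t0 within J))"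

definition C_loc_Lp_loc :: "real \<Rightarrow> real set \<Rightarrow> 'a::euclidean_space set \<Rightarrow> ('a \<times> real \<Rightarrow> real) \<Rightarrow> bool" where
  "C_loc_Lp_loc m J \<Omega> u \<longleftrightarrow> (\<forall>E. compact E \<and> E \<subseteq> \<Omega> \<longrightarrow> C_loc_Lp m J E u)"

definition Lp_loc_Lp :: "real \<Rightarrow> real set \<Rightarrow> 'a::euclidean_space set \<Rightarrow> ('a \<times> real \<Rightarrow> 'b::euclidean_space) \<Rightarrow> bool" where
  "Lp_loc_Lp p J E f \<longleftrightarrow> (\<forall>t1 t2. {t1..t2} \<subseteq> J \<longrightarrow> in_Lp p (E \<times> {t1..t2}) f)"

definition Lp_loc_W1p_loc ::
  "real \<Rightarrow> real set \<Rightarrow> 'a::euclidean_space set \<Rightarrow> ('a \<times> real \<Rightarrow> real) \<Rightarrow> ('a \<times> real \<Rightarrow> 'a) \<Rightarrow> bool" where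
  "Lp_loc_W1p_loc p J \<Omega> u Du \<longleftrightarrow>
     (\<forall>E. compact E \<and> E \<subseteq> \<Omega> \<longrightarrow> Lp_loc_Lp p J E u \<and> Lp_loc_Lp p J E Du) \<and>
     (AE t in lebesgue_on J. W1p_loc p \<Omega> (\<lambda>x. u (x, t)) (\<lambda>x. Du (x, t)))"

definition Lp_loc_W1p_0 ::
  "real \<Rightarrow> real set \<Rightarrow> 'a::euclidean_space set \<Rightarrow> ('a \<times> real \<Rightarrow> real) \<Rightarrow> ('a \<times> real \<Rightarrow> 'a) \<Rightarrow> bool" where
  "Lp_loc_W1p_0 p J E \<zeta> D\<zeta> \<longleftrightarrow> Lp_loc_Lp p J E \<zeta> \<and> Lp_loc_Lp p J E D\<zeta> \<and>
     (AE t in lebesgue_on J. W1p_0 p E (\<lambda>x. \<zeta> (x, t)) (\<lambda>x. D\<zeta> (x, t)))"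

text \<open>\<open>W\<^sup>1\<^sup>,\<^sup>m\<^sub>l\<^sub>o\<^sub>c(J; L\<^sup>m(E))\<close>: the weak time derivative is that of vector-valued distributions, the
  identity between elements of \<open>L\<^sup>m(E)\<close> being read almost everywhere in \<open>E\<close>. Every element has a
  representative in \<open>C(J; L\<^sup>m(E))\<close>; we require \<open>\<zeta>\<close> to be one, because its values at single times
  enter the definition of a solution.\<close>

definition W1m_loc_Lm ::
  "real \<Rightarrow> real set \<Rightarrow> 'a::euclidean_space set \<Rightarrow> ('a \<times> real \<Rightarrow> real) \<Rightarrow> ('a \<times> real \<Rightarrow> real) \<Rightarrow> bool" where
  "W1m_loc_Lm m J E \<zeta> \<zeta>t \<longleftrightarrow> Lp_loc_Lp m J E \<zeta> \<and> Lp_loc_Lp m J E \<zeta>t \<and> C_loc_Lp m J E \<zeta> \<and>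
     (\<forall>\<psi>\<in>Cinf_0 (interior J). AE x in lebesgue_on E.
        (LINT \<tau>|lebesgue_on J. \<zeta> (x, \<tau>) * deriv \<psi> \<tau>) = - (LINT \<tau>|lebesgue_on J. \<zeta>t (x, \<tau>) * \<psi> \<tau>))"

section \<open>The equation\<close>

definition structure_conditions ::
  "real \<Rightarrow> real \<Rightarrow> real \<Rightarrow> 'a::euclidean_space set \<Rightarrow> real \<Rightarrow> ('a \<times> real \<Rightarrow> real \<Rightarrow> 'a \<Rightarrow> 'a) \<Rightarrow> bool" where
  "structure_conditions K1 K2 p \<Omega> T A \<longleftrightarrow>
     (\<forall>v \<xi>. (\<lambda>z. A z v \<xi>) \<in> borel_measurable (lebesgue_on (\<Omega> \<times> {0<..<T}))) \<and>
     (AE z in lebesgue_on (\<Omega> \<times> {0<..<T}). continuous_on UNIV (\<lambda>(v, \<xi>). A z v \<xi>)) \<and>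
     (\<forall>v \<xi>. AE z in lebesgue_on (\<Omega> \<times> {0<..<T}).
        A z v \<xi> \<bullet> \<xi> \<ge> K1 * norm \<xi> powr p \<and> norm (A z v \<xi>) \<le> K2 * norm \<xi> powr (p - 1))"

text \<open>The signed power \<open>|v|\<^sup>q\<^sup>-\<^sup>1 v\<close>.\<close>

definition spow :: "real \<Rightarrow> real \<Rightarrow> real" where
  "spow q v = \<bar>v\<bar> powr (q - 1) * v"

definition weak_form ::
  "real \<Rightarrow> ('a::euclidean_space \<times> real \<Rightarrow> real \<Rightarrow> 'a \<Rightarrow> 'a) \<Rightarrow> ('a \<times> real \<Rightarrow> real) \<Rightarrow> ('a \<times> real \<Rightarrow> 'a) \<Rightarrow>
   'a set \<Rightarrow> real \<Rightarrow> real \<Rightarrow> ('a \<times> real \<Rightarrow> real) \<Rightarrow> ('a \<times> real \<Rightarrow> real) \<Rightarrow> ('a \<times> real \<Rightarrow> 'a) \<Rightarrow> real" where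
  "weak_form q A u Du E t1 t2 \<zeta> \<zeta>t D\<zeta> =
     (LINT x|lebesgue_on E. spow q (u (x, t2)) * \<zeta> (x, t2)) -
     (LINT x|lebesgue_on E. spow q (u (x, t1)) * \<zeta> (x, t1)) +
     (LINT z|lebesgue_on (E \<times> {t1..t2}). - spow q (u z) * \<zeta>t z + A z (u z) (Du z) \<bullet> D\<zeta> z)"

definition test_function ::
  "real \<Rightarrow> real \<Rightarrow> real set \<Rightarrow> 'a::euclidean_space set \<Rightarrow>
   ('a \<times> real \<Rightarrow> real) \<Rightarrow> ('a \<times> real \<Rightarrow> real) \<Rightarrow> ('a \<times> real \<Rightarrow> 'a) \<Rightarrow> bool" where
  "test_function p q J E \<zeta> \<zeta>t D\<zeta> \<longleftrightarrow>
     W1m_loc_Lm (q + 1) J E \<zeta> \<zeta>t \<and> Lp_loc_W1p_0 p J E \<zeta> D\<zeta> \<and>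
     (AE z in lebesgue_on (E \<times> J). 0 \<le> \<zeta> z)"

definition weak_sub_solution ::
  "real \<Rightarrow> real \<Rightarrow> 'a::euclidean_space set \<Rightarrow> real set \<Rightarrow> ('a \<times> real \<Rightarrow> real \<Rightarrow> 'a \<Rightarrow> 'a) \<Rightarrow>
   ('a \<times> real \<Rightarrow> real) \<Rightarrow> bool" where
  "weak_sub_solution p q \<Omega> J A u \<longleftrightarrow> C_loc_Lp_loc (q + 1) J \<Omega> u \<and>
     (\<exists>Du. Lp_loc_W1p_loc p J \<Omega> u Du \<and>
        (\<forall>E t1 t2 \<zeta> \<zeta>t D\<zeta>. compact E \<and> E \<subseteq> \<Omega> \<and> t1 \<le> t2 \<and> {t1..t2} \<subseteq> J \<and> test_function p q J E \<zeta> \<zeta>t D\<zeta>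
           \<longrightarrow> weak_form q A u Du E t1 t2 \<zeta> \<zeta>t D\<zeta> \<le> 0))"

definition weak_super_solution ::
  "real \<Rightarrow> real \<Rightarrow> 'a::euclidean_space set \<Rightarrow> real set \<Rightarrow> ('a \<times> real \<Rightarrow> real \<Rightarrow> 'a \<Rightarrow> 'a) \<Rightarrow>
   ('a \<times> real \<Rightarrow> real) \<Rightarrow> bool" where
  "weak_super_solution p q \<Omega> J A u \<longleftrightarrow> C_loc_Lp_loc (q + 1) J \<Omega> u \<and>
     (\<exists>Du. Lp_loc_W1p_loc p J \<Omega> u Du \<and>
        (\<forall>E t1 t2 \<zeta> \<zeta>t D\<zeta>. compact E \<and> E \<subseteq> \<Omega> \<and> t1 \<le> t2 \<and> {t1..t2} \<subseteq> J \<and> test_function p q J E \<zeta> \<zeta>t D\<zeta>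
           \<longrightarrow> weak_form q A u Du E t1 t2 \<zeta> \<zeta>t D\<zeta> \<ge> 0))"

definition weak_solution ::
  "real \<Rightarrow> real \<Rightarrow> 'a::euclidean_space set \<Rightarrow> real set \<Rightarrow> ('a \<times> real \<Rightarrow> real \<Rightarrow> 'a \<Rightarrow> 'a) \<Rightarrow>
   ('a \<times> real \<Rightarrow> real) \<Rightarrow> bool" where
  "weak_solution p q \<Omega> J A u \<longleftrightarrow> weak_sub_solution p q \<Omega> J A u \<and> weak_super_solution p q \<Omega> J A u"

definition locally_bounded :: "'a::euclidean_space set \<Rightarrow> ('a \<Rightarrow> real) \<Rightarrow> bool" where
  "locally_bounded S u \<longleftrightarrow>
     (\<forall>K. compact K \<and> K \<subseteq> S \<longrightarrow> (\<exists>M. AE z in lebesgue_on K. \<bar>u z\<bar> \<le> M))"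

text \<open>The gradient bound carries a factor \<open>c\<close>. With \<open>c = 1\<close> it is the bound
  \<open>|D\<zeta>| \<le> 1/(\<sigma> r)\<close>, which no \<open>\<zeta>\<close> satisfies: on a ray from \<open>y\<close>, \<open>\<zeta>\<close> has to fall from 1 at
  distance \<open>(1 - \<sigma>) r\<close> to 0 at some distance less than \<open>r\<close>. For every \<open>c > 1\<close> there are such
  functions.\<close>

definition cutoff :: "real \<Rightarrow> 'a::euclidean_space \<Rightarrow> real \<Rightarrow> real \<Rightarrow> ('a \<Rightarrow> real) \<Rightarrow> bool" where
  "cutoff c y r \<sigma> \<zeta> \<longleftrightarrow> \<zeta> \<in> C1_0 (ball y r) \<and> (\<forall>x\<in>ball y (r * (1 - \<sigma>)). \<zeta> x = 1) \<and>
     (\<forall>x. 0 \<le> \<zeta> x \<and> \<zeta> x \<le> 1) \<and> (\<forall>x. norm (grad \<zeta> x) \<le> c / (\<sigma> * r))"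

text \<open>The mean value over \<open>B\<^sub>r(y)\<close>, at time \<open>\<tau>\<close>, of \<open>e (|\<mu>|\<^sup>q\<^sup>-\<^sup>1 \<mu> - |u|\<^sup>q\<^sup>-\<^sup>1 u) \<zeta>\<^sup>l\<close>, where \<open>e\<close> is a sign.\<close>

definition slice_mean ::
  "real \<Rightarrow> real \<Rightarrow> ('a::euclidean_space \<times> real \<Rightarrow> real) \<Rightarrow> 'a \<Rightarrow> real \<Rightarrow> ('a \<Rightarrow> real) \<Rightarrow>
   real \<Rightarrow> real \<Rightarrow> real \<Rightarrow> real" where
  "slice_mean q l u y r \<zeta> e \<mu> \<tau> =
     1 / measure lebesgue (ball y r) *
     (LINT x|lebesgue_on (ball y r). e * (spow q \<mu> - spow q (u (x, \<tau>))) * \<zeta> x powr l)"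

end

theory Submission
  imports Defs
begin

text \<open>Write \<open>v = \<plusminus>(\<mu> - u) \<ge> 0\<close> and \<open>w = \<plusminus>(|\<mu>|^{q-1}\<mu> - |u|^{q-1}u) \<ge> 2^{-q} v^q\<close>, let \<open>I(\<tau>)\<close> be the mean of
\<open>w \<zeta>^l\<close> over the ball \<open>B\<close> at time \<open>\<tau>\<close>, and let \<open>S = sup I\<close>. Testing the inequalities for sub- and
super-solutions with \<open>\<zeta>^l\<close>, which does not depend on time, gives
\<open>|B| |I(\<tau>1) - I(\<tau>2)| \<le> K2 Y\<close> for any two times, where \<open>Y = \<integral>\<integral> |Du|^{p-1} |D\<zeta>^l| dx dt\<close>.
Therefore it is enough to show \<open>K2 Y \<le> |B| (\<delta> S + error)\<close>: taking the supremum over \<open>\<tau>1\<close> and the infimum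
over \<open>\<tau>2\<close> yields \<open>(1 - \<delta>) S \<le> inf I + error\<close>.

To estimate \<open>Y\<close>, the equation is tested with \<open>\<phi>(u) \<zeta>^l\<close>, where \<open>\<phi>\<close> is monotone, \<open>0 \<le> \<phi> \<le> \<kappa>^{-b}\<close>, and
\<open>|\<phi>'(u)|\<close> is at least a multiple of \<open>(v + \<kappa>)^{-b-1}\<close>. By coercivity, the integral
\<open>X = \<integral>\<integral> (v + \<kappa>)^{-b-1} |Du|^p \<zeta>^l dx dt\<close> is at most \<open>C \<kappa>^{-b} (Y + S |B|)\<close>.
Young's inequality splits the integrand of \<open>Y\<close> into a small multiple of that of \<open>X\<close> and a multiple of
\<open>(v + \<kappa>)^m \<zeta>^{l-p}\<close> with \<open>m = (b + 1)(p - 1)\<close>. The choice \<open>b = (q - p + 1) / (2(p - 1))\<close> makes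
\<open>m = (q + p - 1) / 2 < q\<close>, so that a second use of Young's inequality leads to \<open>(v + \<kappa>)^q \<zeta>^l\<close>, whose
integrals over time slices are controlled by \<open>S + \<kappa>^q\<close>; the loss in the power of \<open>\<zeta>\<close> is compensated because
\<open>l\<close> is large. Finally \<open>\<kappa>^{q-p+1} = (t - s) / r^p\<close> makes all error terms multiples of \<open>\<kappa>^q\<close>. These
steps are \<open>gradient_integral_bound\<close>, \<open>absorb_parameters\<close> and \<open>slice_comparison\<close>.

The function \<open>\<phi>(u) \<zeta>^l\<close> is not admissible, since \<open>u\<close> need not have a weak time derivative. It is replaced
by test functions that do not depend on time: the slice \<open>\<phi>(u(\<cdot>,s)) \<zeta>^l\<close> is used on the interval \<open>[s-h, s]\<close>
(\<open>frozen_ineq\<close>; it is a limit of smooth functions by mollification in space, \<open>weak_ineq_comp\<close>). If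
\<open>\<Gamma>\<close> is an antiderivative of \<open>\<phi>\<close> with respect to \<open>U = |u|^{q-1}u\<close>, then \<open>\<Gamma>\<close> is convex in \<open>U\<close> for increasing
\<open>\<phi>\<close> and concave for decreasing \<open>\<phi>\<close>, so that the difference of \<open>\<Gamma>\<close> between the times \<open>s-h\<close> and \<open>s\<close> is bounded
by the tested difference of \<open>U\<close>, with the sign that fits sub-solutions in the first and super-solutions in the
second case (\<open>convex_antiderivative\<close>). After integration over \<open>s\<close> and division by \<open>h\<close> the differences
telescope into averages near the two ends of the time interval, and the flux terms converge as \<open>h \<rightarrow> 0\<close>
because translations are continuous in \<open>L^p\<close> (\<open>Lp_shift_continuous\<close>). The outcome is the inequality
\<open>energy\<close>.\<close>

section \<open>Functions of class \<open>C\<^sup>k\<close> and mollifiers\<close>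

lemma C_k_SucI:
  fixes f :: "'a::euclidean_space \<Rightarrow> real"
  assumes "\<And>x. (f has_derivative f' x) (at x)" and "\<And>b. b \<in> Basis \<Longrightarrow> C_k k (\<lambda>x. f' x b)"
  shows "C_k (Suc k) f"
proof -
  have "frechet_derivative f (at x) = f' x" for x
    using frechet_derivative_at[OF assms(1)] by simp
  moreover have "f differentiable_on UNIV"
    using assms(1) unfolding differentiable_on_def by (auto intro!: differentiableI)
  ultimately show ?thesis using assms(2) by simp
qed

lemma C_k_SucD:
  fixes f :: "'a::euclidean_space \<Rightarrow> real"
  assumes "C_k (Suc k) f"
  shows "(f has_derivative frechet_derivative f (at x)) (at x)"
    and "b \<in> Basis \<Longrightarrow> C_k k (\<lambda>x. frechet_derivative f (at x) b)"
  using assms by (auto simp: differentiable_on_def frechet_derivative_works)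

lemma C_k_cont: "C_k k f \<Longrightarrow> continuous_on UNIV f"
  by (cases k) (auto intro: differentiable_imp_continuous_on)

lemma C_k_Suc_imp: "C_k (Suc k) f \<Longrightarrow> C_k k f"
proof (induction k arbitrary: f)
  case 0
  then show ?case using C_k_cont by (simp del: C_k.simps(2))
next
  case (Suc k)
  show ?case
    by (rule C_k_SucI[OF C_k_SucD(1)[OF Suc.prems] Suc.IH]) (use Suc.prems in auto)
qed

lemma C_k_const: "C_k k (\<lambda>x::'a::euclidean_space. c)"
proof (induction k arbitrary: c)
  case 0 then show ?case by simp
next
  case (Suc k)
  show ?case by (rule C_k_SucI[where f'="\<lambda>x h. 0"]) (auto simp: Suc)
qed

lemma C_k_add: "C_k k f \<Longrightarrow> C_k k g \<Longrightarrow> C_k k (\<lambda>x. f x + g x)"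
proof (induction k arbitrary: f g)
  case 0 then show ?case by (auto intro: continuous_intros)
next
  case (Suc k)
  show ?case
    by (rule C_k_SucI[OF has_derivative_add[OF C_k_SucD(1)[OF Suc.prems(1)] C_k_SucD(1)[OF Suc.prems(2)]]])
       (auto intro!: Suc.IH C_k_SucD(2)[OF Suc.prems(1)] C_k_SucD(2)[OF Suc.prems(2)] simp del: C_k.simps)
qed

lemma C_k_mult: "C_k k f \<Longrightarrow> C_k k g \<Longrightarrow> C_k k (\<lambda>x. f x * g x)"
proof (induction k arbitrary: f g)
  case 0 then show ?case by (auto intro: continuous_intros)
next
  case (Suc k)
  show ?case
    by (rule C_k_SucI[OF has_derivative_mult[OF C_k_SucD(1)[OF Suc.prems(1)] C_k_SucD(1)[OF Suc.prems(2)]]])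
       (auto intro!: C_k_add Suc.IH C_k_SucD(2)[OF Suc.prems(1)] C_k_SucD(2)[OF Suc.prems(2)]
          C_k_Suc_imp[OF Suc.prems(1)] C_k_Suc_imp[OF Suc.prems(2)] simp del: C_k.simps)
qed

lemma C_k_inner: "C_k k (\<lambda>x::'a::euclidean_space. x \<bullet> b)"
proof (cases k)
  case 0 then show ?thesis by (auto intro: continuous_intros)
next
  case (Suc j)
  show ?thesis unfolding Suc
    by (rule C_k_SucI[where f'="\<lambda>x h. h \<bullet> b"]) (auto intro!: derivative_eq_intros C_k_const)
qed

lemma C_k_reflect:
  assumes "C_k k f"
  shows "C_k k (\<lambda>y. f (x - y))"
  using assms
proof (induction k arbitrary: f)
  case 0
  then show ?case by (auto intro!: continuous_on_compose2[of UNIV f] continuous_intros)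
next
  case (Suc k)
  show ?case
  proof (rule C_k_SucI[where f'="\<lambda>y h. frechet_derivative f (at (x - y)) (- h)"])
    fix y
    have "((\<lambda>y. x - y) has_derivative (\<lambda>h. - h)) (at y)"
      by (auto intro!: derivative_eq_intros)
    from has_derivative_compose[OF this C_k_SucD(1)[OF Suc.prems]]
    show "((\<lambda>y. f (x - y)) has_derivative (\<lambda>h. frechet_derivative f (at (x - y)) (- h))) (at y)" .
  next
    fix b :: 'a assume b: "b \<in> Basis"
    have eq: "frechet_derivative f (at (x - y)) (- b) = (-1) * frechet_derivative f (at (x - y)) b" for y
      using linear_neg[OF has_derivative_linear[OF C_k_SucD(1)[OF Suc.prems]]] by simp
    show "C_k k (\<lambda>y. frechet_derivative f (at (x - y)) (- b))"
      unfolding eq by (intro C_k_mult C_k_const Suc.IH C_k_SucD(2)[OF Suc.prems] b)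
  qed
qed

text \<open>The functions \<open>exp(-1/t) t^{-n}\<close>, extended by zero, are closed under differentiation up to linear
combinations; this makes smoothness of \<open>exp(-1/t)\<close> a simple induction.\<close>

definition flat :: "nat \<Rightarrow> real \<Rightarrow> real" where
  "flat n t = (if t > 0 then exp (- (1 / t)) / t ^ n else 0)"

text \<open>A single term of the exponential series for \<open>exp(1/t)\<close> gives this. The quadratic decay is what makes the
derivative at zero vanish.\<close>

lemma flat_bound: "t > 0 \<Longrightarrow> flat n t \<le> fact (Suc (Suc n)) * t^2"
proof -
  assume t: "t > 0"
  have "(\<Sum>i\<in>{n+2}. (1 / t) ^ i /\<^sub>R fact i) \<le> (\<Sum>i. (1 / t) ^ i /\<^sub>R fact i)"
    using t by (intro sum_le_suminf summable_exp_generic) auto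
  then have "(1 / t) ^ (n + 2) /\<^sub>R fact (n + 2) \<le> exp (1 / t)"
    unfolding exp_def by (simp only: sum.insert sum.empty finite.emptyI empty_iff not_False_eq_True add_0_right)
  moreover define F :: real where "F = fact (n + 2)"
  moreover have "F > 0" by (simp add: F_def)
  ultimately have "inverse F * (1 / t) ^ (n + 2) \<le> exp (1 / t)" and F: "F > 0"
    by simp_all
  then have le: "F * (inverse F * (1 / t) ^ (n + 2)) * exp (- (1 / t)) \<le> F * exp (1 / t) * exp (- (1 / t))"
    by (intro mult_right_mono mult_left_mono) auto
  have "(1 / t) ^ (n + 2) * exp (- (1 / t)) \<le> F"
  proof -
    have 1: "F * exp (1 / t) * exp (- (1 / t)) = F"
      by (simp only: mult.assoc exp_minus_inverse mult_1_right)
    have 2: "F * (inverse F * X) = X" for X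
      using F by simp
    show ?thesis using le by (simp only: 1 2)
  qed
  then have "t ^ 2 * ((1 / t) ^ (n + 2) * exp (- (1 / t))) \<le> t ^ 2 * F"
    by (intro mult_left_mono) auto
  moreover have "t ^ 2 * ((1 / t) ^ (n + 2) * exp (- (1 / t))) = exp (- (1 / t)) / t ^ n"
  proof -
    have "t ^ 2 * (1 / t) ^ (n + 2) = (t * (1 / t)) ^ 2 * (1 / t) ^ n"
      by (simp only: power_add power_mult_distrib mult.assoc mult.left_commute mult.commute)
    then have "t ^ 2 * (1 / t) ^ (n + 2) = 1 / t ^ n"
      using t by (simp only: power_divide) simp
    then show ?thesis by (simp only: mult.assoc[symmetric]) simp
  qed
  ultimately have "exp (- (1 / t)) / t ^ n \<le> F * t ^ 2"
    by (simp add: mult.commute)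
  then show ?thesis
    using t by (simp add: flat_def F_def)
qed

lemma flat_has_derivative:
  "(flat n has_real_derivative (flat (n + 2) t - real n * flat (n + 1) t)) (at t)"
proof -
  consider "t > 0" | "t < 0" | "t = 0" by linarith
  then show ?thesis
  proof cases
    case 1
    have "((\<lambda>t. exp (- (1 / t))) has_real_derivative exp (- (1 / t)) * (1 / t ^ 2)) (at t)"
      using 1 by (auto intro!: derivative_eq_intros simp: power2_eq_square)
    moreover have "((\<lambda>t. t ^ n) has_real_derivative real n * t ^ (n - 1)) (at t)"
      by (auto intro!: derivative_eq_intros)
    ultimately have "((\<lambda>t. exp (- (1 / t)) / t ^ n) has_real_derivative
        (exp (- (1 / t)) * (1 / t ^ 2) * t ^ n - exp (- (1 / t)) * (real n * t ^ (n - 1))) / (t ^ n * t ^ n)) (at t)"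
      using 1 by (intro DERIV_divide) auto
    moreover have "(exp (- (1 / t)) * (1 / t ^ 2) * t ^ n - exp (- (1 / t)) * (real n * t ^ (n - 1))) / (t ^ n * t ^ n)
        = flat (n + 2) t - real n * flat (n + 1) t"
    proof (cases n)
      case 0
      then show ?thesis using 1 by (simp add: flat_def power2_eq_square)
    next
      case (Suc j)
      have "exp (- (1 / t)) * (1 / t ^ 2) * t ^ n / (t ^ n * t ^ n) = flat (n + 2) t"
      proof -
        have "E * (1 / a) * T / (T * T) = E / (T * a)" if "a > 0" "T > 0" for E a T :: real
          using that by (simp add: field_simps)
        from this[of "t ^ 2" "t ^ n" "exp (- (1 / t))"] show ?thesis
          using 1 by (simp only: flat_def power_add if_True zero_less_power)
      qed
      moreover have "exp (- (1 / t)) * (real n * t ^ (n - 1)) / (t ^ n * t ^ n) = real n * flat (n + 1) t"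
      proof -
        have "E * (m * S) / ((t * S) * (t * S)) = m * (E / (t * (t * S)))" if "S > 0" for E m S :: real
          using that 1 by (simp add: field_simps)
        from this[of "t ^ j" "exp (- (1 / t))" "real n"] show ?thesis
          using 1 Suc by (simp only: flat_def power_Suc if_True zero_less_power Suc_eq_plus1[symmetric] diff_Suc_1)
      qed
      ultimately show ?thesis by (simp only: diff_divide_distrib)
    qed
    ultimately have "((\<lambda>t. exp (- (1 / t)) / t ^ n) has_real_derivative (flat (n + 2) t - real n * flat (n + 1) t)) (at t)"
      by simp
    moreover have "eventually (\<lambda>t. exp (- (1 / t)) / t ^ n = flat n t) (nhds t)"
      using eventually_nhds_in_open[of "{0<..}" t] 1 by (auto elim!: eventually_mono simp: flat_def)
    ultimately show ?thesis
      using DERIV_cong_ev[OF refl _ refl, THEN iffD1] by fast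
  next
    case 2
    have "((\<lambda>t. 0) has_real_derivative (flat (n + 2) t - real n * flat (n + 1) t)) (at t)"
      using 2 by (auto intro!: derivative_eq_intros simp: flat_def)
    moreover have "eventually (\<lambda>t. 0 = flat n t) (nhds t)"
      using eventually_nhds_in_open[of "{..<0}" t] 2 by (auto elim!: eventually_mono simp: flat_def)
    ultimately show ?thesis
      using DERIV_cong_ev[OF refl _ refl, THEN iffD1] by fast
  next
    case 3
    define c :: real where "c = fact (Suc (Suc n))"
    have bd: "\<bar>flat n h / h\<bar> \<le> c * \<bar>h\<bar>" for h
    proof (cases "h > 0")
      case True
      then have "0 \<le> flat n h" "flat n h \<le> c * h^2"
        using flat_bound[OF True, of n] by (simp_all add: flat_def c_def)
      then show ?thesis using True by (simp add: divide_le_eq power2_eq_square mult.assoc)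
      next
      case False
      then have "flat n h = 0" by (simp add: flat_def)
      then show ?thesis by (simp add: c_def del: fact_Suc)
    qed
    have "((\<lambda>h. c * \<bar>h\<bar>) \<longlongrightarrow> 0) (at 0)"
      by (intro tendsto_mult_right_zero tendsto_rabs_zero tendsto_ident_at)
    then have "((\<lambda>h. flat n h / h) \<longlongrightarrow> 0) (at 0)"
      by (rule Lim_null_comparison[rotated]) (use bd in \<open>simp only: real_norm_def always_eventually simp_thms\<close>)
    moreover have "flat n 0 = 0" "flat (n + 2) 0 - real n * flat (n + 1) 0 = 0"
      by (simp_all add: flat_def)
    ultimately show ?thesis
      using 3 by (simp only: has_field_derivative_iff add_0 diff_zero)
  qed
qed

text \<open>For \<open>n = 0\<close> and \<open>c = e^2\<close> this is the standard bump function supported in the ball of radius \<open>e\<close>. The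
induction needs all \<open>n\<close> at once.\<close>

lemma C_k_flat_radial: "C_k k (\<lambda>x::'a::euclidean_space. flat n (c - x \<bullet> x))"
proof (induction k arbitrary: n)
  case 0
  have "continuous_on UNIV (flat n)"
    using flat_has_derivative by (meson DERIV_isCont continuous_at_imp_continuous_on)
  then show ?case
    by (auto intro!: continuous_on_compose2[of UNIV "flat n"] continuous_intros)
next
  case (Suc k)
  let ?d = "\<lambda>t. flat (n + 2) t - real n * flat (n + 1) t"
  show ?case
  proof (rule C_k_SucI[where f'="\<lambda>x h. ?d (c - x \<bullet> x) * (- 2 * (x \<bullet> h))"])
    fix x :: 'a
    have "((\<lambda>x::'a. c - x \<bullet> x) has_derivative (\<lambda>h. - 2 * (x \<bullet> h))) (at x)"
      by (auto intro!: derivative_eq_intros simp: inner_commute)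
    from has_derivative_compose[OF this flat_has_derivative[of n "c - x \<bullet> x", unfolded has_field_derivative_def]]
    show "((\<lambda>x. flat n (c - x \<bullet> x)) has_derivative (\<lambda>h. ?d (c - x \<bullet> x) * (- 2 * (x \<bullet> h)))) (at x)" .
  next
    fix b :: 'a assume "b \<in> Basis"
    have "C_k k (\<lambda>x::'a. (flat (n + 2) (c - x \<bullet> x) + (- real n) * flat (n + 1) (c - x \<bullet> x)) * ((- 2) * (x \<bullet> b)))"
      by (intro C_k_mult C_k_add C_k_const C_k_inner Suc.IH)
    then show "C_k k (\<lambda>x::'a. ?d (c - x \<bullet> x) * (- 2 * (x \<bullet> b)))"
      by simp
  qed
qed

lemma compact_support_inI:
  fixes f :: "'a::euclidean_space \<Rightarrow> real"
  assumes "compact C" "\<And>x. x \<notin> C \<Longrightarrow> f x = 0" "C \<subseteq> U"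
  shows "compact_support_in f U"
proof -
  have sub: "{x. f x \<noteq> 0} \<subseteq> C" using assms(2) by blast
  then have "closure {x. f x \<noteq> 0} \<subseteq> C"
    using closure_minimal compact_imp_closed[OF assms(1)] by blast
  moreover have "bounded {x. f x \<noteq> 0}"
    using sub assms(1) bounded_subset compact_imp_bounded by blast
  ultimately show ?thesis
    using assms unfolding compact_support_in_def by (auto simp: compact_closure)
qed

lemma compactly_supported_uniformly_continuous:
  fixes f :: "'a::euclidean_space \<Rightarrow> 'b::real_normed_vector"
  assumes "continuous_on UNIV f" "compact C" "\<And>x. x \<notin> C \<Longrightarrow> f x = 0"
  shows "uniformly_continuous_on UNIV f"
proof -
  obtain R where R: "\<And>x. x \<in> C \<Longrightarrow> norm x \<le> R"
    using compact_imp_bounded[OF assms(2)] by (auto simp: bounded_iff)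
  have uc: "uniformly_continuous_on (cball 0 (R + 1)) f"
    by (intro compact_uniformly_continuous continuous_on_subset[OF assms(1)]) auto
  show ?thesis
    unfolding uniformly_continuous_on_def
  proof (intro allI impI)
    fix e :: real assume "e > 0"
    then obtain d where d: "d > 0" "\<And>x x'. x \<in> cball 0 (R+1) \<Longrightarrow> x' \<in> cball 0 (R+1) \<Longrightarrow> dist x' x < d \<Longrightarrow> dist (f x') (f x) < e"
      using uc unfolding uniformly_continuous_on_def by metis
    have "dist (f x') (f x) < e" if "dist x' x < min d 1" for x x'
    proof (cases "x \<in> C \<or> x' \<in> C")
      case True
      have "norm x \<le> R + 1 \<and> norm x' \<le> R + 1"
      proof -
        have "norm (x - x') < 1" using that by (simp add: dist_norm norm_minus_commute)
        then have "norm x \<le> norm x' + 1" "norm x' \<le> norm x + 1"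
          by norm+
        with True show ?thesis using R by fastforce
      qed
      then show ?thesis using d(2)[of x x'] that by auto
    next
      case False
      then show ?thesis using assms(3) \<open>e > 0\<close> by simp
    qed
    then show "\<exists>d>0. \<forall>x\<in>UNIV. \<forall>x'\<in>UNIV. dist x' x < d \<longrightarrow> dist (f x') (f x) < e"
      using d(1) by (intro exI[of _ "min d 1"]) auto
  qed
qed

lemma compactly_supported_bounded:
  fixes f :: "'a::euclidean_space \<Rightarrow> 'b::real_normed_vector"
  assumes "continuous_on UNIV f" "compact C" "\<And>x. x \<notin> C \<Longrightarrow> f x = 0"
  obtains B where "B > 0" "\<And>x. norm (f x) \<le> B"
proof -
  have "bounded (f ` C)"
    using assms by (intro compact_imp_bounded compact_continuous_image continuous_on_subset[OF assms(1)]) auto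
  then obtain B where "B > 0" "\<And>x. x \<in> C \<Longrightarrow> norm (f x) \<le> B"
    by (auto simp: bounded_pos)
  then show ?thesis
    using assms(3) by (intro that[of B]) (metis norm_zero less_imp_le)+
qed

lemma compactly_supported_integrable:
  fixes f :: "'a::euclidean_space \<Rightarrow> 'b::euclidean_space"
  assumes "continuous_on UNIV f" "compact C" "\<And>x. x \<notin> C \<Longrightarrow> f x = 0"
  shows "integrable lborel f"
proof -
  have "integrable lborel (\<lambda>x. indicator C x *\<^sub>R f x)"
    using assms by (intro borel_integrable_compact continuous_on_subset[OF assms(1)]) auto
  moreover have "(\<lambda>x. indicator C x *\<^sub>R f x) = f"
    using assms(3) by (auto simp: indicator_def)
  ultimately show ?thesis by simp
qed

definition mollifier :: "real \<Rightarrow> ('a::euclidean_space \<Rightarrow> real) \<Rightarrow> bool" where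
  "mollifier e K \<longleftrightarrow> (\<forall>k. C_k k K) \<and> (\<forall>x. x \<notin> cball 0 e \<longrightarrow> K x = 0) \<and> (\<forall>x. 0 \<le> K x) \<and>
     (LINT x|lborel. K x) = 1"

lemma mollifier_exists:
  assumes e: "e > 0"
  obtains K :: "'a::euclidean_space \<Rightarrow> real" where "mollifier e K"
proof -
  define J where "J = (\<lambda>x::'a. flat 0 (e^2 - x \<bullet> x))"
  have J: "C_k k J" for k unfolding J_def by (rule C_k_flat_radial)
  have cont: "continuous_on UNIV J" using C_k_cont[OF J[of 0]] .
  have supp: "J x = 0" if "x \<notin> cball 0 e" for x
  proof -
    have "e^2 < (norm x)^2" using that e by (intro power_strict_mono) auto
    then show ?thesis by (simp add: J_def flat_def dot_square_norm)
  qed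
  have nn: "0 \<le> J x" for x by (simp add: J_def flat_def)
  have int: "integrable lborel J"
    using compactly_supported_integrable[OF cont compact_cball supp] by blast
  have "0 < J 0" using e by (simp add: J_def flat_def)
  have "(LINT x|lborel. J x) \<noteq> 0"
  proof
    assume "(LINT x|lborel. J x) = 0"
    then have "AE x in lborel. J x = 0"
      using integral_nonneg_eq_0_iff_AE[OF int] nn by simp
    then have ae: "AE x in lborel. x \<notin> {x. J x \<noteq> 0}" by simp
    have op: "open {x. J x \<noteq> 0}"
      using cont by (intro open_Collect_neq) (auto intro: continuous_intros)
    have "emeasure lborel {x. J x \<noteq> 0} = 0"
      using ae op by (subst (asm) AE_iff_measurable[OF _ refl]) auto
    then have "{x. J x \<noteq> 0} \<in> null_sets lborel" using op by (intro null_setsI) auto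
    then have "negligible {x. J x \<noteq> 0}"
      by (simp add: negligible_iff_null_sets null_sets_completionI)
    moreover have "{x. J x \<noteq> 0} \<noteq> {}" using \<open>0 < J 0\<close> by force
    ultimately show False using open_not_negligible op by blast
  qed
  then have pos: "(LINT x|lborel. J x) > 0"
    using nn by (simp add: order_less_le)
  let ?K = "\<lambda>x. (1 / (LINT x|lborel. J x)) * J x"
  have "mollifier e ?K"
    unfolding mollifier_def
    using pos nn supp int by (intro conjI allI impI C_k_mult C_k_const J) auto
  then show ?thesis by (rule that)
qed

section \<open>Gradients of continuously differentiable functions\<close>

lemma grad_eqI:
  fixes f :: "'a::euclidean_space \<Rightarrow> real"
  assumes "(f has_derivative (\<lambda>h. g \<bullet> h)) (at x)"
  shows "grad f x = g"
proof -
  have "frechet_derivative f (at x) = (\<lambda>h. g \<bullet> h)"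
    using frechet_derivative_at[OF assms] by simp
  then show ?thesis by (simp add: grad_def euclidean_representation)
qed

lemma C1I:
  fixes f :: "'a::euclidean_space \<Rightarrow> real"
  assumes "\<And>x. (f has_derivative (\<lambda>h. g x \<bullet> h)) (at x)" "continuous_on UNIV g"
  shows "C_k 1 f"
  unfolding One_nat_def
  by (rule C_k_SucI[OF assms(1)]) (auto intro!: continuous_intros assms(2))

lemma C1_has_derivative:
  fixes f :: "'a::euclidean_space \<Rightarrow> real"
  assumes "C_k (Suc k) f"
  shows "(f has_derivative (\<lambda>h. grad f x \<bullet> h)) (at x)"
proof -
  note d = C_k_SucD(1)[OF assms, of x]
  have "frechet_derivative f (at x) h = grad f x \<bullet> h" for h
  proof -
    interpret linear "frechet_derivative f (at x)"
      using has_derivative_linear[OF d] .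
    have "frechet_derivative f (at x) (\<Sum>b\<in>Basis. (h \<bullet> b) *\<^sub>R b) = (\<Sum>b\<in>Basis. (h \<bullet> b) * frechet_derivative f (at x) b)"
      by (simp add: sum scale)
    then show ?thesis
      by (simp add: grad_def inner_sum_left inner_commute[of h] mult.commute euclidean_representation[of h, unfolded inner_commute[of h]])
  qed
  then have "frechet_derivative f (at x) = (\<lambda>h. grad f x \<bullet> h)" by blast
  then show ?thesis using d by simp
qed

lemma grad_inner_Basis: "b \<in> Basis \<Longrightarrow> grad f x \<bullet> b = frechet_derivative f (at x) b"
  by (simp add: grad_def)

lemma C1_continuous_grad:
  fixes f :: "'a::euclidean_space \<Rightarrow> real"
  assumes "C_k (Suc k) f"
  shows "continuous_on UNIV (grad f)"
  unfolding grad_def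
  by (intro continuous_intros C_k_cont[OF C_k_SucD(2)[OF assms]])

text \<open>A function that vanishes outside a closed set vanishes near every point of the open complement.\<close>

lemma grad_zero_outside:
  fixes f :: "'a::euclidean_space \<Rightarrow> real"
  assumes "closed C" "\<And>x. x \<notin> C \<Longrightarrow> f x = 0" "x \<notin> C"
  shows "grad f x = 0"
proof (rule grad_eqI)
  have "((\<lambda>x. 0) has_derivative (\<lambda>h. 0 \<bullet> h)) (at x)" by (auto intro!: derivative_eq_intros)
  then show "(f has_derivative (\<lambda>h. 0 \<bullet> h)) (at x)"
    by (rule has_derivative_transform_within_open[where s="- C"]) (use assms in auto)
qed

section \<open>Convolution with smooth kernels\<close>

definition conv :: "('a::euclidean_space \<Rightarrow> real) \<Rightarrow> ('a \<Rightarrow> 'b::euclidean_space) \<Rightarrow> 'a \<Rightarrow> 'b" where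
  "conv f K x = (LINT y|lborel. f y *\<^sub>R K (x - y))"

lemma integrable_conv:
  fixes K :: "'a::euclidean_space \<Rightarrow> 'b::euclidean_space"
  assumes f: "integrable lborel f" and K: "continuous_on UNIV K" and B: "\<And>x. norm (K x) \<le> B"
  shows "integrable lborel (\<lambda>y. f y *\<^sub>R K (x - y))"
proof (rule Bochner_Integration.integrable_bound[where f="\<lambda>y. B * norm (f y)"])
  show "integrable lborel (\<lambda>y. B * norm (f y))"
    using f by auto
  have [measurable]: "K \<in> borel_measurable borel" using K by (rule borel_measurable_continuous_onI)
  have [measurable]: "f \<in> borel_measurable borel" using borel_measurable_integrable[OF f] by simp
  show "(\<lambda>y. f y *\<^sub>R K (x - y)) \<in> borel_measurable lborel" by measurable
  show "AE y in lborel. norm (f y *\<^sub>R K (x - y)) \<le> norm (B * norm (f y))"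
    using B order_trans[OF norm_ge_zero B] by (auto intro!: AE_I2 simp: mult.commute[of B] mult_left_mono)
qed

lemma conv_continuous:
  fixes K :: "'a::euclidean_space \<Rightarrow> 'b::euclidean_space"
  assumes f: "integrable lborel f" and K: "continuous_on UNIV K"
    and C: "compact C" "\<And>x. x \<notin> C \<Longrightarrow> K x = 0"
  shows "continuous_on UNIV (conv f K)"
proof -
  obtain B where B: "\<And>x. norm (K x) \<le> B" using compactly_supported_bounded[OF K C] by metis
  have "isCont (conv f K) x" for x
    unfolding isCont_def tendsto_at_iff_sequentially comp_def
  proof (intro allI impI)
    fix X assume X: "\<forall>i. X i \<in> UNIV - {x}" "X \<longlonglongrightarrow> x"
    show "(\<lambda>i. conv f K (X i)) \<longlonglongrightarrow> conv f K x"
      unfolding conv_def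
    proof (rule integral_dominated_convergence[where w="\<lambda>y. B * norm (f y)"])
      have [measurable]: "K \<in> borel_measurable borel" using K by (rule borel_measurable_continuous_onI)
      have [measurable]: "f \<in> borel_measurable borel" using borel_measurable_integrable[OF f] by simp
      show "(\<lambda>y. f y *\<^sub>R K (x - y)) \<in> borel_measurable lborel" by measurable
      show "(\<lambda>y. f y *\<^sub>R K (X i - y)) \<in> borel_measurable lborel" for i by measurable
      show "integrable lborel (\<lambda>y. B * norm (f y))" using f by auto
      show "AE y in lborel. (\<lambda>i. f y *\<^sub>R K (X i - y)) \<longlonglongrightarrow> f y *\<^sub>R K (x - y)"
        using K X(2) by (intro AE_I2 tendsto_intros) (auto intro!: continuous_on_tendsto_compose[of UNIV K] tendsto_intros)
      show "AE y in lborel. norm (f y *\<^sub>R K (X i - y)) \<le> B * norm (f y)" for i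
        using B by (auto intro!: AE_I2 simp: mult.commute[of B] mult_left_mono)
    qed
  qed
  then show ?thesis by (simp add: continuous_at_imp_continuous_on)
qed

text \<open>The derivative is uniformly continuous, so the first order remainder is small uniformly in the base point. This is
what allows differentiation under the integral in a convolution with a merely integrable function.\<close>

lemma C1_uniform_derivative:
  fixes K :: "'a::euclidean_space \<Rightarrow> real"
  assumes K: "C_k (Suc k) K" and C: "compact C" "\<And>x. x \<notin> C \<Longrightarrow> K x = 0" and e: "e > 0"
  obtains d where "d > 0" "\<And>z h. norm h < d \<Longrightarrow> \<bar>K (z + h) - K z - grad K z \<bullet> h\<bar> \<le> e * norm h"
proof -
  have "uniformly_continuous_on UNIV (grad K)"
    using compactly_supported_uniformly_continuous[OF C1_continuous_grad[OF K] C(1)]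
      grad_zero_outside[OF compact_imp_closed[OF C(1)], of K, OF C(2)] by blast
  then obtain d where d: "d > 0" "\<And>x x'. dist x' x < d \<Longrightarrow> dist (grad K x') (grad K x) < e"
    using e unfolding uniformly_continuous_on_def by (metis UNIV_I)
  have "\<bar>K (z + h) - K z - grad K z \<bullet> h\<bar> \<le> e * norm h" if h: "norm h < d" for z h
  proof -
    have "norm (K (z + h) - K z - (grad K z \<bullet> (z + h - z))) \<le> norm (z + h - z) * e"
    proof (rule differentiable_bound_linearization[where S="ball z d" and f'="\<lambda>x h. grad K x \<bullet> h"])
      show "z + t *\<^sub>R (z + h - z) \<in> ball z d" if "t \<in> {0..1}" for t
        using that h mult_left_le_one_le[of "norm h" t] by (auto simp: dist_norm)
      show "(K has_derivative (\<bullet>) (grad K x)) (at x within ball z d)" for x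
        using C1_has_derivative[OF K] by (rule has_derivative_at_withinI)
      show "z \<in> ball z d" using d by simp
      fix x assume "x \<in> ball z d"
      then have *: "norm (grad K x - grad K z) \<le> e" 
        using d(2)[of z x] by (simp add: dist_norm dist_commute norm_minus_commute)
      have "norm ((grad K x - grad K z) \<bullet> h) \<le> e * norm h" for h
        using Cauchy_Schwarz_ineq2[of "grad K x - grad K z" h] mult_right_mono[OF *, of "norm h"] by simp
      then show "onorm ((\<bullet>) (grad K x) - (\<bullet>) (grad K z)) \<le> e"
        using e by (intro onorm_le) (auto simp: inner_diff_left)
    qed
    then show ?thesis by (simp add: mult.commute)
  qed
  then show ?thesis using that d(1) by blast
qed

lemma conv_has_derivative:
  fixes K :: "'a::euclidean_space \<Rightarrow> real"
  assumes f: "integrable lborel f" and K: "C_k (Suc k) K"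
    and C: "compact C" "\<And>x. x \<notin> C \<Longrightarrow> K x = 0"
  shows "(conv f K has_derivative (\<lambda>h. conv f (grad K) x \<bullet> h)) (at x)"
proof -
  let ?n = "LINT y|lborel. \<bar>f y\<bar>"
  have C': "\<And>x. x \<notin> C \<Longrightarrow> grad K x = 0"
    using grad_zero_outside[OF compact_imp_closed[OF C(1)], of K, OF C(2)] by blast
  note cK = C_k_cont[OF K] and cG = C1_continuous_grad[OF K]
  obtain B where B: "\<And>x. norm (K x) \<le> B" using compactly_supported_bounded[OF cK C] by metis
  obtain B' where B': "\<And>x. norm (grad K x) \<le> B'" using compactly_supported_bounded[OF cG C(1) C'] by metis
  note iK = integrable_conv[OF f cK B] and iG = integrable_conv[OF f cG B']
  show ?thesis
    unfolding has_derivative_within_alt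
  proof (intro conjI allI impI)
    show "bounded_linear (\<lambda>h. conv f (grad K) x \<bullet> h)" by (rule bounded_linear_inner_right)
    fix e :: real assume e: "e > 0"
    have n: "?n \<ge> 0" by simp
    obtain d where d: "d > 0" "\<And>z h. norm h < d \<Longrightarrow> \<bar>K (z + h) - K z - grad K z \<bullet> h\<bar> \<le> (e / (?n + 1)) * norm h"
      using C1_uniform_derivative[OF K C, of "e / (?n + 1)"] e n by (metis add_nonneg_pos divide_pos_pos zero_less_one)
    have "norm (conv f K y - conv f K x - conv f (grad K) x \<bullet> (y - x)) \<le> e * norm (y - x)"
      if y: "norm (y - x) < d" for y
    proof -
      have eq: "conv f K y - conv f K x - conv f (grad K) x \<bullet> (y - x)
          = (LINT z|lborel. f z * (K (y - z) - K (x - z) - grad K (x - z) \<bullet> (y - x)))"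
      proof -
        have "conv f (grad K) x \<bullet> (y - x) = (LINT z|lborel. (f z *\<^sub>R grad K (x - z)) \<bullet> (y - x))"
          unfolding conv_def by (rule integral_inner_left[OF iG, symmetric])
        moreover have "(LINT z|lborel. f z * (K (y - z) - K (x - z) - grad K (x - z) \<bullet> (y - x)))
           = (LINT z|lborel. (f z *\<^sub>R K (y - z) - f z *\<^sub>R K (x - z)) - (f z *\<^sub>R grad K (x - z)) \<bullet> (y - x))"
          by (intro Bochner_Integration.integral_cong) (auto simp: algebra_simps)
        ultimately show ?thesis
          unfolding conv_def using iG iK 
          by (simp only: Bochner_Integration.integral_diff integrable_inner_left Bochner_Integration.integrable_diff)
      qed
      have "norm (LINT z|lborel. f z * (K (y - z) - K (x - z) - grad K (x - z) \<bullet> (y - x)))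
         \<le> (LINT z|lborel. \<bar>f z\<bar> * ((e / (?n + 1)) * norm (y - x)))"
      proof (rule order_trans[OF integral_norm_bound integral_mono[OF integrable_norm]])
        have "integrable lborel (\<lambda>z. (f z *\<^sub>R K (y - z) - f z *\<^sub>R K (x - z)) - (f z *\<^sub>R grad K (x - z)) \<bullet> (y - x))"
          using iG iK by (intro Bochner_Integration.integrable_diff integrable_inner_left) auto
        then show "integrable lborel (\<lambda>z. f z * (K (y - z) - K (x - z) - grad K (x - z) \<bullet> (y - x)))"
          by (simp add: algebra_simps)
        show "integrable lborel (\<lambda>z. \<bar>f z\<bar> * ((e / (?n + 1)) * norm (y - x)))" using f by auto
        show "norm (f z * (K (y - z) - K (x - z) - grad K (x - z) \<bullet> (y - x))) \<le> \<bar>f z\<bar> * ((e / (?n + 1)) * norm (y - x))" for z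
        proof -
          have "\<bar>K (y - z) - K (x - z) - grad K (x - z) \<bullet> (y - x)\<bar> \<le> (e / (?n + 1)) * norm (y - x)"
            using d(2)[OF y, of "x - z"] by (simp add: algebra_simps)
          then show ?thesis by (simp add: abs_mult mult_left_mono del: times_divide_eq_left)
        qed
      qed
      also have "\<dots> = ?n * (e / (?n + 1)) * norm (y - x)" by simp
      also have "\<dots> \<le> e * norm (y - x)"
      proof (intro mult_right_mono)
        have "?n * e \<le> e * (?n + 1)" using e by (simp add: algebra_simps)
        moreover have "0 < ?n + 1" using n by linarith
        ultimately show "?n * (e / (?n + 1)) \<le> e"
          unfolding times_divide_eq_right by (intro mult_imp_div_pos_le)
      qed auto
      finally show ?thesis unfolding eq .
    qed
    then show "\<exists>d>0. \<forall>y\<in>UNIV. norm (y - x) < d \<longrightarrow> norm (conv f K y - conv f K x - conv f (grad K) x \<bullet> (y - x)) \<le> e * norm (y - x)"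
      using d(1) by blast
  qed
qed

lemma grad_conv:
  fixes K :: "'a::euclidean_space \<Rightarrow> real"
  assumes f: "integrable lborel f" and K: "C_k (Suc k) K"
    and C: "compact C" "\<And>x. x \<notin> C \<Longrightarrow> K x = 0"
  shows "grad (conv f K) x = conv f (grad K) x"
  by (rule grad_eqI[OF conv_has_derivative[OF assms]])

lemma conv_inner:
  fixes K :: "'a::euclidean_space \<Rightarrow> 'b::euclidean_space"
  assumes f: "integrable lborel f" and K: "continuous_on UNIV K"
    and C: "compact C" "\<And>x. x \<notin> C \<Longrightarrow> K x = 0"
  shows "conv f K x \<bullet> b = conv f (\<lambda>z. K z \<bullet> b) x"
proof -
  obtain B where B: "\<And>x. norm (K x) \<le> B" using compactly_supported_bounded[OF K C] by metis
  show ?thesis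
    unfolding conv_def using integrable_conv[OF f K B, of x] by (subst integral_inner_left[symmetric]) auto
qed

text \<open>All derivatives fall on the kernel, so convolution inherits the regularity of the kernel.\<close>

lemma conv_C_k:
  fixes K :: "'a::euclidean_space \<Rightarrow> real"
  assumes f: "integrable lborel f" and "C_k k K"
    and C: "compact C" and "\<And>x. x \<notin> C \<Longrightarrow> K x = 0"
  shows "C_k k (conv f K)"
  using assms(2,4)
proof (induction k arbitrary: K)
  case 0
  then show ?case using conv_continuous[OF f _ C, of K] by simp
next
  case (Suc k)
  note K = Suc.prems(1) and C0 = Suc.prems(2)
  have G0: "\<And>x. x \<notin> C \<Longrightarrow> grad K x = 0"
    using grad_zero_outside[OF compact_imp_closed[OF C], of K, OF C0] by blast
  show ?case
  proof (rule C_k_SucI[OF conv_has_derivative[OF f K C C0]])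
    fix b :: 'a assume b: "b \<in> Basis"
    have "C_k k (conv f (\<lambda>z. frechet_derivative K (at z) b))"
      using G0 b by (intro Suc.IH C_k_SucD(2)[OF K]) (auto simp: grad_inner_Basis[symmetric])
    then show "C_k k (\<lambda>x. conv f (grad K) x \<bullet> b)"
      using conv_inner[OF f C1_continuous_grad[OF K] C G0, of _ b] b by (simp add: grad_inner_Basis)
  qed auto
qed

section \<open>Translation invariance of Lebesgue measure\<close>

lemma nn_integral_shift:
  fixes c :: "'a::euclidean_space"
  assumes "f \<in> borel_measurable borel"
  shows "(\<integral>\<^sup>+x. f (x + c) \<partial>lborel) = (\<integral>\<^sup>+x. f x \<partial>lborel)"
proof -
  have "(\<integral>\<^sup>+x. f x \<partial>lborel) = (\<integral>\<^sup>+x. f x \<partial>distr lborel borel ((+) c))"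
    by (simp add: lborel_distr_plus)
  also have "\<dots> = (\<integral>\<^sup>+x. f (c + x) \<partial>lborel)"
    using assms by (subst nn_integral_distr) auto
  finally show ?thesis by (simp add: add.commute)
qed

lemma has_bochner_integral_shift:
  fixes c :: "'a::euclidean_space" and f :: "'a \<Rightarrow> 'b::euclidean_space"
  assumes "integrable lborel f"
  shows "integrable lborel (\<lambda>x. f (x + c))" "(LINT x|lborel. f (x + c)) = (LINT x|lborel. f x)"
proof -
  have [measurable]: "f \<in> borel_measurable borel" using borel_measurable_integrable[OF assms] by simp
  have "integrable (distr lborel borel ((+) c)) f" using assms by (simp add: lborel_distr_plus)
  then show "integrable lborel (\<lambda>x. f (x + c))"
    by (subst (asm) integrable_distr_eq) (auto simp: add.commute)
  have "(LINT x|lborel. f x) = (LINT x|distr lborel borel ((+) c). f x)"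
    by (simp add: lborel_distr_plus)
  also have "\<dots> = (LINT x|lborel. f (c + x))"
    by (subst integral_distr) auto
  finally show "(LINT x|lborel. f (x + c)) = (LINT x|lborel. f x)" by (simp add: add.commute)
qed

lemma lborel_distr_reflect: "distr lborel borel (\<lambda>x. t - x) = (lborel :: 'a::euclidean_space measure)"
  by (subst (2) lborel_affine[of "-1" t]) (auto simp: density_1)

lemma has_bochner_integral_reflect:
  fixes c :: "'a::euclidean_space" and f :: "'a \<Rightarrow> 'b::euclidean_space"
  assumes "integrable lborel f"
  shows "integrable lborel (\<lambda>x. f (c - x))" "(LINT x|lborel. f (c - x)) = (LINT x|lborel. f x)"
proof -
  have [measurable]: "f \<in> borel_measurable borel" using borel_measurable_integrable[OF assms] by simp
  have "integrable (distr lborel borel (\<lambda>x. c - x)) f" using assms by (simp add: lborel_distr_reflect)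
  then show "integrable lborel (\<lambda>x. f (c - x))"
    by (subst (asm) integrable_distr_eq) auto
  have "(LINT x|lborel. f x) = (LINT x|distr lborel borel (\<lambda>x. c - x). f x)"
    by (simp add: lborel_distr_reflect)
  also have "\<dots> = (LINT x|lborel. f (c - x))"
    by (subst integral_distr) auto
  finally show "(LINT x|lborel. f (c - x)) = (LINT x|lborel. f x)" by simp
qed

section \<open>Continuity of translations in \<open>L\<^sup>1\<close>\<close>

text \<open>Continuity of translations is stated along sequences, as dominated convergence is.\<close>

definition L1_shift_cont :: "('a::euclidean_space \<Rightarrow> 'b::euclidean_space) \<Rightarrow> bool" where
  "L1_shift_cont f \<longleftrightarrow> (\<forall>\<tau>. \<tau> \<longlonglongrightarrow> 0 \<longrightarrow> (\<lambda>n. LINT x|lborel. norm (f (x + \<tau> n) - f x)) \<longlonglongrightarrow> 0)"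

lemma L1_shift_cont_approx:
  fixes f :: "'a::euclidean_space \<Rightarrow> 'b::euclidean_space"
  assumes f: "integrable lborel f"
    and ap: "\<And>e. e > 0 \<Longrightarrow> \<exists>g. integrable lborel g \<and> L1_shift_cont g \<and> (LINT x|lborel. norm (f x - g x)) \<le> e"
  shows "L1_shift_cont f"
  unfolding L1_shift_cont_def
proof (intro allI impI)
  fix \<tau> :: "nat \<Rightarrow> 'a" assume \<tau>: "\<tau> \<longlonglongrightarrow> 0"
  show "(\<lambda>n. LINT x|lborel. norm (f (x + \<tau> n) - f x)) \<longlonglongrightarrow> 0"
  proof (rule LIMSEQ_I)
    fix e :: real assume e: "e > 0"
    then obtain g where g: "integrable lborel g" "L1_shift_cont g" "(LINT x|lborel. norm (f x - g x)) \<le> e / 4"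
      using ap[of "e / 4"] by auto
    have "(\<lambda>n. LINT x|lborel. norm (g (x + \<tau> n) - g x)) \<longlonglongrightarrow> 0"
      using g(2) \<tau> by (simp add: L1_shift_cont_def)
    from LIMSEQ_D[OF this, of "e / 4"] e
    obtain N where N: "\<And>n. n \<ge> N \<Longrightarrow> (LINT x|lborel. norm (g (x + \<tau> n) - g x)) < e / 4"
      by auto
    have "(LINT x|lborel. norm (f (x + \<tau> n) - f x)) < e" if n: "n \<ge> N" for n
    proof -
      note ifs = has_bochner_integral_shift[OF f, of "\<tau> n"]
      note igs = has_bochner_integral_shift[OF g(1), of "\<tau> n"]
      note idx = has_bochner_integral_shift[of "\<lambda>x. norm (f x - g x)" "\<tau> n"]
      have i: "integrable lborel (\<lambda>x. norm (f x - g x))"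
        "integrable lborel (\<lambda>x. norm (g (x + \<tau> n) - g x))"
        using f g igs by auto
      have "(LINT x|lborel. norm (f (x + \<tau> n) - f x))
          \<le> (LINT x|lborel. norm (f (x + \<tau> n) - g (x + \<tau> n)) + norm (g (x + \<tau> n) - g x) + norm (f x - g x))"
      proof (rule integral_mono)
        show "integrable lborel (\<lambda>x. norm (f (x + \<tau> n) - f x))" using ifs f by auto
        show "integrable lborel (\<lambda>x. norm (f (x + \<tau> n) - g (x + \<tau> n)) + norm (g (x + \<tau> n) - g x) + norm (f x - g x))"
          using i idx by auto
        show "norm (f (x + \<tau> n) - f x) \<le> norm (f (x + \<tau> n) - g (x + \<tau> n)) + norm (g (x + \<tau> n) - g x) + norm (f x - g x)" for x
          by norm
      qed
      also have "\<dots> = (LINT x|lborel. norm (f x - g x)) + (LINT x|lborel. norm (g (x + \<tau> n) - g x)) + (LINT x|lborel. norm (f x - g x))"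
        using i idx by simp
      also have "\<dots> < e" using N[OF n] g(3) e by linarith
      finally show ?thesis .
    qed
    then show "\<exists>N. \<forall>n\<ge>N. norm ((LINT x|lborel. norm (f (x + \<tau> n) - f x)) - 0) < e"
      by (auto intro!: exI[of _ N])
  qed
qed

text \<open>The indicator of an open set is lower semicontinuous, so dominated convergence shows that the mass of \<open>U\<close> which the
translation moves out of \<open>U\<close> tends to zero. As translations preserve measure, equal mass is moved in.\<close>

lemma L1_shift_cont_open:
  fixes U :: "'a::euclidean_space set"
  assumes U: "open U" "emeasure lborel U < \<infinity>"
  shows "L1_shift_cont (\<lambda>x. indicator U x *\<^sub>R (c::'b::euclidean_space))"
  unfolding L1_shift_cont_def
proof (intro allI impI)
  fix \<tau> :: "nat \<Rightarrow> 'a" assume \<tau>: "\<tau> \<longlonglongrightarrow> 0"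
  let ?I = "indicator U :: 'a \<Rightarrow> real"
  have [measurable]: "U \<in> sets borel" using U by simp
  have iI: "integrable lborel ?I" using U by (auto simp: integrable_indicator_iff)
  have "(\<lambda>n. LINT x|lborel. ?I x * (1 - ?I (x + \<tau> n))) \<longlonglongrightarrow> (LINT x::'a|lborel. 0)"
  proof (rule integral_dominated_convergence[where w="?I"])
    show "AE x in lborel. (\<lambda>n. ?I x * (1 - ?I (x + \<tau> n))) \<longlonglongrightarrow> 0"
    proof (intro AE_I2)
      fix x
      show "(\<lambda>n. ?I x * (1 - ?I (x + \<tau> n))) \<longlonglongrightarrow> 0"
      proof (cases "x \<in> U")
        case True
        have "(\<lambda>n. x + \<tau> n) \<longlonglongrightarrow> x" using tendsto_add[OF tendsto_const \<tau>, of x] by simp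
        then have "eventually (\<lambda>n. x + \<tau> n \<in> U) sequentially"
          using U(1) True topological_tendstoD by blast
        then have "eventually (\<lambda>n. ?I x * (1 - ?I (x + \<tau> n)) = 0) sequentially"
          by (rule eventually_mono) (auto simp: indicator_def)
        then show ?thesis by (rule tendsto_eventually)
      qed simp
    qed
  qed (auto simp: iI indicator_def)
  then have lim: "(\<lambda>n. 2 * (LINT x|lborel. ?I x * (1 - ?I (x + \<tau> n))) * norm c) \<longlonglongrightarrow> 0"
    by (auto intro!: tendsto_eq_intros)
  have "(LINT x|lborel. norm (?I (x + \<tau> n) *\<^sub>R c - ?I x *\<^sub>R c)) = 2 * (LINT x|lborel. ?I x * (1 - ?I (x + \<tau> n))) * norm c" for n
  proof -
    have "norm (?I (x + \<tau> n) *\<^sub>R c - ?I x *\<^sub>R c) = ((?I (x + \<tau> n) - ?I x) + 2 * (?I x * (1 - ?I (x + \<tau> n)))) * norm c" for x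
      by (auto simp: indicator_def)
    moreover have i2: "integrable lborel (\<lambda>x. ?I x * (1 - ?I (x + \<tau> n)))"
      by (rule Bochner_Integration.integrable_bound[OF iI]) (auto simp: indicator_def)
    moreover note iI has_bochner_integral_shift[OF iI, of "\<tau> n"]
    ultimately show ?thesis by simp
  qed
  then show "(\<lambda>n. LINT x|lborel. norm (?I (x + \<tau> n) *\<^sub>R c - ?I x *\<^sub>R c)) \<longlonglongrightarrow> 0"
    using lim by simp
qed

text \<open>Sets of finite measure are approximated by open sets (outer regularity), and general functions by simple
functions.\<close>

lemma L1_shift_continuous:
  fixes f :: "'a::euclidean_space \<Rightarrow> 'b::euclidean_space"
  assumes "integrable lborel f"
  shows "L1_shift_cont f"
  using assms
proof (induction rule: integrable_induct)
  case (base A c)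
  have A: "A \<in> sets borel" "emeasure lborel A < \<infinity>" using base by auto
  show ?case
  proof (rule L1_shift_cont_approx)
    show "integrable lborel (\<lambda>x. indicat_real A x *\<^sub>R c)" using A by (auto simp: integrable_indicator_iff)
    fix e :: real assume e: "e > 0"
    define e' where "e' = e / (norm c + 1)"
    have e': "e' > 0" using e by (simp add: e'_def add_nonneg_pos)
    obtain U where U: "open U" "A \<subseteq> U" "emeasure lborel (U - A) < ennreal e'"
      using outer_regular_lborel[OF A(1) e'] by blast
    have fin: "emeasure lborel (U - A) < \<infinity>" using U(3) by (simp add: order.strict_trans)
    have "emeasure lborel U = emeasure lborel (U - A) + emeasure lborel A"
      using A U by (subst plus_emeasure) (auto simp: Un_absorb2)
    then have finU: "emeasure lborel U < \<infinity>" using fin A by simp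
    have iU: "integrable lborel (\<lambda>x. indicat_real U x *\<^sub>R c)" using U finU by (auto simp: integrable_indicator_iff)
    have "(LINT x|lborel. norm (indicat_real A x *\<^sub>R c - indicat_real U x *\<^sub>R c)) = (LINT x|lborel. indicat_real (U - A) x * norm c)"
      using U(2) by (intro Bochner_Integration.integral_cong) (auto simp: indicator_def)
    also have "\<dots> = measure lborel (U - A) * norm c"
      using A U by simp
    also have "\<dots> \<le> e' * (norm c + 1)"
    proof (intro mult_mono)
      show "measure lborel (U - A) \<le> e'"
        using U(3) e' by (simp add: measure_def enn2real_leI less_imp_le)
    qed (use e' in auto)
    also have "\<dots> = e" by (simp add: e'_def add_nonneg_eq_0_iff)
    finally show "\<exists>g. integrable lborel g \<and> L1_shift_cont g \<and> (LINT x|lborel. norm (indicat_real A x *\<^sub>R c - g x)) \<le> e"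
      using iU L1_shift_cont_open[OF U(1) finU, of c] by blast
  qed
next
  case (add f g)
  show ?case
    unfolding L1_shift_cont_def
  proof (intro allI impI)
    fix \<tau> :: "nat \<Rightarrow> 'a" assume \<tau>: "\<tau> \<longlonglongrightarrow> 0"
    have "(\<lambda>n. (LINT x|lborel. norm (f (x + \<tau> n) - f x)) + (LINT x|lborel. norm (g (x + \<tau> n) - g x))) \<longlonglongrightarrow> 0"
      using add \<tau> by (auto intro!: tendsto_eq_intros simp: L1_shift_cont_def)
    then show "(\<lambda>n. LINT x|lborel. norm (f (x + \<tau> n) + g (x + \<tau> n) - (f x + g x))) \<longlonglongrightarrow> 0"
    proof (rule Lim_null_comparison[rotated], intro always_eventually allI)
      fix n
      note i = has_bochner_integral_shift[OF add(1), of "\<tau> n"] has_bochner_integral_shift[OF add(2), of "\<tau> n"]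
      have "norm (LINT x|lborel. norm (f (x + \<tau> n) + g (x + \<tau> n) - (f x + g x)))
         \<le> (LINT x|lborel. norm (f (x + \<tau> n) - f x) + norm (g (x + \<tau> n) - g x))"
        using i add(1,2) by (simp del: Bochner_Integration.integral_add) 
          (intro integral_mono, auto simp: norm_triangle_ineq intro!: norm_triangle_mono norm_diff_triangle_ineq)
      then show "norm (LINT x|lborel. norm (f (x + \<tau> n) + g (x + \<tau> n) - (f x + g x)))
         \<le> (LINT x|lborel. norm (f (x + \<tau> n) - f x)) + (LINT x|lborel. norm (g (x + \<tau> n) - g x))"
        using i add(1,2) by simp
    qed
  qed
next
  case (lim f s)
  show ?case
  proof (rule L1_shift_cont_approx[OF lim(4)])
    fix e :: real assume e: "e > 0"
    have [measurable]: "f \<in> borel_measurable borel" "\<And>i. s i \<in> borel_measurable borel"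
      using borel_measurable_integrable lim(1,4) by auto
    have "(\<lambda>i. LINT x|lborel. norm (f x - s i x)) \<longlonglongrightarrow> (LINT x::'a|lborel. 0)"
    proof (rule integral_dominated_convergence[where w="\<lambda>x. 3 * norm (f x)"])
      show "integrable lborel (\<lambda>x. 3 * norm (f x))" using lim(4) by auto
      show "AE x in lborel. (\<lambda>i. norm (f x - s i x)) \<longlonglongrightarrow> 0"
      proof (intro AE_I2 tendsto_norm_zero)
        fix x show "(\<lambda>i. f x - s i x) \<longlonglongrightarrow> 0" 
          using tendsto_diff[OF tendsto_const lim(2)[of x], of "f x"] by simp
      qed
      show "AE x in lborel. norm (norm (f x - s i x)) \<le> 3 * norm (f x)" for i
      proof (intro AE_I2)
        fix x show "norm (norm (f x - s i x)) \<le> 3 * norm (f x)"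
          using lim(3)[of x i] norm_triangle_ineq4[of "f x" "s i x"] by simp
      qed
    qed auto
    from LIMSEQ_D[OF this e] obtain i where "(LINT x|lborel. norm (f x - s i x)) < e" by auto
    then show "\<exists>g. integrable lborel g \<and> L1_shift_cont g \<and> (LINT x|lborel. norm (f x - g x)) \<le> e"
      using lim(1,5) by (intro exI[of _ "s i"]) auto
  qed
qed

section \<open>Young's inequality\<close>

lemma powr_add3_le:
  fixes x y z p :: real
  assumes "x \<ge> 0" "y \<ge> 0" "z \<ge> 0" "p \<ge> 0"
  shows "(x + y + z) powr p \<le> 3 powr p * (x powr p + y powr p + z powr p)"
proof -
  define m where "m = max x (max y z)"
  have "(x + y + z) powr p \<le> (3 * m) powr p"
    using assms by (intro powr_mono2) (auto simp: m_def)
  also have "\<dots> = 3 powr p * m powr p" using assms by (simp add: powr_mult)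
  also have "\<dots> \<le> 3 powr p * (x powr p + y powr p + z powr p)"
    by (intro mult_left_mono) (auto simp: m_def max_def)
  finally show ?thesis .
qed

lemma powr_add2_le:
  fixes x y p :: real
  assumes "x \<ge> 0" "y \<ge> 0" "p \<ge> 0"
  shows "(x + y) powr p \<le> 2 powr p * (x powr p + y powr p)"
proof -
  define m where "m = max x y"
  have "(x + y) powr p \<le> (2 * m) powr p"
    using assms by (intro powr_mono2) (auto simp: m_def)
  also have "\<dots> = 2 powr p * m powr p" using assms by (simp add: powr_mult)
  also have "\<dots> \<le> 2 powr p * (x powr p + y powr p)"
    by (intro mult_left_mono) (auto simp: m_def max_def)
  finally show ?thesis .
qed

text \<open>Young's inequality with the constant one instead of the optimal constant: depending on whether
\<open>y \<le> \<beta> x\<close>, the left side is bounded by the first or by the second term. Throughout, this inequality with a free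
parameter \<open>\<beta>\<close> is used where one would otherwise apply Hoelder's inequality.\<close>

lemma young_split:
  fixes x y p \<beta> :: real
  assumes "x \<ge> 0" "y \<ge> 0" "p \<ge> 1" "\<beta> > 0"
  shows "x powr (p - 1) * y \<le> \<beta> * x powr p + \<beta> powr (1 - p) * y powr p"
proof (cases "y \<le> \<beta> * x")
  case True
  have "x powr (p - 1) * y \<le> x powr (p - 1) * (\<beta> * x)"
    using True by (intro mult_left_mono) auto
  also have "\<dots> = \<beta> * x powr p"
    using powr_mult_base[of x "p - 1"] assms by (simp add: mult_ac)
  also have "\<dots> \<le> \<beta> * x powr p + \<beta> powr (1 - p) * y powr p" by simp
  finally show ?thesis .
next
  case False
  then have y: "y > 0" using assms by (smt (verit) mult_nonneg_nonneg)
  have "x \<le> y / \<beta>" using False assms by (simp add: field_simps)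
  then have "x powr (p - 1) * y \<le> (y / \<beta>) powr (p - 1) * y"
    using assms by (intro mult_right_mono powr_mono2) auto
  also have "\<dots> = \<beta> powr (1 - p) * y powr p"
    using powr_mult_base[of y "p - 1"] assms by (simp add: powr_divide powr_minus_divide[symmetric] mult_ac powr_diff)
  also have "\<dots> \<le> \<beta> * x powr p + \<beta> powr (1 - p) * y powr p" using assms by simp
  finally show ?thesis .
qed

lemma young_split1:
  fixes y p \<beta> :: real
  assumes "y \<ge> 0" "p \<ge> 1" "\<beta> > 0"
  shows "y \<le> \<beta> + \<beta> powr (1 - p) * y powr p"
  using young_split[of 1 y p \<beta>] assms by simp

section \<open>Continuity of translations in \<open>L\<^sup>p\<close>\<close>

text \<open>The function is truncated in size and support. For the truncated function, which is bounded by \<open>k\<close>, the \<open>p\<close>-th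
power of a difference is at most \<open>(2k+1)^{p-1}\<close> times the difference, so that the statement for \<open>L^1\<close> applies;
the rest is small by dominated convergence.\<close>

lemma Lp_shift_continuous:
  fixes f :: "'a::euclidean_space \<Rightarrow> 'b::euclidean_space"
  assumes f[measurable]: "f \<in> borel_measurable borel" and fp: "integrable lborel (\<lambda>x. norm (f x) powr p)"
    and p: "p \<ge> 1" and \<tau>: "\<tau> \<longlonglongrightarrow> 0"
  shows "(\<lambda>n. LINT x|lborel. norm (f (x + \<tau> n) - f x) powr p) \<longlonglongrightarrow> 0"
proof (rule LIMSEQ_I)
  fix e :: real assume e: "e > 0"
  define g where "g k x = (if norm (f x) \<le> real k \<and> norm x \<le> real k then f x else 0)" for k x
  have gm[measurable]: "g k \<in> borel_measurable borel" for k unfolding g_def by measurable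
  have gle: "norm (g k x) \<le> norm (f x)" for k x by (simp add: g_def)
  have gk: "norm (g k x) \<le> real k" for k x by (simp add: g_def)
  have ig: "integrable lborel (g k)" for k
  proof (rule Bochner_Integration.integrable_bound)
    show "integrable lborel (\<lambda>x::'a. indicator (cball 0 (real k)) x * real k)"
      using emeasure_lborel_cball_finite[of "0::'a" "real k"]
      by (intro integrable_mult_left) (auto simp: integrable_indicator_iff)
    show "AE x in lborel. norm (g k x) \<le> norm (indicator (cball 0 (real k)) x * real k)"
      by (auto simp: g_def indicator_def)
  qed auto
  have "(\<lambda>k. LINT x|lborel. norm (f x - g k x) powr p) \<longlonglongrightarrow> (LINT x::'a|lborel. 0)"
  proof (rule integral_dominated_convergence[OF _ _ fp])
    show "AE x in lborel. (\<lambda>k. norm (f x - g k x) powr p) \<longlonglongrightarrow> 0"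
    proof (intro AE_I2 tendsto_eventually)
      fix x
      obtain N where N: "norm (f x) \<le> real N" "norm x \<le> real N"
        using real_arch_simple[of "max (norm (f x)) (norm x)"] by auto
      have "norm (f x - g k x) powr p = 0" if "k \<ge> N" for k
        using N that by (simp add: g_def)
      then show "eventually (\<lambda>k. norm (f x - g k x) powr p = 0) sequentially"
        unfolding eventually_sequentially by blast
    qed
    show "AE x in lborel. norm (norm (f x - g k x) powr p) \<le> norm (f x) powr p" for k
      using p by (auto simp: g_def)
  qed auto
  moreover have "e / (4 * 3 powr p) > 0" using e by simp
  ultimately obtain k where k: "(LINT x|lborel. norm (f x - g k x) powr p) < e / (4 * 3 powr p)"
    by (auto dest!: LIMSEQ_D)
  have ifg: "integrable lborel (\<lambda>x. norm (f x - g k x) powr p)"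
    by (rule Bochner_Integration.integrable_bound[OF fp]) (use p in \<open>auto simp: g_def\<close>)
  define C where "C = (2 * real k + 1) powr (p - 1)"
  have C: "C > 0" by (simp add: C_def)
  have "(\<lambda>n. LINT x|lborel. norm (g k (x + \<tau> n) - g k x)) \<longlonglongrightarrow> 0"
    using L1_shift_continuous[OF ig] \<tau> by (simp add: L1_shift_cont_def)
  moreover have "e / (4 * 3 powr p * C) > 0" using e C by simp
  ultimately obtain N where N: "\<And>n. n \<ge> N \<Longrightarrow> (LINT x|lborel. norm (g k (x + \<tau> n) - g k x)) < e / (4 * 3 powr p * C)"
    by (fastforce dest!: LIMSEQ_D)
  have "(LINT x|lborel. norm (f (x + \<tau> n) - f x) powr p) < e" if n: "n \<ge> N" for n
  proof -
    have ish: "integrable lborel (\<lambda>x. norm (f (x + \<tau> n) - g k (x + \<tau> n)) powr p)"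
      "(LINT x|lborel. norm (f (x + \<tau> n) - g k (x + \<tau> n)) powr p) = (LINT x|lborel. norm (f x - g k x) powr p)"
      using has_bochner_integral_shift[OF ifg, of "\<tau> n"] by auto
    have i1: "integrable lborel (\<lambda>x. norm (g k (x + \<tau> n) - g k x))"
      using ig[of k] has_bochner_integral_shift[OF ig, of k "\<tau> n"] by auto
    let ?h = "\<lambda>x. 3 powr p * (norm (f (x + \<tau> n) - g k (x + \<tau> n)) powr p + C * norm (g k (x + \<tau> n) - g k x) + norm (f x - g k x) powr p)"
    have ih: "integrable lborel ?h" using ish(1) i1 ifg by auto
    have le: "norm (f (x + \<tau> n) - f x) powr p \<le> ?h x" for x
    proof -
      have "norm (f (x + \<tau> n) - f x) \<le> norm (f (x + \<tau> n) - g k (x + \<tau> n)) + norm (g k (x + \<tau> n) - g k x) + norm (f x - g k x)"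
        by norm
      then have "norm (f (x + \<tau> n) - f x) powr p \<le> (norm (f (x + \<tau> n) - g k (x + \<tau> n)) + norm (g k (x + \<tau> n) - g k x) + norm (f x - g k x)) powr p"
        using p by (intro powr_mono2) auto
      also have "\<dots> \<le> 3 powr p * (norm (f (x + \<tau> n) - g k (x + \<tau> n)) powr p + norm (g k (x + \<tau> n) - g k x) powr p + norm (f x - g k x) powr p)"
        using p by (intro powr_add3_le) auto
      also have "\<dots> \<le> ?h x"
      proof (intro mult_left_mono add_mono order_refl)
        let ?d = "norm (g k (x + \<tau> n) - g k x)"
        have "?d \<le> 2 * real k + 1"
          using gk[of k x] gk[of k "x + \<tau> n"] norm_triangle_ineq4[of "g k (x + \<tau> n)" "g k x"] by linarith
        then have "?d powr (p - 1) \<le> C" unfolding C_def using p by (intro powr_mono2) auto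
        then have "?d powr (p - 1) * ?d \<le> C * ?d" by (rule mult_right_mono) simp
        then show "?d powr p \<le> C * ?d"
          using powr_mult_base[of ?d "p - 1"] by (simp add: mult.commute)
      qed auto
      finally show ?thesis .
    qed
    have "(LINT x|lborel. norm (f (x + \<tau> n) - f x) powr p) \<le> (LINT x|lborel. ?h x)"
    proof (rule integral_mono)
      show "integrable lborel (\<lambda>x. norm (f (x + \<tau> n) - f x) powr p)"
        by (rule Bochner_Integration.integrable_bound[OF ih]) (use le order_trans[OF powr_ge_zero le] in auto)
    qed (use le ih in auto)
    also have "\<dots> = 3 powr p * ((LINT x|lborel. norm (f x - g k x) powr p) + C * (LINT x|lborel. norm (g k (x + \<tau> n) - g k x))
        + (LINT x|lborel. norm (f x - g k x) powr p))"
      using ish i1 ifg by simp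
    also have "\<dots> < 3 powr p * (e / (4 * 3 powr p) + C * (e / (4 * 3 powr p * C)) + e / (4 * 3 powr p))"
      using k N[OF n] C by (intro mult_strict_left_mono add_strict_mono) auto
    also have "\<dots> = 3 / 4 * e" using C by (simp add: field_simps)
    finally show ?thesis using e by simp
  qed
  then show "\<exists>N. \<forall>n\<ge>N. norm ((LINT x|lborel. norm (f (x + \<tau> n) - f x) powr p) - 0) < e"
    by (auto intro!: exI[of _ N])
qed

lemma Lp_shift_continuous_at:
  fixes f :: "'a::euclidean_space \<Rightarrow> 'b::euclidean_space"
  assumes f[measurable]: "f \<in> borel_measurable borel" and fp: "integrable lborel (\<lambda>x. norm (f x) powr p)"
    and p: "p \<ge> 1"
  shows "((\<lambda>\<tau>. LINT x|lborel. norm (f (x + \<tau>) - f x) powr p) \<longlongrightarrow> 0) (at 0)"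
  unfolding tendsto_at_iff_sequentially comp_def
  using Lp_shift_continuous[OF assms] by auto

lemma integrable_Lp_shift_diff:
  fixes f :: "'a::euclidean_space \<Rightarrow> 'b::euclidean_space"
  assumes f[measurable]: "f \<in> borel_measurable borel" and fp: "integrable lborel (\<lambda>x. norm (f x) powr p)"
    and p: "p \<ge> 1"
  shows "integrable lborel (\<lambda>x. norm (f (x + \<tau>) - f x) powr p)"
proof (rule Bochner_Integration.integrable_bound)
  show "integrable lborel (\<lambda>x. 2 powr p * (norm (f (x + \<tau>)) powr p + norm (f x) powr p))"
    using fp has_bochner_integral_shift(1)[OF fp, of \<tau>] by auto
  have "norm (f (x + \<tau>) - f x) powr p \<le> 2 powr p * (norm (f (x + \<tau>)) powr p + norm (f x) powr p)" for x
    using p powr_mono2[of p "norm (f (x + \<tau>) - f x)" "norm (f (x + \<tau>)) + norm (f x)"]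
      powr_add2_le[of "norm (f (x + \<tau>))" "norm (f x)" p] norm_triangle_ineq4[of "f (x + \<tau>)" "f x"] by auto
  then show "AE x in lborel. norm (norm (f (x + \<tau>) - f x) powr p) \<le> norm (2 powr p * (norm (f (x + \<tau>)) powr p + norm (f x) powr p))"
    by auto
qed auto

section \<open>Mollification\<close>

lemma mollifier_integral:
  fixes K :: "'a::euclidean_space \<Rightarrow> real"
  assumes "mollifier \<epsilon> K"
  shows "integrable lborel K" "integrable lborel (\<lambda>y. K (x - y))" "(LINT y|lborel. K (x - y)) = 1"
proof -
  have K: "C_k 0 K" "\<And>x. x \<notin> cball 0 \<epsilon> \<Longrightarrow> K x = 0" "(LINT x|lborel. K x) = 1"
    using assms unfolding mollifier_def by blast+
  show i: "integrable lborel K"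
    by (rule compactly_supported_integrable[OF C_k_cont[OF K(1)] compact_cball K(2)])
  show "integrable lborel (\<lambda>y. K (x - y))" "(LINT y|lborel. K (x - y)) = 1"
    using has_bochner_integral_reflect[OF i, of x] K(3) by auto
qed

lemma mollifier_bounded:
  fixes K :: "'a::euclidean_space \<Rightarrow> real"
  assumes "mollifier \<epsilon> K"
  obtains B where "\<And>x. \<bar>K x\<bar> \<le> B"
proof -
  have K: "C_k 0 K" "\<And>x. x \<notin> cball 0 \<epsilon> \<Longrightarrow> K x = 0"
    using assms unfolding mollifier_def by blast+
  obtain B where "\<And>x. norm (K x) \<le> B"
    using compactly_supported_bounded[OF C_k_cont[OF K(1)] compact_cball K(2)] by metis
  then show ?thesis by (intro that[of B]) (simp only: real_norm_def[symmetric])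
qed

lemma mollifier_measurable:
  assumes "mollifier \<epsilon> K"
  shows "K \<in> borel_measurable borel"
proof (rule borel_measurable_continuous_onI)
  have "C_k 0 K" using assms unfolding mollifier_def by blast
  then show "continuous_on UNIV K" by simp
qed

lemma integrable_mollifier_mult:
  fixes K :: "'a::euclidean_space \<Rightarrow> real" and g :: "'a \<Rightarrow> 'b::euclidean_space"
  assumes K: "mollifier \<epsilon> K" and g: "integrable lborel g"
  shows "integrable lborel (\<lambda>y. K (x - y) *\<^sub>R g y)"
proof -
  obtain B where B: "\<And>x. \<bar>K x\<bar> \<le> B" using mollifier_bounded[OF K] by metis
  have [measurable]: "K \<in> borel_measurable borel" "g \<in> borel_measurable borel"
    using mollifier_measurable[OF K] borel_measurable_integrable[OF g] by auto
  show ?thesis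
  proof (rule Bochner_Integration.integrable_bound)
    show "integrable lborel (\<lambda>y. B * norm (g y))" using g by auto
    show "AE y in lborel. norm (K (x - y) *\<^sub>R g y) \<le> norm (B * norm (g y))"
      using B order_trans[OF abs_ge_zero B] by (auto intro!: AE_I2 mult_right_mono simp: abs_mult)
  qed measurable
qed

text \<open>The same integral as \<open>conv\<close>, with the roles exchanged: here the function to be smoothed may be vector valued, there
the kernel may be, as is needed for its gradient.\<close>

definition mollify :: "('a::euclidean_space \<Rightarrow> real) \<Rightarrow> ('a \<Rightarrow> 'b::euclidean_space) \<Rightarrow> 'a \<Rightarrow> 'b" where
  "mollify K g x = (LINT y|lborel. K (x - y) *\<^sub>R g y)"

lemma mollify_eq_conv: "mollify K f = conv f K"
proof
  fix x
  have "K (x - y) *\<^sub>R f y = f y *\<^sub>R K (x - y)" for y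
    unfolding real_scaleR_def by (rule mult.commute)
  then show "mollify K f x = conv f K x" unfolding mollify_def conv_def by presburger
qed

text \<open>Inserting \<open>\<beta> = M^{1/p}\<close>, which balances the two terms, turns a family of split bounds into one inequality for powers.\<close>

lemma powr_le_of_young_bounds:
  fixes m M p :: real
  assumes "\<And>\<beta>. \<beta> > 0 \<Longrightarrow> m \<le> \<beta> + \<beta> powr (1 - p) * M" and "0 \<le> m" "0 \<le> M" "p \<ge> 1"
  shows "m powr p \<le> 2 powr p * M"
proof (cases "M = 0")
  case True
  have "m \<le> 0 + e" if "e > 0" for e
    using assms(1)[OF that] unfolding True by simp
  then have "m \<le> 0" by (rule field_le_epsilon)
  then show ?thesis using assms(2-4) by simp
next
  case False
  then have M: "M > 0" using assms(2-4) by simp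
  have "m \<le> M powr (1 / p) + (M powr (1 / p)) powr (1 - p) * M"
    using assms(1)[of "M powr (1 / p)"] M by simp
  also have "(M powr (1 / p)) powr (1 - p) * M = M powr (1 / p)"
  proof -
    have "(M powr (1 / p)) powr (1 - p) * M = M powr ((1 / p) * (1 - p)) * M powr 1"
      using M by (simp add: powr_powr)
    also have "\<dots> = M powr ((1 / p) * (1 - p) + 1)" by (simp only: powr_add)
    also have "(1 / p) * (1 - p) + 1 = 1 / p" using assms(4) by (simp add: field_simps)
    finally show ?thesis .
  qed
  finally have "m \<le> 2 * M powr (1 / p)" by simp
  then have "m powr p \<le> (2 * M powr (1 / p)) powr p"
    using assms(2-4) by (intro powr_mono2) auto
  also have "\<dots> = 2 powr p * M" using M assms(2-4) by (simp add: powr_mult powr_powr)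
  finally show ?thesis .
qed

text \<open>Jensen's inequality up to the factor \<open>2^p\<close>: \<open>K(x - y) dy\<close> is a probability measure. The right side may be infinite.\<close>

lemma mollify_pointwise:
  fixes K :: "'a::euclidean_space \<Rightarrow> real" and g :: "'a \<Rightarrow> 'b::euclidean_space"
  assumes K: "mollifier \<epsilon> K" and g: "integrable lborel g" and p: "p \<ge> 1"
  shows "ennreal (norm (mollify K g x - g x) powr p)
     \<le> ennreal (2 powr p) * (\<integral>\<^sup>+y. ennreal (K (x - y) * norm (g y - g x) powr p) \<partial>lborel)"
    (is "?L \<le> ennreal (2 powr p) * ?M")
proof (cases "?M = \<infinity>")
  case True
  then show ?thesis by (simp add: ennreal_mult_top)
next
  case False
  have [measurable]: "K \<in> borel_measurable borel" "g \<in> borel_measurable borel"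
    using mollifier_measurable[OF K] borel_measurable_integrable[OF g] by auto
  have nn: "0 \<le> K x" for x using K by (simp add: mollifier_def)
  define q where "q y = K (x - y) * norm (g y - g x) powr p" for y
  have q0: "0 \<le> q y" for y using nn by (simp add: q_def)
  have iq: "integrable lborel q"
    using False q0 unfolding q_def[abs_def] by (intro integrableI_nonneg) (auto simp: less_top)
  have Mq: "?M = ennreal (LINT y|lborel. q y)"
    using nn_integral_eq_integral[OF iq] q0 by (simp add: q_def[abs_def])
  have ig: "integrable lborel (\<lambda>y. K (x - y) *\<^sub>R g y)" by (rule integrable_mollifier_mult[OF K g])
  have ic: "integrable lborel (\<lambda>y. K (x - y) *\<^sub>R g x)" using mollifier_integral(2)[OF K] by auto
  have "mollify K g x - g x = (LINT y|lborel. K (x - y) *\<^sub>R g y) - (LINT y|lborel. K (x - y) *\<^sub>R g x)"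
    using mollifier_integral(2,3)[OF K, of x] by (simp add: mollify_def)
  also have "\<dots> = (LINT y|lborel. K (x - y) *\<^sub>R (g y - g x))"
    using ig ic by (simp add: algebra_simps)
  finally have eq: "mollify K g x - g x = (LINT y|lborel. K (x - y) *\<^sub>R (g y - g x))" .
  have id: "integrable lborel (\<lambda>y. K (x - y) *\<^sub>R (g y - g x))" using ig ic by (simp add: algebra_simps)
  have "norm (mollify K g x - g x) powr p \<le> 2 powr p * (LINT y|lborel. q y)"
  proof (rule powr_le_of_young_bounds)
    fix \<beta> :: real assume \<beta>: "\<beta> > 0"
    have "norm (mollify K g x - g x) \<le> (LINT y|lborel. norm (K (x - y) *\<^sub>R (g y - g x)))"
      unfolding eq by (rule integral_norm_bound)
    also have "\<dots> \<le> (LINT y|lborel. K (x - y) * \<beta> + \<beta> powr (1 - p) * q y)"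
    proof (rule integral_mono)
      show "integrable lborel (\<lambda>y. norm (K (x - y) *\<^sub>R (g y - g x)))" by (rule integrable_norm[OF id])
      show "integrable lborel (\<lambda>y. K (x - y) * \<beta> + \<beta> powr (1 - p) * q y)"
        by (intro Bochner_Integration.integrable_add integrable_mult_left integrable_mult_right mollifier_integral(2)[OF K] iq)
      fix y
      have "K (x - y) * norm (g y - g x) \<le> K (x - y) * (\<beta> + \<beta> powr (1 - p) * norm (g y - g x) powr p)"
        using young_split1[of "norm (g y - g x)" p \<beta>] p \<beta> nn by (intro mult_left_mono) auto
      then show "norm (K (x - y) *\<^sub>R (g y - g x)) \<le> K (x - y) * \<beta> + \<beta> powr (1 - p) * q y"
        using nn[of "x - y"] by (simp add: q_def distrib_left mult.left_commute)
    qed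
    also have "\<dots> = \<beta> + \<beta> powr (1 - p) * (LINT y|lborel. q y)"
      using iq mollifier_integral(2,3)[OF K, of x] by simp
    finally show "norm (mollify K g x - g x) \<le> \<beta> + \<beta> powr (1 - p) * (LINT y|lborel. q y)" .
  qed (use q0 p in auto)
  then show ?thesis
    unfolding Mq using q0 by (simp add: ennreal_mult'[symmetric] ennreal_leI)
qed

text \<open>By the pointwise bound and Fubini's theorem, the error in \<open>L^p\<close> is an average of errors of translations by
vectors in the support of the kernel.\<close>

lemma Lp_mollify:
  fixes g :: "'a::euclidean_space \<Rightarrow> 'b::euclidean_space"
  assumes g: "integrable lborel g" and gp: "integrable lborel (\<lambda>x. norm (g x) powr p)"
    and p: "p \<ge> 1" and e: "e > 0"
  obtains d where "d > 0"
    "\<And>\<epsilon> K. mollifier \<epsilon> K \<Longrightarrow> \<epsilon> < d \<Longrightarrow> (\<integral>\<^sup>+x. ennreal (norm (mollify K g x - g x) powr p) \<partial>lborel) \<le> ennreal e"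
proof -
  have [measurable]: "g \<in> borel_measurable borel" using borel_measurable_integrable[OF g] by auto
  let ?e = "e / 2 powr p"
  have e': "?e > 0" using e by simp
  have "eventually (\<lambda>\<tau>. (LINT x|lborel. norm (g (x + \<tau>) - g x) powr p) < ?e) (at 0)"
    using order_tendstoD(2)[OF Lp_shift_continuous_at[OF _ gp p] e'] by simp
  then obtain d where d: "d > 0" "\<And>\<tau>. \<tau> \<noteq> 0 \<Longrightarrow> norm \<tau> < d \<Longrightarrow> (LINT x|lborel. norm (g (x + \<tau>) - g x) powr p) < ?e"
    unfolding eventually_at by auto
  have d': "(LINT x|lborel. norm (g (x + \<tau>) - g x) powr p) \<le> ?e" if "norm \<tau> < d" for \<tau>
    using d(2)[OF _ that] e' by (cases "\<tau> = 0") auto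
  have "(\<integral>\<^sup>+x. ennreal (norm (mollify K g x - g x) powr p) \<partial>lborel) \<le> ennreal e"
    if K: "mollifier \<epsilon> K" and \<epsilon>: "\<epsilon> < d" for \<epsilon> K
  proof -
    have [measurable]: "K \<in> borel_measurable borel" using mollifier_measurable[OF K] .
    have nn: "0 \<le> K x" for x using K by (simp add: mollifier_def)
    have "(\<integral>\<^sup>+x. ennreal (norm (mollify K g x - g x) powr p) \<partial>lborel)
      \<le> (\<integral>\<^sup>+x. ennreal (2 powr p) * (\<integral>\<^sup>+y. ennreal (K (x - y) * norm (g y - g x) powr p) \<partial>lborel) \<partial>lborel)"
      by (intro nn_integral_mono mollify_pointwise[OF K g p])
    also have "\<dots> = ennreal (2 powr p) * (\<integral>\<^sup>+x. (\<integral>\<^sup>+y. ennreal (K (x - y) * norm (g y - g x) powr p) \<partial>lborel) \<partial>lborel)"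
      by (rule nn_integral_cmult) measurable
    also have "(\<integral>\<^sup>+x. (\<integral>\<^sup>+y. ennreal (K (x - y) * norm (g y - g x) powr p) \<partial>lborel) \<partial>lborel)
        = (\<integral>\<^sup>+y. (\<integral>\<^sup>+x. ennreal (K (x - y) * norm (g y - g x) powr p) \<partial>lborel) \<partial>lborel)"
      by (rule lborel_pair.Fubini') measurable
    also have "\<dots> = (\<integral>\<^sup>+y. (\<integral>\<^sup>+x. ennreal (K x * norm (g y - g (x + y)) powr p) \<partial>lborel) \<partial>lborel)"
    proof (rule nn_integral_cong)
      fix y
      have "(\<integral>\<^sup>+x. ennreal (K ((x + y) - y) * norm (g y - g (x + y)) powr p) \<partial>lborel)
          = (\<integral>\<^sup>+x. ennreal (K (x - y) * norm (g y - g x) powr p) \<partial>lborel)"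
        by (rule nn_integral_shift) measurable
      then show "(\<integral>\<^sup>+x. ennreal (K (x - y) * norm (g y - g x) powr p) \<partial>lborel) = (\<integral>\<^sup>+x. ennreal (K x * norm (g y - g (x + y)) powr p) \<partial>lborel)"
        by simp
    qed
    also have "\<dots> = (\<integral>\<^sup>+x. (\<integral>\<^sup>+y. ennreal (K x * norm (g y - g (x + y)) powr p) \<partial>lborel) \<partial>lborel)"
      by (rule lborel_pair.Fubini') measurable
    also have "\<dots> \<le> (\<integral>\<^sup>+x. ennreal (?e * K x) \<partial>lborel)"
    proof (rule nn_integral_mono)
      fix x
      have i: "integrable lborel (\<lambda>y. norm (g (y + x) - g y) powr p)"
        using integrable_Lp_shift_diff[OF _ gp p] by simp
      have "(\<integral>\<^sup>+y. ennreal (K x * norm (g y - g (x + y)) powr p) \<partial>lborel) = ennreal (LINT y|lborel. K x * norm (g (y + x) - g y) powr p)"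
        using i nn by (subst nn_integral_eq_integral[symmetric]) (auto simp: norm_minus_commute add.commute)
      also have "\<dots> \<le> ennreal (?e * K x)"
      proof (cases "norm x < d")
        case True
        then show ?thesis using mult_left_mono[OF d'[OF True] nn[of x]] by (intro ennreal_leI) (simp add: mult.commute)
      next
        case False
        then have "K x = 0" using K \<epsilon> by (auto simp: mollifier_def)
        then show ?thesis by simp
      qed
      finally show "(\<integral>\<^sup>+y. ennreal (K x * norm (g y - g (x + y)) powr p) \<partial>lborel) \<le> ennreal (?e * K x)" .
    qed
    also have "\<dots> = ennreal ?e"
    proof -
      have "(\<integral>\<^sup>+x. ennreal (?e * K x) \<partial>lborel) = ennreal (LINT x|lborel. ?e * K x)"
        using mollifier_integral(1)[OF K] nn e' 
        by (intro nn_integral_eq_integral integrable_mult_right AE_I2 mult_nonneg_nonneg) (auto intro: less_imp_le)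
      also have "(LINT x|lborel. ?e * K x) = ?e * (LINT x|lborel. K x)" by (rule integral_mult_right_zero)
      also have "(LINT x|lborel. K x) = 1" using K by (simp add: mollifier_def)
      finally show ?thesis by simp
    qed
    finally have "(\<integral>\<^sup>+x. ennreal (norm (mollify K g x - g x) powr p) \<partial>lborel) \<le> ennreal (2 powr p) * ennreal ?e"
      by (simp add: mult_left_mono)
    also have "\<dots> = ennreal e" using e by (simp add: ennreal_mult'[symmetric])
    finally show ?thesis .
  qed
  then show ?thesis using that d(1) by blast
qed

lemma mollify_measurable:
  fixes K :: "'a::euclidean_space \<Rightarrow> real" and g :: "'a \<Rightarrow> 'b::euclidean_space"
  assumes K: "mollifier \<epsilon> K" and g: "integrable lborel g"
  shows "mollify K g \<in> borel_measurable borel"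
proof -
  have [measurable]: "K \<in> borel_measurable borel" "g \<in> borel_measurable borel"
    using mollifier_measurable[OF K] borel_measurable_integrable[OF g] by auto
  have "(\<lambda>x. LINT y|lborel. K (x - y) *\<^sub>R g y) \<in> borel_measurable lborel"
    by (rule lborel.borel_measurable_lebesgue_integral) measurable
  then show ?thesis by (simp add: mollify_def[abs_def])
qed

lemma Lp_mollify_integrable:
  fixes K :: "'a::euclidean_space \<Rightarrow> real" and g :: "'a \<Rightarrow> 'b::euclidean_space"
  assumes K: "mollifier \<epsilon> K" and g: "integrable lborel g"
   and le: "(\<integral>\<^sup>+x. ennreal (norm (mollify K g x - g x) powr p) \<partial>lborel) \<le> ennreal e" and e: "e \<ge> 0"
  shows "integrable lborel (\<lambda>x. norm (mollify K g x - g x) powr p)"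
    "(LINT x|lborel. norm (mollify K g x - g x) powr p) \<le> e"
proof -
  have [measurable]: "mollify K g \<in> borel_measurable borel" "g \<in> borel_measurable borel"
    using mollify_measurable[OF K g] borel_measurable_integrable[OF g] by auto
  show i: "integrable lborel (\<lambda>x. norm (mollify K g x - g x) powr p)"
    using le by (intro integrableI_nonneg) (auto simp: le_less_trans)
  show "(LINT x|lborel. norm (mollify K g x - g x) powr p) \<le> e"
    using le nn_integral_eq_integral[OF i] e by simp
qed

text \<open>Convergence in \<open>L^p\<close> implies convergence almost everywhere only for a subsequence; one sequence of
kernels has to serve \<open>f\<close> and \<open>g\<close> simultaneously, because \<open>g\<close> will be the weak gradient of \<open>f\<close>.\<close>

lemma mollifier_sequence:
  fixes f :: "'a::euclidean_space \<Rightarrow> real" and g :: "'a \<Rightarrow> 'b::euclidean_space"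
  assumes f: "integrable lborel f" "integrable lborel (\<lambda>x. norm (f x) powr p)"
    and g: "integrable lborel g" "integrable lborel (\<lambda>x. norm (g x) powr p)"
    and p: "p \<ge> 1" and r: "r > 0"
  obtains \<epsilon> :: "nat \<Rightarrow> real" and K :: "nat \<Rightarrow> 'a \<Rightarrow> real"
  where "\<And>n. 0 < \<epsilon> n" "\<And>n. \<epsilon> n < r" "\<epsilon> \<longlonglongrightarrow> 0" "\<And>n. mollifier (\<epsilon> n) (K n)"
    "AE x in lborel. (\<lambda>n. mollify (K n) f x) \<longlonglongrightarrow> f x"
    "\<And>n. integrable lborel (\<lambda>x. norm (mollify (K n) g x - g x) powr p)"
    "(\<lambda>n. LINT x|lborel. norm (mollify (K n) g x - g x) powr p) \<longlonglongrightarrow> 0"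
proof -
  define P where "P n \<epsilon> K \<longleftrightarrow> 0 < \<epsilon> \<and> \<epsilon> < r \<and> \<epsilon> \<le> 1 / real (Suc n) \<and> mollifier \<epsilon> (K :: 'a \<Rightarrow> real) \<and>
     integrable lborel (\<lambda>x. norm (mollify K f x - f x) powr p) \<and> (LINT x|lborel. norm (mollify K f x - f x) powr p) \<le> 1 / real (Suc n) \<and>
     integrable lborel (\<lambda>x. norm (mollify K g x - g x) powr p) \<and> (LINT x|lborel. norm (mollify K g x - g x) powr p) \<le> 1 / real (Suc n)"
     for n \<epsilon> K
  have "\<exists>\<epsilon> K. P n \<epsilon> K" for n
  proof -
    let ?e = "1 / real (Suc n)"
    have e: "?e > 0" by simp
    obtain d1 where d1: "d1 > 0" "\<And>\<epsilon> K. mollifier \<epsilon> K \<Longrightarrow> \<epsilon> < d1 \<Longrightarrow> (\<integral>\<^sup>+x. ennreal (norm (mollify K f x - f x) powr p) \<partial>lborel) \<le> ennreal ?e"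
      using Lp_mollify[OF f p e] by metis
    obtain d2 where d2: "d2 > 0" "\<And>\<epsilon> K. mollifier \<epsilon> K \<Longrightarrow> \<epsilon> < d2 \<Longrightarrow> (\<integral>\<^sup>+x. ennreal (norm (mollify K g x - g x) powr p) \<partial>lborel) \<le> ennreal ?e"
      using Lp_mollify[OF g p e] by metis
    define m where "m = min (min d1 d2) (min r ?e)"
    have m: "0 < m" "m \<le> d1" "m \<le> d2" "m \<le> r" "m \<le> ?e"
      using d1(1) d2(1) r e unfolding m_def by auto
    define \<epsilon> where "\<epsilon> = m / 2"
    have \<epsilon>: "0 < \<epsilon>" "\<epsilon> < d1" "\<epsilon> < d2" "\<epsilon> < r" "\<epsilon> \<le> ?e"
      using m unfolding \<epsilon>_def by linarith+
    obtain K :: "'a \<Rightarrow> real" where K: "mollifier \<epsilon> K" using mollifier_exists[OF \<epsilon>(1)] by metis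
    show ?thesis
      unfolding P_def
      using \<epsilon> K Lp_mollify_integrable[OF K f(1) d1(2)[OF K \<epsilon>(2)]] Lp_mollify_integrable[OF K g(1) d2(2)[OF K \<epsilon>(3)]] e
      by (intro exI[of _ \<epsilon>] exI[of _ K] conjI) auto
  qed
  then obtain \<epsilon> :: "nat \<Rightarrow> real" and K :: "nat \<Rightarrow> 'a \<Rightarrow> real" where P: "P n (\<epsilon> n) (K n)" for n
    by metis
  have *: "0 < \<epsilon> n" "\<epsilon> n < r" "\<epsilon> n \<le> 1 / real (Suc n)" "mollifier (\<epsilon> n) (K n)"
     "integrable lborel (\<lambda>x. norm (mollify (K n) f x - f x) powr p)" "(LINT x|lborel. norm (mollify (K n) f x - f x) powr p) \<le> 1 / real (Suc n)"
     "integrable lborel (\<lambda>x. norm (mollify (K n) g x - g x) powr p)" "(LINT x|lborel. norm (mollify (K n) g x - g x) powr p) \<le> 1 / real (Suc n)"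
    for n using P[of n] unfolding P_def by blast+
  have lim0: "X \<longlonglongrightarrow> 0" if "\<And>n. 0 \<le> X n" "\<And>n. X n \<le> 1 / real (Suc n)" for X :: "nat \<Rightarrow> real"
    by (rule tendsto_sandwich[OF _ _ tendsto_const LIMSEQ_inverse_real_of_nat])
       (use that in \<open>auto simp: inverse_eq_divide\<close>)
  have L: "(\<lambda>n. LINT x|lborel. norm (norm (mollify (K n) f x - f x) powr p)) \<longlonglongrightarrow> 0"
    using *(6) by (intro lim0) auto
  obtain s :: "nat \<Rightarrow> nat" where s: "strict_mono s" "AE x in lborel. (\<lambda>n. norm (mollify (K (s n)) f x - f x) powr p) \<longlonglongrightarrow> 0"
    using tendsto_L1_AE_subseq[OF *(5) L] by auto
  have "AE x in lborel. (\<lambda>n. mollify (K (s n)) f x) \<longlonglongrightarrow> f x"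
    using s(2)
  proof eventually_elim
    fix x assume "(\<lambda>n. norm (mollify (K (s n)) f x - f x) powr p) \<longlonglongrightarrow> 0"
    then have "(\<lambda>n. (norm (mollify (K (s n)) f x - f x) powr p) powr (1 / p)) \<longlonglongrightarrow> 0 powr (1 / p)"
      using p by (intro tendsto_powr') auto
    then have "(\<lambda>n. norm (mollify (K (s n)) f x - f x)) \<longlonglongrightarrow> 0"
      using p by (simp add: powr_powr)
    then show "(\<lambda>n. mollify (K (s n)) f x) \<longlonglongrightarrow> f x"
      by (rule LIM_zero_cancel[OF tendsto_norm_zero_cancel])
  qed
  moreover have "(\<lambda>n. \<epsilon> (s n)) \<longlonglongrightarrow> 0" "(\<lambda>n. LINT x|lborel. norm (mollify (K (s n)) g x - g x) powr p) \<longlonglongrightarrow> 0"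
    using LIMSEQ_subseq_LIMSEQ[OF lim0[of \<epsilon>] s(1)] 
      LIMSEQ_subseq_LIMSEQ[OF lim0[of "\<lambda>n. LINT x|lborel. norm (mollify (K n) g x - g x) powr p"] s(1)] *(1,3,8)
    by (auto simp: comp_def less_imp_le)
  ultimately show ?thesis
    using that[of "\<lambda>n. \<epsilon> (s n)" "\<lambda>n. K (s n)"] * by auto
qed

section \<open>Spatial test functions of class \<open>C\<^sup>1\<close>\<close>

lemma measurable_fst_snd_borel [measurable]:
  "fst \<in> borel_measurable (borel :: ('a::euclidean_space \<times> 'b::euclidean_space) measure)"
  "snd \<in> borel_measurable (borel :: ('a::euclidean_space \<times> 'b::euclidean_space) measure)"
  by (auto intro!: borel_measurable_continuous_onI continuous_intros)

lemma mollifier_sign: "mollifier \<epsilon> K \<Longrightarrow> 0 \<le> K x"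
  by (simp add: mollifier_def)

lemma mollifier_C_k: "mollifier \<epsilon> K \<Longrightarrow> C_k k K"
  by (simp add: mollifier_def)

lemma mollifier_supp: "mollifier \<epsilon> K \<Longrightarrow> x \<notin> cball 0 \<epsilon> \<Longrightarrow> K x = 0"
  by (simp add: mollifier_def)

lemma integrable_mollifier_conv:
  fixes H :: "'a::euclidean_space \<Rightarrow> 'b::euclidean_space"
  assumes K: "mollifier \<epsilon> K" and H: "continuous_on UNIV H" "\<And>x. norm (H x) \<le> B"
  shows "integrable lborel (\<lambda>y. K y *\<^sub>R H (x - y))"
  by (rule integrable_conv[OF mollifier_integral(1)[OF K] H])

lemma norm_conv_mollifier_le:
  fixes H :: "'a::euclidean_space \<Rightarrow> 'b::euclidean_space"
  assumes K: "mollifier \<epsilon> K" and H: "continuous_on UNIV H" "\<And>x. norm (H x) \<le> B"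
  shows "norm (conv K H x) \<le> B"
proof -
  have "norm (conv K H x) \<le> (LINT y|lborel. norm (K y *\<^sub>R H (x - y)))"
    unfolding conv_def by (rule integral_norm_bound)
  also have "\<dots> \<le> (LINT y|lborel. K y * B)"
  proof (rule integral_mono)
    show "integrable lborel (\<lambda>y. norm (K y *\<^sub>R H (x - y)))"
      by (rule integrable_norm[OF integrable_mollifier_conv[OF K H]])
    show "integrable lborel (\<lambda>y. K y * B)" by (intro integrable_mult_left mollifier_integral(1)[OF K])
    show "norm (K y *\<^sub>R H (x - y)) \<le> K y * B" for y
      using mollifier_sign[OF K, of y] H(2) by (simp add: mult_left_mono)
  qed
  also have "\<dots> = B" using K by (simp add: mollifier_def)
  finally show ?thesis .
qed

lemma conv_mollifier_tendsto:
  fixes H :: "'a::euclidean_space \<Rightarrow> 'b::euclidean_space"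
  assumes K: "\<And>n. mollifier (\<epsilon> n) (K n)" and e: "\<epsilon> \<longlonglongrightarrow> 0"
    and H: "continuous_on UNIV H" "\<And>x. norm (H x) \<le> B"
  shows "(\<lambda>n. conv (K n) H x) \<longlonglongrightarrow> H x"
proof (rule LIMSEQ_I)
  fix r :: real assume r: "r > 0"
  have "isCont H x" using H(1) by (simp add: continuous_on_eq_continuous_at)
  then obtain d where d: "d > 0" "\<And>y. dist y x < d \<Longrightarrow> dist (H y) (H x) < r / 2"
    using r unfolding continuous_at_eps_delta by (metis half_gt_zero)
  have "eventually (\<lambda>n. \<epsilon> n < d) sequentially"
    using order_tendstoD(2)[OF e d(1)] .
  then obtain N where N: "\<And>n. n \<ge> N \<Longrightarrow> \<epsilon> n < d" by (auto simp: eventually_sequentially)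
  have "norm (conv (K n) H x - H x) < r" if n: "n \<ge> N" for n
  proof -
    note i = integrable_mollifier_conv[OF K H, of n x]
    have ic: "integrable lborel (\<lambda>y. K n y *\<^sub>R H x)"
      using mollifier_integral(1)[OF K, of n] by (rule integrable_scaleR_left)
    have one: "(LINT y|lborel. K n y) = 1" using K[of n] by (simp add: mollifier_def)
    have "conv (K n) H x - H x = (LINT y|lborel. K n y *\<^sub>R H (x - y)) - (LINT y|lborel. K n y *\<^sub>R H x)"
      using mollifier_integral(1)[OF K, of n] one by (simp add: conv_def)
    also have "\<dots> = (LINT y|lborel. K n y *\<^sub>R (H (x - y) - H x))"
      using i ic by (simp add: scaleR_diff_right)
    finally have eq: "conv (K n) H x - H x = (LINT y|lborel. K n y *\<^sub>R (H (x - y) - H x))" .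
    have "norm (conv (K n) H x - H x) \<le> (LINT y|lborel. norm (K n y *\<^sub>R (H (x - y) - H x)))"
      unfolding eq by (rule integral_norm_bound)
    also have "\<dots> \<le> (LINT y|lborel. K n y * (r / 2))"
    proof (rule integral_mono)
      have "integrable lborel (\<lambda>y. K n y *\<^sub>R H (x - y) - K n y *\<^sub>R H x)"
        using i ic by (rule Bochner_Integration.integrable_diff)
      then show "integrable lborel (\<lambda>y. norm (K n y *\<^sub>R (H (x - y) - H x)))"
        by (intro integrable_norm) (simp add: scaleR_diff_right)
      show "integrable lborel (\<lambda>y. K n y * (r / 2))"
        by (intro integrable_mult_left mollifier_integral(1)[OF K])
      show "norm (K n y *\<^sub>R (H (x - y) - H x)) \<le> K n y * (r / 2)" for y
      proof (cases "y \<in> cball 0 (\<epsilon> n)")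
        case True
        then have "dist (x - y) x < d" using N[OF n] by (simp add: dist_norm)
        from d(2)[OF this] have "norm (H (x - y) - H x) \<le> r / 2" by (simp add: dist_norm)
        from mult_left_mono[OF this mollifier_sign[OF K, of n y]] show ?thesis
          unfolding norm_scaleR abs_of_nonneg[OF mollifier_sign[OF K]] .
      next
        case False
        then show ?thesis using mollifier_supp[OF K False] by simp
      qed
    qed
    also have "\<dots> = r / 2" using one by simp
    finally show ?thesis using r by simp
  qed
  then show "\<exists>N. \<forall>n\<ge>N. norm (conv (K n) H x - H x) < r" by blast
qed

lemma conv_commute:
  fixes f K :: "'a::euclidean_space \<Rightarrow> real"
  assumes f: "integrable lborel f" and K: "continuous_on UNIV K" and B: "\<And>x. norm (K x) \<le> B"
  shows "conv f K = conv K f"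
proof
  fix x
  have "(LINT y|lborel. f (x - y) * K (x - (x - y))) = (LINT y|lborel. f y * K (x - y))"
    using has_bochner_integral_reflect(2)[OF integrable_conv[OF f K B, of x], of x] by simp
  then show "conv f K x = conv K f x"
    by (simp add: conv_def mult.commute)
qed

text \<open>The weak inequality for test functions \<open>\<eta>(x)\<close> that do not depend on time: \<open>w\<close> stands for the increment of
\<open>|u|^{q-1}u\<close> between two times and \<open>a\<close> for the flux, cut off outside the time interval between them.\<close>

definition weak_ineq ::
  "'a::euclidean_space \<Rightarrow> real \<Rightarrow> ('a \<Rightarrow> real) \<Rightarrow> ('a \<times> real \<Rightarrow> 'a) \<Rightarrow> bool" where
  "weak_ineq c R w a \<longleftrightarrow> (\<forall>\<eta>. (\<forall>k. C_k k \<eta>) \<and> compact_support_in \<eta> (ball c R) \<and> (\<forall>x. 0 \<le> \<eta> x) \<longrightarrow>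
     (LINT x|lborel. w x * \<eta> x) + (LINT z|lborel. a z \<bullet> grad \<eta> (fst z)) \<le> 0)"

text \<open>Mollification of \<open>\<eta>\<close> with radius less than \<open>R - \<rho>\<close> gives admissible functions, which converge pointwise
and boundedly together with their gradients.\<close>

lemma weak_ineq_C1:
  fixes c :: "'a::euclidean_space"
  assumes W: "weak_ineq c R w a" and w: "integrable lborel w" and a: "integrable lborel a"
    and \<eta>: "C_k 1 \<eta>" "\<And>x. 0 \<le> \<eta> x" "\<And>x. x \<notin> cball c \<rho> \<Longrightarrow> \<eta> x = 0" and \<rho>: "\<rho> < R"
  shows "(LINT x|lborel. w x * \<eta> x) + (LINT z|lborel. a z \<bullet> grad \<eta> (fst z)) \<le> 0"
proof -
  have \<eta>1: "C_k (Suc 0) \<eta>" using \<eta>(1) by simp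
  define \<epsilon> where "\<epsilon> n = (R - \<rho>) / 2 * (1 / real (Suc n))" for n
  have \<epsilon>: "0 < \<epsilon> n" "\<epsilon> n \<le> (R - \<rho>) / 2" for n
    using \<rho> mult_left_le[of "1 / real (Suc n)" "(R - \<rho>) / 2"] by (auto simp: \<epsilon>_def)
  have "(\<lambda>n. (R - \<rho>) / 2 * (1 / real (Suc n))) \<longlonglongrightarrow> (R - \<rho>) / 2 * 0"
    using LIMSEQ_inverse_real_of_nat by (intro tendsto_mult tendsto_const) (simp add: inverse_eq_divide)
  then have \<epsilon>0: "\<epsilon> \<longlonglongrightarrow> 0" by (simp add: \<epsilon>_def[abs_def])
  have "\<exists>K :: 'a \<Rightarrow> real. mollifier (\<epsilon> n) K" for n using mollifier_exists[OF \<epsilon>(1)] by metis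
  then obtain K :: "nat \<Rightarrow> 'a \<Rightarrow> real" where K: "\<And>n. mollifier (\<epsilon> n) (K n)" by metis
  note c\<eta> = C_k_cont[OF \<eta>(1)] and cG = C1_continuous_grad[OF \<eta>1]
  have G0: "\<And>x. x \<notin> cball c \<rho> \<Longrightarrow> grad \<eta> x = 0"
    using grad_zero_outside[OF closed_cball, of _ _ \<eta>, OF \<eta>(3)] by blast
  obtain B where B: "\<And>x. norm (\<eta> x) \<le> B"
    using compactly_supported_bounded[OF c\<eta> compact_cball \<eta>(3)] by metis
  obtain B' where B': "\<And>x. norm (grad \<eta> x) \<le> B'"
    using compactly_supported_bounded[OF cG compact_cball G0] by metis
  have i\<eta>: "integrable lborel \<eta>" by (rule compactly_supported_integrable[OF c\<eta> compact_cball \<eta>(3)])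
  have [measurable]: "\<eta> \<in> borel_measurable borel" "grad \<eta> \<in> borel_measurable borel"
    "w \<in> borel_measurable borel" "a \<in> borel_measurable borel"
    using c\<eta> cG borel_measurable_integrable[OF w] borel_measurable_integrable[OF a]
    by (auto intro!: borel_measurable_continuous_onI)
  have comm: "conv (K n) \<eta> = conv \<eta> (K n)" for n
    using conv_commute[OF mollifier_integral(1)[OF K] c\<eta> B] .
  have smooth: "C_k k (conv (K n) \<eta>)" for k n
    unfolding comm by (rule conv_C_k[OF i\<eta> mollifier_C_k[OF K] compact_cball mollifier_supp[OF K]])
  have gr: "grad (conv (K n) \<eta>) x = conv (K n) (grad \<eta>) x" for n x
    by (rule grad_conv[OF mollifier_integral(1)[OF K] \<eta>1 compact_cball \<eta>(3)])
  have nonneg: "0 \<le> conv (K n) \<eta> x" for n x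
    unfolding conv_def by (rule Bochner_Integration.integral_nonneg) (simp add: mollifier_sign[OF K] \<eta>(2))
  have supp: "compact_support_in (conv (K n) \<eta>) (ball c R)" for n
  proof (rule compact_support_inI[OF compact_cball[of c "(R + \<rho>) / 2"]])
    show "cball c ((R + \<rho>) / 2) \<subseteq> ball c R" using \<rho> by auto
    fix x assume x: "x \<notin> cball c ((R + \<rho>) / 2)"
    have "K n y *\<^sub>R \<eta> (x - y) = 0" for y
    proof (cases "y \<in> cball 0 (\<epsilon> n)")
      case True
      then have "norm y \<le> (R - \<rho>) / 2" using \<epsilon>(2)[of n] by simp
      moreover have "norm (x - c) \<le> norm (x - y - c) + norm y" by norm
      ultimately have "x - y \<notin> cball c \<rho>" using x by (simp add: dist_norm norm_minus_commute)
      then show ?thesis using \<eta>(3) by simp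
    next
      case False
      then show ?thesis using mollifier_supp[OF K False] by simp
    qed
    then show "conv (K n) \<eta> x = 0" unfolding conv_def by (simp only: Bochner_Integration.integral_zero)
  qed
  have ineq: "(LINT x|lborel. w x * conv (K n) \<eta> x) + (LINT z|lborel. a z \<bullet> conv (K n) (grad \<eta>) (fst z)) \<le> 0" for n
  proof -
    have "(LINT x|lborel. w x * conv (K n) \<eta> x) + (LINT z|lborel. a z \<bullet> grad (conv (K n) \<eta>) (fst z)) \<le> 0"
      by (rule W[unfolded weak_ineq_def, rule_format]) (intro conjI allI smooth supp nonneg)
    then show ?thesis by (simp only: gr)
  qed
  have m1[measurable]: "conv (K n) \<eta> \<in> borel_measurable borel" for n
    by (intro borel_measurable_continuous_onI C_k_cont[OF smooth[of 0]])
  have m2[measurable]: "conv (K n) (grad \<eta>) \<in> borel_measurable borel" for n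
    using C1_continuous_grad[OF smooth[of "Suc 0" n]] unfolding gr by (intro borel_measurable_continuous_onI)
  have "(\<lambda>n. LINT x|lborel. w x * conv (K n) \<eta> x) \<longlonglongrightarrow> (LINT x|lborel. w x * \<eta> x)"
  proof (rule integral_dominated_convergence[where w="\<lambda>x. \<bar>w x\<bar> * B"])
    show "integrable lborel (\<lambda>x. \<bar>w x\<bar> * B)" using w by auto
    show "AE x in lborel. (\<lambda>n. w x * conv (K n) \<eta> x) \<longlonglongrightarrow> w x * \<eta> x"
      by (intro AE_I2 tendsto_intros conv_mollifier_tendsto[OF K \<epsilon>0 c\<eta> B])
    show "AE x in lborel. norm (w x * conv (K n) \<eta> x) \<le> \<bar>w x\<bar> * B" for n
      using norm_conv_mollifier_le[OF K c\<eta> B, of n] by (intro AE_I2) (simp add: abs_mult mult_left_mono)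
  qed measurable
  moreover have "(\<lambda>n. LINT z|lborel. a z \<bullet> conv (K n) (grad \<eta>) (fst z)) \<longlonglongrightarrow> (LINT z|lborel. a z \<bullet> grad \<eta> (fst z))"
  proof (rule integral_dominated_convergence[where w="\<lambda>x. norm (a x) * B'"])
    show "integrable lborel (\<lambda>x. norm (a x) * B')" using a by auto
    show "AE z in lborel. (\<lambda>n. a z \<bullet> conv (K n) (grad \<eta>) (fst z)) \<longlonglongrightarrow> a z \<bullet> grad \<eta> (fst z)"
      by (intro AE_I2 tendsto_intros conv_mollifier_tendsto[OF K \<epsilon>0 cG B'])
    show "AE z in lborel. norm (a z \<bullet> conv (K n) (grad \<eta>) (fst z)) \<le> norm (a z) * B'" for n
    proof (intro AE_I2)
      fix z
      have "\<bar>a z \<bullet> conv (K n) (grad \<eta>) (fst z)\<bar> \<le> norm (a z) * norm (conv (K n) (grad \<eta>) (fst z))"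
        by (rule Cauchy_Schwarz_ineq2)
      also have "\<dots> \<le> norm (a z) * B'"
        by (intro mult_left_mono norm_conv_mollifier_le[OF K cG B']) auto
      finally show "norm (a z \<bullet> conv (K n) (grad \<eta>) (fst z)) \<le> norm (a z) * B'" by simp
    qed
  qed measurable
  ultimately have "(\<lambda>n. (LINT x|lborel. w x * conv (K n) \<eta> x) + (LINT z|lborel. a z \<bullet> conv (K n) (grad \<eta>) (fst z)))
      \<longlonglongrightarrow> (LINT x|lborel. w x * \<eta> x) + (LINT z|lborel. a z \<bullet> grad \<eta> (fst z))"
    by (rule tendsto_add)
  then show ?thesis by (rule LIMSEQ_le_const2) (intro exI allI impI ineq)
qed

section \<open>Integrals over slabs\<close>

lemma AE_fst:
  assumes "AE x in (lborel :: 'a::euclidean_space measure). P x"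
  shows "AE z in (lborel :: ('a \<times> real) measure). P (fst z)"
proof -
  obtain N where N: "\<And>x. x \<in> space lborel - N \<Longrightarrow> P x" "N \<in> null_sets (lborel :: 'a measure)"
    using AE_E3[OF assms] by metis
  have "N \<times> UNIV \<in> null_sets (lborel \<Otimes>\<^sub>M (lborel :: real measure))"
    using N(2) by (rule lborel.times_in_null_sets1) auto
  then have "N \<times> (UNIV::real set) \<in> null_sets lborel" by (simp add: lborel_prod)
  moreover have "{z \<in> space lborel. \<not> P (fst z)} \<subseteq> N \<times> (UNIV::real set)"
  proof
    fix z :: "'a \<times> real" assume "z \<in> {z \<in> space lborel. \<not> P (fst z)}"
    then have "fst z \<in> N" using N(1)[of "fst z"] by fastforce
    then show "z \<in> N \<times> UNIV" by (simp add: mem_Times_iff)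
  qed
  ultimately show ?thesis by (rule AE_I')
qed

lemma slab_integrable:
  fixes H :: "'a::euclidean_space \<Rightarrow> real"
  assumes H: "integrable lborel H" and t: "t1 \<le> t2"
  shows "integrable lborel (\<lambda>z::'a \<times> real. indicator {t1..t2} (snd z) * H (fst z))"
    "(LINT z|(lborel :: ('a \<times> real) measure). indicator {t1..t2} (snd z) * H (fst z)) = (t2 - t1) * (LINT x|lborel. H x)"
proof -
  have [measurable]: "H \<in> borel_measurable borel" using borel_measurable_integrable[OF H] by auto
  let ?I = "indicator {t1..t2} :: real \<Rightarrow> real"
  have iI: "integrable lborel ?I" using emeasure_lborel_Icc[OF t] by (intro integrable_real_indicator) auto
  have II: "(LINT y|lborel. ?I y) = t2 - t1" using measure_lborel_Icc[OF t] by simp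
  have m: "(\<lambda>z. ?I (snd z) * H (fst z)) \<in> borel_measurable (lborel \<Otimes>\<^sub>M lborel)" by measurable
  have i: "integrable (lborel \<Otimes>\<^sub>M lborel) (\<lambda>z::'a \<times> real. ?I (snd z) * H (fst z))"
  proof (rule lborel_pair.Fubini_integrable[OF m])
    have "(LINT y|lborel. norm (?I (snd (x, y)) * H (fst (x, y)))) = (t2 - t1) * \<bar>H x\<bar>" for x :: 'a
    proof -
      have "(LINT y|lborel. norm (?I (snd (x, y)) * H (fst (x, y)))) = (LINT y|lborel. ?I y * \<bar>H x\<bar>)"
        by (intro Bochner_Integration.integral_cong refl) (simp only: snd_conv fst_conv real_norm_def abs_mult abs_indicator)
      then show ?thesis by (simp only: integral_mult_left_zero II)
    qed
    then show "integrable lborel (\<lambda>x. LINT y|lborel. norm (?I (snd (x, y)) * H (fst (x, y))))"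
      using integrable_mult_right[OF integrable_abs[OF H], of "t2 - t1"] by presburger
    show "AE x in lborel. integrable lborel (\<lambda>y. ?I (snd (x, y)) * H (fst (x, y)))"
      unfolding snd_conv fst_conv by (intro AE_I2 integrable_mult_left iI)
  qed
  then show "integrable lborel (\<lambda>z::'a \<times> real. ?I (snd z) * H (fst z))"
    by (simp only: lborel_prod)
  have "(LINT z|(lborel \<Otimes>\<^sub>M lborel). ?I (snd z) * H (fst z)) = (LINT x|lborel. LINT t|lborel. ?I (snd (x, t)) * H (fst (x, t)))"
    by (rule lborel_pair.integral_fst'[OF i, symmetric])
  also have "\<dots> = (t2 - t1) * (LINT x|lborel. H x)"
    unfolding snd_conv fst_conv integral_mult_left_zero II integral_mult_right_zero ..
  finally show "(LINT z|(lborel :: ('a \<times> real) measure). ?I (snd z) * H (fst z)) = (t2 - t1) * (LINT x|lborel. H x)"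
    by (simp only: lborel_prod)
qed

text \<open>A replacement of Hoelder's inequality for the pairing of a field in \<open>L^{p/(p-1)}\<close> with a function of \<open>x\<close> in \<open>L^p\<close>.\<close>

lemma slab_pairing:
  fixes a :: "'a::euclidean_space \<times> real \<Rightarrow> 'b::euclidean_space" and H :: "'a \<Rightarrow> real"
  assumes [measurable]: "a \<in> borel_measurable borel" "k \<in> borel_measurable borel" "H \<in> borel_measurable borel"
    and ak: "\<And>z. norm (a z) \<le> k z powr (p - 1)" and k0: "\<And>z. 0 \<le> k z"
    and kp: "integrable lborel (\<lambda>z. k z powr p)" and a0: "\<And>z. snd z \<notin> {t1..t2} \<Longrightarrow> a z = 0"
    and H0: "\<And>x. 0 \<le> H x" and Hp: "integrable lborel (\<lambda>x. H x powr p)" and t: "t1 \<le> t2" and p: "p \<ge> 1"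
  shows "integrable lborel (\<lambda>z. norm (a z) * H (fst z))"
    and "\<beta> > 0 \<Longrightarrow> (LINT z|lborel. norm (a z) * H (fst z))
       \<le> \<beta> * (LINT z|lborel. k z powr p) + \<beta> powr (1 - p) * ((t2 - t1) * (LINT x|lborel. H x powr p))"
proof -
  have le: "norm (a z) * H (fst z) \<le> \<beta> * k z powr p + \<beta> powr (1 - p) * (indicator {t1..t2} (snd z) * H (fst z) powr p)"
    if \<beta>: "\<beta> > 0" for \<beta> z
  proof (cases "snd z \<in> {t1..t2}")
    case True
    have "norm (a z) * H (fst z) \<le> k z powr (p - 1) * H (fst z)"
      using ak H0 by (intro mult_right_mono) auto
    also have "\<dots> \<le> \<beta> * k z powr p + \<beta> powr (1 - p) * H (fst z) powr p"
      using k0 H0 p \<beta> by (intro young_split) auto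
    finally show ?thesis using True by simp
  next
    case False
    then show ?thesis using a0[OF False] \<beta> by simp
  qed
  have i: "integrable lborel (\<lambda>z. \<beta> * k z powr p + \<beta> powr (1 - p) * (indicator {t1..t2} (snd z) * H (fst z) powr p))" for \<beta>
    by (intro Bochner_Integration.integrable_add integrable_mult_right kp slab_integrable(1)[OF Hp t])
  show i1: "integrable lborel (\<lambda>z. norm (a z) * H (fst z))"
  proof (rule Bochner_Integration.integrable_bound[OF i[of 1]])
    show "AE z in lborel. norm (norm (a z) * H (fst z))
        \<le> norm (1 * k z powr p + 1 powr (1 - p) * (indicator {t1..t2} (snd z) * H (fst z) powr p))"
      using le[of 1] H0 by (intro AE_I2) (auto simp: abs_mult intro: order_trans[OF _ abs_ge_self])
  qed measurable
  assume \<beta>: "\<beta> > 0"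
  have "(LINT z|lborel. norm (a z) * H (fst z)) \<le> (LINT z|lborel. \<beta> * k z powr p + \<beta> powr (1 - p) * (indicator {t1..t2} (snd z) * H (fst z) powr p))"
    by (rule integral_mono[OF i1 i le[OF \<beta>]])
  also have "\<dots> = \<beta> * (LINT z|lborel. k z powr p) + \<beta> powr (1 - p) * ((t2 - t1) * (LINT x|lborel. H x powr p))"
    using kp slab_integrable[OF Hp t] by simp
  finally show "(LINT z|lborel. norm (a z) * H (fst z))
       \<le> \<beta> * (LINT z|lborel. k z powr p) + \<beta> powr (1 - p) * ((t2 - t1) * (LINT x|lborel. H x powr p))" .
qed

text \<open>First \<open>\<beta>\<close> is chosen small, then the index large.\<close>

lemma young_bound_tendsto_0:
  fixes X Y :: "nat \<Rightarrow> real"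
  assumes X: "\<And>n. 0 \<le> X n" "\<And>n \<beta>. \<beta> > 0 \<Longrightarrow> X n \<le> \<beta> * A + \<beta> powr (1 - p) * (B * Y n)" and Y: "Y \<longlonglongrightarrow> 0" and A: "0 \<le> A"
  shows "X \<longlonglongrightarrow> 0"
proof (rule LIMSEQ_I)
  fix e :: real assume e: "e > 0"
  define \<beta> where "\<beta> = e / (2 * (A + 1))"
  have \<beta>: "\<beta> > 0" using e A by (simp add: \<beta>_def)
  have "(\<lambda>n. \<beta> powr (1 - p) * (B * Y n)) \<longlonglongrightarrow> \<beta> powr (1 - p) * (B * 0)"
    by (intro tendsto_intros Y)
  then have "(\<lambda>n. \<beta> powr (1 - p) * (B * Y n)) \<longlonglongrightarrow> 0" by simp
  from order_tendstoD(2)[OF this, of "e / 2"] e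
  obtain N where N: "\<And>n. n \<ge> N \<Longrightarrow> \<beta> powr (1 - p) * (B * Y n) < e / 2" by (auto simp: eventually_sequentially)
  have "\<beta> * A \<le> e / 2"
  proof -
    have "\<beta> * A \<le> \<beta> * (A + 1)" using \<beta> by simp
    also have "\<dots> = e / 2" using A by (simp add: \<beta>_def field_simps)
    finally show ?thesis .
  qed
  then have "X n < e" if "n \<ge> N" for n using X(2)[OF \<beta>, of n] N[OF that] by linarith
  then show "\<exists>N. \<forall>n\<ge>N. norm (X n - 0) < e" using X(1) by (auto intro!: exI[of _ N])
qed

section \<open>Nonlinear test functions\<close>

text \<open>The test function \<open>\<phi>(f) Z\<close>, where \<open>g\<close> is the weak gradient of \<open>f\<close>. The hypothesis \<open>fg\<close> expresses this in the
form in which it is used: near the support of \<open>Z\<close> the gradient of a mollification of \<open>f\<close> is the mollification of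
\<open>g\<close>. Therefore \<open>\<phi>(f_n) Z\<close>, with mollifications \<open>f_n\<close> of \<open>f\<close>, is a test function of class \<open>C^1\<close> with gradient
\<open>\<phi>'(f_n) Z g_n + \<phi>(f_n) DZ\<close>. Replacing \<open>g_n\<close> by \<open>g\<close> costs a term that vanishes by \<open>slab_pairing\<close>, and what
remains converges by dominated convergence.\<close>

lemma weak_ineq_comp:
  fixes c :: "'a::euclidean_space" and f :: "'a \<Rightarrow> real" and g :: "'a \<Rightarrow> 'a"
    and a :: "'a \<times> real \<Rightarrow> 'a" and k :: "'a \<times> real \<Rightarrow> real"
  assumes W: "weak_ineq c R w a" and w: "integrable lborel w" and a: "integrable lborel a"
    and k[measurable]: "k \<in> borel_measurable borel"
    and ak: "\<And>z. norm (a z) \<le> k z powr (p - 1)" and k0: "\<And>z. 0 \<le> k z"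
    and kp: "integrable lborel (\<lambda>z. k z powr p)" and a0: "\<And>z. snd z \<notin> {t1..t2} \<Longrightarrow> a z = 0"
    and t: "t1 \<le> t2" and p: "p \<ge> 1"
    and f: "integrable lborel f" "integrable lborel (\<lambda>x. norm (f x) powr p)"
    and g: "integrable lborel g" "integrable lborel (\<lambda>x. norm (g x) powr p)"
    and fg: "\<And>\<epsilon> K x. mollifier \<epsilon> K \<Longrightarrow> \<epsilon> < r \<Longrightarrow> x \<in> cball c \<rho> \<Longrightarrow> conv f (grad K) x = mollify K g x"
    and r: "r > 0"
    and Z: "C_k 1 Z" "\<And>x. 0 \<le> Z x" "\<And>x. x \<notin> cball c \<rho> \<Longrightarrow> Z x = 0" and \<rho>: "\<rho> < R"
    and \<phi>: "\<And>v. (\<phi> has_real_derivative \<phi>' v) (at v)" "continuous_on UNIV \<phi>'"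
      "\<And>v. 0 \<le> \<phi> v" "\<And>v. \<phi> v \<le> M" "\<And>v. \<bar>\<phi>' v\<bar> \<le> M'"
  shows "(LINT x|lborel. w x * (\<phi> (f x) * Z x)) +
    (LINT z|lborel. a z \<bullet> ((\<phi>' (f (fst z)) * Z (fst z)) *\<^sub>R g (fst z) + \<phi> (f (fst z)) *\<^sub>R grad Z (fst z))) \<le> 0"
proof -
  have Z1: "C_k (Suc 0) Z" using Z(1) by simp
  note cZ = C_k_cont[OF Z(1)] and cG = C1_continuous_grad[OF Z1]
  have G0: "\<And>x. x \<notin> cball c \<rho> \<Longrightarrow> grad Z x = 0"
    using grad_zero_outside[OF closed_cball, of _ _ Z, OF Z(3)] by blast
  obtain B where B: "B > 0" "\<And>x. norm (Z x) \<le> B"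
    using compactly_supported_bounded[OF cZ compact_cball Z(3)] by metis
  obtain B' where B': "B' > 0" "\<And>x. norm (grad Z x) \<le> B'"
    using compactly_supported_bounded[OF cG compact_cball G0] by metis
  have M0: "0 \<le> M" "0 \<le> M'" using \<phi>(3,4)[of 0] \<phi>(5)[of 0] by linarith+
  have c\<phi>: "continuous_on UNIV \<phi>" using \<phi>(1) by (meson DERIV_isCont continuous_at_imp_continuous_on)
  define S where "S \<epsilon> K \<longleftrightarrow> (\<forall>n::nat. 0 < \<epsilon> n \<and> \<epsilon> n < r \<and> mollifier (\<epsilon> n) (K n) \<and>
      integrable lborel (\<lambda>x. norm (mollify (K n) g x - g x) powr p)) \<and> \<epsilon> \<longlonglongrightarrow> 0 \<and>
      (AE x in lborel. (\<lambda>n. mollify (K n) f x) \<longlonglongrightarrow> f x) \<and>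
      (\<lambda>n. LINT x|lborel. norm (mollify (K n) g x - g x) powr p) \<longlonglongrightarrow> 0" for \<epsilon> K
  have "\<exists>\<epsilon> K. S \<epsilon> K"
    by (rule mollifier_sequence[OF f g p r]) (intro exI, unfold S_def, intro conjI allI)
  then obtain \<epsilon> :: "nat \<Rightarrow> real" and K :: "nat \<Rightarrow> 'a \<Rightarrow> real" where S: "S \<epsilon> K" by blast
  have \<epsilon>: "\<And>n. 0 < \<epsilon> n" "\<And>n. \<epsilon> n < r" "\<epsilon> \<longlonglongrightarrow> 0" and K: "\<And>n. mollifier (\<epsilon> n) (K n)"
      and fl: "AE x in lborel. (\<lambda>n. mollify (K n) f x) \<longlonglongrightarrow> f x"
      and gi: "\<And>n. integrable lborel (\<lambda>x. norm (mollify (K n) g x - g x) powr p)"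
      and gl: "(\<lambda>n. LINT x|lborel. norm (mollify (K n) g x - g x) powr p) \<longlonglongrightarrow> 0"
    using S unfolding S_def by blast+
  define F where "F n = conv f (K n)" for n
  have FM: "F n = mollify (K n) f" for n by (simp add: F_def mollify_eq_conv)
  have dF: "(F n has_derivative (\<lambda>h. conv f (grad (K n)) x \<bullet> h)) (at x)" for n x
    unfolding F_def by (rule conv_has_derivative[OF f(1) mollifier_C_k[OF K] compact_cball mollifier_supp[OF K]])
  have K1: "C_k (Suc 0) (K n)" for n by (rule mollifier_C_k[OF K])
  have KG0: "grad (K n) x = 0" if "x \<notin> cball 0 (\<epsilon> n)" for n x
    by (rule grad_zero_outside[OF closed_cball mollifier_supp[OF K] that])
  have cF: "continuous_on UNIV (F n)" for n
    unfolding F_def by (rule conv_continuous[OF f(1) C_k_cont[OF K1] compact_cball mollifier_supp[OF K]])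
  have cDF: "continuous_on UNIV (conv f (grad (K n)))" for n
    by (rule conv_continuous[OF f(1) C1_continuous_grad[OF K1] compact_cball KG0])
  define D where "D n x = (\<phi>' (F n x) * Z x) *\<^sub>R conv f (grad (K n)) x + \<phi> (F n x) *\<^sub>R grad Z x" for n x
  have dE: "((\<lambda>x. \<phi> (F n x) * Z x) has_derivative (\<lambda>h. D n x \<bullet> h)) (at x)" for n x
  proof -
    have "((\<lambda>x. \<phi> (F n x)) has_derivative (\<lambda>h. \<phi>' (F n x) * (conv f (grad (K n)) x \<bullet> h))) (at x)"
      using has_derivative_compose[OF dF \<phi>(1)[unfolded has_field_derivative_def]] .
    from has_derivative_mult[OF this C1_has_derivative[OF Z1]]
    show ?thesis by (rule has_derivative_eq_rhs) (auto simp: D_def inner_add_left algebra_simps)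
  qed
  have cD: "continuous_on UNIV (D n)" for n
    unfolding D_def
    by (intro continuous_intros continuous_on_compose2[OF \<phi>(2) cF] continuous_on_compose2[OF c\<phi> cF] cZ cG cDF) auto
  have gradE: "grad (\<lambda>x. \<phi> (F n x) * Z x) x = D n x" for n x by (rule grad_eqI[OF dE])
  have ineq: "(LINT x|lborel. w x * (\<phi> (F n x) * Z x)) + (LINT z|lborel. a z \<bullet> D n (fst z)) \<le> 0" for n
  proof -
    have "(LINT x|lborel. w x * (\<phi> (F n x) * Z x)) + (LINT z|lborel. a z \<bullet> grad (\<lambda>x. \<phi> (F n x) * Z x) (fst z)) \<le> 0"
      by (rule weak_ineq_C1[OF W w a C1I[OF dE cD] _ _ \<rho>]) (use \<phi>(3) Z(2,3) in auto)
    then show ?thesis by (simp only: gradE)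
  qed
  have [measurable]: "f \<in> borel_measurable borel" "g \<in> borel_measurable borel" "w \<in> borel_measurable borel"
     "a \<in> borel_measurable borel"
    using borel_measurable_integrable f(1) g(1) w a by auto
  have [measurable]: "\<phi> \<in> borel_measurable borel" "\<phi>' \<in> borel_measurable borel" "Z \<in> borel_measurable borel"
    "grad Z \<in> borel_measurable borel" "\<And>n. F n \<in> borel_measurable borel"
    using c\<phi> \<phi>(2) cZ cG cF by (auto intro!: borel_measurable_continuous_onI)
  have [measurable]: "\<And>n. mollify (K n) g \<in> borel_measurable borel"
    using mollify_measurable[OF K g(1)] .
  have pc: "(\<lambda>n. \<phi> (F n x)) \<longlonglongrightarrow> \<phi> (f x)" "(\<lambda>n. \<phi>' (F n x)) \<longlonglongrightarrow> \<phi>' (f x)"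
    if "(\<lambda>n. mollify (K n) f x) \<longlonglongrightarrow> f x" for x
    using that unfolding FM
    by (auto intro!: continuous_on_tendsto_compose[OF c\<phi>] continuous_on_tendsto_compose[OF \<phi>(2)])
  have L1: "(\<lambda>n. LINT x|lborel. w x * (\<phi> (F n x) * Z x)) \<longlonglongrightarrow> (LINT x|lborel. w x * (\<phi> (f x) * Z x))"
  proof (rule integral_dominated_convergence[where w="\<lambda>x. \<bar>w x\<bar> * (M * B)"])
    show "integrable lborel (\<lambda>x. \<bar>w x\<bar> * (M * B))" using w by auto
    show "AE x in lborel. (\<lambda>n. w x * (\<phi> (F n x) * Z x)) \<longlonglongrightarrow> w x * (\<phi> (f x) * Z x)"
      using fl by eventually_elim (intro tendsto_intros pc)
    show "AE x in lborel. norm (w x * (\<phi> (F n x) * Z x)) \<le> \<bar>w x\<bar> * (M * B)" for n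
    proof (intro AE_I2)
      fix x
      have "\<bar>\<phi> (F n x)\<bar> * \<bar>Z x\<bar> \<le> M * B" using \<phi>(3,4) B M0 by (intro mult_mono) (auto simp: abs_le_iff)
      then show "norm (w x * (\<phi> (F n x) * Z x)) \<le> \<bar>w x\<bar> * (M * B)" by (simp add: abs_mult mult_left_mono)
    qed
  qed measurable
  (* E is the error from replacing the mollified gradient by g; T is the remaining test field. *)
  define E where "E n x = (\<phi>' (F n x) * Z x) *\<^sub>R (mollify (K n) g x - g x)" for n x
  define T where "T \<alpha> \<beta> x = (\<alpha> * Z x) *\<^sub>R g x + \<beta> *\<^sub>R grad Z x" for \<alpha> \<beta> x
  have DET: "D n x = E n x + T (\<phi>' (F n x)) (\<phi> (F n x)) x" for n x
  proof (cases "x \<in> cball c \<rho>")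
    case True
    then show ?thesis using fg[OF K \<epsilon>(2) True, of n] by (simp add: D_def E_def T_def algebra_simps)
  qed (simp add: D_def E_def T_def Z(3))
  note pairing = slab_pairing[where a=a and k=k and p=p and ?t1.0=t1 and ?t2.0=t2, OF _ k _ ak k0 kp a0 _ _ t p]
  have iag: "integrable lborel (\<lambda>z. norm (a z) * norm (g (fst z)))"
    by (rule pairing(1)) (use g(2) in auto)
  let ?dom = "\<lambda>z. M' * B * (norm (a z) * norm (g (fst z))) + M * B' * norm (a z)"
  have idom: "integrable lborel ?dom" using iag a by auto
  have domT: "norm (a z \<bullet> T (\<phi>' u) (\<phi> u) (fst z)) \<le> ?dom z" for z u
  proof -
    have "norm (T (\<phi>' u) (\<phi> u) (fst z)) \<le> (M' * B) * norm (g (fst z)) + M * B'"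
    proof -
      have "norm (T (\<phi>' u) (\<phi> u) (fst z)) \<le> \<bar>\<phi>' u\<bar> * \<bar>Z (fst z)\<bar> * norm (g (fst z)) + \<bar>\<phi> u\<bar> * norm (grad Z (fst z))"
        unfolding T_def by (rule order_trans[OF norm_triangle_ineq]) (simp add: abs_mult)
      also have "\<dots> \<le> (M' * B) * norm (g (fst z)) + M * B'"
        using \<phi>(3,4)[of u] \<phi>(5)[of u] B B' M0 by (intro add_mono mult_mono mult_nonneg_nonneg) auto
      finally show ?thesis .
    qed
    then have "norm (a z) * norm (T (\<phi>' u) (\<phi> u) (fst z)) \<le> norm (a z) * ((M' * B) * norm (g (fst z)) + M * B')"
      by (intro mult_left_mono) auto
    moreover have "norm (a z \<bullet> T (\<phi>' u) (\<phi> u) (fst z)) \<le> norm (a z) * norm (T (\<phi>' u) (\<phi> u) (fst z))"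
      using Cauchy_Schwarz_ineq2 by simp
    ultimately show ?thesis by (simp add: algebra_simps)
  qed
  have L2: "(\<lambda>n. LINT z|lborel. a z \<bullet> T (\<phi>' (F n (fst z))) (\<phi> (F n (fst z))) (fst z))
      \<longlonglongrightarrow> (LINT z|lborel. a z \<bullet> T (\<phi>' (f (fst z))) (\<phi> (f (fst z))) (fst z))"
  proof (rule integral_dominated_convergence[OF _ _ idom])
    show "AE z in lborel. (\<lambda>n. a z \<bullet> T (\<phi>' (F n (fst z))) (\<phi> (F n (fst z))) (fst z)) \<longlonglongrightarrow> a z \<bullet> T (\<phi>' (f (fst z))) (\<phi> (f (fst z))) (fst z)"
      using AE_fst[OF fl] unfolding T_def by eventually_elim (intro tendsto_intros pc)
    show "AE z in lborel. norm (a z \<bullet> T (\<phi>' (F n (fst z))) (\<phi> (F n (fst z))) (fst z)) \<le> ?dom z" for n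
      using domT by simp
  qed (unfold T_def, measurable)
  have iT: "integrable lborel (\<lambda>z. a z \<bullet> T (\<phi>' (F n (fst z))) (\<phi> (F n (fst z))) (fst z))" for n
  proof (rule Bochner_Integration.integrable_bound[OF idom])
    show "AE z in lborel. norm (a z \<bullet> T (\<phi>' (F n (fst z))) (\<phi> (F n (fst z))) (fst z)) \<le> norm (?dom z)"
      using domT by (intro AE_I2) (auto intro: order_trans[OF _ abs_ge_self])
  qed (unfold T_def, measurable)
  have iaE: "integrable lborel (\<lambda>z. norm (a z) * norm (mollify (K n) g (fst z) - g (fst z)))" for n
    by (rule pairing(1)) (use gi in auto)
  have boundE: "norm (a z \<bullet> E n (fst z)) \<le> (M' * B) * (norm (a z) * norm (mollify (K n) g (fst z) - g (fst z)))" for n z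
  proof -
    have 1: "norm (E n (fst z)) \<le> (M' * B) * norm (mollify (K n) g (fst z) - g (fst z))"
      unfolding E_def norm_scaleR abs_mult using \<phi>(5) B M0 by (intro mult_mono) auto
    have "norm (a z \<bullet> E n (fst z)) \<le> norm (a z) * norm (E n (fst z))" using Cauchy_Schwarz_ineq2 by simp
    also have "\<dots> \<le> norm (a z) * ((M' * B) * norm (mollify (K n) g (fst z) - g (fst z)))"
      by (rule mult_left_mono[OF 1]) simp
    finally show ?thesis by (simp add: mult_ac)
  qed
  have iE: "integrable lborel (\<lambda>z. a z \<bullet> E n (fst z))" for n
  proof (rule Bochner_Integration.integrable_bound[OF integrable_mult_right[OF iaE[of n], of "M' * B"]])
    show "AE z in lborel. norm (a z \<bullet> E n (fst z)) \<le> norm ((M' * B) * (norm (a z) * norm (mollify (K n) g (fst z) - g (fst z))))"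
      using boundE by (intro AE_I2) (auto intro: order_trans[OF _ abs_ge_self])
  qed (unfold E_def, measurable)
  have X0: "(\<lambda>n. LINT z|lborel. norm (a z) * norm (mollify (K n) g (fst z) - g (fst z))) \<longlonglongrightarrow> 0"
  proof (rule young_bound_tendsto_0[OF _ _ gl])
    fix n and \<beta> :: real assume "\<beta> > 0"
    then show "(LINT z|lborel. norm (a z) * norm (mollify (K n) g (fst z) - g (fst z)))
      \<le> \<beta> * (LINT z|lborel. k z powr p) + \<beta> powr (1 - p) * ((t2 - t1) * (LINT x|lborel. norm (mollify (K n) g x - g x) powr p))"
      using gi by (intro pairing(2)) auto
  qed auto
  have L3: "(\<lambda>n. LINT z|lborel. a z \<bullet> E n (fst z)) \<longlonglongrightarrow> 0"
  proof (rule Lim_null_comparison[OF always_eventually])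
    show "(\<lambda>n. (M' * B) * (LINT z|lborel. norm (a z) * norm (mollify (K n) g (fst z) - g (fst z)))) \<longlonglongrightarrow> 0"
      using tendsto_mult_right_zero[OF X0] by simp
    show "\<forall>n. norm (LINT z|lborel. a z \<bullet> E n (fst z)) \<le> (M' * B) * (LINT z|lborel. norm (a z) * norm (mollify (K n) g (fst z) - g (fst z)))"
    proof
      fix n
      have "norm (LINT z|lborel. a z \<bullet> E n (fst z)) \<le> (LINT z|lborel. norm (a z \<bullet> E n (fst z)))"
        by (rule integral_norm_bound)
      also have "\<dots> \<le> (LINT z|lborel. (M' * B) * (norm (a z) * norm (mollify (K n) g (fst z) - g (fst z))))"
        by (rule integral_mono[OF integrable_norm[OF iE] integrable_mult_right[OF iaE] boundE])
      finally show "norm (LINT z|lborel. a z \<bullet> E n (fst z)) \<le> (M' * B) * (LINT z|lborel. norm (a z) * norm (mollify (K n) g (fst z) - g (fst z)))"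
        by simp
    qed
  qed
  have split: "(LINT z|lborel. a z \<bullet> D n (fst z)) = (LINT z|lborel. a z \<bullet> E n (fst z)) + (LINT z|lborel. a z \<bullet> T (\<phi>' (F n (fst z))) (\<phi> (F n (fst z))) (fst z))" for n
    unfolding DET inner_add_right by (rule Bochner_Integration.integral_add[OF iE iT])
  have "(\<lambda>n. (LINT x|lborel. w x * (\<phi> (F n x) * Z x)) + (LINT z|lborel. a z \<bullet> D n (fst z)))
     \<longlonglongrightarrow> (LINT x|lborel. w x * (\<phi> (f x) * Z x)) + (0 + (LINT z|lborel. a z \<bullet> T (\<phi>' (f (fst z))) (\<phi> (f (fst z))) (fst z)))"
    unfolding split by (intro tendsto_add L1 L2 L3)
  then have "(LINT x|lborel. w x * (\<phi> (f x) * Z x)) + (0 + (LINT z|lborel. a z \<bullet> T (\<phi>' (f (fst z))) (\<phi> (f (fst z))) (fst z))) \<le> 0"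
    by (rule LIMSEQ_le_const2) (intro exI allI impI ineq)
  then show ?thesis by (simp add: T_def)
qed

section \<open>Averages over small time shifts\<close>

lemma integral_shift:
  fixes c :: "'a::euclidean_space" and f :: "'a \<Rightarrow> 'b::euclidean_space"
  assumes [measurable]: "f \<in> borel_measurable borel"
  shows "(LINT x|lborel. f (x + c)) = (LINT x|lborel. f x)"
proof -
  have "(LINT x|lborel. f x) = (LINT x|distr lborel borel ((+) c). f x)"
    by (simp only: lborel_distr_plus)
  also have "\<dots> = (LINT x|lborel. f (c + x))"
    by (subst integral_distr) auto
  finally show ?thesis by (simp only: add.commute)
qed

lemma integrable_shift_iff:
  fixes c :: "'a::euclidean_space" and f :: "'a \<Rightarrow> 'b::euclidean_space"
  assumes [measurable]: "f \<in> borel_measurable borel"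
  shows "integrable lborel (\<lambda>x. f (x + c)) \<longleftrightarrow> integrable lborel f"
proof
  assume "integrable lborel (\<lambda>x. f (x + c))"
  from has_bochner_integral_shift(1)[OF this, of "- c"] show "integrable lborel f" by simp
next
  assume "integrable lborel f"
  then show "integrable lborel (\<lambda>x. f (x + c))" by (rule has_bochner_integral_shift(1))
qed

text \<open>A field \<open>a\<close> in \<open>L^{p/(p-1)}\<close>, dominated by \<open>k^{p-1}\<close> with \<open>k\<close> in \<open>L^p\<close>, is paired with a field \<open>F\<close> in \<open>L^p\<close>.\<close>

locale Lp_pair =
  fixes a F :: "'a::euclidean_space \<times> real \<Rightarrow> 'a" and k :: "'a \<times> real \<Rightarrow> real" and p :: real
  assumes a_meas[measurable]: "a \<in> borel_measurable borel" and F_meas[measurable]: "F \<in> borel_measurable borel"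
    and k_meas[measurable]: "k \<in> borel_measurable borel"
    and ak: "\<And>z. norm (a z) \<le> k z powr (p - 1)" and k0: "\<And>z. 0 \<le> k z"
    and kp: "integrable lborel (\<lambda>z. k z powr p)" and Fp: "integrable lborel (\<lambda>z. norm (F z) powr p)"
    and p: "p \<ge> 1"
begin

lemma pair_bound: "\<beta> > 0 \<Longrightarrow> norm (a z) * norm v \<le> \<beta> * k z powr p + \<beta> powr (1 - p) * norm v powr p"
  using mult_right_mono[OF ak[of z] norm_ge_zero[of v]] young_split[OF k0 norm_ge_zero p, of \<beta> z v] by linarith

lemma pair_bound1: "\<bar>a z \<bullet> v\<bar> \<le> k z powr p + norm v powr p"
  using pair_bound[of 1 z v] Cauchy_Schwarz_ineq2[of "a z" v] by simp

lemma Fp_shift: "integrable lborel (\<lambda>z. norm (F (z + c)) powr p)"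
   "(LINT z|lborel. norm (F (z + c)) powr p) = (LINT z|lborel. norm (F z) powr p)"
  using has_bochner_integral_shift[OF Fp, of c] by auto

lemma pair_integrable: "integrable lborel (\<lambda>z. a z \<bullet> F (z + c))"
proof (rule Bochner_Integration.integrable_bound)
  show "integrable lborel (\<lambda>z. k z powr p + norm (F (z + c)) powr p)"
    using kp Fp_shift(1) by (rule Bochner_Integration.integrable_add)
  show "AE z in lborel. norm (a z \<bullet> F (z + c)) \<le> norm (k z powr p + norm (F (z + c)) powr p)"
    using pair_bound1 by (intro AE_I2) (auto intro: order_trans[OF _ abs_ge_self])
qed measurable

text \<open>The pairing of \<open>a\<close> with \<open>F\<close> translated in time by \<open>\<theta>\<close>.\<close>

definition \<Psi> :: "real \<Rightarrow> real" where "\<Psi> \<theta> = (LINT z|lborel. a z \<bullet> F (z + (0, \<theta>)))"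

lemma \<Psi>_bound:
  assumes \<beta>: "\<beta> > 0"
  shows "\<bar>\<Psi> \<theta> - \<Psi> 0\<bar> \<le> \<beta> * (LINT z|lborel. k z powr p) + \<beta> powr (1 - p) * (LINT z|lborel. norm (F (z + (0, \<theta>)) - F z) powr p)"
proof -
  have id: "integrable lborel (\<lambda>z. norm (F (z + (0, \<theta>)) - F z) powr p)"
    by (rule integrable_Lp_shift_diff[OF F_meas Fp p])
  have eq: "\<Psi> \<theta> - \<Psi> 0 = (LINT z|lborel. a z \<bullet> (F (z + (0, \<theta>)) - F z))"
    unfolding \<Psi>_def inner_diff_right 
    using pair_integrable[of "(0, \<theta>)"] pair_integrable[of 0] by (simp add: zero_prod_def[symmetric])
  have "integrable lborel (\<lambda>z. a z \<bullet> F (z + (0, \<theta>)) - a z \<bullet> F (z + 0))"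
    by (intro Bochner_Integration.integrable_diff pair_integrable)
  then have i: "integrable lborel (\<lambda>z. a z \<bullet> (F (z + (0, \<theta>)) - F z))" by (simp add: inner_diff_right)
  have "\<bar>\<Psi> \<theta> - \<Psi> 0\<bar> \<le> (LINT z|lborel. norm (a z \<bullet> (F (z + (0, \<theta>)) - F z)))"
    unfolding eq real_norm_def[symmetric] by (rule integral_norm_bound)
  also have "\<dots> \<le> (LINT z|lborel. \<beta> * k z powr p + \<beta> powr (1 - p) * norm (F (z + (0, \<theta>)) - F z) powr p)"
  proof (rule integral_mono)
    show "integrable lborel (\<lambda>z. norm (a z \<bullet> (F (z + (0, \<theta>)) - F z)))" by (rule integrable_norm[OF i])
    show "integrable lborel (\<lambda>z. \<beta> * k z powr p + \<beta> powr (1 - p) * norm (F (z + (0, \<theta>)) - F z) powr p)"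
      by (intro Bochner_Integration.integrable_add integrable_mult_right kp id)
    show "norm (a z \<bullet> (F (z + (0, \<theta>)) - F z)) \<le> \<beta> * k z powr p + \<beta> powr (1 - p) * norm (F (z + (0, \<theta>)) - F z) powr p" for z
      using Cauchy_Schwarz_ineq2[of "a z" "F (z + (0, \<theta>)) - F z"] pair_bound[OF \<beta>, of z "F (z + (0, \<theta>)) - F z"] by simp
  qed
  also have "\<dots> = \<beta> * (LINT z|lborel. k z powr p) + \<beta> powr (1 - p) * (LINT z|lborel. norm (F (z + (0, \<theta>)) - F z) powr p)"
    using kp id by simp
  finally show ?thesis .
qed

lemma \<Psi>_tendsto: "(\<Psi> \<longlongrightarrow> \<Psi> 0) (at 0)"
  unfolding tendsto_at_iff_sequentially comp_def
proof (intro allI impI)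
  fix X :: "nat \<Rightarrow> real" assume "X \<longlonglongrightarrow> 0"
  then have X: "(\<lambda>n. (0::'a, X n)) \<longlonglongrightarrow> 0"
    unfolding zero_prod_def by (intro tendsto_intros)
  note Y = Lp_shift_continuous[OF F_meas Fp p X]
  have "(\<lambda>n. \<bar>\<Psi> (X n) - \<Psi> 0\<bar>) \<longlonglongrightarrow> 0"
    by (rule young_bound_tendsto_0[OF abs_ge_zero _ Y, where A="LINT z|lborel. k z powr p" and B=1])
       (use \<Psi>_bound in auto)
  then show "(\<lambda>n. \<Psi> (X n)) \<longlonglongrightarrow> \<Psi> 0"
    by (rule LIM_zero_cancel[OF tendsto_rabs_zero_cancel])
qed

text \<open>The pairing over the time interval \<open>[s - h, s]\<close> of \<open>a\<close> with the slice of \<open>F\<close> at time \<open>s\<close>. It is the flux term of the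
equation on this interval for a test function that is frozen at time \<open>s\<close>.\<close>

definition shift_average :: "real \<Rightarrow> real \<Rightarrow> real" where
  "shift_average h s = (LINT z|lborel. (indicator {0..h} (s - snd z) * (a z \<bullet> F (fst z, s))))"

text \<open>Fubini's theorem and the substitution \<open>\<theta> = s - t\<close>, where \<open>t\<close> is the time at which \<open>a\<close> is evaluated, turn the integral over
\<open>s\<close> into an average of pairings with translates of \<open>F\<close>.\<close>

lemma shift_average_integral:
  assumes h: "h > 0"
  shows "integrable lborel (shift_average h)"
    and "(LINT s|lborel. shift_average h s) = (LINT \<theta>|lborel. indicator {0..h} \<theta> * \<Psi> \<theta>)"
    and "integrable lborel (\<lambda>\<theta>. indicator {0..h} \<theta> * \<Psi> \<theta>)"
proof -
  let ?I = "indicator {0..h} :: real \<Rightarrow> real"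
  have iI: "integrable lborel ?I" using emeasure_lborel_Icc[of 0 h] h by (intro integrable_real_indicator) auto
  define H' where "H' = (\<lambda>(\<theta>::real, z::'a \<times> real). ?I \<theta> * (a z \<bullet> F (z + (0, \<theta>))))"
  have mH'[measurable]: "H' \<in> borel_measurable (lborel \<Otimes>\<^sub>M lborel)" unfolding H'_def by measurable
  have iH': "integrable (lborel \<Otimes>\<^sub>M lborel) H'"
  proof (rule lborel_pair.Fubini_integrable[OF mH'])
    show "AE \<theta> in lborel. integrable lborel (\<lambda>z. H' (\<theta>, z))"
      unfolding H'_def prod.case by (intro AE_I2 integrable_mult_right pair_integrable)
    have bound: "(LINT z|lborel. norm (H' (\<theta>, z))) \<le> ?I \<theta> * ((LINT z|lborel. k z powr p) + (LINT z|lborel. norm (F z) powr p))" for \<theta>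
    proof -
      have "(LINT z|lborel. norm (H' (\<theta>, z))) = ?I \<theta> * (LINT z|lborel. \<bar>a z \<bullet> F (z + (0, \<theta>))\<bar>)"
        unfolding H'_def prod.case real_norm_def abs_mult abs_indicator by (rule integral_mult_right_zero)
      also have "(LINT z|lborel. \<bar>a z \<bullet> F (z + (0, \<theta>))\<bar>) \<le> (LINT z|lborel. k z powr p + norm (F (z + (0, \<theta>))) powr p)"
        by (rule integral_mono[OF integrable_abs[OF pair_integrable] Bochner_Integration.integrable_add[OF kp Fp_shift(1)] pair_bound1])
      also have "\<dots> = (LINT z|lborel. k z powr p) + (LINT z|lborel. norm (F z) powr p)"
        using Bochner_Integration.integral_add[OF kp Fp_shift(1)[of "(0, \<theta>)"]] Fp_shift(2)[of "(0, \<theta>)"] by simp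
      finally show ?thesis by (simp add: mult_left_mono)
    qed
    show "integrable lborel (\<lambda>\<theta>. LINT z|lborel. norm (H' (\<theta>, z)))"
    proof (rule Bochner_Integration.integrable_bound[OF integrable_mult_left[OF iI, of "(LINT z|lborel. k z powr p) + (LINT z|lborel. norm (F z) powr p)"]])
      show "(\<lambda>\<theta>. LINT z|lborel. norm (H' (\<theta>, z))) \<in> borel_measurable lborel"
        by (rule lborel.borel_measurable_lebesgue_integral) measurable
      show "AE \<theta> in lborel. norm (LINT z|lborel. norm (H' (\<theta>, z))) \<le> norm (?I \<theta> * ((LINT z|lborel. k z powr p) + (LINT z|lborel. norm (F z) powr p)))"
      proof (intro AE_I2)
        fix \<theta>
        have "0 \<le> (LINT z|lborel. norm (H' (\<theta>, z)))" by (rule Bochner_Integration.integral_nonneg) simp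
        then show "norm (LINT z|lborel. norm (H' (\<theta>, z))) \<le> norm (?I \<theta> * ((LINT z|lborel. k z powr p) + (LINT z|lborel. norm (F z) powr p)))"
          using bound[of \<theta>] unfolding real_norm_def by linarith
      qed
    qed
  qed
  have iH2: "integrable (lborel \<Otimes>\<^sub>M lborel) (\<lambda>(z, \<theta>). H' (\<theta>, z))"
    by (rule lborel_pair.integrable_product_swap[OF iH'])
  define H where "H = (\<lambda>(z::'a \<times> real, s::real). ?I (s - snd z) * (a z \<bullet> F (fst z, s)))"
  have mH[measurable]: "H \<in> borel_measurable (lborel \<Otimes>\<^sub>M lborel)" unfolding H_def by measurable
  have sh: "H (z, \<theta> + snd z) = H' (\<theta>, z)" for z \<theta>
    by (cases z) (simp add: H_def H'_def add.commute)
  have mHz: "(\<lambda>s. H (z, s)) \<in> borel_measurable borel" for z unfolding H_def prod.case by measurable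
  have int1: "(LINT s|lborel. H (z, s)) = (LINT \<theta>|lborel. H' (\<theta>, z))" for z
    using integral_shift[OF mHz, of z "snd z"] by (simp only: sh)
  have int2: "(LINT s|lborel. norm (H (z, s))) = (LINT \<theta>|lborel. norm (H' (\<theta>, z)))" for z
    using integral_shift[OF measurable_compose[OF mHz borel_measurable_norm], of z "snd z"] by (simp only: sh)
  have iH: "integrable (lborel \<Otimes>\<^sub>M lborel) H"
  proof (rule lborel_pair.Fubini_integrable[OF mH])
    have "integrable lborel (\<lambda>z. LINT \<theta>|lborel. (\<lambda>(z, \<theta>). norm (H' (\<theta>, z))) (z, \<theta>))"
      using lborel_pair.integrable_fst'[OF integrable_norm[OF iH2]] by (simp add: case_prod_beta')
    then show "integrable lborel (\<lambda>z. LINT s|lborel. norm (H (z, s)))" unfolding int2 by simp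
    have "AE z in lborel. integrable lborel (\<lambda>\<theta>. H' (\<theta>, z))"
      using lborel_pair.AE_integrable_fst'[OF iH2] by simp
    then show "AE z in lborel. integrable lborel (\<lambda>s. H (z, s))"
    proof eventually_elim
      fix z assume "integrable lborel (\<lambda>\<theta>. H' (\<theta>, z))"
      then have "integrable lborel (\<lambda>\<theta>. H (z, \<theta> + snd z))" by (simp only: sh)
      then show "integrable lborel (\<lambda>s. H (z, s))" using integrable_shift_iff[OF mHz] by blast
    qed
  qed
  have iH3: "integrable (lborel \<Otimes>\<^sub>M lborel) (\<lambda>(s, z). H (z, s))"
    by (rule lborel_pair.integrable_product_swap[OF iH])
  have sa: "shift_average h = (\<lambda>s. LINT z|lborel. H (z, s))"
    by (simp add: shift_average_def[abs_def] H_def)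
  show "integrable lborel (shift_average h)"
    unfolding sa using lborel_pair.integrable_fst'[OF iH3] by simp
  have \<Psi>H: "?I \<theta> * \<Psi> \<theta> = (LINT z|lborel. H' (\<theta>, z))" for \<theta>
    by (simp add: \<Psi>_def H'_def)
  show "integrable lborel (\<lambda>\<theta>. ?I \<theta> * \<Psi> \<theta>)"
    unfolding \<Psi>H by (rule lborel_pair.integrable_fst'[OF iH'])
  have "(LINT s|lborel. shift_average h s) = (LINT s|lborel. LINT z|lborel. H (z, s))" by (simp only: sa)
  also have "\<dots> = (LINT z|lborel. LINT s|lborel. H (z, s))"
    using lborel_pair.integral_fst'[OF iH] lborel_pair.integral_fst'[OF iH3] lborel_pair.integral_product_swap[OF borel_measurable_integrable[OF iH]]
    by simp
  also have "\<dots> = (LINT z|lborel. LINT \<theta>|lborel. H' (\<theta>, z))" by (simp only: int1)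
  also have "\<dots> = (LINT \<theta>|lborel. LINT z|lborel. H' (\<theta>, z))"
    using lborel_pair.integral_fst'[OF iH'] lborel_pair.integral_fst'[OF iH2] lborel_pair.integral_product_swap[OF borel_measurable_integrable[OF iH']]
    by simp
  finally show "(LINT s|lborel. shift_average h s) = (LINT \<theta>|lborel. ?I \<theta> * \<Psi> \<theta>)"
    by (simp only: \<Psi>H)
qed

end

text \<open>Averages over intervals shrinking to \<open>t\<close> converge if \<open>g\<close> is close to \<open>L\<close> at almost all points near \<open>t\<close>.
Values on a null set are disregarded, because slices of a solution are controlled only at almost every time.\<close>

lemma average_tendsto:
  fixes g :: "real \<Rightarrow> real"
  assumes g: "\<And>e. e > 0 \<Longrightarrow> \<exists>d>0. AE s in lborel. s \<in> I \<longrightarrow> \<bar>s - t\<bar> < d \<longrightarrow> \<bar>g s - L\<bar> \<le> e"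
    and h: "\<And>n. h n > 0" "h \<longlonglongrightarrow> 0"
    and J: "\<And>n. J n \<subseteq> I" "\<And>n s. s \<in> J n \<Longrightarrow> \<bar>s - t\<bar> \<le> h n" "\<And>n. J n \<in> sets borel"
      "\<And>n. measure lborel (J n) = h n" "\<And>n. emeasure lborel (J n) < \<infinity>"
    and i: "\<And>n. integrable lborel (\<lambda>s. indicator (J n) s * g s)"
  shows "(\<lambda>n. (LINT s|lborel. indicator (J n) s * g s) / h n) \<longlonglongrightarrow> L"
proof (rule LIMSEQ_I)
  fix e :: real assume e: "e > 0"
  obtain d where d: "d > 0" "AE s in lborel. s \<in> I \<longrightarrow> \<bar>s - t\<bar> < d \<longrightarrow> \<bar>g s - L\<bar> \<le> e / 2"
    using g[of "e / 2"] e by auto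
  obtain N where N: "\<And>n. n \<ge> N \<Longrightarrow> h n < d"
    using order_tendstoD(2)[OF h(2) d(1)] by (auto simp: eventually_sequentially)
  have "\<bar>(LINT s|lborel. indicator (J n) s * g s) / h n - L\<bar> < e" if n: "n \<ge> N" for n
  proof -
    have iJ: "integrable lborel (indicator (J n) :: real \<Rightarrow> real)" using J(3,5) by (intro integrable_real_indicator) auto
    have IJ: "(LINT s|lborel. indicator (J n) s :: real) = h n" using J(3,4)[of n] by simp
    have "(LINT s|lborel. indicator (J n) s * g s) - L * h n = (LINT s|lborel. indicator (J n) s * g s - indicator (J n) s * L)"
      using i[of n] iJ IJ by simp
    also have "\<bar>\<dots>\<bar> \<le> (LINT s|lborel. norm (indicator (J n) s * g s - indicator (J n) s * L))"
      unfolding real_norm_def[symmetric] by (rule integral_norm_bound)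
    also have "\<dots> \<le> (LINT s|lborel. indicator (J n) s * (e / 2))"
    proof (rule integral_mono_AE)
      show "integrable lborel (\<lambda>s. norm (indicator (J n) s * g s - indicator (J n) s * L))"
        using i[of n] iJ by (intro integrable_norm Bochner_Integration.integrable_diff integrable_mult_left)
      show "integrable lborel (\<lambda>s. indicator (J n) s * (e / 2))" using iJ by (rule integrable_mult_left)
      show "AE s in lborel. norm (indicator (J n) s * g s - indicator (J n) s * L) \<le> indicator (J n) s * (e / 2)"
        using d(2)
      proof eventually_elim
        fix s assume s: "s \<in> I \<longrightarrow> \<bar>s - t\<bar> < d \<longrightarrow> \<bar>g s - L\<bar> \<le> e / 2"
        show "norm (indicator (J n) s * g s - indicator (J n) s * L) \<le> indicator (J n) s * (e / 2)"
        proof (cases "s \<in> J n")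
          case True
          then have "s \<in> I" "\<bar>s - t\<bar> < d" using J(1)[of n] J(2)[OF True] N[OF n] by auto
          then show ?thesis using s True by simp
        qed simp
      qed
    qed
    also have "\<dots> = h n * (e / 2)" using IJ by simp
    finally have le: "\<bar>(LINT s|lborel. indicator (J n) s * g s) - L * h n\<bar> \<le> h n * (e / 2)" .
    have "(LINT s|lborel. indicator (J n) s * g s) / h n - L = ((LINT s|lborel. indicator (J n) s * g s) - L * h n) / h n"
      using h(1)[of n] by (simp add: field_simps)
    also have "\<bar>\<dots>\<bar> \<le> e / 2" using le h(1)[of n] by (simp add: abs_divide pos_divide_le_eq mult.commute)
    finally show ?thesis using e by simp
  qed
  then show "\<exists>N. \<forall>n\<ge>N. norm ((LINT s|lborel. indicator (J n) s * g s) / h n - L) < e"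
    by auto
qed

lemma (in Lp_pair) shift_average_tendsto:
  assumes h: "\<And>n. h n > 0" "h \<longlonglongrightarrow> 0"
  shows "(\<lambda>n. (LINT s|lborel. shift_average (h n) s) / h n) \<longlonglongrightarrow> (LINT z|lborel. a z \<bullet> F z)"
proof -
  have "(\<lambda>n. (LINT \<theta>|lborel. indicator {0..h n} \<theta> * \<Psi> \<theta>) / h n) \<longlonglongrightarrow> \<Psi> 0"
  proof (rule average_tendsto[where I=UNIV and t=0])
    fix e :: real assume "e > 0"
    then have "eventually (\<lambda>\<theta>. dist (\<Psi> \<theta>) (\<Psi> 0) < e) (at 0)" using tendstoD[OF \<Psi>_tendsto] by blast
    then obtain d where "d > 0" "\<And>\<theta>. \<theta> \<noteq> 0 \<Longrightarrow> \<bar>\<theta>\<bar> < d \<Longrightarrow> \<bar>\<Psi> \<theta> - \<Psi> 0\<bar> < e"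
      unfolding eventually_at by (auto simp: dist_real_def)
    then have "\<bar>\<Psi> \<theta> - \<Psi> 0\<bar> \<le> e" if "\<bar>\<theta>\<bar> < d" for \<theta>
      using that \<open>e > 0\<close> by (cases "\<theta> = 0") (auto intro: less_imp_le)
    then show "\<exists>d>0. AE s in lborel. s \<in> UNIV \<longrightarrow> \<bar>s - 0\<bar> < d \<longrightarrow> \<bar>\<Psi> s - \<Psi> 0\<bar> \<le> e"
      using \<open>d > 0\<close> by (intro exI[of _ d]) auto
  qed (use h shift_average_integral(3)[OF h(1)] in \<open>auto simp: less_imp_le\<close>)
  moreover have "\<Psi> 0 = (LINT z|lborel. a z \<bullet> F z)" by (simp add: \<Psi>_def zero_prod_def[symmetric])
  ultimately show ?thesis by (simp add: shift_average_integral(2)[OF h(1)])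
qed

section \<open>Signed powers and their antiderivatives\<close>

text \<open>At zero the difference quotient is \<open>|h|^{q-1}\<close>, which tends to zero as \<open>q > 1\<close>.\<close>

lemma spow_has_derivative:
  assumes "q > 1"
  shows "(spow q has_real_derivative q * \<bar>v\<bar> powr (q - 1)) (at v)"
proof -
  consider "v > 0" | "v < 0" | "v = 0" by linarith
  then show ?thesis
  proof cases
    case 1
    have "((\<lambda>v. v powr q) has_real_derivative q * v powr (q - 1)) (at v)"
      using 1 by (rule has_real_derivative_powr)
    moreover have "eventually (\<lambda>v. v powr q = spow q v) (nhds v)"
    proof (rule eventually_mono[OF eventually_nhds_in_open[of "{0<..}" v]])
      fix x :: real assume "x \<in> {0<..}"
      then show "x powr q = spow q x" using powr_mult_base[of x "q - 1"] by (simp add: spow_def mult.commute)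
    qed (use 1 in auto)
    ultimately have "(spow q has_real_derivative q * v powr (q - 1)) (at v)"
      using DERIV_cong_ev[OF refl _ refl, THEN iffD1] by fast
    then show ?thesis using 1 by simp
  next
    case 2
    have "((\<lambda>v. (- v) powr q) has_real_derivative q * (- v) powr (q - 1) * (- 1)) (at v)"
      using DERIV_chain2[OF has_real_derivative_powr[of "- v" q] DERIV_minus[OF DERIV_ident]] 2 by simp
    then have "((\<lambda>v. - ((- v) powr q)) has_real_derivative - (q * (- v) powr (q - 1) * (- 1))) (at v)"
      by (rule DERIV_minus)
    moreover have "eventually (\<lambda>v. - ((- v) powr q) = spow q v) (nhds v)"
    proof (rule eventually_mono[OF eventually_nhds_in_open[of "{..<0}" v]])
      fix x :: real assume "x \<in> {..<0}"
      then show "- ((- x) powr q) = spow q x" using powr_mult_base[of "- x" "q - 1"] by (simp add: spow_def mult.commute)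
    qed (use 2 in auto)
    ultimately have "(spow q has_real_derivative - (q * (- v) powr (q - 1) * (- 1))) (at v)"
      using DERIV_cong_ev[OF refl _ refl, THEN iffD1] by fast
    then show ?thesis using 2 by simp
  next
    case 3
    have "((\<lambda>h. \<bar>h\<bar> powr (q - 1)) \<longlongrightarrow> 0 powr (q - 1)) (at 0)"
      using assms by (intro tendsto_powr' tendsto_rabs_zero tendsto_ident_at tendsto_const) auto
    then have "((\<lambda>h. \<bar>h\<bar> powr (q - 1)) \<longlongrightarrow> 0) (at 0)" by simp
    moreover have "eventually (\<lambda>h. \<bar>h\<bar> powr (q - 1) = spow q h / h) (at 0)"
      by (simp add: eventually_at_filter spow_def)
    ultimately have "((\<lambda>h. spow q h / h) \<longlongrightarrow> 0) (at 0)"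
      by (rule Lim_transform_eventually)
    moreover have "spow q 0 = 0" "q * \<bar>0\<bar> powr (q - 1) = 0" by (simp_all add: spow_def)
    ultimately show ?thesis
      using 3 by (simp only: has_field_derivative_iff add_0 diff_zero)
  qed
qed

lemma continuous_on_spow: "q > 1 \<Longrightarrow> continuous_on S (spow q)"
  using spow_has_derivative by (meson DERIV_isCont continuous_at_imp_continuous_on)

lemma continuous_on_abs_powr: "a \<ge> 0 \<Longrightarrow> a \<noteq> 0 \<Longrightarrow> continuous_on S (\<lambda>v::real. \<bar>v\<bar> powr a)"
  by (intro continuous_on_powr' continuous_intros) auto

lemma spow_mono:
  assumes q: "q > 1" and "x \<le> y"
  shows "spow q x \<le> spow q y"
  using DERIV_nonneg_imp_nondecreasing[OF assms(2), of "spow q"] spow_has_derivative[OF q] q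
  by (meson abs_ge_zero less_imp_le mult_nonneg_nonneg order_trans powr_ge_zero zero_le_one)

lemma spow_lipschitz:
  assumes q: "q > 1" and xy: "lo \<le> x" "x \<le> hi" "lo \<le> y" "y \<le> hi"
  shows "\<bar>spow q y - spow q x\<bar> \<le> q * (\<bar>lo\<bar> + \<bar>hi\<bar>) powr (q - 1) * \<bar>y - x\<bar>"
proof -
  have *: "\<bar>spow q y - spow q x\<bar> \<le> q * (\<bar>lo\<bar> + \<bar>hi\<bar>) powr (q - 1) * \<bar>y - x\<bar>"
    if that: "lo \<le> x" "x < y" "y \<le> hi" for x y
  proof -
    note xy = that
    obtain z where z: "z > x" "z < y" "spow q y - spow q x = (y - x) * (q * \<bar>z\<bar> powr (q - 1))"
      using MVT2[OF xy(2), of "spow q" "\<lambda>z. q * \<bar>z\<bar> powr (q - 1)"] spow_has_derivative[OF q] by blast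
    have "\<bar>z\<bar> powr (q - 1) \<le> (\<bar>lo\<bar> + \<bar>hi\<bar>) powr (q - 1)"
      using z xy q by (intro powr_mono2) auto
    then have "q * \<bar>z\<bar> powr (q - 1) \<le> q * (\<bar>lo\<bar> + \<bar>hi\<bar>) powr (q - 1)" using q by simp
    then have "(y - x) * (q * \<bar>z\<bar> powr (q - 1)) \<le> (y - x) * (q * (\<bar>lo\<bar> + \<bar>hi\<bar>) powr (q - 1))"
      by (rule mult_left_mono) (use that in simp)
    moreover have "0 \<le> (y - x) * (q * \<bar>z\<bar> powr (q - 1))" using that q by simp
    ultimately show ?thesis using z(3) that by (simp add: mult.commute)
  qed
  show ?thesis
  proof (rule linorder_cases[of x y])
    assume "y < x"
    from *[OF _ this] xy show ?thesis by (simp add: abs_minus_commute)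
  qed (use *[of x y] xy in auto)
qed

text \<open>\<open>\<Gamma>\<close> is an antiderivative of \<open>\<phi>\<close> times the derivative of the signed power. As a function of the
signed power it has the derivative \<open>\<phi>\<close>; this is expressed by the two estimates of the mean value theorem, which
avoid the inverse of the signed power and its singularity at zero.\<close>

lemma antiderivative_spow:
  fixes \<phi> :: "real \<Rightarrow> real"
  assumes q: "q > 1" and \<phi>: "continuous_on UNIV \<phi>" and le: "lo \<le> hi"
  obtains \<Gamma> where "continuous_on UNIV \<Gamma>"
    "\<And>x y C. lo \<le> x \<Longrightarrow> x \<le> y \<Longrightarrow> y \<le> hi \<Longrightarrow> (\<And>v. x \<le> v \<Longrightarrow> v \<le> y \<Longrightarrow> \<phi> v \<le> C) \<Longrightarrow> \<Gamma> y - \<Gamma> x \<le> C * (spow q y - spow q x)"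
    "\<And>x y C. lo \<le> x \<Longrightarrow> x \<le> y \<Longrightarrow> y \<le> hi \<Longrightarrow> (\<And>v. x \<le> v \<Longrightarrow> v \<le> y \<Longrightarrow> C \<le> \<phi> v) \<Longrightarrow> C * (spow q y - spow q x) \<le> \<Gamma> y - \<Gamma> x"
proof -
  have "continuous_on {lo - 1..hi + 1} (\<lambda>v. \<phi> v * (q * \<bar>v\<bar> powr (q - 1)))"
    using q by (intro continuous_intros continuous_on_abs_powr continuous_on_subset[OF \<phi>]) auto
  then obtain \<Gamma>0 where \<Gamma>0: "\<And>x. x \<in> {lo - 1..hi + 1} \<Longrightarrow> (\<Gamma>0 has_vector_derivative (\<phi> x * (q * \<bar>x\<bar> powr (q - 1)))) (at x within {lo - 1..hi + 1})"
    using antiderivative_continuous by blast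
  have d: "(\<Gamma>0 has_real_derivative (\<phi> x * (q * \<bar>x\<bar> powr (q - 1)))) (at x)" if "lo \<le> x" "x \<le> hi" for x
  proof -
    have "x \<in> interior {lo - 1..hi + 1}" using that by simp
    then have "at x within {lo - 1..hi + 1} = at x" by (rule at_within_interior)
    then show ?thesis using \<Gamma>0[of x] that by (simp add: has_real_derivative_iff_has_vector_derivative)
  qed
  define \<Gamma> where "\<Gamma> v = \<Gamma>0 (max lo (min hi v))" for v
  have "continuous_on {lo..hi} \<Gamma>0"
    using d by (intro continuous_at_imp_continuous_on ballI) (auto intro: DERIV_isCont)
  then have c: "continuous_on UNIV \<Gamma>"
    unfolding \<Gamma>_def by (rule continuous_on_compose2) (use le in \<open>auto intro!: continuous_intros\<close>)
  have eq: "\<Gamma> v = \<Gamma>0 v" if "lo \<le> v" "v \<le> hi" for v using that by (simp add: \<Gamma>_def)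
  have up: "\<Gamma> y - \<Gamma> x \<le> C * (spow q y - spow q x)"
    if "lo \<le> x" "x \<le> y" "y \<le> hi" and C: "\<And>v. x \<le> v \<Longrightarrow> v \<le> y \<Longrightarrow> \<phi> v \<le> C" for x y C
  proof -
    have "C * spow q x - \<Gamma>0 x \<le> C * spow q y - \<Gamma>0 y"
    proof (rule DERIV_nonneg_imp_nondecreasing[OF that(2)])
      fix v assume v: "x \<le> v" "v \<le> y"
      have "((\<lambda>v. C * spow q v - \<Gamma>0 v) has_real_derivative (C * (q * \<bar>v\<bar> powr (q - 1)) - \<phi> v * (q * \<bar>v\<bar> powr (q - 1)))) (at v)"
        using v that by (intro DERIV_diff DERIV_cmult spow_has_derivative[OF q] d) auto
      moreover have "0 \<le> C * (q * \<bar>v\<bar> powr (q - 1)) - \<phi> v * (q * \<bar>v\<bar> powr (q - 1))"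
        using mult_right_mono[OF C[OF v], of "q * \<bar>v\<bar> powr (q - 1)"] q by simp
      ultimately show "\<exists>y. ((\<lambda>v. C * spow q v - \<Gamma>0 v) has_real_derivative y) (at v) \<and> 0 \<le> y" by blast
    qed
    then show ?thesis using eq[of x] eq[of y] that by (simp add: algebra_simps)
  qed
  have lower: "C * (spow q y - spow q x) \<le> \<Gamma> y - \<Gamma> x"
    if "lo \<le> x" "x \<le> y" "y \<le> hi" and C: "\<And>v. x \<le> v \<Longrightarrow> v \<le> y \<Longrightarrow> C \<le> \<phi> v" for x y C
  proof -
    have "\<Gamma>0 x - C * spow q x \<le> \<Gamma>0 y - C * spow q y"
    proof (rule DERIV_nonneg_imp_nondecreasing[OF that(2)])
      fix v assume v: "x \<le> v" "v \<le> y"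
      have "((\<lambda>v. \<Gamma>0 v - C * spow q v) has_real_derivative (\<phi> v * (q * \<bar>v\<bar> powr (q - 1)) - C * (q * \<bar>v\<bar> powr (q - 1)))) (at v)"
        using v that by (intro DERIV_diff DERIV_cmult spow_has_derivative[OF q] d) auto
      moreover have "0 \<le> \<phi> v * (q * \<bar>v\<bar> powr (q - 1)) - C * (q * \<bar>v\<bar> powr (q - 1))"
        using mult_right_mono[OF C[OF v], of "q * \<bar>v\<bar> powr (q - 1)"] q by simp
      ultimately show "\<exists>y. ((\<lambda>v. \<Gamma>0 v - C * spow q v) has_real_derivative y) (at v) \<and> 0 \<le> y" by blast
    qed
    then show ?thesis using eq[of x] eq[of y] that by (simp add: algebra_simps)
  qed
  show ?thesis by (rule that[OF c up lower])
qed

text \<open>As a function of the signed power, \<open>\<Gamma>\<close> has the derivative \<open>\<phi>\<close>, so it is convex if \<open>\<phi>\<close> increases (\<open>e = 1\<close>) and concave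
if \<open>\<phi>\<close> decreases (\<open>e = -1\<close>). The first estimate compares \<open>\<Gamma>\<close> with its tangent at \<open>y\<close>.\<close>

lemma convex_antiderivative:
  fixes \<phi> :: "real \<Rightarrow> real"
  assumes q: "q > 1" and \<phi>: "continuous_on UNIV \<phi>" and le: "lo \<le> hi"
    and b: "\<And>v. 0 \<le> \<phi> v" "\<And>v. \<phi> v \<le> M" and e: "e = 1 \<or> e = - 1"
    and mono: "\<And>x y. lo \<le> x \<Longrightarrow> x \<le> y \<Longrightarrow> y \<le> hi \<Longrightarrow> e * \<phi> x \<le> e * \<phi> y"
  obtains \<Gamma> where "continuous_on UNIV \<Gamma>"
    "\<And>x y. x \<in> {lo..hi} \<Longrightarrow> y \<in> {lo..hi} \<Longrightarrow> e * (\<Gamma> y - \<Gamma> x) \<le> e * (\<phi> y * (spow q y - spow q x))"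
    "\<And>x y. x \<in> {lo..hi} \<Longrightarrow> y \<in> {lo..hi} \<Longrightarrow> \<bar>\<Gamma> y - \<Gamma> x\<bar> \<le> M * \<bar>spow q y - spow q x\<bar>"
proof -
  obtain \<Gamma> where c: "continuous_on UNIV \<Gamma>"
    and up: "\<And>x y C. lo \<le> x \<Longrightarrow> x \<le> y \<Longrightarrow> y \<le> hi \<Longrightarrow> (\<And>v. x \<le> v \<Longrightarrow> v \<le> y \<Longrightarrow> \<phi> v \<le> C) \<Longrightarrow> \<Gamma> y - \<Gamma> x \<le> C * (spow q y - spow q x)"
    and lower: "\<And>x y C. lo \<le> x \<Longrightarrow> x \<le> y \<Longrightarrow> y \<le> hi \<Longrightarrow> (\<And>v. x \<le> v \<Longrightarrow> v \<le> y \<Longrightarrow> C \<le> \<phi> v) \<Longrightarrow> C * (spow q y - spow q x) \<le> \<Gamma> y - \<Gamma> x"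
    using antiderivative_spow[OF q \<phi> le] by metis
  have 1: "e * (\<Gamma> y - \<Gamma> x) \<le> e * (\<phi> y * (spow q y - spow q x))" if "x \<in> {lo..hi}" "y \<in> {lo..hi}" for x y
  proof (cases "x \<le> y")
    case True
    show ?thesis
    proof (cases "e = 1")
      case e1: True
      have "\<phi> v \<le> \<phi> y" if "x \<le> v" "v \<le> y" for v
        using mono[of v y] that \<open>x \<in> _\<close> \<open>y \<in> _\<close> e1 by simp
      then show ?thesis using up[of x y "\<phi> y"] that True e1 by simp
    next
      case False
      then have e1: "e = - 1" using e by simp
      have "\<phi> y \<le> \<phi> v" if "x \<le> v" "v \<le> y" for v
        using mono[of v y] that \<open>x \<in> _\<close> \<open>y \<in> _\<close> e1 by simp
      then show ?thesis using lower[of x y "\<phi> y"] that True e1 by simp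
    qed
  next
    case False
    show ?thesis
    proof (cases "e = 1")
      case e1: True
      have "\<phi> y \<le> \<phi> v" if "y \<le> v" "v \<le> x" for v
        using mono[of y v] that \<open>x \<in> _\<close> \<open>y \<in> _\<close> e1 by simp
      then show ?thesis using lower[of y x "\<phi> y"] that False e1 by (simp add: algebra_simps)
    next
      case e0: False
      then have e1: "e = - 1" using e by simp
      have "\<phi> v \<le> \<phi> y" if "y \<le> v" "v \<le> x" for v
        using mono[of y v] that \<open>x \<in> _\<close> \<open>y \<in> _\<close> e1 by simp
      then show ?thesis using up[of y x "\<phi> y"] that False e1 by (simp add: algebra_simps)
    qed
  qed
  have 2: "\<bar>\<Gamma> y - \<Gamma> x\<bar> \<le> M * \<bar>spow q y - spow q x\<bar>" if "lo \<le> x" "x \<le> y" "y \<le> hi" for x y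
    using up[OF that, of M] lower[OF that, of 0] b spow_mono[OF q that(2)] by simp
  have 3: "\<bar>\<Gamma> y - \<Gamma> x\<bar> \<le> M * \<bar>spow q y - spow q x\<bar>" if "x \<in> {lo..hi}" "y \<in> {lo..hi}" for x y
    using 2[of x y] 2[of y x] that by (cases "x \<le> y") (auto simp: abs_minus_commute)
  show ?thesis by (rule that[OF c 1 3])
qed

lemma AE_shift_real:
  assumes "AE t in lborel. P t"
  shows "AE t in lborel. P (t - (h::real))"
proof -
  obtain N where N: "\<And>x. x \<in> space lborel - N \<Longrightarrow> P x" "N \<in> null_sets (lborel :: real measure)"
    using AE_E3[OF assms] by metis
  have "AE x in lborel. - h + 1 * x \<notin> N"
    by (rule AE_borel_affine) (use N(2) AE_not_in in auto)
  then show ?thesis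
  proof eventually_elim
    fix x assume "- h + 1 * x \<notin> N"
    then show "P (x - h)" using N(1)[of "x - h"] by simp
  qed
qed

section \<open>The energy inequality\<close>

text \<open>The part of a solution that enters the proof, as everywhere defined Borel functions on a slab
\<open>cball c R \<times> [\<alpha>, \<beta>]\<close>: \<open>V\<close> is the solution, \<open>G\<close> its gradient, \<open>a\<close> its flux. The sign \<open>e\<close> is \<open>1\<close> for
sub-solutions and \<open>-1\<close> for super-solutions. \<open>T0\<close> is a set of full measure of good times, whose slices are weakly
differentiable; \<open>T0_grad\<close> says this in terms of mollifications, and at good times \<open>V\<close> is continuous with values in \<open>L^1\<close>.\<close>

locale weak_slab =
  fixes c :: "'a::euclidean_space" and R \<rho> \<alpha> \<beta> :: real
    and V :: "'a \<times> real \<Rightarrow> real" and G a :: "'a \<times> real \<Rightarrow> 'a"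
    and e K1 K2 p q lo hi :: real and T0 :: "real set"
  assumes p: "p > 1" and q: "q > 1" and K1: "K1 > 0" and K2: "K2 > 0" and \<rho>R: "\<rho> < R"
    and lohi: "lo \<le> hi" and e: "e = 1 \<or> e = - 1"
    and V_meas[measurable]: "V \<in> borel_measurable borel"
    and G_meas[measurable]: "G \<in> borel_measurable borel"
    and a_meas[measurable]: "a \<in> borel_measurable borel"
    and V_range: "\<And>z. lo \<le> V z" "\<And>z. V z \<le> hi"
    and aG: "\<And>z. K1 * norm (G z) powr p \<le> a z \<bullet> G z"
    and aK: "\<And>z. norm (a z) \<le> K2 * norm (G z) powr (p - 1)"
    and Gp: "integrable lborel (\<lambda>z. norm (G z) powr p)"
    and G0: "\<And>z. z \<notin> cball c R \<times> {\<alpha>..\<beta>} \<Longrightarrow> G z = 0"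
    and T0_sub: "T0 \<subseteq> {\<alpha>..\<beta>}"
    and T0_AE: "AE t in lborel. t \<in> {\<alpha>..\<beta>} \<longrightarrow> t \<in> T0"
    and T0_cont: "\<And>t X. t \<in> T0 \<Longrightarrow> (\<And>n. X n \<in> T0) \<Longrightarrow> X \<longlonglongrightarrow> t \<Longrightarrow>
        (\<lambda>n. LINT x|lborel. indicator (cball c R) x * \<bar>V (x, X n) - V (x, t)\<bar>) \<longlonglongrightarrow> 0"
    and T0_G: "\<And>t. t \<in> T0 \<Longrightarrow> integrable lborel (\<lambda>x. norm (G (x, t)) powr p)"
    and T0_grad: "\<And>t \<epsilon> K x. t \<in> T0 \<Longrightarrow> mollifier \<epsilon> K \<Longrightarrow> \<epsilon> < R - \<rho> \<Longrightarrow> x \<in> cball c \<rho> \<Longrightarrow>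
        conv (\<lambda>x. indicator (cball c R) x * V (x, t)) (grad K) x = mollify K (\<lambda>x. G (x, t)) x"
    and weak: "\<And>t1 t2. t1 \<in> T0 \<Longrightarrow> t2 \<in> T0 \<Longrightarrow> t1 \<le> t2 \<Longrightarrow>
        weak_ineq c R (\<lambda>x. e * (indicator (cball c R) x * (spow q (V (x, t2)) - spow q (V (x, t1)))))
          (\<lambda>z. (e * indicator {t1..t2} (snd z)) *\<^sub>R a z)"
begin

abbreviation "ind \<equiv> (indicator (cball c R) :: 'a \<Rightarrow> real)"

lemma ind_integrable: "integrable lborel ind"
  using emeasure_lborel_cball_finite[of c R] by (intro integrable_real_indicator) auto

lemma bounded_on_ball_integrable:
  fixes f :: "'a \<Rightarrow> real"
  assumes [measurable]: "f \<in> borel_measurable borel" and B: "\<And>x. \<bar>f x\<bar> \<le> B"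
  shows "integrable lborel (\<lambda>x. ind x * f x)"
proof -
  have [measurable]: "cball c R \<in> sets borel" by simp
  show ?thesis
proof (rule Bochner_Integration.integrable_bound[OF integrable_mult_left[OF ind_integrable, of B]])
  show "AE x in lborel. norm (ind x * f x) \<le> norm (ind x * B)"
    using B by (intro AE_I2) (auto simp: indicator_def intro: order_trans[OF _ abs_ge_self])
qed measurable
qed

lemma V_abs: "\<bar>V z\<bar> \<le> \<bar>lo\<bar> + \<bar>hi\<bar>"
  using V_range[of z] by linarith

lemma spow_measurable[measurable]: "spow q \<in> borel_measurable borel"
  by (rule borel_measurable_continuous_onI[OF continuous_on_spow[OF q]])

lemma slice_measurable[measurable]: "(\<lambda>x. V (x, t)) \<in> borel_measurable borel" "(\<lambda>x. G (x, t)) \<in> borel_measurable borel"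
  by measurable

text \<open>Its power \<open>p - 1\<close> dominates the flux, so that it is the function \<open>k\<close> of a pairing \<open>Lp_pair\<close>.\<close>

definition a_majorant :: "'a \<times> real \<Rightarrow> real" where "a_majorant z = K2 powr (1 / (p - 1)) * norm (G z)"

lemma a_majorant_meas[measurable]: "a_majorant \<in> borel_measurable borel" unfolding a_majorant_def by measurable

lemma a_majorant: "norm (a z) \<le> a_majorant z powr (p - 1)" "0 \<le> a_majorant z" "integrable lborel (\<lambda>z. a_majorant z powr p)"
proof -
  have "a_majorant z powr (p - 1) = K2 * norm (G z) powr (p - 1)"
    using p K2 by (simp add: a_majorant_def powr_mult powr_powr)
  then show "norm (a z) \<le> a_majorant z powr (p - 1)" using aK by simp
  show "0 \<le> a_majorant z" by (simp add: a_majorant_def)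
  show "integrable lborel (\<lambda>z. a_majorant z powr p)"
    unfolding a_majorant_def powr_mult by (rule integrable_mult_right[OF Gp])
qed

lemma a0: "z \<notin> cball c R \<times> {\<alpha>..\<beta>} \<Longrightarrow> a z = 0"
  using aK[of z] G0[of z] p by simp

lemma powr_le_1_plus: "y \<ge> 0 \<Longrightarrow> y powr (p - 1) \<le> 1 + y powr p"
  using young_split[of y 1 p 1] p by simp

lemma norm_le_1_plus: "y \<ge> 0 \<Longrightarrow> y \<le> 1 + y powr p"
  using young_split1[of y p 1] p by simp

lemma slab_set_integrable: "integrable lborel (\<lambda>z. indicator (cball c R \<times> {\<alpha>..\<beta>}) z :: real)"
proof -
  have "bounded (cball c R \<times> {\<alpha>..\<beta>})" by (intro bounded_Times) auto
  from emeasure_bounded_finite[OF this] show ?thesis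
    by (intro integrable_real_indicator) (auto intro!: borel_closed closed_Times)
qed

lemma integrable_G_pm1: "integrable lborel (\<lambda>z. norm (G z) powr (p - 1))"
proof (rule Bochner_Integration.integrable_bound[OF Bochner_Integration.integrable_add[OF slab_set_integrable Gp]])
  show "AE z in lborel. norm (norm (G z) powr (p - 1)) \<le> norm (indicat_real (cball c R \<times> {\<alpha>..\<beta>}) z + norm (G z) powr p)"
  proof (intro AE_I2)
    fix z
    show "norm (norm (G z) powr (p - 1)) \<le> norm (indicat_real (cball c R \<times> {\<alpha>..\<beta>}) z + norm (G z) powr p)"
    proof (cases "z \<in> cball c R \<times> {\<alpha>..\<beta>}")
      case True
      then show ?thesis using powr_le_1_plus[of "norm (G z)"] by simp
    next
      case False
      then show ?thesis using G0[OF False] p by simp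
    qed
  qed
qed measurable

lemma integrable_a: "integrable lborel a"
proof (rule Bochner_Integration.integrable_bound[OF integrable_mult_right[OF integrable_G_pm1, of K2]])
  show "AE z in lborel. norm (a z) \<le> norm (K2 * norm (G z) powr (p - 1))"
    using aK K2 by (intro AE_I2) (simp add: abs_mult)
qed measurable

lemma integrable_bounded_time_a: 
  assumes [measurable]: "f \<in> borel_measurable borel" and B: "\<And>z. \<bar>f z\<bar> \<le> B"
  shows "integrable lborel (\<lambda>z. f z *\<^sub>R a z)"
proof (rule Bochner_Integration.integrable_bound[OF integrable_mult_right[OF integrable_norm[OF integrable_a], of B]])
  show "AE z in lborel. norm (f z *\<^sub>R a z) \<le> norm (B * norm (a z))"
    using B by (intro AE_I2) (auto simp: abs_mult intro!: mult_right_mono intro: order_trans[OF _ abs_ge_self])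
qed measurable

lemma integrable_w:
  "integrable lborel (\<lambda>x. e * (ind x * (spow q (V (x, t2)) - spow q (V (x, t1)))))"
proof (intro integrable_mult_right bounded_on_ball_integrable)
  have b: "\<bar>spow q (V z)\<bar> \<le> \<bar>spow q lo\<bar> + \<bar>spow q hi\<bar>" for z
    using spow_mono[OF q V_range(1)[of z]] spow_mono[OF q V_range(2)[of z]] by linarith
  show "\<bar>spow q (V (x, t2)) - spow q (V (x, t1))\<bar> \<le> 2 * (\<bar>spow q lo\<bar> + \<bar>spow q hi\<bar>)" for x
    using abs_triangle_ineq4[of "spow q (V (x, t2))" "spow q (V (x, t1))"] add_mono[OF b[of "(x, t2)"] b[of "(x, t1)"]] by simp
qed measurable

text \<open>The test function \<open>Z(x)\<close>. The time derivative contributes the difference of two slices, which is bounded by the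
integral of \<open>|Du|^{p-1} |DZ|\<close>.\<close>

lemma linear_ineq:
  assumes t: "t1 \<in> T0" "t2 \<in> T0" "t1 \<le> t2"
    and Z: "C_k 1 Z" "\<And>x. 0 \<le> Z x" "\<And>x. x \<notin> cball c \<rho> \<Longrightarrow> Z x = 0"
  shows "e * (LINT x|lborel. ind x * (spow q (V (x, t2)) - spow q (V (x, t1))) * Z x)
     \<le> K2 * (LINT z|lborel. indicator {t1..t2} (snd z) * (norm (G z) powr (p - 1) * norm (grad Z (fst z))))"
proof -
  have Z1: "C_k (Suc 0) Z" using Z(1) by simp
  note cG = C1_continuous_grad[OF Z1]
  have gZ0: "\<And>x. x \<notin> cball c \<rho> \<Longrightarrow> grad Z x = 0"
    using grad_zero_outside[OF closed_cball, of _ _ Z, OF Z(3)] by blast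
  obtain B where B: "B > 0" "\<And>x. norm (grad Z x) \<le> B"
    using compactly_supported_bounded[OF cG compact_cball gZ0] by metis
  have [measurable]: "grad Z \<in> borel_measurable borel" using cG by (rule borel_measurable_continuous_onI)
  let ?a = "\<lambda>z. (e * indicator {t1..t2} (snd z)) *\<^sub>R a z"
  have ia: "integrable lborel ?a"
    using e by (intro integrable_bounded_time_a[where B=1]) (auto simp: indicator_def)
  have le: "norm (?a z \<bullet> grad Z (fst z)) \<le> K2 * (indicator {t1..t2} (snd z) * (norm (G z) powr (p - 1) * norm (grad Z (fst z))))" for z
  proof -
    have "norm (?a z \<bullet> grad Z (fst z)) \<le> norm (?a z) * norm (grad Z (fst z))"
      unfolding real_norm_def by (rule Cauchy_Schwarz_ineq2)
    also have "norm (?a z) \<le> indicator {t1..t2} (snd z) * (K2 * norm (G z) powr (p - 1))"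
      using aK[of z] e by (auto simp: indicator_def)
    finally show ?thesis by (simp add: mult_ac mult_right_mono)
  qed
  have i2: "integrable lborel (\<lambda>z. K2 * (indicator {t1..t2} (snd z) * (norm (G z) powr (p - 1) * norm (grad Z (fst z)))))"
  proof (rule Bochner_Integration.integrable_bound[OF integrable_mult_right[OF integrable_G_pm1, of "K2 * B"]])
    show "AE z in lborel. norm (K2 * (indicator {t1..t2} (snd z) * (norm (G z) powr (p - 1) * norm (grad Z (fst z))))) \<le> norm ((K2 * B) * norm (G z) powr (p - 1))"
    proof (intro AE_I2)
      fix z
      have "norm (G z) powr (p - 1) * norm (grad Z (fst z)) \<le> norm (G z) powr (p - 1) * B"
        using B(2) by (intro mult_left_mono) auto
      then show "norm (K2 * (indicator {t1..t2} (snd z) * (norm (G z) powr (p - 1) * norm (grad Z (fst z))))) \<le> norm ((K2 * B) * norm (G z) powr (p - 1))"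
        using K2 B(1) by (auto simp: indicator_def abs_mult mult_ac)
    qed
  qed measurable
  have ii: "integrable lborel (\<lambda>z. ?a z \<bullet> grad Z (fst z))"
  proof (rule Bochner_Integration.integrable_bound[OF i2])
    show "AE z in lborel. norm (?a z \<bullet> grad Z (fst z)) \<le> norm (K2 * (indicator {t1..t2} (snd z) * (norm (G z) powr (p - 1) * norm (grad Z (fst z)))))"
      using le by (intro AE_I2) (auto intro: order_trans[OF _ abs_ge_self])
  qed measurable
  have "(LINT x|lborel. (e * (ind x * (spow q (V (x, t2)) - spow q (V (x, t1))))) * Z x) + (LINT z|lborel. ?a z \<bullet> grad Z (fst z)) \<le> 0"
    by (rule weak_ineq_C1[OF weak[OF t] integrable_w ia Z \<rho>R])
  moreover have "(LINT x|lborel. (e * (ind x * (spow q (V (x, t2)) - spow q (V (x, t1))))) * Z x)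
      = e * (LINT x|lborel. ind x * (spow q (V (x, t2)) - spow q (V (x, t1))) * Z x)"
    by (simp only: mult.assoc integral_mult_right_zero)
  moreover have "- (LINT z|lborel. ?a z \<bullet> grad Z (fst z)) \<le> (LINT z|lborel. norm (?a z \<bullet> grad Z (fst z)))"
    using integral_norm_bound[of lborel "\<lambda>z. ?a z \<bullet> grad Z (fst z)"] unfolding real_norm_def by linarith
  moreover have "(LINT z|lborel. norm (?a z \<bullet> grad Z (fst z)))
     \<le> (LINT z|lborel. K2 * (indicator {t1..t2} (snd z) * (norm (G z) powr (p - 1) * norm (grad Z (fst z)))))"
    by (rule integral_mono[OF integrable_norm[OF ii] i2 le])
  ultimately show ?thesis by simp
qed

end

text \<open>The data of the test function \<open>\<phi>(V) Z\<close>. The condition \<open>e\<phi>'\<close> says that \<open>\<phi>\<close> increases for sub-solutions and decreases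
for super-solutions: in both cases the elliptic term has a good sign, and so has the error made by freezing the
test function in time. The strict inequality \<open>\<alpha> < t1\<close> leaves room for looking back from \<open>t1\<close> by a small time.\<close>

locale weak_slab_test = weak_slab +
  fixes Z :: "'a \<Rightarrow> real" and \<phi> \<phi>' :: "real \<Rightarrow> real" and M M' t1 t2 :: real
  assumes Z: "C_k 1 Z" "\<And>x. 0 \<le> Z x" "\<And>x. x \<notin> cball c \<rho> \<Longrightarrow> Z x = 0"
    and \<phi>: "\<And>v. (\<phi> has_real_derivative \<phi>' v) (at v)" "continuous_on UNIV \<phi>'"
      "\<And>v. 0 \<le> \<phi> v" "\<And>v. \<phi> v \<le> M" "\<And>v. \<bar>\<phi>' v\<bar> \<le> M'"
    and e\<phi>': "\<And>v. lo \<le> v \<Longrightarrow> v \<le> hi \<Longrightarrow> 0 \<le> e * \<phi>' v"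
    and t12: "t1 \<in> T0" "t2 \<in> T0" "t1 < t2" "\<alpha> < t1"
begin

lemma Z1: "C_k (Suc 0) Z" using Z(1) by simp

lemma gradZ0: "x \<notin> cball c \<rho> \<Longrightarrow> grad Z x = 0"
  using grad_zero_outside[OF closed_cball, of _ _ Z, OF Z(3)] by blast

lemma Z_bounds: obtains B where "B > 0" "\<And>x. Z x \<le> B" "\<And>x. norm (grad Z x) \<le> B"
proof -
  obtain B1 where B1: "B1 > 0" "\<And>x. norm (Z x) \<le> B1"
    using compactly_supported_bounded[OF C_k_cont[OF Z(1)] compact_cball Z(3)] by metis
  obtain B2 where B2: "B2 > 0" "\<And>x. norm (grad Z x) \<le> B2"
    using compactly_supported_bounded[OF C1_continuous_grad[OF Z1] compact_cball gradZ0] by metis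
  show ?thesis
  proof (rule that[of "max B1 B2"])
    show "Z x \<le> max B1 B2" for x using B1(2)[of x] by simp
    show "norm (grad Z x) \<le> max B1 B2" for x using B2(2)[of x] by simp
  qed (use B1 in simp)
qed

lemma continuous_\<phi>: "continuous_on UNIV \<phi>"
  using \<phi>(1) by (meson DERIV_isCont continuous_at_imp_continuous_on)

lemma test_measurable[measurable]: "Z \<in> borel_measurable borel" "grad Z \<in> borel_measurable borel"
   "\<phi> \<in> borel_measurable borel" "\<phi>' \<in> borel_measurable borel"
  using C_k_cont[OF Z(1)] C1_continuous_grad[OF Z1] continuous_\<phi> \<phi>(2)
  by (auto intro: borel_measurable_continuous_onI)

lemma M_nonneg: "0 \<le> M" "0 \<le> M'"
  using \<phi>(3,4)[of 0] \<phi>(5)[of 0] by linarith+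

text \<open>The spatial gradient of \<open>\<phi>(V) Z\<close>.\<close>

definition \<Phi> :: "'a \<times> real \<Rightarrow> 'a" where
  "\<Phi> z = (\<phi>' (V z) * Z (fst z)) *\<^sub>R G z + \<phi> (V z) *\<^sub>R grad Z (fst z)"

lemma \<Phi>_meas[measurable]: "\<Phi> \<in> borel_measurable borel" unfolding \<Phi>_def by measurable

definition F :: "'a \<times> real \<Rightarrow> 'a" where "F z = indicator {t1..t2} (snd z) *\<^sub>R \<Phi> z"

lemma F_meas[measurable]: "F \<in> borel_measurable borel" unfolding F_def by measurable

lemma F_Lp: "integrable lborel (\<lambda>z. norm (F z) powr p)"
proof -
  obtain B where B: "B > 0" "\<And>x. Z x \<le> B" "\<And>x. norm (grad Z x) \<le> B" using Z_bounds by metis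
  have iZ: "integrable lborel (\<lambda>x. norm (grad Z x) powr p)"
  proof (rule compactly_supported_integrable[where C="cball c \<rho>"])
    show "continuous_on UNIV (\<lambda>x. norm (grad Z x) powr p)"
      using p by (intro continuous_on_powr' continuous_intros C1_continuous_grad[OF Z1]) auto
  qed (use gradZ0 in auto)
  let ?d = "\<lambda>z. 2 powr p * ((M' * B) powr p * norm (G z) powr p + M powr p * (indicator {t1..t2} (snd z) * norm (grad Z (fst z)) powr p))"
  have id: "integrable lborel ?d"
    by (intro integrable_mult_right Bochner_Integration.integrable_add Gp slab_integrable(1)[OF iZ]) (use t12 in simp)
  show ?thesis
  proof (rule Bochner_Integration.integrable_bound[OF id])
    show "AE z in lborel. norm (norm (F z) powr p) \<le> norm (?d z)"
    proof (intro AE_I2)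
      fix z
      show "norm (norm (F z) powr p) \<le> norm (?d z)"
      proof (cases "snd z \<in> {t1..t2}")
        case True
        have "norm (\<Phi> z) \<le> (M' * B) * norm (G z) + M * norm (grad Z (fst z))"
        proof -
          have "norm (\<Phi> z) \<le> \<bar>\<phi>' (V z)\<bar> * \<bar>Z (fst z)\<bar> * norm (G z) + \<bar>\<phi> (V z)\<bar> * norm (grad Z (fst z))"
            unfolding \<Phi>_def by (rule order_trans[OF norm_triangle_ineq]) (simp add: abs_mult)
          also have "\<dots> \<le> (M' * B) * norm (G z) + M * norm (grad Z (fst z))"
            using \<phi>(3,4)[of "V z"] \<phi>(5)[of "V z"] B Z(2) M_nonneg by (intro add_mono mult_mono mult_nonneg_nonneg) auto
          finally show ?thesis .
        qed
        then have "norm (\<Phi> z) powr p \<le> ((M' * B) * norm (G z) + M * norm (grad Z (fst z))) powr p"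
          using p by (intro powr_mono2) auto
        also have "\<dots> \<le> 2 powr p * (((M' * B) * norm (G z)) powr p + (M * norm (grad Z (fst z))) powr p)"
          using M_nonneg B p by (intro powr_add2_le) auto
        also have "\<dots> = ?d z" using True by (simp only: powr_mult indicator_simps mult_1_left)
        finally show ?thesis using True by (simp add: F_def)
      next
        case False
        then show ?thesis using p by (simp add: F_def)
      qed
    qed
  qed measurable
qed

sublocale Lp_pair a F a_majorant p
  by (unfold_locales) (use a_majorant F_Lp p in auto)

text \<open>The slice \<open>\<phi>(V(\<cdot>, s)) Z\<close> is a test function that does not depend on time; it is used on \<open>[s - h, s]\<close>.\<close>

lemma frozen_ineq:
  assumes s: "s \<in> T0" "s - h \<in> T0" "h > 0" "s \<in> {t1..t2}"
  shows "e * (LINT x|lborel. ind x * (spow q (V (x, s)) - spow q (V (x, s - h))) * \<phi> (V (x, s)) * Z x)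
     + e * shift_average h s \<le> 0"
proof -
  let ?a = "\<lambda>z. (e * indicator {s - h..s} (snd z)) *\<^sub>R a z"
  let ?f = "\<lambda>x. ind x * V (x, s)"
  let ?g = "\<lambda>x. G (x, s)"
  have ia: "integrable lborel ?a"
    using e by (intro integrable_bounded_time_a[where B=1]) (auto simp: indicator_def)
  have f1: "integrable lborel ?f" by (rule bounded_on_ball_integrable[OF _ V_abs]) measurable
  have f2: "integrable lborel (\<lambda>x. norm (?f x) powr p)"
  proof -
    have "integrable lborel (\<lambda>x. ind x * (\<bar>V (x, s)\<bar> powr p))"
    proof (rule bounded_on_ball_integrable)
      show "\<bar>\<bar>V (x, s)\<bar> powr p\<bar> \<le> (\<bar>lo\<bar> + \<bar>hi\<bar>) powr p" for x
        using V_abs[of "(x, s)"] p by (simp add: powr_mono2)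
    qed measurable
    moreover have "norm (?f x) powr p = ind x * (\<bar>V (x, s)\<bar> powr p)" for x
      using p by (simp add: indicator_def)
    ultimately show ?thesis by simp
  qed
  have g2: "integrable lborel (\<lambda>x. norm (?g x) powr p)" by (rule T0_G[OF s(1)])
  have g1: "integrable lborel ?g"
  proof (rule Bochner_Integration.integrable_bound[OF Bochner_Integration.integrable_add[OF ind_integrable g2]])
    show "AE x in lborel. norm (?g x) \<le> norm (ind x + norm (?g x) powr p)"
    proof (intro AE_I2)
      fix x show "norm (?g x) \<le> norm (ind x + norm (?g x) powr p)"
      proof (cases "x \<in> cball c R")
        case True
        then show ?thesis using norm_le_1_plus[of "norm (?g x)"] by simp
      next
        case False
        then show ?thesis using G0[of "(x, s)"] by simp
      qed
    qed
  qed measurable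
  have an: "norm (?a z) \<le> a_majorant z powr (p - 1)" for z
    using a_majorant(1)[of z] e order_trans[OF norm_ge_zero a_majorant(1)[of z]] by (auto simp: indicator_def)
  have sub: "cball c \<rho> \<subseteq> cball c R" using \<rho>R by auto
  have fV: "\<phi> (?f x) * Z x = \<phi> (V (x, s)) * Z x" "\<phi>' (?f x) * Z x = \<phi>' (V (x, s)) * Z x"
     "\<phi> (?f x) *\<^sub>R grad Z x = \<phi> (V (x, s)) *\<^sub>R grad Z x" for x
  proof -
    have "?f x = V (x, s) \<or> (Z x = 0 \<and> grad Z x = 0)"
    proof (cases "x \<in> cball c \<rho>")
      case True
      then have "x \<in> cball c R" using sub by blast
      then show ?thesis by simp
    next
      case False
      then show ?thesis using Z(3) gradZ0 by blast
    qed
    then show "\<phi> (?f x) * Z x = \<phi> (V (x, s)) * Z x" "\<phi>' (?f x) * Z x = \<phi>' (V (x, s)) * Z x"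
     "\<phi> (?f x) *\<^sub>R grad Z x = \<phi> (V (x, s)) *\<^sub>R grad Z x" by auto
  qed
  have "(LINT x|lborel. (e * (ind x * (spow q (V (x, s)) - spow q (V (x, s - h))))) * (\<phi> (?f x) * Z x)) +
    (LINT z|lborel. ?a z \<bullet> ((\<phi>' (?f (fst z)) * Z (fst z)) *\<^sub>R ?g (fst z) + \<phi> (?f (fst z)) *\<^sub>R grad Z (fst z))) \<le> 0"
  proof (rule weak_ineq_comp[where k=a_majorant and p=p and ?t1.0="s - h" and ?t2.0=s and r="R - \<rho>" and f="?f" and g="?g" and M=M and M'=M'])
    show "weak_ineq c R (\<lambda>x. e * (ind x * (spow q (V (x, s)) - spow q (V (x, s - h))))) ?a"
      using weak[OF s(2,1)] s(3) by simp
    show "conv ?f (grad K) x = mollify K ?g x" if "mollifier \<epsilon> K" "\<epsilon> < R - \<rho>" "x \<in> cball c \<rho>" for \<epsilon> K x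
      by (rule T0_grad[OF s(1) that])
    show "?a z = 0" if "snd z \<notin> {s - h..s}" for z using that by simp
  qed (use integrable_w ia an a_majorant f1 f2 g1 g2 Z \<phi> \<rho>R p s(3) in auto)
  moreover have eq1: "(e * (ind x * (spow q (V (x, s)) - spow q (V (x, s - h))))) * (\<phi> (?f x) * Z x)
     = e * (ind x * (spow q (V (x, s)) - spow q (V (x, s - h))) * \<phi> (V (x, s)) * Z x)" for x
    unfolding fV by (simp only: mult_ac)
  moreover have eq2: "?a z \<bullet> ((\<phi>' (?f (fst z)) * Z (fst z)) *\<^sub>R ?g (fst z) + \<phi> (?f (fst z)) *\<^sub>R grad Z (fst z))
     = e * (indicator {0..h} (s - snd z) * (a z \<bullet> F (fst z, s)))" for z
  proof -
    have "indicator {s - h..s} (snd z) = (indicator {0..h} (s - snd z) :: real)" by (auto simp: indicator_def)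
    then show ?thesis unfolding fV using s(4) by (simp add: F_def \<Phi>_def)
  qed
  ultimately show ?thesis by (simp only: eq1 eq2 integral_mult_right_zero shift_average_def)
qed

text \<open>By \<open>convex_antiderivative\<close>, the inequality for the frozen test function bounds the backward difference of
\<open>g(s) = \<integral> \<Gamma>(V(x, s)) Z(x) dx\<close>. Its integral over \<open>s \<in> [t1, t2]\<close> telescopes to integrals of \<open>g\<close> over two intervals of
length \<open>h\<close> that end at \<open>t2\<close> and \<open>t1\<close>. Dividing by \<open>h\<close> and letting \<open>h \<rightarrow> 0\<close> gives
\<open>e (g(t2) - g(t1)) + e \<integral> a \<cdot> D(\<phi>(V) Z) \<le> 0\<close>, from which the structure conditions give the claim.\<close>

lemma energy:
  "K1 * (LINT z|lborel. indicator {t1..t2} (snd z) * (\<bar>\<phi>' (V z)\<bar> * norm (G z) powr p * Z (fst z)))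
   \<le> K2 * M * (LINT z|lborel. indicator {t1..t2} (snd z) * (norm (G z) powr (p - 1) * norm (grad Z (fst z))))
     + M * (LINT x|lborel. ind x * \<bar>spow q (V (x, t2)) - spow q (V (x, t1))\<bar> * Z x)"
proof -
  obtain B where B: "B > 0" "\<And>x. Z x \<le> B" "\<And>x. norm (grad Z x) \<le> B" using Z_bounds by metis
  have mono: "e * \<phi> x \<le> e * \<phi> y" if "lo \<le> x" "x \<le> y" "y \<le> hi" for x y
  proof (rule DERIV_nonneg_imp_nondecreasing[OF that(2)])
    fix v assume "x \<le> v" "v \<le> y"
    then show "\<exists>d. ((\<lambda>v. e * \<phi> v) has_real_derivative d) (at v) \<and> 0 \<le> d"
      using that e\<phi>'[of v] DERIV_cmult[OF \<phi>(1)[of v], of e] by (intro exI[of _ "e * \<phi>' v"]) auto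
  qed
  obtain \<Gamma> where \<Gamma>c: "continuous_on UNIV \<Gamma>"
    and \<Gamma>1: "\<And>x y. x \<in> {lo..hi} \<Longrightarrow> y \<in> {lo..hi} \<Longrightarrow> e * (\<Gamma> y - \<Gamma> x) \<le> e * (\<phi> y * (spow q y - spow q x))"
    and \<Gamma>2: "\<And>x y. x \<in> {lo..hi} \<Longrightarrow> y \<in> {lo..hi} \<Longrightarrow> \<bar>\<Gamma> y - \<Gamma> x\<bar> \<le> M * \<bar>spow q y - spow q x\<bar>"
  proof (rule convex_antiderivative[OF q continuous_\<phi> lohi \<phi>(3,4) e])
    show "e * \<phi> x \<le> e * \<phi> y" if "lo \<le> x" "x \<le> y" "y \<le> hi" for x y by (rule mono[OF that])
  qed (rule that)
  have [measurable]: "\<Gamma> \<in> borel_measurable borel" using \<Gamma>c by (rule borel_measurable_continuous_onI)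
  have Vr: "V z \<in> {lo..hi}" for z using V_range by simp
  define L where "L = q * (\<bar>lo\<bar> + \<bar>hi\<bar>) powr (q - 1)"
  have L0: "0 \<le> L" using q by (simp add: L_def)
  have spL: "\<bar>spow q (V z) - spow q (V z')\<bar> \<le> L * \<bar>V z - V z'\<bar>" for z z'
    unfolding L_def using V_range by (intro spow_lipschitz[OF q])
  have sp_b: "\<bar>spow q (V z) - spow q (V z')\<bar> \<le> L * (hi - lo)" for z z'
  proof -
    have "L * \<bar>V z - V z'\<bar> \<le> L * (hi - lo)"
      using V_range[of z] V_range[of z'] L0 by (intro mult_left_mono) (auto simp: abs_le_iff)
    then show ?thesis using spL[of z z'] by linarith
  qed
  define BG where "BG = \<bar>\<Gamma> lo\<bar> + M * (\<bar>spow q lo\<bar> + \<bar>spow q hi\<bar>)"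
  have \<Gamma>B: "\<bar>\<Gamma> (V z)\<bar> \<le> BG" for z
  proof -
    have "\<bar>\<Gamma> (V z) - \<Gamma> lo\<bar> \<le> M * \<bar>spow q (V z) - spow q lo\<bar>"
      using \<Gamma>2[of lo "V z"] Vr[of z] lohi by simp
    moreover have "\<bar>spow q (V z) - spow q lo\<bar> \<le> \<bar>spow q lo\<bar> + \<bar>spow q hi\<bar>"
      using spow_mono[OF q V_range(1)[of z]] spow_mono[OF q V_range(2)[of z]] by linarith
    ultimately have "\<bar>\<Gamma> (V z) - \<Gamma> lo\<bar> \<le> M * (\<bar>spow q lo\<bar> + \<bar>spow q hi\<bar>)"
      using M_nonneg(1) by (meson mult_left_mono order_trans)
    then show ?thesis unfolding BG_def by linarith
  qed
  have BG0: "0 \<le> BG" using \<Gamma>B[of undefined] by linarith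
  have ZB: "\<bar>Z x\<bar> \<le> B" for x using B(2)[of x] Z(2)[of x] by simp
  have iG: "integrable lborel (\<lambda>x. ind x * (\<Gamma> (V (x, t)) * Z x))" for t
  proof (rule bounded_on_ball_integrable)
    show "\<bar>\<Gamma> (V (x, t)) * Z x\<bar> \<le> BG * B" for x
      unfolding abs_mult using \<Gamma>B ZB BG0 by (intro mult_mono) auto
  qed measurable
  define g where "g t = (LINT x|lborel. ind x * (\<Gamma> (V (x, t)) * Z x))" for t
  have [measurable]: "cball c R \<in> sets borel" by simp
  have gm[measurable]: "g \<in> borel_measurable borel"
  proof -
    have "(\<lambda>t. LINT x|lborel. ind x * (\<Gamma> (V (x, t)) * Z x)) \<in> borel_measurable (lborel :: real measure)"
      by (rule lborel.borel_measurable_lebesgue_integral) measurable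
    then show ?thesis by (simp add: g_def[abs_def])
  qed
  define BB where "BB = (LINT x|lborel. ind x * (BG * B))"
  have gB: "\<bar>g t\<bar> \<le> BB" for t
  proof -
    have "\<bar>g t\<bar> \<le> (LINT x|lborel. norm (ind x * (\<Gamma> (V (x, t)) * Z x)))"
      unfolding g_def real_norm_def[symmetric] by (rule integral_norm_bound)
    also have "\<dots> \<le> BB" unfolding BB_def
    proof (rule integral_mono[OF integrable_norm[OF iG] integrable_mult_left[OF ind_integrable]])
      show "norm (ind x * (\<Gamma> (V (x, t)) * Z x)) \<le> ind x * (BG * B)" for x
        unfolding real_norm_def abs_mult abs_indicator using \<Gamma>B ZB BG0 by (intro mult_mono mult_left_mono) auto
    qed
    finally show ?thesis .
  qed
  have gdiff: "g s - g t = (LINT x|lborel. ind x * ((\<Gamma> (V (x, s)) - \<Gamma> (V (x, t))) * Z x))" for s t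
  proof -
    have "g s - g t = (LINT x|lborel. ind x * (\<Gamma> (V (x, s)) * Z x) - ind x * (\<Gamma> (V (x, t)) * Z x))"
      unfolding g_def by (rule Bochner_Integration.integral_diff[OF iG iG, symmetric])
    then show ?thesis by (simp only: left_diff_distrib right_diff_distrib)
  qed
  have iGd: "integrable lborel (\<lambda>x. ind x * ((\<Gamma> (V (x, s)) - \<Gamma> (V (x, t))) * Z x))" for s t
  proof -
    have "integrable lborel (\<lambda>x. ind x * (\<Gamma> (V (x, s)) * Z x) - ind x * (\<Gamma> (V (x, t)) * Z x))"
      by (rule Bochner_Integration.integrable_diff[OF iG iG])
    then show ?thesis by (simp only: left_diff_distrib right_diff_distrib)
  qed
  have iVd: "integrable lborel (\<lambda>x. ind x * \<bar>V (x, s) - V (x, t)\<bar>)" for s t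
  proof (rule bounded_on_ball_integrable)
    show "\<bar>\<bar>V (x, s) - V (x, t)\<bar>\<bar> \<le> hi - lo" for x
      using V_range[of "(x, s)"] V_range[of "(x, t)"] by (simp add: abs_le_iff)
  qed measurable
  (* Continuity of V in L1 at good times passes to g, as Gamma and the signed power are Lipschitz on [lo, hi]. *)
  have glip: "\<bar>g s - g t\<bar> \<le> (M * L * B) * (LINT x|lborel. ind x * \<bar>V (x, s) - V (x, t)\<bar>)" for s t
  proof -
    have "\<bar>g s - g t\<bar> \<le> (LINT x|lborel. norm (ind x * ((\<Gamma> (V (x, s)) - \<Gamma> (V (x, t))) * Z x)))"
      unfolding gdiff real_norm_def[symmetric] by (rule integral_norm_bound)
    also have "\<dots> \<le> (LINT x|lborel. (M * L * B) * (ind x * \<bar>V (x, s) - V (x, t)\<bar>))"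
    proof (rule integral_mono[OF integrable_norm[OF iGd] integrable_mult_right[OF iVd]])
      fix x
      have "\<bar>\<Gamma> (V (x, s)) - \<Gamma> (V (x, t))\<bar> \<le> M * \<bar>spow q (V (x, s)) - spow q (V (x, t))\<bar>" by (rule \<Gamma>2[OF Vr Vr])
      also have "\<dots> \<le> M * (L * \<bar>V (x, s) - V (x, t)\<bar>)" by (rule mult_left_mono[OF spL M_nonneg(1)])
      finally have "\<bar>\<Gamma> (V (x, s)) - \<Gamma> (V (x, t))\<bar> * \<bar>Z x\<bar> \<le> (M * (L * \<bar>V (x, s) - V (x, t)\<bar>)) * B"
        using ZB[of x] M_nonneg L0 by (intro mult_mono) auto
      then have "ind x * (\<bar>\<Gamma> (V (x, s)) - \<Gamma> (V (x, t))\<bar> * \<bar>Z x\<bar>) \<le> ind x * ((M * (L * \<bar>V (x, s) - V (x, t)\<bar>)) * B)"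
        by (rule mult_left_mono) simp
      then show "norm (ind x * ((\<Gamma> (V (x, s)) - \<Gamma> (V (x, t))) * Z x)) \<le> (M * L * B) * (ind x * \<bar>V (x, s) - V (x, t)\<bar>)"
        unfolding real_norm_def abs_mult abs_indicator by (simp only: mult_ac)
    qed
    finally show ?thesis by (simp only: integral_mult_right_zero)
  qed
  have gcont: "\<exists>d>0. AE s in lborel. s \<in> {\<alpha>..\<beta>} \<longrightarrow> \<bar>s - t\<bar> < d \<longrightarrow> \<bar>g s - g t\<bar> \<le> r"
    if t: "t \<in> T0" and r: "r > 0" for t r
  proof -
    have "\<exists>d>0. \<forall>s\<in>T0. \<bar>s - t\<bar> < d \<longrightarrow> \<bar>g s - g t\<bar> \<le> r"
    proof (rule ccontr)
      assume "\<not> ?thesis"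
      then have "\<exists>s\<in>T0. \<bar>s - t\<bar> < 1 / real (Suc n) \<and> r < \<bar>g s - g t\<bar>" for n
        by (metis not_le of_nat_0_less_iff zero_less_Suc zero_less_divide_1_iff)
      then obtain X where X: "\<And>n. X n \<in> T0" "\<And>n. \<bar>X n - t\<bar> < 1 / real (Suc n)" "\<And>n. r < \<bar>g (X n) - g t\<bar>"
        by metis
      have "(\<lambda>n. X n - t) \<longlonglongrightarrow> 0"
        by (rule Lim_null_comparison[OF always_eventually LIMSEQ_inverse_real_of_nat])
           (use X(2) in \<open>auto simp: inverse_eq_divide less_imp_le\<close>)
      then have "X \<longlonglongrightarrow> t" by (rule LIM_zero_cancel)
      from tendsto_mult_right_zero[OF T0_cont[OF t X(1) this], of "M * L * B"]
      have "(\<lambda>n. g (X n) - g t) \<longlonglongrightarrow> 0"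
        by (rule Lim_null_comparison[rotated]) (use glip in auto)
      from LIMSEQ_D[OF this r] X(3) show False by (metis diff_zero less_asym' order_refl real_norm_def)
    qed
    then obtain d where d: "d > 0" "\<And>s. s \<in> T0 \<Longrightarrow> \<bar>s - t\<bar> < d \<Longrightarrow> \<bar>g s - g t\<bar> \<le> r" by blast
    have "AE s in lborel. s \<in> {\<alpha>..\<beta>} \<longrightarrow> \<bar>s - t\<bar> < d \<longrightarrow> \<bar>g s - g t\<bar> \<le> r"
      using T0_AE by eventually_elim (use d(2) in blast)
    then show ?thesis using d(1) by blast
  qed
  (* Steps h <= delta stay inside the slab when looking back from t1, and make J2 a part of [t1, t2]. *)
  define \<delta> where "\<delta> = min (t1 - \<alpha>) (t2 - t1)"
  have \<delta>: "\<delta> > 0" "\<delta> \<le> t1 - \<alpha>" "\<delta> \<le> t2 - t1" using t12 by (auto simp: \<delta>_def)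
  define h where "h n = \<delta> * (1 / real (Suc n))" for n
  have h: "h n > 0" "h n \<le> \<delta>" for n using \<delta> mult_left_le[of "1 / real (Suc n)" \<delta>] by (auto simp: h_def)
  have "(\<lambda>n. \<delta> * (1 / real (Suc n))) \<longlonglongrightarrow> \<delta> * 0"
    using LIMSEQ_inverse_real_of_nat by (intro tendsto_mult tendsto_const) (simp add: inverse_eq_divide)
  then have h0: "h \<longlonglongrightarrow> 0" by (simp add: h_def[abs_def])
  have t2\<beta>: "t2 \<le> \<beta>" using t12 T0_sub by auto
  define J2 where "J2 n = {t2 - h n<..t2}" for n
  define J1 where "J1 n = {t1 - h n..<t1}" for n
  (* J2 and J1 are what remains of [t1, t2] and of its translate by -h after cancellation. *)
  have ibd: "integrable lborel (\<lambda>s. indicator S s * f s)" if [measurable]: "S \<in> sets borel" "f \<in> borel_measurable borel"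
     and "emeasure lborel S < \<infinity>" "\<And>s. \<bar>f s\<bar> \<le> BB" for S :: "real set" and f :: "real \<Rightarrow> real"
  proof (rule Bochner_Integration.integrable_bound)
    show "integrable lborel (\<lambda>s. indicator S s * BB)"
      using that by (intro integrable_mult_left integrable_real_indicator) auto
    show "AE s in lborel. norm (indicator S s * f s) \<le> norm (indicator S s * BB)"
      using that(4) by (intro AE_I2) (auto simp: indicator_def intro: order_trans[OF _ abs_ge_self])
  qed measurable
  let ?I = "indicator {t1..t2} :: real \<Rightarrow> real"
  have step: "e * ((LINT s|lborel. indicator (J2 n) s * g s) - (LINT s|lborel. indicator (J1 n) s * g s))
     + e * (LINT s|lborel. shift_average (h n) s) \<le> 0" for n
  proof -
    have sa_supp: "shift_average (h n) s = ?I s * shift_average (h n) s" for s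
      by (cases "s \<in> {t1..t2}") (auto simp: shift_average_def F_def)
    have AE1: "AE s in lborel. ?I s * (e * (g s - g (s - h n)) + e * shift_average (h n) s) \<le> 0"
      using T0_AE AE_shift_real[OF T0_AE, of "h n"]
    proof eventually_elim
      fix s assume s: "s \<in> {\<alpha>..\<beta>} \<longrightarrow> s \<in> T0" "s - h n \<in> {\<alpha>..\<beta>} \<longrightarrow> s - h n \<in> T0"
      show "?I s * (e * (g s - g (s - h n)) + e * shift_average (h n) s) \<le> 0"
      proof (cases "s \<in> {t1..t2}")
        case True
        have sT: "s \<in> T0" "s - h n \<in> T0" using s True h[of n] \<delta> t2\<beta> t12 by auto
        have "e * (g s - g (s - h n)) = (LINT x|lborel. e * (ind x * ((\<Gamma> (V (x, s)) - \<Gamma> (V (x, s - h n))) * Z x)))"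
          unfolding gdiff by (rule integral_mult_right_zero[symmetric])
        also have "\<dots> \<le> (LINT x|lborel. e * (ind x * (spow q (V (x, s)) - spow q (V (x, s - h n))) * \<phi> (V (x, s)) * Z x))"
        proof (rule integral_mono)
          show "integrable lborel (\<lambda>x. e * (ind x * ((\<Gamma> (V (x, s)) - \<Gamma> (V (x, s - h n))) * Z x)))"
            by (rule integrable_mult_right[OF iGd])
          have "integrable lborel (\<lambda>x. ind x * ((spow q (V (x, s)) - spow q (V (x, s - h n))) * \<phi> (V (x, s)) * Z x))"
          proof (rule bounded_on_ball_integrable)
            show "\<bar>(spow q (V (x, s)) - spow q (V (x, s - h n))) * \<phi> (V (x, s)) * Z x\<bar> \<le> (L * (hi - lo)) * M * B" for x
              unfolding abs_mult using sp_b ZB \<phi>(3,4)[of "V (x, s)"] L0 lohi M_nonneg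
              by (intro mult_mono) auto
          qed measurable
          then show "integrable lborel (\<lambda>x. e * (ind x * (spow q (V (x, s)) - spow q (V (x, s - h n))) * \<phi> (V (x, s)) * Z x))"
            by (intro integrable_mult_right) (simp only: mult.assoc)
          fix x
          have "e * (\<Gamma> (V (x, s)) - \<Gamma> (V (x, s - h n))) * (ind x * Z x)
             \<le> e * (\<phi> (V (x, s)) * (spow q (V (x, s)) - spow q (V (x, s - h n)))) * (ind x * Z x)"
            by (rule mult_right_mono[OF \<Gamma>1[OF Vr Vr]]) (simp add: Z(2))
          then show "e * (ind x * ((\<Gamma> (V (x, s)) - \<Gamma> (V (x, s - h n))) * Z x))
            \<le> e * (ind x * (spow q (V (x, s)) - spow q (V (x, s - h n))) * \<phi> (V (x, s)) * Z x)"
            by (simp only: mult_ac)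
        qed
        also have "\<dots> = e * (LINT x|lborel. ind x * (spow q (V (x, s)) - spow q (V (x, s - h n))) * \<phi> (V (x, s)) * Z x)"
          by (rule integral_mult_right_zero)
        finally show ?thesis using frozen_ineq[OF sT h(1) True] True by simp
      qed simp
    qed
    have ig1: "integrable lborel (\<lambda>s. ?I s * g s)" using gB emeasure_lborel_Icc[of t1 t2] t12 by (intro ibd) auto
    have ig2: "integrable lborel (\<lambda>s. ?I s * g (s - h n))" using gB emeasure_lborel_Icc[of t1 t2] t12 by (intro ibd) auto
    note isa = shift_average_integral(1)[OF h(1), of n]
    have "(LINT s|lborel. e * (?I s * g s - ?I s * g (s - h n)) + e * shift_average (h n) s) \<le> (LINT s::real|lborel. 0)"
    proof (rule integral_mono_AE)
      show "integrable lborel (\<lambda>s. e * (?I s * g s - ?I s * g (s - h n)) + e * shift_average (h n) s)"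
        by (intro Bochner_Integration.integrable_add integrable_mult_right Bochner_Integration.integrable_diff ig1 ig2 isa)
      show "AE s in lborel. e * (?I s * g s - ?I s * g (s - h n)) + e * shift_average (h n) s \<le> 0"
        using AE1
      proof eventually_elim
        fix s assume "?I s * (e * (g s - g (s - h n)) + e * shift_average (h n) s) \<le> 0"
        moreover have "?I s * (e * (g s - g (s - h n)) + e * shift_average (h n) s)
           = e * (?I s * g s - ?I s * g (s - h n)) + e * (?I s * shift_average (h n) s)" by (simp add: algebra_simps)
        ultimately show "e * (?I s * g s - ?I s * g (s - h n)) + e * shift_average (h n) s \<le> 0"
          by (simp only: sa_supp[symmetric])
      qed
    qed simp
    then have 1: "e * ((LINT s|lborel. ?I s * g s) - (LINT s|lborel. ?I s * g (s - h n))) + e * (LINT s|lborel. shift_average (h n) s) \<le> 0"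
      using ig1 ig2 isa by simp
    have 2: "(LINT s|lborel. ?I s * g (s - h n)) = (LINT s|lborel. ?I (s + h n) * g s)"
      using integral_shift[of "\<lambda>s. ?I (s + h n) * g s" "- h n"] by simp
    have ig3: "integrable lborel (\<lambda>s. ?I (s + h n) * g s)"
      using integrable_shift_iff[of "\<lambda>s. ?I (s + h n) * g s" "- h n"] ig2 by simp
    have ig4: "integrable lborel (\<lambda>s. indicator (J2 n) s * g s)"
      unfolding J2_def using gB h(1)[of n] by (intro ibd) auto
    have ig5: "integrable lborel (\<lambda>s. indicator (J1 n) s * g s)"
      unfolding J1_def using gB h(1)[of n] by (intro ibd) auto
    have "?I s * g s - ?I (s + h n) * g s = indicator (J2 n) s * g s - indicator (J1 n) s * g s" for s
      using h[of n] \<delta>(3) by (auto simp: J1_def J2_def indicator_def)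
    then have "(LINT s|lborel. ?I s * g s - ?I (s + h n) * g s) = (LINT s|lborel. indicator (J2 n) s * g s - indicator (J1 n) s * g s)"
      by presburger
    then have "(LINT s|lborel. ?I s * g s) - (LINT s|lborel. ?I (s + h n) * g s)
       = (LINT s|lborel. indicator (J2 n) s * g s) - (LINT s|lborel. indicator (J1 n) s * g s)"
      using ig1 ig3 ig4 ig5 by simp
    with 1 2 show ?thesis by simp
  qed
  have lim2: "(\<lambda>n. (LINT s|lborel. indicator (J2 n) s * g s) / h n) \<longlonglongrightarrow> g t2"
  proof (rule average_tendsto[where I="{\<alpha>..\<beta>}" and t=t2])
    show "J2 n \<subseteq> {\<alpha>..\<beta>}" for n using h[of n] \<delta> t2\<beta> t12 by (auto simp: J2_def)
    show "\<bar>s - t2\<bar> \<le> h n" if "s \<in> J2 n" for n s using that by (auto simp: J2_def)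
    show "integrable lborel (\<lambda>s. indicator (J2 n) s * g s)" for n
      unfolding J2_def using gB h(1)[of n] by (intro ibd) auto
  qed (use gcont[OF t12(2)] h h0 in \<open>auto simp: J2_def less_imp_le\<close>)
  have lim1: "(\<lambda>n. (LINT s|lborel. indicator (J1 n) s * g s) / h n) \<longlonglongrightarrow> g t1"
  proof (rule average_tendsto[where I="{\<alpha>..\<beta>}" and t=t1])
    show "J1 n \<subseteq> {\<alpha>..\<beta>}" for n using h[of n] \<delta> t2\<beta> t12 by (auto simp: J1_def)
    show "\<bar>s - t1\<bar> \<le> h n" if "s \<in> J1 n" for n s using that by (auto simp: J1_def)
    show "integrable lborel (\<lambda>s. indicator (J1 n) s * g s)" for n
      unfolding J1_def using gB h(1)[of n] by (intro ibd) auto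
  qed (use gcont[OF t12(1)] h h0 in \<open>auto simp: J1_def less_imp_le\<close>)
  have lim3: "(\<lambda>n. (LINT s|lborel. shift_average (h n) s) / h n) \<longlonglongrightarrow> (LINT z|lborel. a z \<bullet> F z)"
    by (rule shift_average_tendsto[OF h(1) h0])
  have "(\<lambda>n. e * ((LINT s|lborel. indicator (J2 n) s * g s) / h n - (LINT s|lborel. indicator (J1 n) s * g s) / h n)
     + e * ((LINT s|lborel. shift_average (h n) s) / h n)) \<longlonglongrightarrow> e * (g t2 - g t1) + e * (LINT z|lborel. a z \<bullet> F z)"
    by (intro tendsto_intros lim1 lim2 lim3)
  moreover have "e * ((LINT s|lborel. indicator (J2 n) s * g s) / h n - (LINT s|lborel. indicator (J1 n) s * g s) / h n)
     + e * ((LINT s|lborel. shift_average (h n) s) / h n) \<le> 0" for n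
  proof -
    have "e * (x / h n - y / h n) + e * (w / h n) = (e * (x - y) + e * w) / h n" for x y w
      by (simp only: add_divide_distrib diff_divide_distrib right_diff_distrib times_divide_eq_right)
    then show ?thesis using divide_nonpos_pos[OF step[of n] h(1)] by presburger
  qed
  ultimately have chain: "e * (g t2 - g t1) + e * (LINT z|lborel. a z \<bullet> F z) \<le> 0"
    by (intro LIMSEQ_le_const2) auto
  have iSp: "integrable lborel (\<lambda>x. ind x * (\<bar>spow q (V (x, t2)) - spow q (V (x, t1))\<bar> * Z x))"
  proof (rule bounded_on_ball_integrable)
    show "\<bar>\<bar>spow q (V (x, t2)) - spow q (V (x, t1))\<bar> * Z x\<bar> \<le> (L * (hi - lo)) * B" for x
      unfolding abs_mult abs_idempotent using sp_b ZB L0 lohi by (intro mult_mono) auto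
  qed measurable
  have bt: "- (e * (g t2 - g t1)) \<le> M * (LINT x|lborel. ind x * \<bar>spow q (V (x, t2)) - spow q (V (x, t1))\<bar> * Z x)"
  proof -
    have "- (e * (g t2 - g t1)) \<le> \<bar>g t2 - g t1\<bar>" using e by auto
    also have "\<dots> \<le> (LINT x|lborel. norm (ind x * ((\<Gamma> (V (x, t2)) - \<Gamma> (V (x, t1))) * Z x)))"
      unfolding gdiff real_norm_def[symmetric] by (rule integral_norm_bound)
    also have "\<dots> \<le> (LINT x|lborel. M * (ind x * (\<bar>spow q (V (x, t2)) - spow q (V (x, t1))\<bar> * Z x)))"
    proof (rule integral_mono[OF integrable_norm[OF iGd] integrable_mult_right[OF iSp]])
      fix x
      have "\<bar>\<Gamma> (V (x, t2)) - \<Gamma> (V (x, t1))\<bar> * (ind x * Z x) \<le> (M * \<bar>spow q (V (x, t2)) - spow q (V (x, t1))\<bar>) * (ind x * Z x)"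
        by (rule mult_right_mono[OF \<Gamma>2[OF Vr Vr]]) (simp add: Z(2))
      then show "norm (ind x * ((\<Gamma> (V (x, t2)) - \<Gamma> (V (x, t1))) * Z x)) \<le> M * (ind x * (\<bar>spow q (V (x, t2)) - spow q (V (x, t1))\<bar> * Z x))"
        unfolding real_norm_def abs_mult abs_indicator abs_of_nonneg[OF Z(2)] by (simp only: mult_ac)
    qed
    finally show ?thesis by (simp only: integral_mult_right_zero mult.assoc)
  qed
  let ?X = "\<lambda>z. indicator {t1..t2} (snd z) * (\<bar>\<phi>' (V z)\<bar> * norm (G z) powr p * Z (fst z))"
  let ?Y = "\<lambda>z. indicator {t1..t2} (snd z) * (norm (G z) powr (p - 1) * norm (grad Z (fst z)))"
  have iX: "integrable lborel ?X"
  proof (rule Bochner_Integration.integrable_bound[OF integrable_mult_right[OF Gp, of "M' * B"]])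
    show "AE z in lborel. norm (?X z) \<le> norm ((M' * B) * norm (G z) powr p)"
    proof (intro AE_I2)
      fix z
      have "\<bar>\<phi>' (V z)\<bar> * norm (G z) powr p * Z (fst z) \<le> M' * norm (G z) powr p * B"
        using \<phi>(5) B Z(2) M_nonneg by (intro mult_mono mult_nonneg_nonneg) auto
      then show "norm (?X z) \<le> norm ((M' * B) * norm (G z) powr p)"
        using M_nonneg B(1) Z(2) by (auto simp: indicator_def abs_mult mult_ac)
    qed
  qed measurable
  have iY: "integrable lborel ?Y"
  proof (rule Bochner_Integration.integrable_bound[OF integrable_mult_right[OF integrable_G_pm1, of B]])
    show "AE z in lborel. norm (?Y z) \<le> norm (B * norm (G z) powr (p - 1))"
      using B by (intro AE_I2) (auto simp: indicator_def abs_mult mult.commute[of B] intro!: mult_left_mono)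
  qed measurable
  have iaF: "integrable lborel (\<lambda>z. a z \<bullet> F z)" using pair_integrable[of 0] by simp
  have "(LINT z|lborel. K1 * ?X z - K2 * M * ?Y z) \<le> (LINT z|lborel. e * (a z \<bullet> F z))"
  proof (rule integral_mono)
    show "integrable lborel (\<lambda>z. K1 * ?X z - K2 * M * ?Y z)"
      by (intro Bochner_Integration.integrable_diff integrable_mult_right iX iY)
    show "integrable lborel (\<lambda>z. e * (a z \<bullet> F z))" by (rule integrable_mult_right[OF iaF])
    fix z
    show "K1 * ?X z - K2 * M * ?Y z \<le> e * (a z \<bullet> F z)"
    proof (cases "snd z \<in> {t1..t2}")
      case True
      have ab: "\<bar>\<phi>' (V z)\<bar> = e * \<phi>' (V z)"
        using e\<phi>'[OF V_range(1)[of z] V_range(2)[of z]] e by auto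
      have 1: "K1 * (\<bar>\<phi>' (V z)\<bar> * norm (G z) powr p * Z (fst z)) \<le> (\<bar>\<phi>' (V z)\<bar> * Z (fst z)) * (a z \<bullet> G z)"
        using mult_left_mono[OF aG[of z], of "\<bar>\<phi>' (V z)\<bar> * Z (fst z)"] Z(2) by (simp add: mult_ac)
      have 2: "- (K2 * M * (norm (G z) powr (p - 1) * norm (grad Z (fst z)))) \<le> e * \<phi> (V z) * (a z \<bullet> grad Z (fst z))"
      proof -
        have "\<bar>e * \<phi> (V z) * (a z \<bullet> grad Z (fst z))\<bar> = \<phi> (V z) * \<bar>a z \<bullet> grad Z (fst z)\<bar>"
          using e \<phi>(3)[of "V z"] by (auto simp: abs_mult)
        also have "\<dots> \<le> M * ((K2 * norm (G z) powr (p - 1)) * norm (grad Z (fst z)))"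
        proof (intro mult_mono)
          show "\<bar>a z \<bullet> grad Z (fst z)\<bar> \<le> (K2 * norm (G z) powr (p - 1)) * norm (grad Z (fst z))"
            using Cauchy_Schwarz_ineq2[of "a z" "grad Z (fst z)"] mult_right_mono[OF aK[of z] norm_ge_zero[of "grad Z (fst z)"]] by linarith
        qed (use \<phi>(3,4) M_nonneg in auto)
        finally have "\<bar>e * \<phi> (V z) * (a z \<bullet> grad Z (fst z))\<bar> \<le> K2 * M * (norm (G z) powr (p - 1) * norm (grad Z (fst z)))"
          by (simp only: mult_ac)
        then show ?thesis by linarith
      qed
      have "e * (a z \<bullet> F z) = (\<bar>\<phi>' (V z)\<bar> * Z (fst z)) * (a z \<bullet> G z) + e * \<phi> (V z) * (a z \<bullet> grad Z (fst z))"
        unfolding ab using True by (simp add: F_def \<Phi>_def inner_add_right algebra_simps)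
      then show ?thesis using 1 2 True by simp
    next
      case False
      then show ?thesis by (simp add: F_def)
    qed
  qed
  moreover have "(LINT z|lborel. K1 * ?X z - K2 * M * ?Y z) = K1 * (LINT z|lborel. ?X z) - K2 * M * (LINT z|lborel. ?Y z)"
    by (simp only: Bochner_Integration.integral_diff[OF integrable_mult_right[OF iX] integrable_mult_right[OF iY]] integral_mult_right_zero)
  moreover have "(LINT z|lborel. e * (a z \<bullet> F z)) = e * (LINT z|lborel. a z \<bullet> F z)" by (rule integral_mult_right_zero)
  ultimately show ?thesis using chain bt by linarith
qed

end

section \<open>Differences of signed powers\<close>

text \<open>Each of \<open>x^q\<close> and \<open>y^q\<close> is at most the corresponding base times \<open>(x + y)^{q-1}\<close>.\<close>

lemma powr_superadditive:
  fixes x y q :: real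
  assumes "x \<ge> 0" "y \<ge> 0" "q \<ge> 1"
  shows "x powr q + y powr q \<le> (x + y) powr q"
proof -
  have "x powr q = x powr (q - 1) * x" using powr_mult_base[of x "q - 1"] assms by (simp add: mult.commute)
  also have "\<dots> \<le> (x + y) powr (q - 1) * x" using assms by (intro mult_right_mono powr_mono2) auto
  finally have 1: "x powr q \<le> (x + y) powr (q - 1) * x" .
  have "y powr q = y powr (q - 1) * y" using powr_mult_base[of y "q - 1"] assms by (simp add: mult.commute)
  also have "\<dots> \<le> (x + y) powr (q - 1) * y" using assms by (intro mult_right_mono powr_mono2) auto
  finally have 2: "y powr q \<le> (x + y) powr (q - 1) * y" .
  have "(x + y) powr (q - 1) * x + (x + y) powr (q - 1) * y = (x + y) powr q"
    using powr_mult_base[of "x + y" "q - 1"] assms by (simp add: algebra_simps)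
  then show ?thesis using 1 2 by linarith
qed

lemma spow_nonneg_eq: "v \<ge> 0 \<Longrightarrow> spow q v = v powr q"
  using powr_mult_base[of v "q - 1"] by (simp add: spow_def mult.commute)

lemma spow_minus: "spow q (- v) = - spow q v"
  by (simp add: spow_def)

text \<open>If \<open>x\<close> and \<open>y\<close> have the same sign this is superadditivity of the power, with constant one; if they have opposite
signs the factor \<open>2^q\<close> comes from \<open>(y + |x|)^q \<le> 2^q (y^q + |x|^q)\<close>.\<close>

lemma diff_powr_le_spow:
  assumes q: "q > 1" and "x \<le> y"
  shows "(y - x) powr q \<le> 2 powr q * (spow q y - spow q x)"
proof -
  have one: "1 \<le> 2 powr q" using q by (simp add: ge_one_powr_ge_zero)
  consider "x \<ge> 0" | "y \<le> 0" | "x < 0" "y > 0" by linarith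
  then show ?thesis
  proof cases
    case 1
    have l1: "(y - x) powr q \<le> spow q y - spow q x"
      using powr_superadditive[of x "y - x" q] 1 assms by (simp add: spow_nonneg_eq)
    have d0: "0 \<le> spow q y - spow q x" using spow_mono[OF assms] by simp
    show ?thesis using order_trans[OF l1 mult_right_mono[OF one d0, unfolded mult_1_left]] .
  next
    case 2
    have "spow q y = - ((- y) powr q)" "spow q x = - ((- x) powr q)"
      using 2 assms spow_nonneg_eq[of "- y" q] spow_nonneg_eq[of "- x" q] by (auto simp: spow_minus)
    then have l1: "(y - x) powr q \<le> spow q y - spow q x"
      using powr_superadditive[of "- y" "y - x" q] 2 assms by simp
    have d0: "0 \<le> spow q y - spow q x" using spow_mono[OF assms] by simp
    show ?thesis using order_trans[OF l1 mult_right_mono[OF one d0, unfolded mult_1_left]] .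
  next
    case 3
    have "spow q x = - ((- x) powr q)" "spow q y = y powr q"
      using 3 spow_nonneg_eq[of y q] spow_nonneg_eq[of "- x" q] by (auto simp: spow_minus)
    moreover have "(y + (- x)) powr q \<le> 2 powr q * (y powr q + (- x) powr q)"
      using 3 q by (intro powr_add2_le) auto
    ultimately show ?thesis by simp
  qed
qed

text \<open>The term \<open>y^m\<close> is at most the first or the second term on the right, depending on whether \<open>\<beta> y^{q-m} \<ge> 1\<close>.\<close>

lemma young_powr:
  fixes y m q \<beta> :: real
  assumes "y \<ge> 0" "0 < m" "m < q" "\<beta> > 0"
  shows "y powr m \<le> \<beta> * y powr q + \<beta> powr (- (m / (q - m)))"
proof (cases "y powr (q - m) \<ge> 1 / \<beta>")
  case True
  have "y powr m \<le> (\<beta> * y powr (q - m)) * y powr m"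
    using mult_right_mono[of 1 "\<beta> * y powr (q - m)" "y powr m"] True assms by (simp add: field_simps)
  also have "\<dots> = \<beta> * y powr q" by (simp add: powr_add[symmetric])
  finally show ?thesis by (simp add: add_increasing2)
next
  case False
  then have le: "y powr (q - m) \<le> \<beta> powr (- 1)" using assms by (simp add: powr_minus_divide)
  have "y powr m = (y powr (q - m)) powr (m / (q - m))" using assms by (simp add: powr_powr)
  also have "\<dots> \<le> (\<beta> powr (- 1)) powr (m / (q - m))" using le assms by (intro powr_mono2) auto
  also have "\<dots> = \<beta> powr (- (m / (q - m)))" unfolding powr_powr by (simp only: mult_minus_left mult_1_left)
  finally show ?thesis using assms by (simp add: add_increasing)
qed

section \<open>A regularised negative power\<close>

text \<open>A substitute for \<open>(x + \<kappa>)^{-a}\<close> that is smooth and bounded on the whole line. For \<open>x \<ge> 0\<close> it has the same size up to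
constants, since \<open>(x + \<kappa>)^2 + \<kappa>^2\<close> lies between \<open>(x + \<kappa>)^2\<close> and \<open>2 (x + \<kappa>)^2\<close>.\<close>

definition reg_power :: "real \<Rightarrow> real \<Rightarrow> real \<Rightarrow> real" where
  "reg_power a \<kappa> x = ((x + \<kappa>)^2 + \<kappa>^2) powr (- a / 2)"

definition reg_power_deriv :: "real \<Rightarrow> real \<Rightarrow> real \<Rightarrow> real" where
  "reg_power_deriv a \<kappa> x = - (a * (x + \<kappa>) * ((x + \<kappa>)^2 + \<kappa>^2) powr (- a / 2 - 1))"

lemma reg_power_props:
  assumes a: "a > 0" and \<kappa>: "\<kappa> > 0"
  shows "(reg_power a \<kappa> has_real_derivative reg_power_deriv a \<kappa> x) (at x)"
    and "continuous_on UNIV (reg_power_deriv a \<kappa>)"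
    and "0 \<le> reg_power a \<kappa> x" "reg_power a \<kappa> x \<le> \<kappa> powr (- a)" "\<bar>reg_power_deriv a \<kappa> x\<bar> \<le> a * \<kappa> powr (- a - 1)"
    and "0 \<le> x \<Longrightarrow> reg_power_deriv a \<kappa> x \<le> - (a * 2 powr (- a / 2 - 1) * (x + \<kappa>) powr (- a - 1))"
proof -
  have pos: "(x + \<kappa>)^2 + \<kappa>^2 > 0" for x using \<kappa> by (simp add: add_nonneg_pos)
  have "((\<lambda>x. (x + \<kappa>)^2 + \<kappa>^2) has_real_derivative 2 * (x + \<kappa>)) (at x)"
    by (auto intro!: derivative_eq_intros)
  from DERIV_fun_powr[OF this pos, of "- a / 2"]
  show "(reg_power a \<kappa> has_real_derivative reg_power_deriv a \<kappa> x) (at x)"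
    unfolding reg_power_def[abs_def] reg_power_deriv_def by (rule DERIV_cong) (simp add: field_simps)
  show "continuous_on UNIV (reg_power_deriv a \<kappa>)"
    unfolding reg_power_deriv_def[abs_def] using pos by (intro continuous_intros) (auto simp: less_imp_neq[symmetric])
  show "0 \<le> reg_power a \<kappa> x" by (simp add: reg_power_def)
  have k2: "(\<kappa>^2) powr b = \<kappa> powr (2 * b)" for b
  proof -
    have "\<kappa>^2 = \<kappa> powr 2" using powr_realpow[OF \<kappa>, of 2] by simp
    then show ?thesis by (simp only: powr_powr)
  qed
  have "((x + \<kappa>)^2 + \<kappa>^2) powr (- a / 2) \<le> (\<kappa>^2) powr (- a / 2)"
    using a \<kappa> by (intro powr_mono2') auto
  then show "reg_power a \<kappa> x \<le> \<kappa> powr (- a)" by (simp add: reg_power_def k2)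
  let ?s = "(x + \<kappa>)^2 + \<kappa>^2"
  have "\<bar>x + \<kappa>\<bar> = ((x + \<kappa>)^2) powr (1 / 2)" by (simp add: powr_half_sqrt)
  also have "\<dots> \<le> ?s powr (1 / 2)" by (intro powr_mono2) auto
  finally have "\<bar>reg_power_deriv a \<kappa> x\<bar> \<le> a * (?s powr (1 / 2)) * ?s powr (- a / 2 - 1)"
    unfolding reg_power_deriv_def using a by (simp add: abs_mult mult_right_mono mult_left_mono)
  also have "\<dots> = a * ?s powr (- (a + 1) / 2)"
    unfolding mult.assoc powr_add[symmetric] by (simp add: field_simps)
  also have "?s powr (- (a + 1) / 2) \<le> (\<kappa>^2) powr (- (a + 1) / 2)"
    using a \<kappa> by (intro powr_mono2') auto
  also have "(\<kappa>^2) powr (- (a + 1) / 2) = \<kappa> powr (- a - 1)"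
  proof -
    have "2 * (- (a + 1) / 2) = - a - 1" by (simp add: field_simps)
    then show ?thesis by (simp only: k2)
  qed
  finally show "\<bar>reg_power_deriv a \<kappa> x\<bar> \<le> a * \<kappa> powr (- a - 1)" using a by (simp add: mult_left_mono)
  assume x: "0 \<le> x"
  have "?s \<le> 2 * (x + \<kappa>)^2"
    using power_mono[of \<kappa> "x + \<kappa>" 2] x \<kappa> by simp
  then have "(2 * (x + \<kappa>)^2) powr (- a / 2 - 1) \<le> ?s powr (- a / 2 - 1)"
    using a pos by (intro powr_mono2') auto
  also have "(2 * (x + \<kappa>)^2) powr (- a / 2 - 1) = 2 powr (- a / 2 - 1) * (x + \<kappa>) powr (- a - 2)"
  proof -
    have "((x + \<kappa>)^2) powr (- a / 2 - 1) = ((x + \<kappa>) powr 2) powr (- a / 2 - 1)"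
      using x \<kappa> powr_realpow[of "x + \<kappa>" 2] by simp
    also have "\<dots> = (x + \<kappa>) powr (- a - 2)" unfolding powr_powr by (simp add: algebra_simps)
    finally show ?thesis by (simp add: powr_mult)
  qed
  finally have le: "a * (x + \<kappa>) * (2 powr (- a / 2 - 1) * (x + \<kappa>) powr (- a - 2)) \<le> a * (x + \<kappa>) * ?s powr (- a / 2 - 1)"
    using a x \<kappa> by (intro mult_left_mono) auto
  have eq: "(x + \<kappa>) * (x + \<kappa>) powr (- a - 2) = (x + \<kappa>) powr (- a - 1)"
  proof -
    have "(x + \<kappa>) * (x + \<kappa>) powr (- a - 2) = (x + \<kappa>) powr (1 + (- a - 2))"
      using x \<kappa> by (intro powr_mult_base) simp
    also have "1 + (- a - 2) = - a - 1" by simp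
    finally show ?thesis .
  qed
  have eq2: "a * (x + \<kappa>) * (2 powr (- a / 2 - 1) * (x + \<kappa>) powr (- a - 2)) = a * 2 powr (- a / 2 - 1) * ((x + \<kappa>) * (x + \<kappa>) powr (- a - 2))"
    by (simp only: mult_ac)
  show "reg_power_deriv a \<kappa> x \<le> - (a * 2 powr (- a / 2 - 1) * (x + \<kappa>) powr (- a - 1))"
    using le unfolding reg_power_deriv_def eq2 eq by (rule le_imp_neg_le)
qed

section \<open>The bound for the gradient integral\<close>

text \<open>Young's inequality with the weight \<open>V^{-(a+1)/p}\<close> moved from one factor to the other; the powers of \<open>x\<close>
are distributed such that the first term on the right carries the full power \<open>x^l\<close>.\<close>

lemma gradient_young:
  fixes g V x D a p l \<beta> :: real
  assumes "0 \<le> g" "0 < V" "0 \<le> x" "0 < D" "p > 1" "\<beta> > 0"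
  shows "g powr (p - 1) * (D * x powr (l - 1))
     \<le> \<beta> * (V powr (- a - 1) * g powr p * x powr l) + \<beta> powr (1 - p) * (D powr p * (V powr ((a + 1) * (p - 1)) * x powr (l - p)))"
proof (cases "x = 0")
  case True
  then show ?thesis by simp
next
  case False
  then have x: "x > 0" using assms by simp
  define X where "X = g * V powr ((- a - 1) / p) * x powr (l / p)"
  define Y where "Y = D * V powr ((a + 1) * (p - 1) / p) * x powr ((l - p) / p)"
  have "X powr (p - 1) * Y \<le> \<beta> * X powr p + \<beta> powr (1 - p) * Y powr p"
    using assms by (intro young_split) (auto simp: X_def Y_def)
  moreover have "X powr p = V powr (- a - 1) * g powr p * x powr l"
    using assms by (simp add: X_def powr_mult powr_powr)
  moreover have "Y powr p = D powr p * (V powr ((a + 1) * (p - 1)) * x powr (l - p))"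
    using assms by (simp add: Y_def powr_mult powr_powr)
  moreover have "X powr (p - 1) * Y = g powr (p - 1) * (D * x powr (l - 1))"
  proof -
    have "X powr (p - 1) * Y = g powr (p - 1) * D * (V powr ((- a - 1) / p * (p - 1)) * V powr ((a + 1) * (p - 1) / p))
        * (x powr (l / p * (p - 1)) * x powr ((l - p) / p))"
      unfolding X_def Y_def powr_mult powr_powr by (simp only: mult_ac)
    also have "V powr ((- a - 1) / p * (p - 1)) * V powr ((a + 1) * (p - 1) / p) = V powr ((- a - 1) / p * (p - 1) + (a + 1) * (p - 1) / p)"
      by (rule powr_add[symmetric])
    also have "(- a - 1) / p * (p - 1) + (a + 1) * (p - 1) / p = 0" using assms by (simp add: field_simps)
    also have "x powr (l / p * (p - 1)) * x powr ((l - p) / p) = x powr (l / p * (p - 1) + (l - p) / p)"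
      by (rule powr_add[symmetric])
    also have "l / p * (p - 1) + (l - p) / p = l - 1" using assms by (simp add: field_simps)
    finally show ?thesis using assms by simp
  qed
  ultimately show ?thesis by simp
qed

text \<open>Applied to \<open>y = V x^{l/q}\<close>, Young's inequality produces \<open>y^q = V^q x^l\<close>. The surplus power
\<open>x^{l-p-lm/q}\<close> has a nonnegative exponent precisely because \<open>pq \<le> l(q - m)\<close>.\<close>

lemma weight_young:
  fixes V x l p m q \<beta> :: real
  assumes "0 < V" "0 \<le> x" "x \<le> 1" "0 < m" "m < q" "\<beta> > 0" "p * q \<le> l * (q - m)"
  shows "V powr m * x powr (l - p) \<le> \<beta> * (V powr q * x powr l) + \<beta> powr (- (m / (q - m)))"
proof (cases "x = 0")
  case True
  then show ?thesis by simp
next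
  case False
  then have x: "x > 0" using assms by simp
  have q: "q > 0" using assms by simp
  define y where "y = V * x powr (l / q)"
  have "V powr m * x powr (l - p) = y powr m * x powr (l - p - l / q * m)"
    unfolding y_def powr_mult powr_powr by (simp add: mult.assoc powr_add[symmetric])
  also have "\<dots> \<le> y powr m * 1"
  proof (intro mult_left_mono powr_le1)
    have "p \<le> l * (q - m) / q" using assms(7) q by (simp add: pos_le_divide_eq)
    also have "\<dots> = l - l / q * m" using q by (simp add: field_simps)
    finally show "0 \<le> l - p - l / q * m" by simp
  qed (use x assms in auto)
  also have "\<dots> \<le> \<beta> * y powr q + \<beta> powr (- (m / (q - m)))"
    using young_powr[of y m q \<beta>] assms by (simp add: y_def)
  also have "y powr q = V powr q * x powr l" using q by (simp add: y_def powr_mult powr_powr)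
  finally show ?thesis .
qed

context weak_slab
begin

text \<open>Here \<open>e\<close> is the sign of the sub- or super-solution inequality and \<open>ee\<close> the sign in \<open>v = ee (\<mu> - V)\<close>; the two are
independent. The test function uses \<open>reg_power b \<kappa> v\<close> if they agree and \<open>\<kappa>^{-b} - reg_power b \<kappa> v\<close>
otherwise, so that \<open>e \<phi>' \<ge> 0\<close> in every case. The energy inequality bounds
\<open>X = \<integral>\<integral> (v + \<kappa>)^{-b-1} |G|^p \<zeta>^l\<close> by \<open>C1 \<kappa>^{-b} (Y + S N)\<close>, and \<open>gradient_young\<close> and \<open>weight_young\<close>
bound \<open>Y\<close> by a small multiple of \<open>Y + S N\<close> plus slice integrals of \<open>(v + \<kappa>)^q \<zeta>^l\<close>.\<close>

lemma gradient_integral_bound: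
  fixes \<zeta> :: "'a \<Rightarrow> real" and ee \<mu> S N \<theta> \<kappa> l D b m \<delta>1 \<beta>2 t1 t2 C1 :: real
  defines "Z \<equiv> \<lambda>x. \<zeta> x powr l"
  defines "Y \<equiv> LINT z|lborel. indicator {t1..t2} (snd z) * (norm (G z) powr (p - 1) * norm (grad Z (fst z)))"
  assumes \<zeta>: "\<And>x. 0 \<le> \<zeta> x" "\<And>x. \<zeta> x \<le> 1" and \<zeta>m[measurable]: "\<zeta> \<in> borel_measurable borel"
    and Z: "C_k 1 Z" "\<And>x. x \<notin> cball c \<rho> \<Longrightarrow> \<zeta> x = 0"
    and DZ: "\<And>x. norm (grad Z x) \<le> D * \<zeta> x powr (l - 1)" and D: "D > 0"
    and ee: "ee = 1 \<or> ee = - 1" and \<mu>: "\<mu> = (if ee = 1 then hi else lo)"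
    and S: "\<And>t. t \<in> T0 \<Longrightarrow> (LINT x|lborel. ind x * (ee * (spow q \<mu> - spow q (V (x, t))) * Z x)) \<le> S * N"
    and N: "measure lborel (cball c R) \<le> N" and S0: "0 \<le> S"
    and t: "t1 \<in> T0" "t2 \<in> T0" "t1 < t2" "\<alpha> < t1" "t2 - t1 \<le> \<theta>"
    and \<kappa>: "\<kappa> > 0" and b: "b > 0" "m = (b + 1) * (p - 1)" "m < q" "p * q \<le> l * (q - m)"
    and C1: "C1 = (K2 + 2) / (K1 * (b * 2 powr (- b / 2 - 1)))"
    and \<delta>1: "0 < \<delta>1" "\<delta>1 \<le> 1 / 2" and \<beta>2: "\<beta>2 > 0"
  shows "Y \<le> 2 * \<delta>1 * S * N + 2 * (\<delta>1 * \<kappa> powr b / C1) powr (1 - p) * D powr p * \<theta> * N *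
      (\<beta>2 * 4 powr q * (S + \<kappa> powr q) + \<beta>2 powr (- (m / (q - m))))"
proof -
  have q0: "q > 0" using q by simp
  have m0: "m > 0" using b(1,2) p by simp
  define v where "v z = ee * (\<mu> - V z)" for z
  have v0: "0 \<le> v z" for z using ee V_range[of z] by (auto simp: v_def \<mu>)
  have vm[measurable]: "v \<in> borel_measurable borel" unfolding v_def by measurable
  have vB: "v z \<le> hi - lo" for z using ee V_range[of z] by (auto simp: v_def \<mu>)
  define w where "w z = ee * (spow q \<mu> - spow q (V z))" for z
  have w0: "0 \<le> w z" for z
    using ee spow_mono[OF q V_range(1)[of z]] spow_mono[OF q V_range(2)[of z]] by (auto simp: w_def \<mu>)
  have wm[measurable]: "w \<in> borel_measurable borel" unfolding w_def by measurable
  have vw: "v z powr q \<le> 2 powr q * w z" for z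
    using ee diff_powr_le_spow[OF q V_range(1)[of z]] diff_powr_le_spow[OF q V_range(2)[of z]] by (auto simp: v_def w_def \<mu>)
  have wB: "w z \<le> spow q hi - spow q lo" for z
    using ee spow_mono[OF q V_range(1)[of z]] spow_mono[OF q V_range(2)[of z]] by (auto simp: w_def \<mu>)
  have Z01: "0 \<le> Z x" "Z x \<le> 1" for x
    using \<zeta>[of x] order_trans[OF mult_nonneg_nonneg[of p q] b(4)] p q b(3)
    by (auto simp: Z_def intro!: powr_le1 simp: zero_le_mult_iff)
  have Zm[measurable]: "Z \<in> borel_measurable borel" unfolding Z_def by measurable
  define \<phi> where "\<phi> u = (if e = ee then reg_power b \<kappa> (ee * (\<mu> - u)) else \<kappa> powr (- b) - reg_power b \<kappa> (ee * (\<mu> - u)))" for u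
  define \<phi>' where "\<phi>' u = - e * reg_power_deriv b \<kappa> (ee * (\<mu> - u))" for u
  note reg_power = reg_power_props[OF b(1) \<kappa>]
  have d\<phi>: "(\<phi> has_real_derivative \<phi>' u) (at u)" for u
  proof -
    have "((\<lambda>u. ee * (\<mu> - u)) has_real_derivative - ee) (at u)" by (auto intro!: derivative_eq_intros)
    from DERIV_chain2[OF reg_power(1) this]
    have d: "((\<lambda>u. reg_power b \<kappa> (ee * (\<mu> - u))) has_real_derivative reg_power_deriv b \<kappa> (ee * (\<mu> - u)) * - ee) (at u)" .
    show ?thesis
    proof (cases "e = ee")
      case True
      then show ?thesis using d unfolding \<phi>_def \<phi>'_def by (simp add: mult.commute)
    next
      case False
      then have "e = - ee" using e ee by auto
      then show ?thesis using DERIV_diff[OF DERIV_const d, of "\<kappa> powr (- b)"] False unfolding \<phi>_def \<phi>'_def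
        by (simp add: mult.commute)
    qed
  qed
  have abs\<phi>': "\<bar>\<phi>' u\<bar> = \<bar>reg_power_deriv b \<kappa> (ee * (\<mu> - u))\<bar>" for u using e by (auto simp: \<phi>'_def)
  interpret test: weak_slab_test c R \<rho> \<alpha> \<beta> V G a e K1 K2 p q lo hi T0 Z \<phi> \<phi>' "\<kappa> powr (- b)" "b * \<kappa> powr (- b - 1)" t1 t2
  proof unfold_locales
    show "continuous_on UNIV \<phi>'" unfolding \<phi>'_def[abs_def]
      by (intro continuous_intros continuous_on_compose2[OF reg_power(2)]) auto
    show "0 \<le> \<phi> u" "\<phi> u \<le> \<kappa> powr (- b)" for u
      using reg_power(3)[of "ee * (\<mu> - u)"] reg_power(4)[of "ee * (\<mu> - u)"] by (auto simp: \<phi>_def)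
    show "\<bar>\<phi>' u\<bar> \<le> b * \<kappa> powr (- b - 1)" for u unfolding abs\<phi>' by (rule reg_power(5))
    show "0 \<le> e * \<phi>' u" if "lo \<le> u" "u \<le> hi" for u
    proof -
      have "0 \<le> ee * (\<mu> - u)" using that ee by (auto simp: \<mu>)
      from reg_power(6)[OF this] have "reg_power_deriv b \<kappa> (ee * (\<mu> - u)) \<le> 0" using b(1) by (smt (verit) mult_nonneg_nonneg powr_ge_zero)
      then show ?thesis using e by (auto simp: \<phi>'_def)
    qed
    show "Z x = 0" if "x \<notin> cball c \<rho>" for x using Z(2)[OF that] by (simp add: Z_def)
  qed (use Z Z01 d\<phi> t in auto)
  let ?I = "\<lambda>z. indicator {t1..t2} (snd z) :: real"
  define X where "X = (LINT z|lborel. ?I z * ((v z + \<kappa>) powr (- b - 1) * norm (G z) powr p * Z (fst z)))"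
  define c0 where "c0 = b * 2 powr (- b / 2 - 1)"
  have c0: "c0 > 0" using b by (simp add: c0_def)
  have W1: "(v z + \<kappa>) powr (- b - 1) \<le> \<kappa> powr (- b - 1)" for z
    using v0[of z] \<kappa> b by (intro powr_mono2') auto
  have iX: "integrable lborel (\<lambda>z. ?I z * ((v z + \<kappa>) powr (- b - 1) * norm (G z) powr p * Z (fst z)))"
  proof (rule Bochner_Integration.integrable_bound[OF integrable_mult_right[OF Gp, of "\<kappa> powr (- b - 1)"]])
    show "AE z in lborel. norm (?I z * ((v z + \<kappa>) powr (- b - 1) * norm (G z) powr p * Z (fst z))) \<le> norm (\<kappa> powr (- b - 1) * norm (G z) powr p)"
    proof (intro AE_I2)
      fix z :: "'a \<times> real"
      have "(v z + \<kappa>) powr (- b - 1) * norm (G z) powr p * Z (fst z) \<le> \<kappa> powr (- b - 1) * norm (G z) powr p * 1"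
        using W1 Z01 by (intro mult_mono mult_nonneg_nonneg) auto
      then show "norm (?I z * ((v z + \<kappa>) powr (- b - 1) * norm (G z) powr p * Z (fst z))) \<le> norm (\<kappa> powr (- b - 1) * norm (G z) powr p)"
        using Z01 by (auto simp: indicator_def abs_mult)
    qed
  qed measurable
  have iX': "integrable lborel (\<lambda>z. ?I z * (\<bar>\<phi>' (V z)\<bar> * norm (G z) powr p * Z (fst z)))"
  proof (rule Bochner_Integration.integrable_bound[OF integrable_mult_right[OF Gp, of "b * \<kappa> powr (- b - 1)"]])
    show "AE z in lborel. norm (?I z * (\<bar>\<phi>' (V z)\<bar> * norm (G z) powr p * Z (fst z))) \<le> norm (b * \<kappa> powr (- b - 1) * norm (G z) powr p)"
    proof (intro AE_I2)
      fix z :: "'a \<times> real"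
      have "\<bar>\<phi>' (V z)\<bar> * norm (G z) powr p * Z (fst z) \<le> (b * \<kappa> powr (- b - 1)) * norm (G z) powr p * 1"
        using test.\<phi>(5) Z01 b by (intro mult_mono mult_nonneg_nonneg) auto
      then show "norm (?I z * (\<bar>\<phi>' (V z)\<bar> * norm (G z) powr p * Z (fst z))) \<le> norm (b * \<kappa> powr (- b - 1) * norm (G z) powr p)"
        using Z01 b by (auto simp: indicator_def abs_mult)
    qed
  qed measurable
  have Xle: "c0 * X \<le> (LINT z|lborel. ?I z * (\<bar>\<phi>' (V z)\<bar> * norm (G z) powr p * Z (fst z)))"
  proof -
    have "(LINT z|lborel. c0 * (?I z * ((v z + \<kappa>) powr (- b - 1) * norm (G z) powr p * Z (fst z))))
       \<le> (LINT z|lborel. ?I z * (\<bar>\<phi>' (V z)\<bar> * norm (G z) powr p * Z (fst z)))"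
    proof (rule integral_mono[OF integrable_mult_right[OF iX] iX'])
      fix z :: "'a \<times> real"
      have "c0 * (v z + \<kappa>) powr (- b - 1) \<le> \<bar>\<phi>' (V z)\<bar>"
        using reg_power(6)[OF v0[of z]] unfolding abs\<phi>' v_def[symmetric] c0_def by linarith
      then have "(c0 * (v z + \<kappa>) powr (- b - 1)) * (?I z * (norm (G z) powr p * Z (fst z))) \<le> \<bar>\<phi>' (V z)\<bar> * (?I z * (norm (G z) powr p * Z (fst z)))"
        using Z01 by (intro mult_right_mono) auto
      then show "c0 * (?I z * ((v z + \<kappa>) powr (- b - 1) * norm (G z) powr p * Z (fst z))) \<le> ?I z * (\<bar>\<phi>' (V z)\<bar> * norm (G z) powr p * Z (fst z))"
        by (simp only: mult_ac)
    qed
    then show ?thesis by (simp only: X_def integral_mult_right_zero)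
  qed
  have iw: "integrable lborel (\<lambda>x. ind x * (w (x, s) * Z x))" for s
  proof (rule bounded_on_ball_integrable)
    show "\<bar>w (x, s) * Z x\<bar> \<le> (spow q hi - spow q lo) * 1" for x
      unfolding abs_mult using w0[of "(x, s)"] wB[of "(x, s)"] Z01 by (intro mult_mono) auto
  qed measurable
  have Sw: "(LINT x|lborel. ind x * (w (x, s) * Z x)) \<le> S * N" if "s \<in> T0" for s
    using S[OF that] by (simp only: w_def)
  have iU: "integrable lborel (\<lambda>x. ind x * (\<bar>spow q (V (x, t2)) - spow q (V (x, t1))\<bar> * Z x))"
  proof (rule bounded_on_ball_integrable)
    show "\<bar>\<bar>spow q (V (x, t2)) - spow q (V (x, t1))\<bar> * Z x\<bar> \<le> (spow q hi - spow q lo) * 1" for x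
      unfolding abs_mult abs_idempotent
      using Z01 spow_mono[OF q V_range(1)[of "(x, t1)"]] spow_mono[OF q V_range(2)[of "(x, t1)"]]
       spow_mono[OF q V_range(1)[of "(x, t2)"]] spow_mono[OF q V_range(2)[of "(x, t2)"]] 
      by (intro mult_mono) auto
  qed measurable
  have Ule: "(LINT x|lborel. ind x * \<bar>spow q (V (x, t2)) - spow q (V (x, t1))\<bar> * Z x) \<le> 2 * (S * N)"
  proof -
    have "(LINT x|lborel. ind x * (\<bar>spow q (V (x, t2)) - spow q (V (x, t1))\<bar> * Z x))
       \<le> (LINT x|lborel. ind x * (w (x, t2) * Z x) + ind x * (w (x, t1) * Z x))"
    proof (rule integral_mono[OF iU Bochner_Integration.integrable_add[OF iw iw]])
      fix x
      have "\<bar>spow q (V (x, t2)) - spow q (V (x, t1))\<bar> \<le> w (x, t2) + w (x, t1)"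
        using w0[of "(x, t1)"] w0[of "(x, t2)"] ee by (auto simp: w_def)
      then have "\<bar>spow q (V (x, t2)) - spow q (V (x, t1))\<bar> * (ind x * Z x) \<le> (w (x, t2) + w (x, t1)) * (ind x * Z x)"
        using Z01 by (intro mult_right_mono) auto
      then show "ind x * (\<bar>spow q (V (x, t2)) - spow q (V (x, t1))\<bar> * Z x) \<le> ind x * (w (x, t2) * Z x) + ind x * (w (x, t1) * Z x)"
        by (simp add: algebra_simps)
    qed
    also have "\<dots> \<le> S * N + S * N"
      unfolding Bochner_Integration.integral_add[OF iw iw] by (intro add_mono Sw t)
    finally show ?thesis unfolding mult.assoc by linarith
  qed
  have Y0: "0 \<le> Y" unfolding Y_def by (rule Bochner_Integration.integral_nonneg) simp
  have N0: "0 \<le> N" using N measure_nonneg order_trans by blast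
  have SN: "0 \<le> S * N" using S0 N0 by simp
  have XY: "X \<le> C1 * \<kappa> powr (- b) * (Y + S * N)"
  proof -
    have "K1 * (c0 * X) \<le> K1 * (LINT z|lborel. ?I z * (\<bar>\<phi>' (V z)\<bar> * norm (G z) powr p * Z (fst z)))"
      using Xle K1 by (intro mult_left_mono) auto
    also have "\<dots> \<le> K2 * \<kappa> powr (- b) * Y + \<kappa> powr (- b) * (2 * (S * N))"
      using test.energy mult_left_mono[OF Ule, of "\<kappa> powr (- b)"] unfolding Y_def by simp
    also have "\<dots> \<le> (K2 + 2) * \<kappa> powr (- b) * (Y + S * N)"
    proof -
      have gen: "K2 * k * Y + k * (2 * P) \<le> (K2 + 2) * k * (Y + P)" if "0 \<le> K2 * (k * P)" "0 \<le> 2 * (k * Y)" for k P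
        using that by (simp add: algebra_simps)
      have "0 \<le> \<kappa> powr (- b) * (S * N)" "0 \<le> \<kappa> powr (- b) * Y"
        using mult_nonneg_nonneg[OF powr_ge_zero SN] mult_nonneg_nonneg[OF powr_ge_zero Y0] by blast+
      then show ?thesis using K2 by (intro gen) simp_all
    qed
    finally have "(K1 * c0) * X \<le> (K2 + 2) * \<kappa> powr (- b) * (Y + S * N)" by (simp only: mult.assoc)
    then have "X \<le> ((K2 + 2) * \<kappa> powr (- b) * (Y + S * N)) / (K1 * c0)"
      using K1 c0 by (simp add: pos_le_divide_eq mult.commute)
    then show ?thesis by (simp add: C1 c0_def)
  qed
  have C1pos: "C1 > 0" using K1 K2 c0 by (simp add: C1 c0_def)
  (* The parameter for gradient_young: with it the contribution of X is at most delta1 (Y + S N). *)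
  define bb where "bb = \<delta>1 * \<kappa> powr b / C1"
  have bb: "bb > 0" using \<delta>1 \<kappa> C1pos by (simp add: bb_def)
  have bX: "bb * X \<le> \<delta>1 * (Y + S * N)"
  proof -
    have "bb * X \<le> bb * (C1 * \<kappa> powr (- b) * (Y + S * N))" using XY bb by (intro mult_left_mono) auto
    also have "\<dots> = \<delta>1 * (Y + S * N)" using C1pos \<kappa> by (simp add: bb_def powr_minus field_simps)
    finally show ?thesis .
  qed
  define N1 where "N1 = (LINT z|lborel. ?I z * (ind (fst z) * ((v z + \<kappa>) powr m * \<zeta> (fst z) powr (l - p))))"
  have [measurable]: "cball c R \<in> sets borel" by simp
  have ind_fst: "(\<lambda>z::'a \<times> real. ind (fst z)) \<in> borel_measurable borel"
    by (rule measurable_compose[OF measurable_fst_snd_borel(1)]) simp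
  have N1_meas: "(\<lambda>z. ?I z * (ind (fst z) * ((v z + \<kappa>) powr m * \<zeta> (fst z) powr (l - p)))) \<in> borel_measurable borel"
    by (intro borel_measurable_times ind_fst) measurable
  have slabI: "integrable lborel (\<lambda>z::'a \<times> real. ?I z * (ind (fst z)))"
    using slab_integrable(1)[OF ind_integrable, of t1 t2] t by simp
  have lp: "0 \<le> l - p"
  proof -
    have "p * q \<le> l * q"
    proof -
      have "0 \<le> l" using b(3,4) p q0 by (smt (verit) mult_pos_pos mult_less_0_iff)
      then have "l * (q - m) \<le> l * q" using m0 by (intro mult_left_mono) auto
      then show ?thesis using b(4) by linarith
    qed
    then show ?thesis using q0 by simp
  qed
  have \<zeta>1: "\<zeta> x powr (l - p) \<le> 1" for x using \<zeta> lp by (intro powr_le1) auto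
  have iN1: "integrable lborel (\<lambda>z. ?I z * (ind (fst z) * ((v z + \<kappa>) powr m * \<zeta> (fst z) powr (l - p))))"
  proof (rule Bochner_Integration.integrable_bound[OF integrable_mult_left[OF slabI, of "(hi - lo + \<kappa>) powr m"]])
    show "AE z in lborel. norm (?I z * (ind (fst z) * ((v z + \<kappa>) powr m * \<zeta> (fst z) powr (l - p)))) \<le> norm (?I z * ind (fst z) * (hi - lo + \<kappa>) powr m)"
    proof (intro AE_I2)
      fix z :: "'a \<times> real"
      have "(v z + \<kappa>) powr m * \<zeta> (fst z) powr (l - p) \<le> (hi - lo + \<kappa>) powr m * 1"
        using v0[of z] vB[of z] \<kappa> m0 \<zeta>1 by (intro mult_mono powr_mono2) auto
      then show "norm (?I z * (ind (fst z) * ((v z + \<kappa>) powr m * \<zeta> (fst z) powr (l - p)))) \<le> norm (?I z * ind (fst z) * (hi - lo + \<kappa>) powr m)"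
        by (auto simp: indicator_def)
    qed
  qed (use N1_meas in simp)
  have YN1: "Y \<le> bb * X + bb powr (1 - p) * (D powr p * N1)"
  proof -
    have "Y \<le> (LINT z|lborel. bb * (?I z * ((v z + \<kappa>) powr (- b - 1) * norm (G z) powr p * Z (fst z)))
        + bb powr (1 - p) * (D powr p * (?I z * (ind (fst z) * ((v z + \<kappa>) powr m * \<zeta> (fst z) powr (l - p))))))"
      unfolding Y_def
    proof (rule integral_mono)
      show "integrable lborel (\<lambda>z. bb * (?I z * ((v z + \<kappa>) powr (- b - 1) * norm (G z) powr p * Z (fst z)))
        + bb powr (1 - p) * (D powr p * (?I z * (ind (fst z) * ((v z + \<kappa>) powr m * \<zeta> (fst z) powr (l - p))))))"
        by (intro Bochner_Integration.integrable_add integrable_mult_right iX iN1)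
      show "integrable lborel (\<lambda>z. ?I z * (norm (G z) powr (p - 1) * norm (grad Z (fst z))))"
      proof (rule Bochner_Integration.integrable_bound[OF integrable_mult_right[OF integrable_G_pm1, of D]])
        show "AE z in lborel. norm (?I z * (norm (G z) powr (p - 1) * norm (grad Z (fst z)))) \<le> norm (D * norm (G z) powr (p - 1))"
        proof (intro AE_I2)
          fix z :: "'a \<times> real"
          have "\<zeta> (fst z) powr (l - 1) \<le> 1" using \<zeta> lp p by (intro powr_le1) auto
          from mult_left_mono[OF this less_imp_le[OF D]]
          have "norm (grad Z (fst z)) \<le> D" using DZ[of "fst z"] by linarith
          then have "norm (G z) powr (p - 1) * norm (grad Z (fst z)) \<le> norm (G z) powr (p - 1) * D" by (intro mult_left_mono) auto
          then show "norm (?I z * (norm (G z) powr (p - 1) * norm (grad Z (fst z)))) \<le> norm (D * norm (G z) powr (p - 1))"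
            using D by (auto simp: indicator_def abs_mult mult.commute)
        qed
      qed measurable
      fix z :: "'a \<times> real"
      show "?I z * (norm (G z) powr (p - 1) * norm (grad Z (fst z)))
         \<le> bb * (?I z * ((v z + \<kappa>) powr (- b - 1) * norm (G z) powr p * Z (fst z)))
        + bb powr (1 - p) * (D powr p * (?I z * (ind (fst z) * ((v z + \<kappa>) powr m * \<zeta> (fst z) powr (l - p)))))"
      proof (cases "\<zeta> (fst z) = 0")
        case True
        then have "norm (grad Z (fst z)) = 0" using DZ[of "fst z"] by simp
        then have "?I z * (norm (G z) powr (p - 1) * norm (grad Z (fst z))) = 0" by (simp only: mult_zero_right)
        moreover have "0 \<le> bb * (?I z * ((v z + \<kappa>) powr (- b - 1) * norm (G z) powr p * Z (fst z)))
        + bb powr (1 - p) * (D powr p * (?I z * (ind (fst z) * ((v z + \<kappa>) powr m * \<zeta> (fst z) powr (l - p)))))"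
          using bb Z01 by (intro add_nonneg_nonneg mult_nonneg_nonneg) auto
        ultimately show ?thesis by linarith
      next
        case False
        then have "fst z \<in> cball c \<rho>" using Z(2) by blast
        then have "fst z \<in> cball c R" using \<rho>R by simp
        then have c1: "ind (fst z) = 1" by simp
        have "norm (G z) powr (p - 1) * norm (grad Z (fst z)) \<le> norm (G z) powr (p - 1) * (D * \<zeta> (fst z) powr (l - 1))"
          using DZ by (intro mult_left_mono) auto
        also have "\<dots> \<le> bb * ((v z + \<kappa>) powr (- b - 1) * norm (G z) powr p * \<zeta> (fst z) powr l)
            + bb powr (1 - p) * (D powr p * ((v z + \<kappa>) powr ((b + 1) * (p - 1)) * \<zeta> (fst z) powr (l - p)))"
          using v0[of z] \<kappa> \<zeta> D p bb by (intro gradient_young) auto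
        finally have "?I z * (norm (G z) powr (p - 1) * norm (grad Z (fst z))) \<le> ?I z * (bb * ((v z + \<kappa>) powr (- b - 1) * norm (G z) powr p * \<zeta> (fst z) powr l)
            + bb powr (1 - p) * (D powr p * ((v z + \<kappa>) powr m * \<zeta> (fst z) powr (l - p))))"
          unfolding b(2) by (intro mult_left_mono) auto
        then show ?thesis unfolding c1 Z_def by (simp only: mult_1_left distrib_left mult_ac)
      qed
    qed
    also have "\<dots> = bb * X + bb powr (1 - p) * (D powr p * N1)"
      unfolding X_def N1_def
      by (simp only: Bochner_Integration.integral_add[OF integrable_mult_right[OF iX] integrable_mult_right[OF integrable_mult_right[OF iN1]]] integral_mult_right_zero)
    finally show ?thesis .
  qed
  have N1le: "N1 \<le> \<theta> * N * (\<beta>2 * 4 powr q * (S + \<kappa> powr q) + \<beta>2 powr (- (m / (q - m))))"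
  proof -
    define Q where "Q = \<beta>2 * 4 powr q * (S + \<kappa> powr q) + \<beta>2 powr (- (m / (q - m)))"
    have Q0: "0 \<le> Q" unfolding Q_def using \<beta>2 S0 by (intro add_nonneg_nonneg mult_nonneg_nonneg) auto
    define f where "f = (\<lambda>(x::'a, s::real). indicator {t1..t2} s * (ind x * ((v (x, s) + \<kappa>) powr m * \<zeta> x powr (l - p))))"
    have if': "integrable (lborel \<Otimes>\<^sub>M lborel) f"
      using iN1 by (simp add: lborel_prod f_def case_prod_beta')
    have N1f: "N1 = (LINT s|lborel. LINT x|lborel. f (x, s))"
      using lborel_pair.integral_snd[of "\<lambda>x s. f (x, s)"] if' by (simp add: N1_def lborel_prod f_def case_prod_beta')
    have inner: "(LINT x|lborel. f (x, s)) \<le> indicator {t1..t2} s * (Q * N)" if s: "s \<in> {\<alpha>..\<beta>} \<longrightarrow> s \<in> T0" for s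
    proof (cases "s \<in> {t1..t2}")
      case True
      have sT: "s \<in> T0" using s True t T0_sub by auto
      have i1: "integrable lborel (\<lambda>x. ind x * ((v (x, s) + \<kappa>) powr m * \<zeta> x powr (l - p)))"
      proof (rule bounded_on_ball_integrable)
        show "\<bar>(v (x, s) + \<kappa>) powr m * \<zeta> x powr (l - p)\<bar> \<le> (hi - lo + \<kappa>) powr m * 1" for x
          unfolding abs_mult using v0[of "(x, s)"] vB[of "(x, s)"] \<kappa> m0 \<zeta>1 by (intro mult_mono) (auto intro!: powr_mono2)
      qed measurable
      have i2: "integrable lborel (\<lambda>x. \<beta>2 * 4 powr q * (ind x * (w (x, s) * Z x)) + (\<beta>2 * 4 powr q * \<kappa> powr q + \<beta>2 powr (- (m / (q - m)))) * ind x)"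
        by (intro Bochner_Integration.integrable_add integrable_mult_right iw ind_integrable)
      have "(LINT x|lborel. f (x, s)) = (LINT x|lborel. ind x * ((v (x, s) + \<kappa>) powr m * \<zeta> x powr (l - p)))"
        using True by (simp add: f_def)
      also have "\<dots> \<le> (LINT x|lborel. \<beta>2 * 4 powr q * (ind x * (w (x, s) * Z x)) + (\<beta>2 * 4 powr q * \<kappa> powr q + \<beta>2 powr (- (m / (q - m)))) * ind x)"
      proof (rule integral_mono[OF i1 i2])
        fix x
        have 1: "(v (x, s) + \<kappa>) powr m * \<zeta> x powr (l - p) \<le> \<beta>2 * ((v (x, s) + \<kappa>) powr q * \<zeta> x powr l) + \<beta>2 powr (- (m / (q - m)))"
          using v0[of "(x, s)"] \<kappa> \<zeta> m0 b \<beta>2 by (intro weight_young) auto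
        have "(v (x, s) + \<kappa>) powr q \<le> 2 powr q * (v (x, s) powr q + \<kappa> powr q)"
          using v0 \<kappa> q by (intro powr_add2_le) auto
        also have "\<dots> \<le> 2 powr q * (2 powr q * w (x, s) + 2 powr q * \<kappa> powr q)"
        proof (intro mult_left_mono add_mono vw)
          have "1 \<le> 2 powr q" using q by (simp add: ge_one_powr_ge_zero)
          then show "\<kappa> powr q \<le> 2 powr q * \<kappa> powr q" using mult_right_mono[of 1 "2 powr q" "\<kappa> powr q"] by simp
        qed auto
        also have "\<dots> = 4 powr q * (w (x, s) + \<kappa> powr q)"
          by (simp add: distrib_left mult.assoc[symmetric] powr_mult[symmetric])
        finally have "(v (x, s) + \<kappa>) powr q * Z x \<le> 4 powr q * (w (x, s) + \<kappa> powr q) * Z x"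
          using Z01 by (intro mult_right_mono) auto
        also have "\<dots> = 4 powr q * (w (x, s) * Z x) + 4 powr q * \<kappa> powr q * Z x" by (simp add: algebra_simps)
        also have "\<dots> \<le> 4 powr q * (w (x, s) * Z x) + 4 powr q * \<kappa> powr q * 1"
          by (intro add_left_mono mult_left_mono) (use Z01 in auto)
        finally have "\<beta>2 * ((v (x, s) + \<kappa>) powr q * Z x) \<le> \<beta>2 * (4 powr q * (w (x, s) * Z x) + 4 powr q * \<kappa> powr q)"
          using \<beta>2 by (intro mult_left_mono) auto
        with 1 have "(v (x, s) + \<kappa>) powr m * \<zeta> x powr (l - p) \<le> \<beta>2 * 4 powr q * (w (x, s) * Z x) + (\<beta>2 * 4 powr q * \<kappa> powr q + \<beta>2 powr (- (m / (q - m))))"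
          unfolding Z_def by (simp add: algebra_simps)
        then have "ind x * ((v (x, s) + \<kappa>) powr m * \<zeta> x powr (l - p)) \<le> ind x * (\<beta>2 * 4 powr q * (w (x, s) * Z x) + (\<beta>2 * 4 powr q * \<kappa> powr q + \<beta>2 powr (- (m / (q - m)))))"
          by (intro mult_left_mono) auto
        then show "ind x * ((v (x, s) + \<kappa>) powr m * \<zeta> x powr (l - p))
          \<le> \<beta>2 * 4 powr q * (ind x * (w (x, s) * Z x)) + (\<beta>2 * 4 powr q * \<kappa> powr q + \<beta>2 powr (- (m / (q - m)))) * ind x"
          by (simp only: distrib_left distrib_right mult_ac)
      qed
      also have "\<dots> = \<beta>2 * 4 powr q * (LINT x|lborel. ind x * (w (x, s) * Z x)) + (\<beta>2 * 4 powr q * \<kappa> powr q + \<beta>2 powr (- (m / (q - m)))) * (LINT x|lborel. ind x)"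
        by (simp only: Bochner_Integration.integral_add[OF integrable_mult_right[OF iw] integrable_mult_right[OF ind_integrable]] integral_mult_right_zero)
      also have "(LINT x|lborel. ind x) = measure lborel (cball c R)" by simp
      also have "\<beta>2 * 4 powr q * (LINT x|lborel. ind x * (w (x, s) * Z x)) + (\<beta>2 * 4 powr q * \<kappa> powr q + \<beta>2 powr (- (m / (q - m)))) * measure lborel (cball c R)
          \<le> \<beta>2 * 4 powr q * (S * N) + (\<beta>2 * 4 powr q * \<kappa> powr q + \<beta>2 powr (- (m / (q - m)))) * N"
        using \<beta>2 by (intro add_mono mult_left_mono Sw[OF sT] N add_nonneg_nonneg mult_nonneg_nonneg) auto
      also have "\<dots> = Q * N" by (simp add: Q_def algebra_simps)
      finally show ?thesis using True by simp
    next
      case False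
      then show ?thesis by (simp add: f_def)
    qed
    have "N1 \<le> (LINT s|lborel. indicator {t1..t2} s * (Q * N))"
      unfolding N1f
    proof (rule integral_mono_AE)
      show "integrable lborel (\<lambda>s. LINT x|lborel. f (x, s))"
        using lborel_pair.integrable_snd[of "\<lambda>x s. f (x, s)"] if' by (simp add: case_prod_beta')
      show "integrable lborel (\<lambda>s. indicator {t1..t2} s * (Q * N))"
        using emeasure_lborel_Icc[of t1 t2] t by (intro integrable_mult_left integrable_real_indicator) auto
      show "AE s in lborel. (LINT x|lborel. f (x, s)) \<le> indicator {t1..t2} s * (Q * N)"
        using T0_AE by eventually_elim (rule inner)
    qed
    also have "\<dots> = (t2 - t1) * (Q * N)" using t by simp
    also have "\<dots> \<le> \<theta> * (Q * N)" using t Q0 N0 by (intro mult_right_mono) auto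
    finally show ?thesis by (simp add: Q_def mult_ac)
  qed
  have "Y \<le> \<delta>1 * (Y + S * N) + bb powr (1 - p) * (D powr p * (\<theta> * N * (\<beta>2 * 4 powr q * (S + \<kappa> powr q) + \<beta>2 powr (- (m / (q - m))))))"
    using YN1 bX mult_left_mono[OF mult_left_mono[OF N1le, of "D powr p"], of "bb powr (1 - p)"] by simp
  moreover have "\<delta>1 * Y \<le> (1 / 2) * Y" using \<delta>1 Y0 by (intro mult_right_mono) auto
  ultimately have "Y \<le> 2 * (\<delta>1 * (S * N)) + 2 * (bb powr (1 - p) * (D powr p * (\<theta> * N * (\<beta>2 * 4 powr q * (S + \<kappa> powr q) + \<beta>2 powr (- (m / (q - m)))))))"
    by (simp add: distrib_left)
  then show ?thesis unfolding bb_def by (simp only: mult.assoc)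
qed

end

section \<open>Choice of the parameters\<close>

text \<open>With \<open>\<delta>1\<close> a fixed multiple of \<open>\<delta>\<close>, and \<open>\<beta>2\<close> such that its coefficient in front of \<open>S\<close> equals \<open>\<delta>1\<close>, the terms with \<open>S\<close>
add up to at most \<open>\<delta> S\<close>. All other terms are multiples of \<open>\<kappa>^q\<close>: the powers of \<open>\<kappa>\<close> combine to \<open>\<kappa>^{q-m}\<close> in front,
and with \<open>n = m/(q-m)\<close> one has \<open>(q - m)(1 + n) = q\<close>. The factors depend on \<open>\<delta>\<close> and \<open>\<sigma>\<close> through negative powers
\<open>g1\<close> and \<open>g2\<close>, which may be enlarged to one common exponent \<open>\<gamma>\<close>.\<close>

lemma absorb_parameters:
  fixes K1 K2 p q b m l c C1 :: real
  assumes K: "K1 > 0" "K2 > 0" and p: "p > 1" and b: "b > 0" "m = (b + 1) * (p - 1)" "m < q"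
    and C1: "C1 > 0" and lc: "l > 0" "c > 0"
  obtains \<gamma> where "\<gamma> > 0" and
    "\<And>\<delta> \<sigma> r \<kappa> S N Y. \<lbrakk>0 < \<delta>; \<delta> < 1; 0 < \<sigma>; \<sigma> < 1; 0 < r; 0 < \<kappa>; 0 \<le> S; 0 \<le> N;
      \<And>\<delta>1 \<beta>2. 0 < \<delta>1 \<Longrightarrow> \<delta>1 \<le> 1 / 2 \<Longrightarrow> 0 < \<beta>2 \<Longrightarrow>
        Y \<le> 2 * \<delta>1 * S * N + 2 * (\<delta>1 * \<kappa> powr b / C1) powr (1 - p) * (l * c / (\<sigma> * r)) powr p * (r powr p * \<kappa> powr (q - p + 1)) * N *
          (\<beta>2 * 4 powr q * (S + \<kappa> powr q) + \<beta>2 powr (- (m / (q - m))))\<rbrakk>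
     \<Longrightarrow> K2 * Y \<le> N * (\<delta> * S + \<gamma> / (\<delta> powr \<gamma> * \<sigma> powr \<gamma>) * \<kappa> powr q)"
proof -
  define n where "n = m / (q - m)"
  have m0: "m > 0" using b p by simp
  have n0: "n > 0" using m0 b by (simp add: n_def)
  define B where "B = 2 * C1 powr (p - 1) * (l * c) powr p"
  have B0: "B > 0" using C1 lc by (simp add: B_def)
  define g1 where "g1 = (p - 1) * (1 + n) + n"
  define g2 where "g2 = p * (1 + n)"
  define C5 where "C5 = B powr (1 + n) * (4 powr q) powr n"
  define C6 where "C6 = K2 * C5 * (3 * K2 + 2) powr g1"
  have C5: "C5 \<ge> 0" by (simp add: C5_def)
  have C6: "C6 \<ge> 0" using C5 K by (simp add: C6_def)
  have g: "g1 > 0" "g2 > 0" using p n0 by (auto simp: g1_def g2_def intro!: add_nonneg_pos)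
  define \<gamma> where "\<gamma> = g1 + g2 + 1 + C6"
  have \<gamma>: "\<gamma> > 0" "g1 \<le> \<gamma>" "g2 \<le> \<gamma>" "1 + C6 \<le> \<gamma>" using g C6 by (auto simp: \<gamma>_def)
  have main: "K2 * Y \<le> N * (\<delta> * S + \<gamma> / (\<delta> powr \<gamma> * \<sigma> powr \<gamma>) * \<kappa> powr q)"
    if \<delta>: "0 < \<delta>" "\<delta> < 1" and \<sigma>: "0 < \<sigma>" "\<sigma> < 1" and r: "0 < r" and \<kappa>: "0 < \<kappa>" and S: "0 \<le> S" and N: "0 \<le> N"
      and H: "\<And>\<delta>1 \<beta>2. 0 < \<delta>1 \<Longrightarrow> \<delta>1 \<le> 1 / 2 \<Longrightarrow> 0 < \<beta>2 \<Longrightarrow>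
        Y \<le> 2 * \<delta>1 * S * N + 2 * (\<delta>1 * \<kappa> powr b / C1) powr (1 - p) * (l * c / (\<sigma> * r)) powr p * (r powr p * \<kappa> powr (q - p + 1)) * N *
          (\<beta>2 * 4 powr q * (S + \<kappa> powr q) + \<beta>2 powr (- (m / (q - m))))"
    for \<delta> \<sigma> r \<kappa> S N Y
  proof -
    define \<delta>1 where "\<delta>1 = \<delta> / (3 * K2 + 2)"
    have \<delta>1: "0 < \<delta>1" "\<delta>1 \<le> 1 / 2" using \<delta> K by (auto simp: \<delta>1_def field_simps)
    have K2\<delta>1: "3 * K2 * \<delta>1 \<le> \<delta>" using \<delta> K by (simp add: \<delta>1_def field_simps)
    define A where "A = B * \<delta>1 powr (1 - p) * \<sigma> powr (- p)"
    have A0: "A > 0" using B0 \<delta>1 \<sigma> by (simp add: A_def)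
    define k where "k = \<kappa> powr (q - m)"
    have k0: "k > 0" using \<kappa> by (simp add: k_def)
    have A: "2 * (\<delta>1 * \<kappa> powr b / C1) powr (1 - p) * (l * c / (\<sigma> * r)) powr p * (r powr p * \<kappa> powr (q - p + 1)) = A * k"
    proof -
      have "(\<delta>1 * \<kappa> powr b / C1) powr (1 - p) = \<delta>1 powr (1 - p) * \<kappa> powr (b * (1 - p)) * C1 powr (p - 1)"
      proof -
        have "C1 powr (p - 1) = inverse (C1 powr (1 - p))" using powr_minus[of C1 "1 - p"] by simp
        then show ?thesis unfolding powr_divide powr_mult powr_powr by (simp only: divide_inverse)
      qed
      moreover have "(l * c / (\<sigma> * r)) powr p = (l * c) powr p * \<sigma> powr (- p) / r powr p"
        unfolding powr_divide powr_mult unfolding powr_minus divide_inverse inverse_mult_distrib by (simp only: mult.assoc)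
      moreover have "\<kappa> powr (b * (1 - p)) * \<kappa> powr (q - p + 1) = k"
        unfolding k_def powr_add[symmetric] b(2) by (simp add: algebra_simps)
      ultimately show ?thesis using r by (simp add: A_def B_def mult_ac)
    qed
    define \<beta>2 where "\<beta>2 = \<delta>1 / (A * 4 powr q * k)"
    have \<beta>2: "\<beta>2 > 0" using \<delta>1 A0 k0 by (simp add: \<beta>2_def)
    have e1: "A * k * (\<beta>2 * 4 powr q) = \<delta>1" using A0 k0 by (simp add: \<beta>2_def)
    have e2: "A * k * \<beta>2 powr (- n) = C5 * \<delta>1 powr (- g1) * \<sigma> powr (- g2) * \<kappa> powr q"
    proof -
      have "\<beta>2 powr (- n) = inverse (\<delta>1 powr n) * ((A * 4 powr q * k) powr n)"
      proof -
        have "\<beta>2 powr (- n) = inverse (\<delta>1 powr n / (A * 4 powr q * k) powr n)"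
          unfolding \<beta>2_def powr_minus powr_divide ..
        then show ?thesis by (simp only: divide_inverse inverse_mult_distrib inverse_inverse_eq)
      qed
      also have "(A * 4 powr q * k) powr n = A powr n * (4 powr q) powr n * k powr n" by (simp add: powr_mult)
      finally have "A * k * \<beta>2 powr (- n) = (A * A powr n) * (k * k powr n) * (4 powr q) powr n * \<delta>1 powr (- n)"
        unfolding powr_minus[of \<delta>1] by (simp only: mult_ac)
      also have "A * A powr n = A powr (1 + n)" using A0 by (simp add: powr_mult_base)
      also have "k * k powr n = \<kappa> powr q"
      proof -
        have "k * k powr n = k powr (1 + n)" using k0 by (simp add: powr_mult_base)
        also have "\<dots> = \<kappa> powr ((q - m) * (1 + n))" by (simp add: k_def powr_powr)
        also have "(q - m) * (1 + n) = q" using b by (simp add: n_def field_simps)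
        finally show ?thesis .
      qed
      also have "A powr (1 + n) = B powr (1 + n) * \<delta>1 powr ((1 - p) * (1 + n)) * \<sigma> powr (- p * (1 + n))"
        by (simp only: A_def powr_mult powr_powr)
      finally have "A * k * \<beta>2 powr (- n) = C5 * (\<delta>1 powr ((1 - p) * (1 + n)) * \<delta>1 powr (- n)) * \<sigma> powr (- p * (1 + n)) * \<kappa> powr q"
        unfolding C5_def by (simp only: mult_ac)
      also have "\<delta>1 powr ((1 - p) * (1 + n)) * \<delta>1 powr (- n) = \<delta>1 powr (- g1)"
        unfolding powr_add[symmetric] g1_def by (simp add: algebra_simps)
      also have "- p * (1 + n) = - g2" by (simp add: g2_def)
      finally show ?thesis .
    qed
    define P where "P = 1 / (\<delta> powr \<gamma> * \<sigma> powr \<gamma>)"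
    have P1: "1 \<le> P"
    proof -
      have "\<delta> powr \<gamma> * \<sigma> powr \<gamma> \<le> 1 * 1" using \<delta> \<sigma> \<gamma> by (intro mult_mono powr_le1) auto
      then show ?thesis using \<delta> \<sigma> by (simp add: P_def)
    qed
    have P2: "\<delta> powr (- g1) * \<sigma> powr (- g2) \<le> P"
    proof -
      have "\<delta> powr (- g1) * \<sigma> powr (- g2) \<le> \<delta> powr (- \<gamma>) * \<sigma> powr (- \<gamma>)"
        using \<delta> \<sigma> \<gamma> by (intro mult_mono powr_mono') auto
      also have "\<dots> = P" unfolding P_def powr_minus divide_inverse inverse_mult_distrib by simp
      finally show ?thesis .
    qed
    have \<delta>1g: "\<delta>1 powr (- g1) = (3 * K2 + 2) powr g1 * \<delta> powr (- g1)"
    proof -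
      have "\<delta>1 powr (- g1) = inverse (\<delta> powr g1 / (3 * K2 + 2) powr g1)"
        unfolding \<delta>1_def powr_minus powr_divide ..
      then show ?thesis unfolding powr_minus by (simp only: divide_inverse inverse_mult_distrib inverse_inverse_eq mult.commute)
    qed
    have "Y \<le> 2 * \<delta>1 * S * N + A * k * N * (\<beta>2 * 4 powr q * (S + \<kappa> powr q) + \<beta>2 powr (- n))"
      using H[OF \<delta>1 \<beta>2] unfolding A n_def .
    also have "\<dots> = N * (2 * \<delta>1 * S + A * k * (\<beta>2 * 4 powr q) * (S + \<kappa> powr q) + A * k * \<beta>2 powr (- n))"
      by (simp add: algebra_simps)
    also have "\<dots> = N * (3 * \<delta>1 * S + \<delta>1 * \<kappa> powr q + C5 * \<delta>1 powr (- g1) * \<sigma> powr (- g2) * \<kappa> powr q)"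
      unfolding e1 e2 by (simp add: algebra_simps)
    finally have "K2 * Y \<le> K2 * (N * (3 * \<delta>1 * S + \<delta>1 * \<kappa> powr q + C5 * \<delta>1 powr (- g1) * \<sigma> powr (- g2) * \<kappa> powr q))"
      using K by (intro mult_left_mono) auto
    also have "\<dots> = N * ((3 * K2 * \<delta>1) * S + (K2 * \<delta>1 + C6 * (\<delta> powr (- g1) * \<sigma> powr (- g2))) * \<kappa> powr q)"
      unfolding \<delta>1g C6_def by (simp add: algebra_simps)
    also have "\<dots> \<le> N * (\<delta> * S + (\<gamma> * P) * \<kappa> powr q)"
    proof (intro mult_left_mono add_mono mult_right_mono K2\<delta>1)
      have "0 \<le> K2 * \<delta>1" using K \<delta>1 by simp
      then have "K2 * \<delta>1 \<le> P" using K2\<delta>1 \<delta> P1 by linarith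
      moreover have "C6 * (\<delta> powr (- g1) * \<sigma> powr (- g2)) \<le> C6 * P" by (rule mult_left_mono[OF P2 C6])
      ultimately have "K2 * \<delta>1 + C6 * (\<delta> powr (- g1) * \<sigma> powr (- g2)) \<le> (1 + C6) * P" by (simp add: algebra_simps)
      also have "\<dots> \<le> \<gamma> * P" using \<gamma> P1 by (intro mult_right_mono) auto
      finally show "K2 * \<delta>1 + C6 * (\<delta> powr (- g1) * \<sigma> powr (- g2)) \<le> \<gamma> * P" .
    qed (use N S in auto)
    finally show ?thesis by (simp add: P_def)
  qed
  show ?thesis
  proof (rule that[OF \<gamma>(1)], goal_cases)
    case (1 \<delta> \<sigma> r \<kappa> S N Y)
    show ?case by (rule main[OF 1(1-8)]) (rule 1(9))
  qed
qed

section \<open>Borel representatives\<close>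

lemma lebesgue_AE_eq:
  fixes f g :: "'a::euclidean_space \<Rightarrow> 'b::euclidean_space"
  assumes g[measurable]: "g \<in> borel_measurable borel" and eq: "AE x in lborel. f x = g x"
  shows "f \<in> borel_measurable lebesgue" "(LINT x|lebesgue. f x) = (LINT x|lborel. g x)"
    "integrable lebesgue f \<longleftrightarrow> integrable lborel g"
proof -
  obtain N where N: "\<And>x. x \<in> space lborel - N \<Longrightarrow> f x = g x" "N \<in> null_sets (lborel :: 'a measure)"
    using AE_E3[OF eq] by metis
  have Nl: "N \<in> null_sets lebesgue" using N(2) by (rule null_sets_completionI)
  have gl: "g \<in> borel_measurable lebesgue" by (rule measurable_completion) measurable
  show f: "f \<in> borel_measurable lebesgue"
  proof (rule measurableI)
    fix S :: "'b set" assume S: "S \<in> sets borel"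
    have "f -` S \<inter> space lebesgue = (g -` S \<inter> space lebesgue - N) \<union> (f -` S \<inter> N)"
      using N(1) by auto
    moreover have "g -` S \<inter> space lebesgue \<in> sets lebesgue" using gl S by (rule measurable_sets)
    moreover have "f -` S \<inter> N \<in> sets lebesgue"
      using null_sets_completion_subset[of "f -` S \<inter> N" N lborel] Nl by auto
    ultimately show "f -` S \<inter> space lebesgue \<in> sets lebesgue"
      using sets.Un[OF sets.Diff[OF _ null_setsD2[OF Nl]]] by presburger
  qed simp
  have ae: "AE x in lebesgue. f x = g x" using eq by (rule AE_completion)
  have "(LINT x|lebesgue. f x) = (LINT x|lebesgue. g x)" by (rule integral_cong_AE[OF f gl ae])
  also have "\<dots> = (LINT x|lborel. g x)" by (rule integral_completion) measurable
  finally show "(LINT x|lebesgue. f x) = (LINT x|lborel. g x)" .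
  have "integrable lebesgue f \<longleftrightarrow> integrable lebesgue g" by (rule integrable_cong_AE[OF f gl ae])
  also have "\<dots> \<longleftrightarrow> integrable lborel g" by (rule integrable_completion) measurable
  finally show "integrable lebesgue f \<longleftrightarrow> integrable lborel g" .
qed

text \<open>Lebesgue integrals over a set are transferred to integrals of Borel functions on the whole space, where
Fubini's theorem and translations are easier to use.\<close>

lemma lebesgue_on_AE_eq:
  fixes f g :: "'a::euclidean_space \<Rightarrow> 'b::euclidean_space"
  assumes S: "S \<in> sets lebesgue" and g: "g \<in> borel_measurable borel" and eq: "AE x in lborel. indicator S x *\<^sub>R f x = g x"
  shows "(LINT x|lebesgue_on S. f x) = (LINT x|lborel. g x)"
    "integrable (lebesgue_on S) f \<longleftrightarrow> integrable lborel g"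
    "f \<in> borel_measurable (lebesgue_on S)"
proof -
  note L = lebesgue_AE_eq[OF g eq]
  show "(LINT x|lebesgue_on S. f x) = (LINT x|lborel. g x)"
    using L(2) S by (subst integral_restrict_space) auto
  show "integrable (lebesgue_on S) f \<longleftrightarrow> integrable lborel g"
    using L(3) S by (subst integrable_restrict_space) auto
  show "f \<in> borel_measurable (lebesgue_on S)"
    using L(1) S by (subst borel_measurable_restrict_space_iff) auto
qed

lemma borel_representative:
  fixes f :: "'a::euclidean_space \<Rightarrow> 'b::euclidean_space"
  assumes f: "f \<in> borel_measurable lebesgue"
  obtains g where "g \<in> borel_measurable borel" "AE x in lborel. f x = g x"
proof -
  have "\<exists>h\<in>borel_measurable lborel. AE x in lborel. f x \<bullet> b = h x" for b
    using f by (intro completion_ex_borel_measurable_real) auto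
  then obtain h where h: "\<And>b. h b \<in> borel_measurable lborel" "\<And>b. AE x in lborel. f x \<bullet> b = h b x" by metis
  show ?thesis
  proof
    show "(\<lambda>x. \<Sum>b\<in>Basis. h b x *\<^sub>R b) \<in> borel_measurable borel" using h(1) by auto
    have "AE x in lborel. \<forall>b\<in>Basis. f x \<bullet> b = h b x" using h(2) by (intro AE_finite_allI) auto
    then show "AE x in lborel. f x = (\<Sum>b\<in>Basis. h b x *\<^sub>R b)"
    proof eventually_elim
      fix x assume "\<forall>b\<in>Basis. f x \<bullet> b = h b x"
      then have "(\<Sum>b\<in>Basis. h b x *\<^sub>R b) = (\<Sum>b\<in>Basis. (f x \<bullet> b) *\<^sub>R b)" by (intro sum.cong) auto
      then show "f x = (\<Sum>b\<in>Basis. h b x *\<^sub>R b)" by (simp add: euclidean_representation)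
    qed
  qed
qed

lemma borel_representative_on:
  fixes f :: "'a::euclidean_space \<Rightarrow> 'b::euclidean_space"
  assumes f: "f \<in> borel_measurable (lebesgue_on S)" and S: "S \<in> sets lebesgue"
  obtains g where "g \<in> borel_measurable borel" "AE x in lborel. indicator S x *\<^sub>R f x = g x"
proof -
  have "(\<lambda>x. indicator S x *\<^sub>R f x) \<in> borel_measurable lebesgue"
    using f S by (subst (asm) borel_measurable_restrict_space_iff) auto
  from borel_representative[OF this] show ?thesis using that by metis
qed

text \<open>Fubini's theorem is applied to a Borel null set that contains all exceptional points, as \<open>P\<close> itself need not be
measurable.\<close>

lemma AE_slices:
  assumes "AE z in (lborel :: ('a::euclidean_space \<times> real) measure). P z"
  shows "AE t in lborel. AE x in lborel. P (x, t)"
proof -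
  obtain N where N: "\<And>z. z \<in> space lborel - N \<Longrightarrow> P z" "N \<in> null_sets (lborel :: ('a \<times> real) measure)"
    using AE_E3[OF assms] by metis
  have Nb[measurable]: "N \<in> sets (lborel \<Otimes>\<^sub>M lborel)" unfolding lborel_prod using N(2) by (rule null_setsD2)
  have "AE z in lborel. z \<notin> N" using N(2) by (rule AE_not_in)
  then have "AE z in (lborel \<Otimes>\<^sub>M lborel). z \<notin> N" unfolding lborel_prod .
  then have "AE x in lborel. AE t in lborel. (x, t) \<notin> N" by (rule lborel_pair.AE_pair)
  then have "AE t in lborel. AE x in lborel. (x, t) \<notin> N"
  proof (rule lborel_pair.AE_commute[THEN iffD1, rotated])
    have "{z \<in> space (lborel \<Otimes>\<^sub>M lborel). (fst z, snd z) \<notin> N} = space (lborel \<Otimes>\<^sub>M lborel) - N" by auto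
    then show "{z \<in> space (lborel \<Otimes>\<^sub>M lborel). (fst z, snd z) \<notin> N} \<in> sets (lborel \<Otimes>\<^sub>M lborel)"
      using sets.compl_sets[OF Nb] by presburger
  qed
  then show ?thesis
  proof eventually_elim
    fix t assume "AE x in lborel. (x, t) \<notin> N"
    then show "AE x in lborel. P (x, t)" by eventually_elim (use N(1) in auto)
  qed
qed

section \<open>Caratheodory functions\<close>

text \<open>For simple \<open>w\<close> this is a countable case distinction; the general case follows by continuity in the second argument.\<close>

lemma caratheodory_measurable:
  fixes A :: "'z \<Rightarrow> 'b::euclidean_space \<Rightarrow> 'c::euclidean_space"
  assumes A: "\<And>y. (\<lambda>z. A z y) \<in> borel_measurable M" and c: "\<And>z. continuous_on UNIV (A z)"
    and w: "w \<in> borel_measurable M"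
  shows "(\<lambda>z. A z (w z)) \<in> borel_measurable M"
proof -
  obtain s where s: "\<And>i. simple_function M (s i)" "\<And>z. z \<in> space M \<Longrightarrow> (\<lambda>i. s i z) \<longlonglongrightarrow> w z"
    using borel_measurable_implies_sequence_metric[OF w] by metis
  have "(\<lambda>z. A z (s i z)) \<in> borel_measurable M" for i
  proof (rule measurable_compose_countable'[where I="s i ` space M" and g="s i" and f="\<lambda>y z. A z y"])
    show "s i \<in> M \<rightarrow>\<^sub>M count_space (s i ` space M)"
      using s(1)[of i] by (simp add: simple_function_def measurable_count_space_eq2)
    show "countable (s i ` space M)" using s(1)[of i] by (simp add: simple_function_def countable_finite)
  qed (rule A)
  then show ?thesis
  proof (rule borel_measurable_LIMSEQ_metric)
    fix z assume "z \<in> space M"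
    then show "(\<lambda>i. A z (s i z)) \<longlonglongrightarrow> A z (w z)"
      using continuous_on_tendsto_compose[OF c s(2)] by auto
  qed
qed

text \<open>The exceptional null set of the structure conditions depends on the arguments \<open>v\<close>, \<open>\<xi>\<close>. The union over a countable dense set
of arguments is a null set outside of which the conditions extend to all arguments by continuity.\<close>

lemma structure_conditions_uniform:
  fixes A :: "'a::euclidean_space \<times> real \<Rightarrow> real \<Rightarrow> 'a \<Rightarrow> 'a"
  assumes sc: "structure_conditions K1 K2 p \<Omega> T A" and p: "p > 1"
  shows "AE z in lebesgue_on (\<Omega> \<times> {0<..<T}). continuous_on UNIV (\<lambda>(v, \<xi>). A z v \<xi>) \<and>
     (\<forall>v \<xi>. K1 * norm \<xi> powr p \<le> A z v \<xi> \<bullet> \<xi> \<and> norm (A z v \<xi>) \<le> K2 * norm \<xi> powr (p - 1))"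
proof -
  obtain D :: "(real \<times> 'a) set" where D: "countable D" "\<And>X. open X \<Longrightarrow> X \<noteq> {} \<Longrightarrow> \<exists>d\<in>D. d \<in> X"
    using countable_dense_exists by metis
  have clD: "closure D = UNIV"
  proof (rule ccontr)
    assume "closure D \<noteq> UNIV"
    then have "- closure D \<noteq> {}" by blast
    moreover have "open (- closure D)" by (intro open_Compl closed_closure)
    ultimately obtain d where "d \<in> D" "d \<in> - closure D" using D(2) by blast
    then show False using closure_subset[of D] by blast
  qed
  let ?Q = "\<lambda>z v \<xi>. K1 * norm \<xi> powr p \<le> A z v \<xi> \<bullet> \<xi> \<and> norm (A z v \<xi>) \<le> K2 * norm \<xi> powr (p - 1)"
  have "\<And>d. d \<in> D \<Longrightarrow> AE z in lebesgue_on (\<Omega> \<times> {0<..<T}). ?Q z (fst d) (snd d)"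
    using sc unfolding structure_conditions_def by auto
  then have 1: "AE z in lebesgue_on (\<Omega> \<times> {0<..<T}). \<forall>d\<in>D. ?Q z (fst d) (snd d)"
    by (subst AE_ball_countable[OF D(1)]) (rule ballI)
  have 2: "AE z in lebesgue_on (\<Omega> \<times> {0<..<T}). continuous_on UNIV (\<lambda>(v, \<xi>). A z v \<xi>)"
    using sc unfolding structure_conditions_def by auto
  from 1 2 show ?thesis
  proof eventually_elim
    fix z assume d: "\<forall>d\<in>D. ?Q z (fst d) (snd d)" and c: "continuous_on UNIV (\<lambda>(v, \<xi>). A z v \<xi>)"
    have c': "continuous_on UNIV (\<lambda>d. A z (fst d) (snd d))" using c by (simp add: case_prod_beta')
    have n: "continuous_on UNIV (\<lambda>d::real \<times> 'a. norm (snd d) powr b)" if "b > 0" for b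
      using that by (intro continuous_on_powr' continuous_intros) auto
    have "closed {d. K1 * norm (snd d) powr p \<le> A z (fst d) (snd d) \<bullet> snd d}"
      using p by (intro closed_Collect_le continuous_on_mult continuous_on_const n continuous_on_inner c' continuous_on_snd continuous_on_id) auto
    moreover have "closed {d. norm (A z (fst d) (snd d)) \<le> K2 * norm (snd d) powr (p - 1)}"
      using p by (intro closed_Collect_le continuous_on_mult continuous_on_const n continuous_on_norm c') auto
    ultimately have "closed {d. ?Q z (fst d) (snd d)}" by (simp only: Collect_conj_eq closed_Int)
    then have "closure D \<subseteq> {d. ?Q z (fst d) (snd d)}" using d by (intro closure_minimal) auto
    then have Q: "{d. ?Q z (fst d) (snd d)} = UNIV" unfolding clD by (rule top_le)
    have QQ: "?Q z v \<xi>" for v \<xi>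
    proof -
      have "(v, \<xi>) \<in> {d. ?Q z (fst d) (snd d)}" unfolding Q by (rule UNIV_I)
      then show ?thesis by simp
    qed
    show "continuous_on UNIV (\<lambda>(v, \<xi>). A z v \<xi>) \<and> (\<forall>v \<xi>. ?Q z v \<xi>)"
      by (rule conjI[OF c], rule allI, rule allI, rule QQ)
  qed
qed

section \<open>Test functions that do not depend on time\<close>

lemma continuous_in_Lp:
  fixes f :: "'a::euclidean_space \<Rightarrow> 'b::euclidean_space"
  assumes f: "continuous_on UNIV f" and E: "compact E" and m: "m > 0"
  shows "in_Lp m E f"
proof -
  have Em: "E \<in> sets lebesgue" using E by (simp add: compact_imp_closed borel_closed)
  have Eb[measurable]: "E \<in> sets borel" using E by (simp add: compact_imp_closed borel_closed)
  have [measurable]: "f \<in> borel_measurable borel" using f by (rule borel_measurable_continuous_onI)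
  have c: "continuous_on UNIV (\<lambda>x. norm (f x) powr m)"
    using m by (intro continuous_on_powr' continuous_intros f) auto
  have "f \<in> borel_measurable (lebesgue_on E)"
    by (rule lebesgue_on_AE_eq(3)[OF Em, of "\<lambda>x. indicator E x *\<^sub>R f x"]) auto
  moreover have "integrable (lebesgue_on E) (\<lambda>x. norm (f x) powr m)"
  proof -
    have "integrable lborel (\<lambda>x. indicator E x *\<^sub>R (norm (f x) powr m))"
      by (rule borel_integrable_compact[OF E continuous_on_subset[OF c]]) simp
    moreover have "integrable (lebesgue_on E) (\<lambda>x. norm (f x) powr m) \<longleftrightarrow> integrable lborel (\<lambda>x. indicator E x *\<^sub>R (norm (f x) powr m))"
      by (rule lebesgue_on_AE_eq(2)[OF Em]) auto
    ultimately show ?thesis by blast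
  qed
  ultimately show ?thesis by (simp add: in_Lp_def)
qed

text \<open>Through this identity, functions that are constant in time have the weak time derivative zero.\<close>

lemma Cinf_0_real_integral_deriv:
  fixes \<psi> :: "real \<Rightarrow> real"
  assumes \<psi>: "\<psi> \<in> Cinf_0 (interior J)" and J: "J \<in> sets lebesgue"
  shows "(LINT \<tau>|lebesgue_on J. deriv \<psi> \<tau>) = 0"
proof -
  define C where "C = closure {x. \<psi> x \<noteq> 0}"
  have C: "compact C" "C \<subseteq> interior J" using \<psi> by (auto simp: Cinf_0_def compact_support_in_def C_def)
  have C1: "C_k (Suc 0) \<psi>" using \<psi> unfolding Cinf_0_def by blast
  have C0: "\<psi> x = 0" if "x \<notin> C" for x using that closure_subset[of "{x. \<psi> x \<noteq> 0}"] unfolding C_def by blast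
  have d: "(\<psi> has_real_derivative grad \<psi> x) (at x)" for x
    using C1_has_derivative[OF C1, of x] by (simp add: has_field_derivative_def inner_real_def)
  have dg: "deriv \<psi> = grad \<psi>" by (rule ext) (rule DERIV_imp_deriv[OF d])
  have gc: "continuous_on UNIV (grad \<psi>)" by (rule C1_continuous_grad[OF C1])
  have g0: "grad \<psi> x = 0" if "x \<notin> C" for x
    by (rule grad_zero_outside[OF compact_imp_closed[OF C(1)] C0 that])
  have [measurable]: "grad \<psi> \<in> borel_measurable borel" using gc by (rule borel_measurable_continuous_onI)
  have "(LINT \<tau>|lebesgue_on J. deriv \<psi> \<tau>) = (LINT \<tau>|lborel. grad \<psi> \<tau>)"
  proof (rule lebesgue_on_AE_eq(1)[OF J])
    have "indicator J x *\<^sub>R deriv \<psi> x = grad \<psi> x" for x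
      using g0[of x] C(2) interior_subset[of J] unfolding dg by (auto simp: indicator_def)
    then show "AE x in lborel. indicator J x *\<^sub>R deriv \<psi> x = grad \<psi> x" by simp
  qed measurable
  also have "\<dots> = 0"
  proof -
    obtain b where b: "\<And>x. x \<in> C \<Longrightarrow> norm x \<le> b" using compact_imp_bounded[OF C(1)] by (auto simp: bounded_iff)
    define B where "B = \<bar>b\<bar> + 1"
    have out: "x \<notin> C" if "\<bar>x\<bar> \<ge> B" for x using b[of x] that by (auto simp: B_def)
    have "(LINT \<tau>|lborel. grad \<psi> \<tau> * indicator {- B..B} \<tau>) = \<psi> B - \<psi> (- B)"
      using gc d by (intro integral_FTC_Icc_real) (auto simp: B_def continuous_on_eq_continuous_at)
    moreover have "grad \<psi> \<tau> * indicator {- B..B} \<tau> = grad \<psi> \<tau>" for \<tau>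
    proof (cases "B \<le> \<bar>\<tau>\<bar>")
      case True
      then show ?thesis using g0[OF out, of \<tau>] by simp
    next
      case False
      then have "\<tau> \<in> {- B..B}" by auto
      then show ?thesis by simp
    qed
    moreover have "\<psi> B = 0" "\<psi> (- B) = 0" by (auto intro!: C0 out simp: B_def)
    ultimately show ?thesis by simp
  qed
  finally show ?thesis .
qed

lemma constant_test_function:
  fixes \<eta> :: "'a::euclidean_space \<Rightarrow> real"
  assumes \<eta>: "\<And>k. C_k k \<eta>" "compact_support_in \<eta> (ball y R)" "\<And>x. 0 \<le> \<eta> x"
    and p: "p > 1" and q: "q > 1" and J: "J \<in> sets lebesgue"
  shows "test_function p q J (cball y R) (\<lambda>z. \<eta> (fst z)) (\<lambda>z. 0) (\<lambda>z. grad \<eta> (fst z))"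
proof -
  have c\<eta>: "continuous_on UNIV \<eta>" using C_k_cont[OF \<eta>(1)[of 0]] .
  have cg: "continuous_on UNIV (grad \<eta>)" by (rule C1_continuous_grad[OF \<eta>(1)[of "Suc 0"]])
  have cf: "continuous_on UNIV (\<lambda>z::'a \<times> real. \<eta> (fst z))" "continuous_on UNIV (\<lambda>z::'a \<times> real. grad \<eta> (fst z))"
    by (intro continuous_on_compose2[OF c\<eta>] continuous_on_compose2[OF cg] continuous_intros subset_UNIV)+
  have L: "Lp_loc_Lp m J (cball y R) f" if "continuous_on UNIV f" "m > 0" for m and f :: "'a \<times> real \<Rightarrow> 'b::euclidean_space"
    unfolding Lp_loc_Lp_def by (intro allI impI continuous_in_Lp[OF that(1) _ that(2)] compact_Times) auto
  have deriv0: "(LINT \<tau>|lebesgue_on J. \<eta> (fst (x, \<tau>)) * deriv \<psi> \<tau>) = - (LINT \<tau>|lebesgue_on J. 0 * \<psi> \<tau>)"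
    if "\<psi> \<in> Cinf_0 (interior J)" for \<psi> x
    using Cinf_0_real_integral_deriv[OF that J] by simp
  have W: "W1p_0 p (cball y R) \<eta> (grad \<eta>)"
    unfolding W1p_0_def
  proof (intro conjI exI[of _ "\<lambda>n. \<eta>"] allI)
    show "in_Lp p (cball y R) \<eta>" "in_Lp p (cball y R) (grad \<eta>)"
      using p by (auto intro!: continuous_in_Lp c\<eta> cg)
    show "\<eta> \<in> Cinf_0 (interior (cball y R))" using \<eta> by (simp add: Cinf_0_def)
  qed (use p in auto)
  have C: "C_loc_Lp (q + 1) J (cball y R) (\<lambda>z. \<eta> (fst z))"
    unfolding C_loc_Lp_def using q by (auto intro!: continuous_in_Lp c\<eta>)
  show ?thesis
    unfolding test_function_def W1m_loc_Lm_def Lp_loc_W1p_0_def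
    using L[OF cf(1)] L[OF cf(2)] L[OF continuous_on_const[of UNIV "0::real"]] p q deriv0 W C \<eta>(3)
    by (auto intro!: AE_I2)
qed

section \<open>Solutions as Borel data on a slab\<close>

lemma AE_lebesgue_on_lborel:
  assumes "AE z in lebesgue_on S. P z" "S \<in> sets lebesgue"
  shows "AE z in lborel. z \<in> S \<longrightarrow> P z"
  using assms by (simp add: AE_restrict_space_iff AE_completion_iff)

lemma C_loc_Lp_sequentially:
  assumes C: "C_loc_Lp m J E u" and \<tau>: "\<tau> \<in> J" "\<And>n. X n \<in> J" "X \<longlonglongrightarrow> \<tau>"
  shows "(\<lambda>n. LINT x|lebesgue_on E. \<bar>u (x, X n) - u (x, \<tau>)\<bar> powr m) \<longlonglongrightarrow> 0"
proof -
  define D where "D s = (LINT x|lebesgue_on E. \<bar>u (x, s) - u (x, \<tau>)\<bar> powr m)" for s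
  have "(D \<longlongrightarrow> 0) (at \<tau> within J)"
    using C \<tau>(1) unfolding C_loc_Lp_def D_def by blast
  moreover have D0: "D \<tau> = 0" by (simp add: D_def)
  ultimately have "continuous (at \<tau> within J) D" by (simp add: continuous_within)
  then have "(\<lambda>n. D (X n)) \<longlonglongrightarrow> 0"
    using \<tau> D0 unfolding continuous_within_sequentially comp_def by metis
  then show ?thesis by (simp only: D_def)
qed

text \<open>The solution, its gradient and its flux are replaced by Borel representatives. The solution is truncated to \<open>[lo, hi]\<close>,
and gradient and flux are set to zero where the structure conditions fail, so that bounds valid almost everywhere
hold everywhere. A time is good if almost every point of its slice is good and the slice is weakly differentiable. For the
mollification identity, the kernel \<open>K(x - \<cdot>)\<close> itself serves as test function in the definition of the weak gradient.\<close>

lemma solution_gives_weak_slab: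
  fixes u :: "'a::euclidean_space \<times> real \<Rightarrow> real" and Du :: "'a \<times> real \<Rightarrow> 'a"
  assumes par: "K1 > 0" "K2 > 0" "p > 1" "q > 1" and \<Omega>: "open \<Omega>"
    and J: "J = {0<..<T} \<or> J = {0<..T}"
    and sc: "structure_conditions K1 K2 p \<Omega> T A"
    and Cq: "C_loc_Lp_loc (q + 1) J \<Omega> u" and Du: "Lp_loc_W1p_loc p J \<Omega> u Du"
    and weak: "\<And>E t1 t2 \<zeta> \<zeta>t D\<zeta>. compact E \<Longrightarrow> E \<subseteq> \<Omega> \<Longrightarrow> t1 \<le> t2 \<Longrightarrow> {t1..t2} \<subseteq> J \<Longrightarrow>
       test_function p q J E \<zeta> \<zeta>t D\<zeta> \<Longrightarrow> e * weak_form q A u Du E t1 t2 \<zeta> \<zeta>t D\<zeta> \<le> 0"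
    and e: "e = 1 \<or> e = - 1"
    and cyl: "ball y r \<subseteq> \<Omega>" "{s<..<t} \<subseteq> {0<..<T}"
    and bd: "AE z in lebesgue_on (ball y r \<times> {s<..<t}). lo \<le> u z \<and> u z \<le> hi"
    and ab: "s < \<alpha>" "\<alpha> < \<beta>" "\<beta> < t" and \<rho>: "0 < \<rho>" "\<rho> < R" "R < r" and lohi: "lo \<le> hi"
  obtains V G a T0 where "weak_slab y R \<rho> \<alpha> \<beta> V G a e K1 K2 p q lo hi T0"
    "\<And>\<tau>. \<tau> \<in> T0 \<Longrightarrow> AE x in lborel. x \<in> cball y R \<longrightarrow> V (x, \<tau>) = u (x, \<tau>)"
proof -
  define E where "E = cball y R"
  define Q where "Q = E \<times> {\<alpha>..\<beta>}"
  have E: "compact E" "E \<subseteq> ball y r" "E \<subseteq> \<Omega>" using \<rho> cyl(1) by (auto simp: E_def)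
  have \<alpha>\<beta>: "{\<alpha>..\<beta>} \<subseteq> {s<..<t}" using ab by auto
  have \<alpha>\<beta>T: "{\<alpha>..\<beta>} \<subseteq> {0<..<T}" using \<alpha>\<beta> cyl(2) by blast
  have \<alpha>\<beta>J: "{\<alpha>..\<beta>} \<subseteq> J" using \<alpha>\<beta>T J by fastforce
  have Jm: "J \<in> sets lebesgue" using J by auto
  have Eb[measurable]: "E \<in> sets borel" by (simp add: E_def)
  have Em: "E \<in> sets lebesgue" using Eb by simp
  have Qb[measurable]: "Q \<in> sets borel" unfolding Q_def E_def by (intro borel_closed closed_Times) auto
  have Qm: "Q \<in> sets lebesgue" using Qb by simp
  have inLp: "in_Lp p Q u" "in_Lp p Q Du"
    using Du E \<alpha>\<beta>J unfolding Lp_loc_W1p_loc_def Lp_loc_Lp_def Q_def by blast+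
  have bdQ: "AE z in lborel. z \<in> Q \<longrightarrow> lo \<le> u z \<and> u z \<le> hi"
  proof -
    have "ball y r \<times> {s<..<t} \<in> sets (lebesgue :: ('a \<times> real) measure)"
      by (intro borel_open[THEN sets_completionI_sets[of _ lborel, unfolded sets_lborel]] open_Times) auto
    from AE_lebesgue_on_lborel[OF bd this] show ?thesis
      by eventually_elim (use E \<alpha>\<beta> in \<open>auto simp: Q_def\<close>)
  qed
  obtain V0 where V0[measurable]: "V0 \<in> borel_measurable borel" and V0': "AE z in lborel. indicator Q z *\<^sub>R u z = V0 z"
    using borel_representative_on[of u Q] inLp(1) Qm unfolding in_Lp_def by blast
  define V where "V z = max lo (min hi (V0 z))" for z
  have V[measurable]: "V \<in> borel_measurable borel" unfolding V_def by measurable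
  have VU: "AE z in lborel. z \<in> Q \<longrightarrow> V z = u z"
    using bdQ V0' by eventually_elim (auto simp: V_def)
  obtain G0 where G0[measurable]: "G0 \<in> borel_measurable borel" and G0': "AE z in lborel. indicator Q z *\<^sub>R Du z = G0 z"
    using borel_representative_on[of Du Q] inLp(2) Qm unfolding in_Lp_def by blast
  let ?P = "\<lambda>z. continuous_on UNIV (\<lambda>(v, \<xi>). A z v \<xi>) \<and>
     (\<forall>v \<xi>. K1 * norm \<xi> powr p \<le> A z v \<xi> \<bullet> \<xi> \<and> norm (A z v \<xi>) \<le> K2 * norm \<xi> powr (p - 1))"
  have \<Omega>Tm: "\<Omega> \<times> {0<..<T} \<in> sets (lebesgue :: ('a \<times> real) measure)"
    by (intro borel_open[THEN sets_completionI_sets[of _ lborel, unfolded sets_lborel]] open_Times \<Omega>) auto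
  have SC: "AE z in lborel. z \<in> \<Omega> \<times> {0<..<T} \<longrightarrow> ?P z"
    by (rule AE_lebesgue_on_lborel[OF structure_conditions_uniform[OF sc par(3)] \<Omega>Tm])
  obtain N where N: "\<And>z. z \<in> space lborel - N \<Longrightarrow> z \<in> \<Omega> \<times> {0<..<T} \<longrightarrow> ?P z" "N \<in> null_sets (lborel :: ('a \<times> real) measure)"
    using AE_E3[OF SC] by metis
  have QN: "?P z" if "z \<in> Q - N" for z
    using N(1)[of z] that E(3) \<alpha>\<beta>T by (auto simp: Q_def)
  (* Setting A to zero off Q - N makes it a Caratheodory function at every point, not only almost everywhere. *)
  define A2 where "A2 z = (\<lambda>(v, \<xi>). if z \<in> Q - N then A z v \<xi> else 0)" for z
  have mA2: "(\<lambda>z. A2 z d) \<in> borel_measurable lebesgue" for d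
  proof -
    have "(\<lambda>z. A z (fst d) (snd d)) \<in> borel_measurable (lebesgue_on (\<Omega> \<times> {0<..<T}))"
      using sc unfolding structure_conditions_def by blast
    then have 1: "(\<lambda>z. indicator (\<Omega> \<times> {0<..<T}) z *\<^sub>R A z (fst d) (snd d)) \<in> borel_measurable lebesgue"
      using \<Omega>Tm by (subst (asm) borel_measurable_restrict_space_iff) auto
    have QNm: "Q - N \<in> sets lebesgue" using Qm null_sets_completionI[OF N(2)] by auto
    have "(\<lambda>z. indicator (Q - N) z *\<^sub>R (indicator (\<Omega> \<times> {0<..<T}) z *\<^sub>R A z (fst d) (snd d))) \<in> borel_measurable lebesgue"
      by (intro borel_measurable_scaleR borel_measurable_indicator QNm 1)
    moreover have "indicator (Q - N) z *\<^sub>R (indicator (\<Omega> \<times> {0<..<T}) z *\<^sub>R A z (fst d) (snd d)) = A2 z d" for z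
      using E(3) \<alpha>\<beta>T by (auto simp: A2_def Q_def indicator_def case_prod_beta')
    ultimately show ?thesis by simp
  qed
  have cA2: "continuous_on UNIV (A2 z)" for z
  proof (cases "z \<in> Q - N")
    case True
    then show ?thesis using QN[OF True] by (simp add: A2_def)
  next
    case False
    then have "A2 z = (\<lambda>d. 0)" by (auto simp: A2_def fun_eq_iff)
    then show ?thesis by simp
  qed
  have "(\<lambda>z. (V z, G0 z)) \<in> borel_measurable borel" by measurable
  then have wm: "(\<lambda>z. (V z, G0 z)) \<in> borel_measurable lebesgue" by (intro measurable_completion) simp
  obtain a0 where a0[measurable]: "a0 \<in> borel_measurable borel" and a0': "AE z in lborel. A2 z (V z, G0 z) = a0 z"
    using borel_representative[OF caratheodory_measurable[OF mA2 cA2 wm]] by metis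
  define Good where "Good = {z \<in> Q. K1 * norm (G0 z) powr p \<le> a0 z \<bullet> G0 z \<and> norm (a0 z) \<le> K2 * norm (G0 z) powr (p - 1)}"
  have Good[measurable]: "Good \<in> sets borel" unfolding Good_def by measurable
  define G where "G z = indicator Good z *\<^sub>R G0 z" for z
  define a where "a z = indicator Good z *\<^sub>R a0 z" for z
  have Gm[measurable]: "G \<in> borel_measurable borel" unfolding G_def by measurable
  have am[measurable]: "a \<in> borel_measurable borel" unfolding a_def by measurable
  have NN: "AE z in lborel. z \<notin> N" using N(2) by (rule AE_not_in)
  have all: "AE z in lborel. z \<in> Q \<longrightarrow> V z = u z \<and> G z = Du z \<and> a z = A z (u z) (Du z)"
    using VU G0' a0' NN
  proof eventually_elim
    fix z assume h: "z \<in> Q \<longrightarrow> V z = u z" "indicator Q z *\<^sub>R Du z = G0 z" "A2 z (V z, G0 z) = a0 z" "z \<notin> N"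
    show "z \<in> Q \<longrightarrow> V z = u z \<and> G z = Du z \<and> a z = A z (u z) (Du z)"
    proof
      assume z: "z \<in> Q"
      then have g: "G0 z = Du z" and a: "a0 z = A z (u z) (Du z)" using h by (auto simp: A2_def)
      have st: "K1 * norm (Du z) powr p \<le> A z (u z) (Du z) \<bullet> Du z \<and> norm (A z (u z) (Du z)) \<le> K2 * norm (Du z) powr (p - 1)"
        using QN[of z] z h(4) by blast
      have "z \<in> Good" unfolding Good_def mem_Collect_eq g a using z st by blast
      then show "V z = u z \<and> G z = Du z \<and> a z = A z (u z) (Du z)" using z h g a by (simp add: G_def a_def)
    qed
  qed
  have GoodQ: "Good \<subseteq> Q" by (auto simp: Good_def)
  have G0Q: "G z = 0" and a0Q: "a z = 0" if "z \<notin> Q" for z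
  proof -
    have "z \<notin> Good" using that GoodQ by blast
    then show "G z = 0" "a z = 0" by (simp_all add: G_def a_def)
  qed
  have Gp: "integrable lborel (\<lambda>z. norm (G z) powr p)"
  proof -
    have "integrable (lebesgue_on Q) (\<lambda>z. norm (Du z) powr p) \<longleftrightarrow> integrable lborel (\<lambda>z. norm (G z) powr p)"
    proof (rule lebesgue_on_AE_eq(2)[OF Qm])
      show "AE z in lborel. indicator Q z *\<^sub>R (norm (Du z) powr p) = norm (G z) powr p"
        using all by eventually_elim (use G0Q par in \<open>auto simp: indicator_def\<close>)
    qed measurable
    then show ?thesis using inLp(2) by (simp add: in_Lp_def)
  qed
  define T0 where "T0 = {\<tau> \<in> {\<alpha>..\<beta>}. (AE x in lborel. x \<in> E \<longrightarrow> V (x, \<tau>) = u (x, \<tau>) \<and> G (x, \<tau>) = Du (x, \<tau>)) \<and>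
     W1p_loc p \<Omega> (\<lambda>x. u (x, \<tau>)) (\<lambda>x. Du (x, \<tau>))}"
  have T0V: "AE x in lborel. x \<in> E \<longrightarrow> V (x, \<tau>) = u (x, \<tau>)" "AE x in lborel. x \<in> E \<longrightarrow> G (x, \<tau>) = Du (x, \<tau>)"
    "W1p_loc p \<Omega> (\<lambda>x. u (x, \<tau>)) (\<lambda>x. Du (x, \<tau>))" "\<tau> \<in> {\<alpha>..\<beta>}" if "\<tau> \<in> T0" for \<tau>
  proof -
    from that have "AE x in lborel. x \<in> E \<longrightarrow> V (x, \<tau>) = u (x, \<tau>) \<and> G (x, \<tau>) = Du (x, \<tau>)" by (simp add: T0_def)
    then show "AE x in lborel. x \<in> E \<longrightarrow> V (x, \<tau>) = u (x, \<tau>)" "AE x in lborel. x \<in> E \<longrightarrow> G (x, \<tau>) = Du (x, \<tau>)"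
      by (eventually_elim, simp)+
  qed (use that in \<open>auto simp: T0_def\<close>)
  have Em2: "y' \<in> E \<longleftrightarrow> y' \<in> cball y R" for y' by (simp add: E_def)
  have sliceE: "(LINT x|lebesgue_on E. f x) = (LINT x|lborel. g x)" 
    if "g \<in> borel_measurable borel" "AE x in lborel. indicator E x *\<^sub>R f x = g x" for f g :: "'a \<Rightarrow> real"
    by (rule lebesgue_on_AE_eq(1)[OF Em that])
  have slab: "weak_slab y R \<rho> \<alpha> \<beta> V G a e K1 K2 p q lo hi T0"
  proof unfold_locales
    show "lo \<le> V z" "V z \<le> hi" for z using lohi by (auto simp: V_def)
    show "K1 * norm (G z) powr p \<le> a z \<bullet> G z" "norm (a z) \<le> K2 * norm (G z) powr (p - 1)" for z
      using par by (auto simp: G_def a_def Good_def indicator_def)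
    show "G z = 0" if "z \<notin> cball y R \<times> {\<alpha>..\<beta>}" for z using G0Q that by (simp add: Q_def E_def)
    show "T0 \<subseteq> {\<alpha>..\<beta>}" by (auto simp: T0_def)
    show "AE t in lborel. t \<in> {\<alpha>..\<beta>} \<longrightarrow> t \<in> T0"
    proof -
      have 1: "AE t in lborel. t \<in> J \<longrightarrow> W1p_loc p \<Omega> (\<lambda>x. u (x, t)) (\<lambda>x. Du (x, t))"
        using Du Jm unfolding Lp_loc_W1p_loc_def by (intro AE_lebesgue_on_lborel) auto
      show ?thesis using AE_slices[OF all] 1
      proof eventually_elim
        fix t assume h: "AE x in lborel. (x, t) \<in> Q \<longrightarrow> V (x, t) = u (x, t) \<and> G (x, t) = Du (x, t) \<and> a (x, t) = A (x, t) (u (x, t)) (Du (x, t))"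
          "t \<in> J \<longrightarrow> W1p_loc p \<Omega> (\<lambda>x. u (x, t)) (\<lambda>x. Du (x, t))"
        show "t \<in> {\<alpha>..\<beta>} \<longrightarrow> t \<in> T0"
        proof
          assume t: "t \<in> {\<alpha>..\<beta>}"
          have "AE x in lborel. x \<in> E \<longrightarrow> V (x, t) = u (x, t) \<and> G (x, t) = Du (x, t)"
            using h(1) by eventually_elim (use t in \<open>auto simp: Q_def\<close>)
          then show "t \<in> T0" using t h(2) \<alpha>\<beta>J by (auto simp: T0_def)
        qed
      qed
    qed
    show "integrable lborel (\<lambda>x. norm (G (x, t)) powr p)" if t: "t \<in> T0" for t
    proof -
      have "integrable (lebesgue_on E) (\<lambda>x. norm (Du (x, t)) powr p) \<longleftrightarrow> integrable lborel (\<lambda>x. norm (G (x, t)) powr p)"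
      proof (rule lebesgue_on_AE_eq(2)[OF Em])
        show "AE x in lborel. indicator E x *\<^sub>R (norm (Du (x, t)) powr p) = norm (G (x, t)) powr p"
          using T0V(2)[OF t] by eventually_elim (use G0Q[of "(_, t)"] par in \<open>auto simp: indicator_def Q_def\<close>)
      qed measurable
      moreover have "integrable (lebesgue_on E) (\<lambda>x. norm (Du (x, t)) powr p)"
        using T0V(3)[OF t] E unfolding W1p_loc_def in_Lp_def by blast
      ultimately show ?thesis by blast
    qed
    show "(\<lambda>n. LINT x|lborel. indicator (cball y R) x * \<bar>V (x, X n) - V (x, t)\<bar>) \<longlonglongrightarrow> 0"
      if t: "t \<in> T0" and X: "\<And>n. X n \<in> T0" "X \<longlonglongrightarrow> t" for t X
    proof -
      have tJ: "t \<in> J" "X n \<in> J" for n using T0V(4) t X \<alpha>\<beta>J by blast+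
      define D where "D \<tau> = (LINT x|lebesgue_on E. \<bar>u (x, \<tau>) - u (x, t)\<bar> powr (q + 1))" for \<tau>
      have CE: "C_loc_Lp (q + 1) J E u" using Cq E unfolding C_loc_Lp_loc_def by blast
      have DX: "(\<lambda>n. D (X n)) \<longlonglongrightarrow> 0"
        unfolding D_def by (rule C_loc_Lp_sequentially[OF CE tJ X(2)])
      let ?d = "\<lambda>n x. \<bar>V (x, X n) - V (x, t)\<bar>"
      have dB: "?d n x \<le> hi - lo" for n x using lohi by (auto simp: V_def)
      have iE: "integrable lborel (indicator E :: 'a \<Rightarrow> real)"
        using emeasure_lborel_cball_finite[of y R] by (intro integrable_real_indicator) (auto simp: E_def)
      have bi: "integrable lborel (\<lambda>x. indicator E x * f x)" if [measurable]: "f \<in> borel_measurable borel" and "\<And>x. \<bar>f x\<bar> \<le> B" for f :: "'a \<Rightarrow> real" and B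
      proof (rule Bochner_Integration.integrable_bound[OF integrable_mult_left[OF iE, of B]])
        show "AE x in lborel. norm (indicator E x * f x) \<le> norm (indicator E x * B)"
          using that(2) by (intro AE_I2) (auto simp: indicator_def intro: order_trans[OF _ abs_ge_self])
      qed measurable
      have i1: "integrable lborel (\<lambda>x. indicator E x * ?d n x)" for n
        using dB by (intro bi[where B="hi - lo"]) auto
      have i2: "integrable lborel (\<lambda>x. indicator E x * (?d n x powr (q + 1)))" for n
        using dB par by (intro bi[where B="(hi - lo) powr (q + 1)"]) (auto intro!: powr_mono2)
      have DV: "D (X n) = (LINT x|lborel. indicator E x * (?d n x powr (q + 1)))" for n
        unfolding D_def
      proof (rule sliceE)
        show "AE x in lborel. indicator E x *\<^sub>R (\<bar>u (x, X n) - u (x, t)\<bar> powr (q + 1)) = indicator E x * (?d n x powr (q + 1))"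
          using T0V(1)[OF t] T0V(1)[OF X(1)[of n]] by eventually_elim (auto simp: indicator_def)
      qed measurable
      have "(\<lambda>n. LINT x|lborel. indicator E x * ?d n x) \<longlonglongrightarrow> 0"
      proof (rule young_bound_tendsto_0[OF _ _ DX, where B=1 and p="q + 1" and A="LINT x|lborel. indicator E x"])
        fix n and b :: real assume b: "b > 0"
        have "(LINT x|lborel. indicator E x * ?d n x) \<le> (LINT x|lborel. b * indicator E x + b powr (1 - (q + 1)) * (indicator E x * (?d n x powr (q + 1))))"
        proof (rule integral_mono[OF i1])
          show "integrable lborel (\<lambda>x. b * indicator E x + b powr (1 - (q + 1)) * (indicator E x * (?d n x powr (q + 1))))"
            by (intro Bochner_Integration.integrable_add integrable_mult_right iE i2)
          show "indicator E x * ?d n x \<le> b * indicator E x + b powr (1 - (q + 1)) * (indicator E x * (?d n x powr (q + 1)))" for x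
            using young_split1[of "?d n x" "q + 1" b] b par by (auto simp: indicator_def)
        qed
        also have "\<dots> = b * (LINT x|lborel. indicator E x) + b powr (1 - (q + 1)) * D (X n)"
          unfolding DV by (simp only: Bochner_Integration.integral_add[OF integrable_mult_right[OF iE] integrable_mult_right[OF i2]] integral_mult_right_zero)
        finally show "(LINT x|lborel. indicator E x * ?d n x) \<le> b * (LINT x|lborel. indicator E x) + b powr (1 - (q + 1)) * (1 * D (X n))"
          by (simp only: mult_1_left)
      qed (auto intro!: Bochner_Integration.integral_nonneg)
      then show ?thesis by (simp only: E_def)
    qed
    show "conv (\<lambda>x. indicator (cball y R) x * V (x, t)) (grad K) x = mollify K (\<lambda>x. G (x, t)) x"
      if t: "t \<in> T0" and K: "mollifier \<epsilon> K" and \<epsilon>: "\<epsilon> < R - \<rho>" and x: "x \<in> cball y \<rho>" for t \<epsilon> K x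
    proof (rule euclidean_eqI)
      fix b :: 'a assume b: "b \<in> Basis"
      have K1: "C_k (Suc 0) K" by (rule mollifier_C_k[OF K])
      have cK: "continuous_on UNIV K" using C_k_cont[OF K1] .
      have cG: "continuous_on UNIV (grad K)" by (rule C1_continuous_grad[OF K1])
      have Gr0: "grad K z = 0" if "z \<notin> cball 0 \<epsilon>" for z
        by (rule grad_zero_outside[OF closed_cball mollifier_supp[OF K] that])
      have [measurable]: "K \<in> borel_measurable borel" "grad K \<in> borel_measurable borel"
        using cK cG by (auto intro: borel_measurable_continuous_onI)
      have inE: "w \<in> E" if "x - w \<in> cball 0 \<epsilon>" for w
      proof -
        have "dist y w \<le> dist y x + dist x w" by (rule dist_triangle)
        then show ?thesis using x that \<epsilon> by (simp add: E_def dist_norm norm_minus_commute[of w x])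
      qed
      let ?\<phi> = "\<lambda>w. K (x - w)"
      have d\<phi>: "(?\<phi> has_derivative (\<lambda>h. (- grad K (x - w)) \<bullet> h)) (at w)" for w
      proof -
        have "((\<lambda>w. x - w) has_derivative (\<lambda>h. - h)) (at w)" by (auto intro!: derivative_eq_intros)
        from has_derivative_compose[OF this C1_has_derivative[OF K1]] show ?thesis by simp
      qed
      have g\<phi>: "grad ?\<phi> w = - grad K (x - w)" for w by (rule grad_eqI[OF d\<phi>])
      have ballE: "cball x \<epsilon> \<subseteq> \<Omega>"
      proof
        fix w assume "w \<in> cball x \<epsilon>"
        then have "w \<in> E" by (intro inE) (simp add: dist_norm norm_minus_commute[of w x])
        then show "w \<in> \<Omega>" using E(3) by blast
      qed
      have "?\<phi> \<in> Cinf_0 \<Omega>"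
        unfolding Cinf_0_def
      proof (intro CollectI conjI allI)
        show "C_k k ?\<phi>" for k by (rule C_k_reflect[OF mollifier_C_k[OF K]])
        show "compact_support_in ?\<phi> \<Omega>"
          by (rule compact_support_inI[OF compact_cball[of x \<epsilon>] _ ballE]) (rule mollifier_supp[OF K], simp add: dist_norm norm_minus_commute[of x])
      qed
      then have eq: "(LINT w|lebesgue_on \<Omega>. u (w, t) * (grad ?\<phi> w \<bullet> b)) = - (LINT w|lebesgue_on \<Omega>. (Du (w, t) \<bullet> b) * ?\<phi> w)"
        using T0V(3)[OF t] b unfolding W1p_loc_def weak_gradient_def by blast
      have \<Omega>l: "\<Omega> \<in> sets lebesgue" using \<Omega> by (simp add: borel_open)
      have L: "(LINT w|lebesgue_on \<Omega>. u (w, t) * (grad ?\<phi> w \<bullet> b)) = (LINT w|lborel. - ((indicator E w * V (w, t)) * (grad K (x - w) \<bullet> b)))"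
      proof (rule lebesgue_on_AE_eq(1)[OF \<Omega>l])
        show "AE w in lborel. indicator \<Omega> w *\<^sub>R (u (w, t) * (grad ?\<phi> w \<bullet> b)) = - ((indicator E w * V (w, t)) * (grad K (x - w) \<bullet> b))"
          using T0V(1)[OF t]
        proof eventually_elim
          fix w assume h: "w \<in> E \<longrightarrow> V (w, t) = u (w, t)"
          show "indicator \<Omega> w *\<^sub>R (u (w, t) * (grad ?\<phi> w \<bullet> b)) = - ((indicator E w * V (w, t)) * (grad K (x - w) \<bullet> b))"
          proof (cases "x - w \<in> cball 0 \<epsilon>")
            case True
            then have "w \<in> E" "w \<in> \<Omega>" using inE E(3) by auto
            then show ?thesis using h by (simp add: g\<phi>)
          next
            case False
            then show ?thesis using Gr0[OF False] by (simp add: g\<phi>)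
          qed
        qed
      qed measurable
      have Rr: "(LINT w|lebesgue_on \<Omega>. (Du (w, t) \<bullet> b) * ?\<phi> w) = (LINT w|lborel. (G (w, t) \<bullet> b) * K (x - w))"
      proof (rule lebesgue_on_AE_eq(1)[OF \<Omega>l])
        show "AE w in lborel. indicator \<Omega> w *\<^sub>R ((Du (w, t) \<bullet> b) * ?\<phi> w) = (G (w, t) \<bullet> b) * K (x - w)"
          using T0V(2)[OF t]
        proof eventually_elim
          fix w assume h: "w \<in> E \<longrightarrow> G (w, t) = Du (w, t)"
          show "indicator \<Omega> w *\<^sub>R ((Du (w, t) \<bullet> b) * ?\<phi> w) = (G (w, t) \<bullet> b) * K (x - w)"
          proof (cases "x - w \<in> cball 0 \<epsilon>")
            case True
            then have "w \<in> E" "w \<in> \<Omega>" using inE E(3) by auto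
            then show ?thesis using h by simp
          next
            case False
            then show ?thesis using mollifier_supp[OF K False] by simp
          qed
        qed
      qed measurable
      have iE: "integrable lborel (indicator E :: 'a \<Rightarrow> real)"
        using emeasure_lborel_cball_finite[of y R] by (intro integrable_real_indicator) (auto simp: E_def)
      have iV: "integrable lborel (\<lambda>w. indicator E w * V (w, t))"
      proof (rule Bochner_Integration.integrable_bound[OF integrable_mult_left[OF iE, of "\<bar>lo\<bar> + \<bar>hi\<bar>"]])
        show "AE w in lborel. norm (indicator E w * V (w, t)) \<le> norm (indicator E w * (\<bar>lo\<bar> + \<bar>hi\<bar>))"
          by (intro AE_I2) (auto simp: indicator_def V_def)
      qed measurable
      have iG1: "integrable lborel (\<lambda>w. G (w, t))"
      proof -
        have "integrable (lebesgue_on E) (\<lambda>w. Du (w, t))"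
          using T0V(3)[OF t] E unfolding W1p_loc_def weak_gradient_def by blast
        moreover have "integrable (lebesgue_on E) (\<lambda>w. Du (w, t)) \<longleftrightarrow> integrable lborel (\<lambda>w. G (w, t))"
        proof (rule lebesgue_on_AE_eq(2)[OF Em])
          show "AE w in lborel. indicator E w *\<^sub>R Du (w, t) = G (w, t)"
            using T0V(2)[OF t] by eventually_elim (use G0Q[of "(_, t)"] in \<open>auto simp: indicator_def Q_def\<close>)
        qed measurable
        ultimately show ?thesis by blast
      qed
      have "conv (\<lambda>x. indicator (cball y R) x * V (x, t)) (grad K) x \<bullet> b = conv (\<lambda>w. indicator E w * V (w, t)) (\<lambda>z. grad K z \<bullet> b) x"
        unfolding E_def[symmetric] by (rule conv_inner[OF iV cG compact_cball Gr0])
      also have "\<dots> = - (LINT w|lborel. - ((indicator E w * V (w, t)) * (grad K (x - w) \<bullet> b)))"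
        unfolding conv_def real_scaleR_def by simp
      also have "\<dots> = (LINT w|lborel. (G (w, t) \<bullet> b) * K (x - w))" using eq L Rr by simp
      also have "\<dots> = (LINT w|lborel. (K (x - w) *\<^sub>R G (w, t)) \<bullet> b)" by (simp add: mult.commute)
      also have "\<dots> = mollify K (\<lambda>x. G (x, t)) x \<bullet> b"
        unfolding mollify_def by (rule integral_inner_left[OF integrable_mollifier_mult[OF K iG1]])
      finally show "conv (\<lambda>x. indicator (cball y R) x * V (x, t)) (grad K) x \<bullet> b = mollify K (\<lambda>x. G (x, t)) x \<bullet> b" .
    qed
    show "weak_ineq y R (\<lambda>x. e * (indicator (cball y R) x * (spow q (V (x, t2)) - spow q (V (x, t1)))))
          (\<lambda>z. (e * indicator {t1..t2} (snd z)) *\<^sub>R a z)"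
      if t: "t1 \<in> T0" "t2 \<in> T0" "t1 \<le> t2" for t1 t2
      unfolding weak_ineq_def
    proof (intro allI impI)
      fix \<eta> :: "'a \<Rightarrow> real"
      assume \<eta>: "(\<forall>k. C_k k \<eta>) \<and> compact_support_in \<eta> (ball y R) \<and> (\<forall>x. 0 \<le> \<eta> x)"
      have t12: "{t1..t2} \<subseteq> {\<alpha>..\<beta>}" using T0V(4) t by fastforce
      have tf: "test_function p q J E (\<lambda>z. \<eta> (fst z)) (\<lambda>z. 0) (\<lambda>z. grad \<eta> (fst z))"
        unfolding E_def using \<eta> par Jm by (intro constant_test_function) auto
      have ineq: "e * weak_form q A u Du E t1 t2 (\<lambda>z. \<eta> (fst z)) (\<lambda>z. 0) (\<lambda>z. grad \<eta> (fst z)) \<le> 0"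
        using t12 \<alpha>\<beta>J by (intro weak[OF E(1,3) t(3) _ tf]) blast
      have \<eta>1: "C_k (Suc 0) \<eta>" using \<eta> by blast
      have c\<eta>: "continuous_on UNIV \<eta>" using C_k_cont[OF \<eta>1] .
      have cg: "continuous_on UNIV (grad \<eta>)" by (rule C1_continuous_grad[OF \<eta>1])
      have [measurable]: "\<eta> \<in> borel_measurable borel" "grad \<eta> \<in> borel_measurable borel" "spow q \<in> borel_measurable borel"
        using c\<eta> cg continuous_on_spow[OF par(4)] by (auto intro: borel_measurable_continuous_onI)
      have s: "(LINT x|lebesgue_on E. spow q (u (x, \<tau>)) * \<eta> (fst (x, \<tau>))) = (LINT x|lborel. indicator E x * spow q (V (x, \<tau>)) * \<eta> x)"
        if \<tau>: "\<tau> \<in> T0" for \<tau>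
      proof (rule sliceE)
        show "AE x in lborel. indicator E x *\<^sub>R (spow q (u (x, \<tau>)) * \<eta> (fst (x, \<tau>))) = indicator E x * spow q (V (x, \<tau>)) * \<eta> x"
          using T0V(1)[OF \<tau>] by eventually_elim (auto simp: indicator_def)
      qed measurable
      have Q2m: "E \<times> {t1..t2} \<in> sets (lebesgue :: ('a \<times> real) measure)"
        unfolding E_def by (intro borel_closed[THEN sets_completionI_sets[of _ lborel, unfolded sets_lborel]] closed_Times) auto
      have z: "(LINT z|lebesgue_on (E \<times> {t1..t2}). - spow q (u z) * 0 + A z (u z) (Du z) \<bullet> grad \<eta> (fst z))
         = (LINT z|lborel. indicator {t1..t2} (snd z) * (a z \<bullet> grad \<eta> (fst z)))"
      proof (rule lebesgue_on_AE_eq(1)[OF Q2m])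
        show "AE z in lborel. indicator (E \<times> {t1..t2}) z *\<^sub>R (- spow q (u z) * 0 + A z (u z) (Du z) \<bullet> grad \<eta> (fst z)) = indicator {t1..t2} (snd z) * (a z \<bullet> grad \<eta> (fst z))"
          using all
        proof eventually_elim
          fix z assume h: "z \<in> Q \<longrightarrow> V z = u z \<and> G z = Du z \<and> a z = A z (u z) (Du z)"
          show "indicator (E \<times> {t1..t2}) z *\<^sub>R (- spow q (u z) * 0 + A z (u z) (Du z) \<bullet> grad \<eta> (fst z)) = indicator {t1..t2} (snd z) * (a z \<bullet> grad \<eta> (fst z))"
          proof (cases "z \<in> E \<times> {t1..t2}")
            case True
            then have "z \<in> Q" "snd z \<in> {t1..t2}" using t12 by (auto simp: Q_def)
            then show ?thesis using h True by simp
          next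
            case False
            then have "snd z \<notin> {t1..t2} \<or> z \<notin> Q" by (cases z) (auto simp: Q_def)
            then show ?thesis
            proof
              assume "snd z \<notin> {t1..t2}"
              then show ?thesis using False by simp
            next
              assume "z \<notin> Q"
              then show ?thesis using False a0Q[of z] by simp
            qed
          qed
        qed
      qed measurable
      have iE: "integrable lborel (indicator E :: 'a \<Rightarrow> real)"
        using emeasure_lborel_cball_finite[of y R] by (intro integrable_real_indicator) (auto simp: E_def)
      obtain B where B: "\<And>x. \<bar>\<eta> x\<bar> \<le> B"
      proof -
        have 1: "compact (closure {x. \<eta> x \<noteq> 0})" using \<eta> unfolding compact_support_in_def by blast
        have 2: "\<eta> x = 0" if "x \<notin> closure {x. \<eta> x \<noteq> 0}" for x
          using that closure_subset[of "{x. \<eta> x \<noteq> 0}"] by blast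
        obtain B where "\<And>x. norm (\<eta> x) \<le> B" using compactly_supported_bounded[OF c\<eta> 1 2] by metis
        then show thesis by (intro that[of B]) (simp only: real_norm_def)
      qed
      have spB: "\<bar>spow q (V z)\<bar> \<le> \<bar>spow q lo\<bar> + \<bar>spow q hi\<bar>" for z
      proof -
        have "lo \<le> V z" "V z \<le> hi" using lohi by (auto simp: V_def)
        then show ?thesis using spow_mono[OF par(4), of lo "V z"] spow_mono[OF par(4), of "V z" hi] by linarith
      qed
      have iS: "integrable lborel (\<lambda>x. indicator E x * spow q (V (x, \<tau>)) * \<eta> x)" for \<tau>
      proof (rule Bochner_Integration.integrable_bound[OF integrable_mult_left[OF iE, of "(\<bar>spow q lo\<bar> + \<bar>spow q hi\<bar>) * B"]])
        show "AE x in lborel. norm (indicator E x * spow q (V (x, \<tau>)) * \<eta> x) \<le> norm (indicator E x * ((\<bar>spow q lo\<bar> + \<bar>spow q hi\<bar>) * B))"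
        proof (intro AE_I2)
          fix x
          have "\<bar>spow q (V (x, \<tau>))\<bar> * \<bar>\<eta> x\<bar> \<le> (\<bar>spow q lo\<bar> + \<bar>spow q hi\<bar>) * B"
            by (intro mult_mono spB B) auto
          then show "norm (indicator E x * spow q (V (x, \<tau>)) * \<eta> x) \<le> norm (indicator E x * ((\<bar>spow q lo\<bar> + \<bar>spow q hi\<bar>) * B))"
            using order_trans[OF abs_ge_zero B] by (cases "x \<in> E") (simp_all add: abs_mult)
        qed
      qed measurable
      have "(LINT x|lborel. e * (indicator (cball y R) x * (spow q (V (x, t2)) - spow q (V (x, t1)))) * \<eta> x)
        = (LINT x|lborel. e * (indicator E x * spow q (V (x, t2)) * \<eta> x - indicator E x * spow q (V (x, t1)) * \<eta> x))"
        unfolding E_def by (intro Bochner_Integration.integral_cong refl) (simp add: algebra_simps)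
      also have "\<dots> = e * ((LINT x|lborel. indicator E x * spow q (V (x, t2)) * \<eta> x) - (LINT x|lborel. indicator E x * spow q (V (x, t1)) * \<eta> x))"
        by (simp only: integral_mult_right_zero Bochner_Integration.integral_diff[OF iS iS])
      finally have 1: "(LINT x|lborel. e * (indicator (cball y R) x * (spow q (V (x, t2)) - spow q (V (x, t1)))) * \<eta> x)
        = e * ((LINT x|lborel. indicator E x * spow q (V (x, t2)) * \<eta> x) - (LINT x|lborel. indicator E x * spow q (V (x, t1)) * \<eta> x))" .
      have "(LINT z|lborel. ((e * indicator {t1..t2} (snd z)) *\<^sub>R a z) \<bullet> grad \<eta> (fst z))
         = (LINT z|lborel. e * (indicator {t1..t2} (snd z) * (a z \<bullet> grad \<eta> (fst z))))"
        by (intro Bochner_Integration.integral_cong refl) simp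
      also have "\<dots> = e * (LINT z|lborel. indicator {t1..t2} (snd z) * (a z \<bullet> grad \<eta> (fst z)))" by (rule integral_mult_right_zero)
      finally have 2: "(LINT z|lborel. ((e * indicator {t1..t2} (snd z)) *\<^sub>R a z) \<bullet> grad \<eta> (fst z))
         = e * (LINT z|lborel. indicator {t1..t2} (snd z) * (a z \<bullet> grad \<eta> (fst z)))" .
      show "(LINT x|lborel. e * (indicator (cball y R) x * (spow q (V (x, t2)) - spow q (V (x, t1)))) * \<eta> x) +
          (LINT z|lborel. ((e * indicator {t1..t2} (snd z)) *\<^sub>R a z) \<bullet> grad \<eta> (fst z)) \<le> 0"
        using ineq unfolding weak_form_def z s[OF t(1)] s[OF t(2)] 1 2 by (simp only: distrib_left)
    qed
  qed (use par e \<rho> lohi Gp in auto)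
  show ?thesis
  proof (rule that[OF slab])
    show "AE x in lborel. x \<in> cball y R \<longrightarrow> V (x, \<tau>) = u (x, \<tau>)" if "\<tau> \<in> T0" for \<tau>
      using T0V(1)[OF that] by (simp only: E_def)
  qed
qed

section \<open>Powers of cutoff functions\<close>

lemma cutoff_power:
  fixes \<zeta> :: "'a::euclidean_space \<Rightarrow> real"
  assumes \<zeta>: "C_k 1 \<zeta>" "\<And>x. 0 \<le> \<zeta> x" and l: "l > 1"
  shows "C_k 1 (\<lambda>x. \<zeta> x powr l)" "grad (\<lambda>x. \<zeta> x powr l) x = (l * \<zeta> x powr (l - 1)) *\<^sub>R grad \<zeta> x"
proof -
  have \<zeta>1: "C_k (Suc 0) \<zeta>" using \<zeta>(1) by simp
  have eq: "(\<lambda>x. \<zeta> x powr l) = (\<lambda>x. spow l (\<zeta> x))" using \<zeta>(2) by (simp add: spow_nonneg_eq)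
  have d: "((\<lambda>x. \<zeta> x powr l) has_derivative (\<lambda>h. ((l * \<zeta> x powr (l - 1)) *\<^sub>R grad \<zeta> x) \<bullet> h)) (at x)" for x
    unfolding eq
    using has_derivative_compose[OF C1_has_derivative[OF \<zeta>1, of x] spow_has_derivative[OF l, of "\<zeta> x", unfolded has_field_derivative_def]] \<zeta>(2)[of x]
    by simp
  have "continuous_on UNIV (\<lambda>x. (l * \<zeta> x powr (l - 1)) *\<^sub>R grad \<zeta> x)"
    using l \<zeta>(2) by (intro continuous_intros continuous_on_powr' C_k_cont[OF \<zeta>(1)] C1_continuous_grad[OF \<zeta>1]) auto
  then show "C_k 1 (\<lambda>x. \<zeta> x powr l)" by (rule C1I[OF d])
  show "grad (\<lambda>x. \<zeta> x powr l) x = (l * \<zeta> x powr (l - 1)) *\<^sub>R grad \<zeta> x" by (rule grad_eqI[OF d])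
qed

section \<open>Time slices\<close>

lemma in_Lp_diff_integrable:
  fixes f g :: "'a::euclidean_space \<Rightarrow> real"
  assumes f: "in_Lp m E f" and g: "in_Lp m E g" and m: "m > 0"
  shows "integrable (lebesgue_on E) (\<lambda>x. \<bar>f x - g x\<bar> powr m)"
proof (rule Bochner_Integration.integrable_bound)
  show "integrable (lebesgue_on E) (\<lambda>x. 2 powr m * (norm (f x) powr m + norm (g x) powr m))"
    using f g unfolding in_Lp_def by (intro integrable_mult_right Bochner_Integration.integrable_add) auto
  have "\<bar>f x - g x\<bar> powr m \<le> 2 powr m * (norm (f x) powr m + norm (g x) powr m)" for x
    using powr_mono2[of m "\<bar>f x - g x\<bar>" "\<bar>f x\<bar> + \<bar>g x\<bar>"] powr_add2_le[of "\<bar>f x\<bar>" "\<bar>g x\<bar>" m] m abs_triangle_ineq4[of "f x" "g x"] by simp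
  then show "AE x in lebesgue_on E. norm (\<bar>f x - g x\<bar> powr m) \<le> norm (2 powr m * (norm (f x) powr m + norm (g x) powr m))"
    by (intro AE_I2) (auto intro: order_trans[OF _ abs_ge_self])
  show "(\<lambda>x. \<bar>f x - g x\<bar> powr m) \<in> borel_measurable (lebesgue_on E)"
    using f g unfolding in_Lp_def by (intro powr_real_measurable borel_measurable_abs borel_measurable_diff borel_measurable_const) auto
qed

text \<open>A nonempty open interval has positive measure.\<close>

lemma AE_point_in_interval:
  fixes a b :: real
  assumes "AE x in lborel. P x" "a < b"
  shows "\<exists>x\<in>{a<..<b}. P x"
proof (rule ccontr)
  assume n: "\<not> ?thesis"
  have "AE x in lborel. x \<notin> {a<..<b}"
    using assms(1) by eventually_elim (use n in blast)
  then have "{a<..<b} \<in> null_sets lborel"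
    by (subst AE_iff_null_sets) auto
  then have "emeasure lborel {a<..<b} = 0" by blast
  then show False using assms(2) by simp
qed

text \<open>The bounds are inherited by almost every slice. A given slice, possibly at an end of the time interval, is a limit in
\<open>L^m\<close> of such slices, and its distance to the truncation to \<open>[lo, hi]\<close> is at most the distance to any of them.\<close>

lemma slice_bounds:
  fixes u :: "'a::euclidean_space \<times> real \<Rightarrow> real"
  assumes C: "C_loc_Lp m J (cball y R) u" and m: "m > 0"
    and bd: "AE z in lebesgue_on (ball y r \<times> {s<..<t}). lo \<le> u z \<and> u z \<le> hi"
    and R: "R < r" and st: "s < t" "{s<..<t} \<subseteq> J" and \<tau>: "\<tau> \<in> J" "s \<le> \<tau>" "\<tau> \<le> t" and lohi: "lo \<le> hi"
  shows "AE x in lebesgue_on (cball y R). lo \<le> u (x, \<tau>) \<and> u (x, \<tau>) \<le> hi"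
proof -
  let ?E = "cball y R"
  have Em: "?E \<in> sets lebesgue" by simp
  have "ball y r \<times> {s<..<t} \<in> sets (lebesgue :: ('a \<times> real) measure)"
    by (intro borel_open[THEN sets_completionI_sets[of _ lborel, unfolded sets_lborel]] open_Times) auto
  from AE_slices[OF AE_lebesgue_on_lborel[OF bd this]]
  have good: "AE \<sigma> in lborel. \<sigma> \<in> {s<..<t} \<longrightarrow> (AE x in lebesgue_on ?E. lo \<le> u (x, \<sigma>) \<and> u (x, \<sigma>) \<le> hi)"
  proof eventually_elim
    fix \<sigma> assume h: "AE x in lborel. (x, \<sigma>) \<in> ball y r \<times> {s<..<t} \<longrightarrow> lo \<le> u (x, \<sigma>) \<and> u (x, \<sigma>) \<le> hi"
    show "\<sigma> \<in> {s<..<t} \<longrightarrow> (AE x in lebesgue_on ?E. lo \<le> u (x, \<sigma>) \<and> u (x, \<sigma>) \<le> hi)"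
    proof
      assume "\<sigma> \<in> {s<..<t}"
      then have "AE x in lborel. x \<in> ?E \<longrightarrow> lo \<le> u (x, \<sigma>) \<and> u (x, \<sigma>) \<le> hi"
        using h by eventually_elim (use R \<open>\<sigma> \<in> {s<..<t}\<close> in auto)
      then show "AE x in lebesgue_on ?E. lo \<le> u (x, \<sigma>) \<and> u (x, \<sigma>) \<le> hi"
        using Em by (subst AE_restrict_space_iff) (simp_all only: space_completion space_lborel space_borel Int_UNIV_right AE_completion_iff)
    qed
  qed
  have *: "\<exists>\<sigma>. \<sigma> \<in> {s<..<t} \<and> \<bar>\<sigma> - \<tau>\<bar> < 1 / real (Suc n) \<and> (AE x in lebesgue_on ?E. lo \<le> u (x, \<sigma>) \<and> u (x, \<sigma>) \<le> hi)" for n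
  proof -
    define d where "d = 1 / real (Suc n)"
    have d: "d > 0" by (simp add: d_def)
    define a b where "a = max s (\<tau> - d)" and "b = min t (\<tau> + d)"
    have ab: "a < b" using d st \<tau> by (auto simp: a_def b_def)
    obtain \<sigma> where \<sigma>: "\<sigma> \<in> {a<..<b}" "\<sigma> \<in> {s<..<t} \<longrightarrow> (AE x in lebesgue_on ?E. lo \<le> u (x, \<sigma>) \<and> u (x, \<sigma>) \<le> hi)"
      using AE_point_in_interval[OF good ab] by metis
    then show ?thesis by (intro exI[of _ \<sigma>]) (auto simp: a_def b_def d_def)
  qed
  obtain X where X: "\<And>n. X n \<in> {s<..<t}" "\<And>n. \<bar>X n - \<tau>\<bar> < 1 / real (Suc n)"
    "\<And>n. AE x in lebesgue_on ?E. lo \<le> u (x, X n) \<and> u (x, X n) \<le> hi"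
  proof -
    assume th: thesis if "\<And>n. X n \<in> {s<..<t}" "\<And>n. \<bar>X n - \<tau>\<bar> < 1 / real (Suc n)"
      "\<And>n. AE x in lebesgue_on ?E. lo \<le> u (x, X n) \<and> u (x, X n) \<le> hi" for X
    from choice[OF allI[OF *]] obtain X where "\<forall>n. X n \<in> {s<..<t} \<and> \<bar>X n - \<tau>\<bar> < 1 / real (Suc n) \<and>
      (AE x in lebesgue_on ?E. lo \<le> u (x, X n) \<and> u (x, X n) \<le> hi)" ..
    then have X: "X n \<in> {s<..<t} \<and> \<bar>X n - \<tau>\<bar> < 1 / real (Suc n) \<and>
      (AE x in lebesgue_on ?E. lo \<le> u (x, X n) \<and> u (x, X n) \<le> hi)" for n by (rule spec)
    show thesis by (rule th[OF conjunct1[OF X] conjunct1[OF conjunct2[OF X]] conjunct2[OF conjunct2[OF X]]])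
  qed
  have "(\<lambda>n. X n - \<tau>) \<longlonglongrightarrow> 0"
    by (rule Lim_null_comparison[OF always_eventually LIMSEQ_inverse_real_of_nat])
       (use X(2) in \<open>auto simp: inverse_eq_divide less_imp_le\<close>)
  then have X\<tau>: "X \<longlonglongrightarrow> \<tau>" by (rule LIM_zero_cancel)
  have XJ: "X n \<in> J" for n using X(1) st by blast
  note lim = C_loc_Lp_sequentially[OF C \<tau>(1) XJ X\<tau>]
  have L: "in_Lp m ?E (\<lambda>x. u (x, \<sigma>))" if "\<sigma> \<in> J" for \<sigma> using C that unfolding C_loc_Lp_def by blast
  have um: "(\<lambda>x. u (x, \<tau>)) \<in> borel_measurable (lebesgue_on ?E)" using L[OF \<tau>(1)] by (simp add: in_Lp_def)
  define cl where "cl v = max lo (min hi v)" for v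
  define f where "f x = \<bar>u (x, \<tau>) - cl (u (x, \<tau>))\<bar> powr m" for x
  have fm: "f \<in> borel_measurable (lebesgue_on ?E)"
    unfolding f_def cl_def using um by (intro powr_real_measurable borel_measurable_abs borel_measurable_diff borel_measurable_const borel_measurable_max borel_measurable_min)
  have fle: "AE x in lebesgue_on ?E. f x \<le> \<bar>u (x, X n) - u (x, \<tau>)\<bar> powr m" for n
    using X(3)[of n]
  proof eventually_elim
    fix x assume "lo \<le> u (x, X n) \<and> u (x, X n) \<le> hi"
    then have "\<bar>u (x, \<tau>) - cl (u (x, \<tau>))\<bar> \<le> \<bar>u (x, X n) - u (x, \<tau>)\<bar>" by (auto simp: cl_def)
    then show "f x \<le> \<bar>u (x, X n) - u (x, \<tau>)\<bar> powr m" unfolding f_def using m by (intro powr_mono2) auto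
  qed
  have iD: "integrable (lebesgue_on ?E) (\<lambda>x. \<bar>u (x, X n) - u (x, \<tau>)\<bar> powr m)" for n
    by (rule in_Lp_diff_integrable[OF L[OF XJ] L[OF \<tau>(1)] m])
  have if': "integrable (lebesgue_on ?E) f"
    by (rule Bochner_Integration.integrable_bound[OF iD[of 0] fm])
       (use fle[of 0] in eventually_elim, auto simp: f_def)
  have "(LINT x|lebesgue_on ?E. f x) \<le> (LINT x|lebesgue_on ?E. \<bar>u (x, X n) - u (x, \<tau>)\<bar> powr m)" for n
    by (rule integral_mono_AE[OF if' iD fle])
  then have "(LINT x|lebesgue_on ?E. f x) \<le> 0"
    by (intro LIMSEQ_le_const[OF lim]) auto
  moreover have f0: "0 \<le> f x" for x by (simp add: f_def)
  then have "0 \<le> (LINT x|lebesgue_on ?E. f x)" by (rule Bochner_Integration.integral_nonneg)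
  ultimately have "(LINT x|lebesgue_on ?E. f x) = 0" by linarith
  then have "AE x in lebesgue_on ?E. f x = 0"
    using integral_nonneg_eq_0_iff_AE[OF if' AE_I2] by (simp add: f0)
  then show ?thesis
  proof eventually_elim
    fix x assume "f x = 0"
    then have "u (x, \<tau>) = cl (u (x, \<tau>))" by (simp add: f_def)
    moreover have "lo \<le> cl v" "cl v \<le> hi" for v using lohi by (auto simp: cl_def)
    ultimately show "lo \<le> u (x, \<tau>) \<and> u (x, \<tau>) \<le> hi" by metis
  qed
qed

section \<open>Comparison of time slices\<close>

lemma compact_in_smaller_cball:
  fixes C :: "'a::euclidean_space set"
  assumes C: "compact C" "C \<subseteq> ball y r" and r: "r > 0"
  obtains \<rho> where "0 < \<rho>" "\<rho> < r" "C \<subseteq> cball y \<rho>"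
proof (cases "C = {}")
  case True
  then show ?thesis using r by (intro that[of "r / 2"]) auto
next
  case False
  obtain x where x: "x \<in> C" "\<And>w. w \<in> C \<Longrightarrow> dist y w \<le> dist y x"
    using continuous_attains_sup[OF C(1) False continuous_on_dist[OF continuous_on_const continuous_on_id]] by blast
  have "dist y x < r" using x(1) C(2) by auto
  then show ?thesis
    using r x(2) by (intro that[of "max (dist y x) (r / 2)"]) (auto simp: le_max_iff_disj)
qed

text \<open>The hypothesis \<open>H\<close> is the absorption of the gradient integral, with \<open>\<Gamma>\<close> as error. Both the sub- and the super-solution
inequality are tested with \<open>\<zeta>^l\<close>, which bounds the difference of two slices at good times in both
directions. Good times are dense and slice means are continuous in time, so the bound holds for all times in
\<open>[s, t]\<close>, and supremum and infimum can be taken.\<close>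

lemma slice_comparison:
  fixes u :: "'a::euclidean_space \<times> real \<Rightarrow> real"
  assumes par: "K1 > 0" "K2 > 0" "p > 1" "q > 1" and \<Omega>: "open \<Omega>"
    and J: "J = {0<..<T} \<or> J = {0<..T}"
    and sc: "structure_conditions K1 K2 p \<Omega> T A"
    and sol: "weak_solution p q \<Omega> J A u"
    and cyl: "r > 0" "s < t" "ball y r \<subseteq> \<Omega>" "{s<..<t} \<subseteq> {0<..<T}"
    and bd: "AE z in lebesgue_on (ball y r \<times> {s<..<t}). lo \<le> u z \<and> u z \<le> hi" and lohi: "lo \<le> hi"
    and ee: "ee = 1 \<or> ee = - 1" and \<mu>: "\<mu> = (if ee = 1 then hi else lo)"
    and \<zeta>: "cutoff c y r \<sigma> \<zeta>" and c: "c > 0" and \<sigma>: "\<sigma> > 0"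
    and \<kappa>: "\<kappa> > 0" and b: "b > 0" "m = (b + 1) * (p - 1)" "m < q" "p * q \<le> l * (q - m)" and l: "l > 1"
    and C1: "C1 = (K2 + 2) / (K1 * (b * 2 powr (- b / 2 - 1)))"
    and \<delta>: "0 < \<delta>" "\<delta> < 1" and \<Gamma>: "\<Gamma> \<ge> 0"
    and H: "\<And>S N Y. 0 \<le> S \<Longrightarrow> 0 \<le> N \<Longrightarrow> (\<And>\<delta>1 \<beta>2. 0 < \<delta>1 \<Longrightarrow> \<delta>1 \<le> 1 / 2 \<Longrightarrow> 0 < \<beta>2 \<Longrightarrow>
        Y \<le> 2 * \<delta>1 * S * N + 2 * (\<delta>1 * \<kappa> powr b / C1) powr (1 - p) * (l * c / (\<sigma> * r)) powr p * (t - s) * N *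
          (\<beta>2 * 4 powr q * (S + \<kappa> powr q) + \<beta>2 powr (- (m / (q - m))))) \<Longrightarrow> K2 * Y \<le> N * (\<delta> * S + \<Gamma>)"
  shows "(SUP \<tau>\<in>{s..t} \<inter> J. slice_mean q l u y r \<zeta> ee \<mu> \<tau>)
      \<le> 1 / (1 - \<delta>) * (INF \<tau>\<in>{s..t} \<inter> J. slice_mean q l u y r \<zeta> ee \<mu> \<tau>) + \<Gamma> / (1 - \<delta>)"
proof -
  define JJ where "JJ = {s..t} \<inter> J"
  define I where "I \<tau> = slice_mean q l u y r \<zeta> ee \<mu> \<tau>" for \<tau>
  have stJ: "{s<..<t} \<subseteq> J" using cyl(4) J by (auto simp: greaterThanLessThan_subseteq_greaterThanLessThan)
  have stJJ: "{s<..<t} \<subseteq> JJ" using stJ by (auto simp: JJ_def)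
  have \<zeta>C1: "C_k 1 \<zeta>" "compact_support_in \<zeta> (ball y r)" using \<zeta> by (auto simp: cutoff_def C1_0_def)
  have \<zeta>01: "0 \<le> \<zeta> x" "\<zeta> x \<le> 1" for x using \<zeta> by (auto simp: cutoff_def)
  have \<zeta>g: "norm (grad \<zeta> x) \<le> c / (\<sigma> * r)" for x using \<zeta> by (auto simp: cutoff_def)
  have [measurable]: "\<zeta> \<in> borel_measurable borel"
    by (rule borel_measurable_continuous_onI[OF C_k_cont[OF \<zeta>C1(1)]])
  define C where "C = closure {x. \<zeta> x \<noteq> 0}"
  have C: "compact C" "C \<subseteq> ball y r" using \<zeta>C1(2) by (auto simp: compact_support_in_def C_def)
  obtain \<rho> where \<rho>: "0 < \<rho>" "\<rho> < r" "C \<subseteq> cball y \<rho>" using compact_in_smaller_cball[OF C cyl(1)] by metis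
  have \<zeta>0: "\<zeta> x = 0" if "x \<notin> cball y \<rho>" for x
    using that \<rho>(3) closure_subset[of "{x. \<zeta> x \<noteq> 0}"] unfolding C_def by blast
  define R where "R = (\<rho> + r) / 2"
  have R: "\<rho> < R" "R < r" "0 < R" using \<rho> by (auto simp: R_def)
  define E where "E = cball y R"
  have E: "compact E" "E \<subseteq> ball y r" "E \<subseteq> \<Omega>" using R cyl(3) by (auto simp: E_def)
  have Em: "E \<in> sets lebesgue" by (simp add: E_def)
  define N where "N = measure lebesgue (ball y r)"
  have N0: "N > 0" using content_ball_pos[OF cyl(1), of y] by (simp add: N_def)
  have EN: "measure lborel E \<le> N"
  proof -
    have "measure lborel E = measure lebesgue E" by (simp add: E_def)
    also have "\<dots> \<le> N" unfolding N_def by (rule measure_mono_fmeasurable[OF E(2) Em lmeasurable_ball])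
    finally show ?thesis .
  qed
  let ?Z = "\<lambda>x. \<zeta> x powr l"
  note Z = cutoff_power[OF \<zeta>C1(1) \<zeta>01(1) l]
  have Z01: "0 \<le> ?Z x" "?Z x \<le> 1" for x using \<zeta>01[of x] l by (auto intro!: powr_le1)
  define D where "D = l * c / (\<sigma> * r)"
  have D: "D > 0" using l c \<sigma> cyl(1) by (simp add: D_def)
  have DZ: "norm (grad ?Z x) \<le> D * \<zeta> x powr (l - 1)" for x
  proof -
    have "norm (grad ?Z x) = l * \<zeta> x powr (l - 1) * norm (grad \<zeta> x)" using l unfolding Z(2) by simp
    also have "\<dots> \<le> l * \<zeta> x powr (l - 1) * (c / (\<sigma> * r))" using l \<zeta>g by (intro mult_left_mono) auto
    finally show ?thesis by (simp add: D_def mult_ac)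
  qed
  have subs: "weak_sub_solution p q \<Omega> J A u" "weak_super_solution p q \<Omega> J A u"
    using sol by (auto simp: weak_solution_def)
  have Cq: "C_loc_Lp_loc (q + 1) J \<Omega> u" using subs(1) by (simp add: weak_sub_solution_def)
  have CE: "C_loc_Lp (q + 1) J E u" using Cq E unfolding C_loc_Lp_loc_def by blast
  have uE: "in_Lp (q + 1) E (\<lambda>x. u (x, \<tau>))" if "\<tau> \<in> J" for \<tau> using CE that unfolding C_loc_Lp_def by blast
  have bds: "AE x in lebesgue_on E. lo \<le> u (x, \<tau>) \<and> u (x, \<tau>) \<le> hi" if "\<tau> \<in> JJ" for \<tau>
    unfolding E_def using that par(4)
    by (intro slice_bounds[OF CE[unfolded E_def] _ bd R(2) cyl(2) stJ _ _ _ lohi]) (auto simp: JJ_def)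
  have NI: "N * I \<tau> = (LINT x|lebesgue_on E. ee * (spow q \<mu> - spow q (u (x, \<tau>))) * ?Z x)" for \<tau>
  proof -
    have "(LINT x|lebesgue_on (ball y r). ee * (spow q \<mu> - spow q (u (x, \<tau>))) * ?Z x)
        = (LINT x|lebesgue. indicator (ball y r) x *\<^sub>R (ee * (spow q \<mu> - spow q (u (x, \<tau>))) * ?Z x))"
      by (rule integral_restrict_space) auto
    also have "\<dots> = (LINT x|lebesgue. indicator E x *\<^sub>R (ee * (spow q \<mu> - spow q (u (x, \<tau>))) * ?Z x))"
    proof (intro Bochner_Integration.integral_cong refl)
      fix x
      show "indicator (ball y r) x *\<^sub>R (ee * (spow q \<mu> - spow q (u (x, \<tau>))) * ?Z x) = indicator E x *\<^sub>R (ee * (spow q \<mu> - spow q (u (x, \<tau>))) * ?Z x)"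
      proof (cases "x \<in> cball y \<rho>")
        case True
        then have "x \<in> E" using R by (simp add: E_def)
        then show ?thesis using E(2) by (auto simp: indicator_def)
      next
        case False
        then show ?thesis using \<zeta>0[OF False] by simp
      qed
    qed
    also have "\<dots> = (LINT x|lebesgue_on E. ee * (spow q \<mu> - spow q (u (x, \<tau>))) * ?Z x)"
      by (rule integral_restrict_space[symmetric]) (use Em in auto)
    finally show ?thesis using N0 by (simp add: I_def slice_mean_def N_def)
  qed
  have spm: "spow q \<in> borel_measurable borel" by (rule borel_measurable_continuous_onI[OF continuous_on_spow[OF par(4)]])
  have fin: "integrable (lebesgue_on E) (\<lambda>x. k)" for k :: real
  proof -
    have "integrable (lebesgue_on E) (\<lambda>x. k) \<longleftrightarrow> integrable lborel (\<lambda>x. indicator E x * k)"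
      by (rule lebesgue_on_AE_eq(2)[OF Em]) (auto simp: E_def intro!: borel_measurable_times borel_measurable_indicator)
    moreover have "integrable lborel (\<lambda>x. indicator E x * k)"
      using emeasure_lborel_cball_finite[of y R] by (intro integrable_mult_left integrable_real_indicator) (auto simp: E_def)
    ultimately show ?thesis by blast
  qed
  have gm: "(\<lambda>x. ee * (spow q \<mu> - spow q (u (x, \<tau>))) * ?Z x) \<in> borel_measurable (lebesgue_on E)" if "\<tau> \<in> J" for \<tau>
  proof -
    have 1: "(\<lambda>x. u (x, \<tau>)) \<in> borel_measurable (lebesgue_on E)" using uE[OF that] by (simp add: in_Lp_def)
    have 2: "?Z \<in> borel_measurable (lebesgue_on E)"
      by (rule lebesgue_on_AE_eq(3)[OF Em, of "\<lambda>x. indicator E x *\<^sub>R ?Z x"]) (auto simp: E_def intro!: borel_measurable_times borel_measurable_indicator)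
    show ?thesis
      by (intro borel_measurable_times borel_measurable_diff borel_measurable_const 2 measurable_compose[OF 1 spm])
  qed
  define W where "W = spow q hi - spow q lo"
  have W0: "0 \<le> W" using spow_mono[OF par(4) lohi] by (simp add: W_def)
  have gb: "AE x in lebesgue_on E. 0 \<le> ee * (spow q \<mu> - spow q (u (x, \<tau>))) * ?Z x \<and> ee * (spow q \<mu> - spow q (u (x, \<tau>))) * ?Z x \<le> W"
    if "\<tau> \<in> JJ" for \<tau>
    using bds[OF that]
  proof eventually_elim
    fix x assume "lo \<le> u (x, \<tau>) \<and> u (x, \<tau>) \<le> hi"
    then have "0 \<le> ee * (spow q \<mu> - spow q (u (x, \<tau>)))" "ee * (spow q \<mu> - spow q (u (x, \<tau>))) \<le> W"
      using ee spow_mono[OF par(4), of lo "u (x, \<tau>)"] spow_mono[OF par(4), of "u (x, \<tau>)" hi] by (auto simp: W_def \<mu>)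
    then show "0 \<le> ee * (spow q \<mu> - spow q (u (x, \<tau>))) * ?Z x \<and> ee * (spow q \<mu> - spow q (u (x, \<tau>))) * ?Z x \<le> W"
      using Z01[of x] mult_mono[of "ee * (spow q \<mu> - spow q (u (x, \<tau>)))" W "?Z x" 1] W0 by simp
  qed
  have gi: "integrable (lebesgue_on E) (\<lambda>x. ee * (spow q \<mu> - spow q (u (x, \<tau>))) * ?Z x)" if "\<tau> \<in> JJ" for \<tau>
  proof (rule Bochner_Integration.integrable_bound[OF fin[of W]])
    show "(\<lambda>x. ee * (spow q \<mu> - spow q (u (x, \<tau>))) * ?Z x) \<in> borel_measurable (lebesgue_on E)"
      using that by (intro gm) (simp add: JJ_def)
    show "AE x in lebesgue_on E. norm (ee * (spow q \<mu> - spow q (u (x, \<tau>))) * ?Z x) \<le> norm W"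
      using gb[OF that]
    proof eventually_elim
      fix x assume h: "0 \<le> ee * (spow q \<mu> - spow q (u (x, \<tau>))) * ?Z x \<and> ee * (spow q \<mu> - spow q (u (x, \<tau>))) * ?Z x \<le> W"
      then show "norm (ee * (spow q \<mu> - spow q (u (x, \<tau>))) * ?Z x) \<le> norm W"
        unfolding real_norm_def by linarith
    qed
  qed
  have I0: "0 \<le> I \<tau>" if "\<tau> \<in> JJ" for \<tau>
  proof -
    have "0 \<le> N * I \<tau>" unfolding NI
      by (rule integral_nonneg_AE) (use gb[OF that] in eventually_elim, blast)
    then show ?thesis using N0 by (simp add: zero_le_mult_iff)
  qed
  define Bd where "Bd = (LINT x|lebesgue_on E. W) / N"
  have IB: "I \<tau> \<le> Bd" if "\<tau> \<in> JJ" for \<tau>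
  proof -
    have "N * I \<tau> \<le> (LINT x|lebesgue_on E. W)" unfolding NI
      by (rule integral_mono_AE[OF gi[OF that] fin]) (use gb[OF that] in eventually_elim, blast)
    then show ?thesis using N0 by (simp add: Bd_def pos_le_divide_eq mult.commute)
  qed
  define L where "L = q * (\<bar>lo\<bar> + \<bar>hi\<bar>) powr (q - 1)"
  have L0: "0 \<le> L" using par by (simp add: L_def)
  have Icont: "(\<lambda>n. I (X n)) \<longlonglongrightarrow> I \<tau>" if \<tau>: "\<tau> \<in> JJ" and X: "\<And>n. X n \<in> JJ" "X \<longlonglongrightarrow> \<tau>" for \<tau> X
  proof -
    have \<tau>J: "\<tau> \<in> J" "X n \<in> J" for n using \<tau> X(1) by (auto simp: JJ_def)
    note lim = C_loc_Lp_sequentially[OF CE \<tau>J X(2)]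
    have iD: "integrable (lebesgue_on E) (\<lambda>x. \<bar>u (x, X n) - u (x, \<tau>)\<bar> powr (q + 1))" for n
      by (rule in_Lp_diff_integrable[OF uE[OF \<tau>J(2)] uE[OF \<tau>J(1)]]) (use par in simp)
    have "(\<lambda>n. \<bar>N * I (X n) - N * I \<tau>\<bar>) \<longlonglongrightarrow> 0"
    proof (rule young_bound_tendsto_0[OF abs_ge_zero _ lim, where A="LINT x|lebesgue_on E. L" and B=L and p="q + 1"])
      fix n and \<beta> :: real assume \<beta>: "\<beta> > 0"
      have "\<bar>N * I (X n) - N * I \<tau>\<bar> = \<bar>LINT x|lebesgue_on E. ee * (spow q \<mu> - spow q (u (x, X n))) * ?Z x - ee * (spow q \<mu> - spow q (u (x, \<tau>))) * ?Z x\<bar>"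
        unfolding NI Bochner_Integration.integral_diff[OF gi[OF X(1)] gi[OF \<tau>]] ..
      also have "\<dots> \<le> (LINT x|lebesgue_on E. norm (ee * (spow q \<mu> - spow q (u (x, X n))) * ?Z x - ee * (spow q \<mu> - spow q (u (x, \<tau>))) * ?Z x))"
        unfolding real_norm_def[symmetric] by (rule integral_norm_bound)
      also have "\<dots> \<le> (LINT x|lebesgue_on E. \<beta> * L + \<beta> powr (1 - (q + 1)) * (L * \<bar>u (x, X n) - u (x, \<tau>)\<bar> powr (q + 1)))"
      proof (rule integral_mono_AE)
        show "integrable (lebesgue_on E) (\<lambda>x. norm (ee * (spow q \<mu> - spow q (u (x, X n))) * ?Z x - ee * (spow q \<mu> - spow q (u (x, \<tau>))) * ?Z x))"
          by (rule integrable_norm[OF Bochner_Integration.integrable_diff[OF gi[OF X(1)] gi[OF \<tau>]]])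
        show "integrable (lebesgue_on E) (\<lambda>x. \<beta> * L + \<beta> powr (1 - (q + 1)) * (L * \<bar>u (x, X n) - u (x, \<tau>)\<bar> powr (q + 1)))"
          by (intro Bochner_Integration.integrable_add integrable_mult_right fin iD)
        show "AE x in lebesgue_on E. norm (ee * (spow q \<mu> - spow q (u (x, X n))) * ?Z x - ee * (spow q \<mu> - spow q (u (x, \<tau>))) * ?Z x)
            \<le> \<beta> * L + \<beta> powr (1 - (q + 1)) * (L * \<bar>u (x, X n) - u (x, \<tau>)\<bar> powr (q + 1))"
          using bds[OF X(1)[of n]] bds[OF \<tau>]
        proof eventually_elim
          fix x assume h: "lo \<le> u (x, X n) \<and> u (x, X n) \<le> hi" "lo \<le> u (x, \<tau>) \<and> u (x, \<tau>) \<le> hi"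
          have "ee * (spow q \<mu> - spow q (u (x, X n))) * ?Z x - ee * (spow q \<mu> - spow q (u (x, \<tau>))) * ?Z x
             = - ee * (spow q (u (x, X n)) - spow q (u (x, \<tau>))) * ?Z x" by (simp add: algebra_simps)
          moreover have "\<bar>- ee * (spow q (u (x, X n)) - spow q (u (x, \<tau>))) * ?Z x\<bar> = \<bar>spow q (u (x, X n)) - spow q (u (x, \<tau>))\<bar> * ?Z x"
            using ee Z01(1)[of x] by (auto simp: abs_mult)
          moreover have "\<bar>spow q (u (x, X n)) - spow q (u (x, \<tau>))\<bar> * ?Z x \<le> (L * \<bar>u (x, X n) - u (x, \<tau>)\<bar>) * 1"
            using h Z01[of x] L0 unfolding L_def by (intro mult_mono spow_lipschitz[OF par(4)]) auto
          moreover have "L * \<bar>u (x, X n) - u (x, \<tau>)\<bar> \<le> L * (\<beta> + \<beta> powr (1 - (q + 1)) * \<bar>u (x, X n) - u (x, \<tau>)\<bar> powr (q + 1))"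
            using par \<beta> by (intro mult_left_mono[OF _ L0] young_split1) auto
          ultimately show "norm (ee * (spow q \<mu> - spow q (u (x, X n))) * ?Z x - ee * (spow q \<mu> - spow q (u (x, \<tau>))) * ?Z x)
            \<le> \<beta> * L + \<beta> powr (1 - (q + 1)) * (L * \<bar>u (x, X n) - u (x, \<tau>)\<bar> powr (q + 1))"
            unfolding real_norm_def by (simp add: algebra_simps)
        qed
      qed
      also have "\<dots> = \<beta> * (LINT x|lebesgue_on E. L) + \<beta> powr (1 - (q + 1)) * (L * (LINT x|lebesgue_on E. \<bar>u (x, X n) - u (x, \<tau>)\<bar> powr (q + 1)))"
        by (simp only: Bochner_Integration.integral_add[OF integrable_mult_right[OF fin] integrable_mult_right[OF integrable_mult_right[OF iD]]] integral_mult_right_zero)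
      finally show "\<bar>N * I (X n) - N * I \<tau>\<bar> \<le> \<beta> * (LINT x|lebesgue_on E. L) + \<beta> powr (1 - (q + 1)) * (L * (LINT x|lebesgue_on E. \<bar>u (x, X n) - u (x, \<tau>)\<bar> powr (q + 1)))" .
    qed (rule Bochner_Integration.integral_nonneg, rule L0)
    then have "(\<lambda>n. N * I (X n) - N * I \<tau>) \<longlonglongrightarrow> 0" by (rule tendsto_rabs_zero_cancel)
    then have "(\<lambda>n. N * I (X n)) \<longlonglongrightarrow> N * I \<tau>" by (rule LIM_zero_cancel)
    then have "(\<lambda>n. N * I (X n) / N) \<longlonglongrightarrow> N * I \<tau> / N" by (rule tendsto_divide[OF _ tendsto_const]) (use N0 in simp)
    then show ?thesis using N0 by simp
  qed
  define S where "S = (SUP \<tau>\<in>JJ. I \<tau>)"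
  have bdd: "bdd_above (I ` JJ)" by (rule bdd_aboveI2[OF IB])
  have IS: "I \<tau> \<le> S" if "\<tau> \<in> JJ" for \<tau> unfolding S_def by (rule cSUP_upper[OF that bdd])
  have mid: "(s + t) / 2 \<in> JJ" using stJJ cyl(2) by (auto simp: subset_iff)
  have S0: "0 \<le> S" using I0[OF mid] IS[OF mid] by linarith
  have good: "\<exists>T0. (AE \<tau> in lborel. \<tau> \<in> {\<alpha>..\<beta>} \<longrightarrow> \<tau> \<in> T0) \<and>
      (\<forall>t1\<in>T0. \<forall>t2\<in>T0. \<alpha> < t1 \<and> t1 < t2 \<longrightarrow> - (e * ee) * (I t2 - I t1) \<le> \<delta> * S + \<Gamma>)"
    if e: "e = 1 \<or> e = - 1" and ab: "s < \<alpha>" "\<alpha> < \<beta>" "\<beta> < t" for e \<alpha> \<beta>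
  proof -
    have "\<exists>Du. Lp_loc_W1p_loc p J \<Omega> u Du \<and>
        (\<forall>E t1 t2 \<zeta> \<zeta>t D\<zeta>. compact E \<and> E \<subseteq> \<Omega> \<and> t1 \<le> t2 \<and> {t1..t2} \<subseteq> J \<and> test_function p q J E \<zeta> \<zeta>t D\<zeta>
           \<longrightarrow> e * weak_form q A u Du E t1 t2 \<zeta> \<zeta>t D\<zeta> \<le> 0)"
    proof (cases "e = 1")
      case True
      then show ?thesis using subs(1) unfolding weak_sub_solution_def by simp
    next
      case False
      then have "e = - 1" using e by simp
      then show ?thesis using subs(2) unfolding weak_super_solution_def by simp
    qed
    then obtain Du where Du: "Lp_loc_W1p_loc p J \<Omega> u Du \<and>
        (\<forall>E t1 t2 \<zeta> \<zeta>t D\<zeta>. compact E \<and> E \<subseteq> \<Omega> \<and> t1 \<le> t2 \<and> {t1..t2} \<subseteq> J \<and> test_function p q J E \<zeta> \<zeta>t D\<zeta>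
           \<longrightarrow> e * weak_form q A u Du E t1 t2 \<zeta> \<zeta>t D\<zeta> \<le> 0)" ..
    have weak: "e * weak_form q A u Du F t1 t2 \<eta> \<eta>t D\<eta> \<le> 0"
      if "compact F" "F \<subseteq> \<Omega>" "t1 \<le> t2" "{t1..t2} \<subseteq> J" "test_function p q J F \<eta> \<eta>t D\<eta>" for F t1 t2 \<eta> \<eta>t D\<eta>
      by (rule conjunct2[OF Du, rule_format]) (intro conjI that)
    have "\<exists>V G a T0. weak_slab y R \<rho> \<alpha> \<beta> V G a e K1 K2 p q lo hi T0 \<and>
        (\<forall>\<tau>\<in>T0. AE x in lborel. x \<in> cball y R \<longrightarrow> V (x, \<tau>) = u (x, \<tau>))"
      by (rule solution_gives_weak_slab[OF par \<Omega> J sc Cq conjunct1[OF Du] weak e cyl(3,4) bd ab \<rho>(1) R(1,2) lohi])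
         (assumption | intro exI conjI ballI)+
    then obtain V G a T0 where slab: "weak_slab y R \<rho> \<alpha> \<beta> V G a e K1 K2 p q lo hi T0"
      and VT0: "\<forall>\<tau>\<in>T0. AE x in lborel. x \<in> cball y R \<longrightarrow> V (x, \<tau>) = u (x, \<tau>)"
      by (elim exE conjE) (rule that)
    note VT = bspec[OF VT0]
    interpret weak_slab y R \<rho> \<alpha> \<beta> V G a e K1 K2 p q lo hi T0 by (rule slab)
    have TJ: "\<tau> \<in> JJ" if "\<tau> \<in> T0" for \<tau> using that T0_sub ab stJJ by (auto simp: subset_iff)
    have NIV: "N * I \<tau> = (LINT x|lborel. indicator (cball y R) x * (ee * (spow q \<mu> - spow q (V (x, \<tau>))) * ?Z x))" if \<tau>: "\<tau> \<in> T0" for \<tau>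
      unfolding NI
    proof (rule lebesgue_on_AE_eq(1)[OF Em])
      show "AE x in lborel. indicator E x *\<^sub>R (ee * (spow q \<mu> - spow q (u (x, \<tau>))) * ?Z x) = indicator (cball y R) x * (ee * (spow q \<mu> - spow q (V (x, \<tau>))) * ?Z x)"
        using VT[OF \<tau>] by eventually_elim (auto simp: E_def indicator_def)
      have [measurable]: "cball y R \<in> sets borel" by simp
      show "(\<lambda>x. indicator (cball y R) x * (ee * (spow q \<mu> - spow q (V (x, \<tau>))) * ?Z x)) \<in> borel_measurable borel" by measurable
    qed
    have Zsupp: "?Z x = 0" if "x \<notin> cball y \<rho>" for x using \<zeta>0[OF that] by simp
    have "- (e * ee) * (I t2 - I t1) \<le> \<delta> * S + \<Gamma>" if t12: "t1 \<in> T0" "t2 \<in> T0" "\<alpha> < t1" "t1 < t2" for t1 t2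
    proof -
      define Y where "Y = (LINT z|lborel. indicator {t1..t2} (snd z) * (norm (G z) powr (p - 1) * norm (grad ?Z (fst z))))"
      have "K2 * Y \<le> N * (\<delta> * S + \<Gamma>)"
      proof (rule H[OF S0 less_imp_le[OF N0]])
        fix \<delta>1 \<beta>2 :: real assume d: "0 < \<delta>1" "\<delta>1 \<le> 1 / 2" "0 < \<beta>2"
        show "Y \<le> 2 * \<delta>1 * S * N + 2 * (\<delta>1 * \<kappa> powr b / C1) powr (1 - p) * (l * c / (\<sigma> * r)) powr p * (t - s) * N *
          (\<beta>2 * 4 powr q * (S + \<kappa> powr q) + \<beta>2 powr (- (m / (q - m))))"
          unfolding Y_def D_def[symmetric]
        proof (rule gradient_integral_bound[where ee=ee and \<mu>=\<mu>])
          show "(LINT x|lborel. indicator (cball y R) x * (ee * (spow q \<mu> - spow q (V (x, \<tau>))) * ?Z x)) \<le> S * N" if "\<tau> \<in> T0" for \<tau>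
            using mult_right_mono[OF IS[OF TJ[OF that]] less_imp_le[OF N0]] NIV[OF that] by (simp add: mult.commute)
          show "t2 - t1 \<le> t - s" using t12 T0_sub ab by (auto simp: subset_iff)
          show "measure lborel (cball y R) \<le> N" using EN by (simp only: E_def)
        qed (use \<zeta>01 Z(1) \<zeta>0 DZ D ee \<mu> S0 t12 \<kappa> b C1 d in auto)
      qed
      moreover have "e * (LINT x|lborel. indicator (cball y R) x * (spow q (V (x, t2)) - spow q (V (x, t1))) * ?Z x) \<le> K2 * Y"
        unfolding Y_def by (rule linear_ineq[OF t12(1,2) _ Z(1) Z01(1) Zsupp]) (use t12 in simp)
      moreover have "(LINT x|lborel. indicator (cball y R) x * (spow q (V (x, t2)) - spow q (V (x, t1))) * ?Z x) = - ee * (N * I t2 - N * I t1)"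
      proof -
        have [measurable]: "cball y R \<in> sets borel" by simp
        have i: "integrable lborel (\<lambda>x. indicator (cball y R) x * (ee * (spow q \<mu> - spow q (V (x, \<tau>))) * ?Z x))" for \<tau>
        proof (rule bounded_on_ball_integrable)
          fix x
          have "0 \<le> ee * (spow q \<mu> - spow q (V (x, \<tau>)))" "ee * (spow q \<mu> - spow q (V (x, \<tau>))) \<le> W"
            using ee spow_mono[OF par(4) V_range(1)[of "(x, \<tau>)"]] spow_mono[OF par(4) V_range(2)[of "(x, \<tau>)"]] by (auto simp: W_def \<mu>)
          then show "\<bar>ee * (spow q \<mu> - spow q (V (x, \<tau>))) * ?Z x\<bar> \<le> W * 1"
            unfolding abs_mult[of _ "?Z x"] using Z01[of x] by (intro mult_mono) auto
        qed measurable
        have "(LINT x|lborel. indicator (cball y R) x * (spow q (V (x, t2)) - spow q (V (x, t1))) * ?Z x)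
           = (LINT x|lborel. - ee * (indicator (cball y R) x * (ee * (spow q \<mu> - spow q (V (x, t2))) * ?Z x) - indicator (cball y R) x * (ee * (spow q \<mu> - spow q (V (x, t1))) * ?Z x)))"
          using ee by (intro Bochner_Integration.integral_cong refl) (auto simp: algebra_simps)
        also have "\<dots> = - ee * (N * I t2 - N * I t1)"
          unfolding NIV[OF t12(1)] NIV[OF t12(2)] by (simp only: integral_mult_right_zero Bochner_Integration.integral_diff[OF i i])
        finally show ?thesis .
      qed
      ultimately have "e * (- ee * (N * I t2 - N * I t1)) \<le> N * (\<delta> * S + \<Gamma>)" by simp
      moreover have "N * (- (e * ee) * (I t2 - I t1)) = e * (- ee * (N * I t2 - N * I t1))" by (simp add: algebra_simps)
      ultimately have "N * (- (e * ee) * (I t2 - I t1)) \<le> N * (\<delta> * S + \<Gamma>)" by linarith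
      then show ?thesis by (rule mult_left_le_imp_le[OF _ N0])
    qed
    then show ?thesis using T0_AE by (intro exI[of _ T0]) blast
  qed
  (* The order of the two times does not matter: e = 1 and e = -1 give both signs of the difference. *)
  have two_sided: "I \<tau>1 - I \<tau>2 \<le> \<delta> * S + \<Gamma>" if \<tau>: "\<tau>1 \<in> JJ" "\<tau>2 \<in> JJ" for \<tau>1 \<tau>2
  proof -
    have seq: "\<exists>O1 O2. s < O1 \<and> O1 < O2 \<and> O2 < t \<and> (\<forall>x\<in>{O1<..<O2}. \<bar>x - \<tau>\<bar> < d)" if "\<tau> \<in> JJ" "d > 0" for \<tau> d
    proof -
      define a where "a = max s (\<tau> - d)"
      define b where "b = min t (\<tau> + d)"
      have ab: "a < b" "s \<le> a" "b \<le> t" "\<tau> - d \<le> a" "b \<le> \<tau> + d" using that cyl(2) by (auto simp: a_def b_def JJ_def)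
      show ?thesis
        by (rule exI[of _ "a + (b - a) / 3"], rule exI[of _ "b - (b - a) / 3"]) (use ab in \<open>auto simp: abs_less_iff field_simps\<close>)
    qed
    have "\<exists>x1 x2. x1 \<in> {s<..<t} \<and> x2 \<in> {s<..<t} \<and> \<bar>x1 - \<tau>1\<bar> < 1 / real (Suc n) \<and> \<bar>x2 - \<tau>2\<bar> < 1 / real (Suc n) \<and> I x1 - I x2 \<le> \<delta> * S + \<Gamma>" for n
    proof -
      define d where "d = 1 / real (Suc n)"
      have d: "d > 0" by (simp add: d_def)
      obtain O1 O2 where O: "s < O1" "O1 < O2" "O2 < t" "\<And>x. x \<in> {O1<..<O2} \<Longrightarrow> \<bar>x - \<tau>1\<bar> < d"
        using seq[OF \<tau>(1) d] by blast
      obtain P1 P2 where P: "s < P1" "P1 < P2" "P2 < t" "\<And>x. x \<in> {P1<..<P2} \<Longrightarrow> \<bar>x - \<tau>2\<bar> < d"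
        using seq[OF \<tau>(2) d] by blast
      define \<alpha> where "\<alpha> = min O1 P1"
      define \<beta> where "\<beta> = max O2 P2"
      have ab: "s < \<alpha>" "\<alpha> < \<beta>" "\<beta> < t" using O P by (auto simp: \<alpha>_def \<beta>_def)
      obtain Tp where Tp: "AE \<tau> in lborel. \<tau> \<in> {\<alpha>..\<beta>} \<longrightarrow> \<tau> \<in> Tp"
        "\<And>t1 t2. t1 \<in> Tp \<Longrightarrow> t2 \<in> Tp \<Longrightarrow> \<alpha> < t1 \<Longrightarrow> t1 < t2 \<Longrightarrow> - (1 * ee) * (I t2 - I t1) \<le> \<delta> * S + \<Gamma>"
        using good[of 1, OF _ ab] by blast
      obtain Tm where Tm: "AE \<tau> in lborel. \<tau> \<in> {\<alpha>..\<beta>} \<longrightarrow> \<tau> \<in> Tm"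
        "\<And>t1 t2. t1 \<in> Tm \<Longrightarrow> t2 \<in> Tm \<Longrightarrow> \<alpha> < t1 \<Longrightarrow> t1 < t2 \<Longrightarrow> - (- 1 * ee) * (I t2 - I t1) \<le> \<delta> * S + \<Gamma>"
        using good[of "- 1", OF _ ab] by blast
      have AE: "AE \<tau> in lborel. \<tau> \<in> {\<alpha>..\<beta>} \<longrightarrow> \<tau> \<in> Tp \<and> \<tau> \<in> Tm"
        using Tp(1) Tm(1) by eventually_elim blast
      obtain x1 where x1: "x1 \<in> {O1<..<O2}" "x1 \<in> {\<alpha>..\<beta>} \<longrightarrow> x1 \<in> Tp \<and> x1 \<in> Tm"
        using AE_point_in_interval[OF AE O(2)] by blast
      obtain x2 where x2: "x2 \<in> {P1<..<P2}" "x2 \<in> {\<alpha>..\<beta>} \<longrightarrow> x2 \<in> Tp \<and> x2 \<in> Tm"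
        using AE_point_in_interval[OF AE P(2)] by blast
      have in1: "\<alpha> < x1" "x1 \<le> \<beta>" "s < x1" "x1 < t" using x1(1) O by (auto simp: \<alpha>_def \<beta>_def)
      have in2: "\<alpha> < x2" "x2 \<le> \<beta>" "s < x2" "x2 < t" using x2(1) P by (auto simp: \<alpha>_def \<beta>_def)
      have T1: "x1 \<in> Tp" "x1 \<in> Tm" using x1(2) in1 by auto
      have T2: "x2 \<in> Tp" "x2 \<in> Tm" using x2(2) in2 by auto
      have R0: "0 \<le> \<delta> * S + \<Gamma>" using \<delta> S0 \<Gamma> by simp
      have "I x1 - I x2 \<le> \<delta> * S + \<Gamma>"
      proof (rule linorder_cases[of x1 x2])
        assume lt: "x1 < x2"
        show ?thesis using Tp(2)[OF T1(1) T2(1) in1(1) lt] Tm(2)[OF T1(2) T2(2) in1(1) lt] ee by auto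
      next
        assume lt: "x2 < x1"
        show ?thesis using Tp(2)[OF T2(1) T1(1) in2(1) lt] Tm(2)[OF T2(2) T1(2) in2(1) lt] ee by auto
      next
        assume "x1 = x2"
        then show ?thesis using R0 by simp
      qed
      then show ?thesis using in1 in2 O(4)[OF x1(1)] P(4)[OF x2(1)] unfolding d_def
        by (intro exI[of _ x1] exI[of _ x2]) auto
    qed
    then obtain X1 X2 where X: "\<And>n. X1 n \<in> {s<..<t}" "\<And>n. X2 n \<in> {s<..<t}" "\<And>n. \<bar>X1 n - \<tau>1\<bar> < 1 / real (Suc n)"
      "\<And>n. \<bar>X2 n - \<tau>2\<bar> < 1 / real (Suc n)" "\<And>n. I (X1 n) - I (X2 n) \<le> \<delta> * S + \<Gamma>" by metis
    have conv: "X \<longlonglongrightarrow> \<tau>" if "\<And>n. \<bar>X n - \<tau>\<bar> < 1 / real (Suc n)" for X \<tau>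
    proof -
      have "(\<lambda>n. X n - \<tau>) \<longlonglongrightarrow> 0"
        by (rule Lim_null_comparison[OF always_eventually LIMSEQ_inverse_real_of_nat])
           (use that in \<open>auto simp: inverse_eq_divide less_imp_le\<close>)
      then show ?thesis by (rule LIM_zero_cancel)
    qed
    have "(\<lambda>n. I (X1 n) - I (X2 n)) \<longlonglongrightarrow> I \<tau>1 - I \<tau>2"
      using X(1,2) stJJ by (intro tendsto_diff Icont \<tau> conv X(3,4)) blast+
    then show ?thesis by (rule LIMSEQ_le_const2) (intro exI allI impI X(5))
  qed
  have "(1 - \<delta>) * S - \<Gamma> \<le> I \<tau>2" if "\<tau>2 \<in> JJ" for \<tau>2
  proof -
    have "S \<le> I \<tau>2 + \<delta> * S + \<Gamma>"
      unfolding S_def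
    proof (rule cSUP_least)
      show "JJ \<noteq> {}" using mid by blast
      show "I \<tau> \<le> I \<tau>2 + \<delta> * (SUP \<tau>\<in>JJ. I \<tau>) + \<Gamma>" if "\<tau> \<in> JJ" for \<tau>
        using two_sided[OF that \<open>\<tau>2 \<in> JJ\<close>] unfolding S_def by linarith
    qed
    then show ?thesis by (simp add: algebra_simps)
  qed
  then have "(1 - \<delta>) * S - \<Gamma> \<le> (INF \<tau>\<in>JJ. I \<tau>)"
    using mid by (intro cINF_greatest) auto
  then have "S \<le> ((INF \<tau>\<in>JJ. I \<tau>) + \<Gamma>) / (1 - \<delta>)"
    using \<delta> by (simp add: pos_le_divide_eq algebra_simps)
  then show ?thesis
    unfolding S_def I_def JJ_def by (simp add: add_divide_distrib)
qed

theorem theorem1p3: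
  fixes K1 K2 p q l c :: real
  assumes "K1 > 0" and "K2 > 0" and "p > 1" and "q > p - 1" and "q > 1"
    and "l \<ge> 2 * q * p^2 / (q - p + 1)" and "c > 0"
  shows "\<exists>\<gamma>>0. \<forall>(\<Omega> :: (real^'n) set) T J A u y r s t \<mu>m \<mu>p \<delta> \<sigma> \<zeta>.
    open \<Omega> \<and> T > 0 \<and> (J = {0<..<T} \<or> J = {0<..T}) \<and>
    structure_conditions K1 K2 p \<Omega> T A \<and>
    weak_solution p q \<Omega> J A u \<and> locally_bounded (\<Omega> \<times> {0<..<T}) u \<and>
    r > 0 \<and> s < t \<and> ball y r \<times> {s<..<t} \<subseteq> \<Omega> \<times> {0<..<T} \<and>
    (AE z in lebesgue_on (ball y r \<times> {s<..<t}). \<mu>m \<le> u z \<and> u z \<le> \<mu>p) \<and>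
    \<delta> \<in> {0<..<1} \<and> \<sigma> \<in> {0<..<1} \<and> cutoff c y r \<sigma> \<zeta>
    \<longrightarrow> (\<forall>(e, \<mu>) \<in> {(1, \<mu>p), (-1, \<mu>m)}.
      (SUP \<tau>\<in>{s..t} \<inter> J. slice_mean q l u y r \<zeta> e \<mu> \<tau>)
      \<le> 1 / (1 - \<delta>) * (INF \<tau>\<in>{s..t} \<inter> J. slice_mean q l u y r \<zeta> e \<mu> \<tau>)
        + \<gamma> / ((1 - \<delta>) * \<delta> powr \<gamma> * \<sigma> powr \<gamma>) * ((t - s) / r powr p) powr (q / (q - p + 1)))"
proof -
  (* With this b, the exponent m = (b + 1) (p - 1) is the midpoint of p - 1 and q. *)
  define w where "w = q - p + 1"
  have w: "w > 0" using assms by (simp add: w_def)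
  define b where "b = w / (2 * (p - 1))"
  define m where "m = (b + 1) * (p - 1)"
  have b0: "b > 0" using w assms by (simp add: b_def)
  have m_eq: "m = w / 2 + (p - 1)" using assms by (simp add: m_def b_def field_simps)
  have qm: "q - m = w / 2" unfolding m_eq w_def by (simp add: field_simps)
  have "0 < q - m" unfolding qm using w by simp
  then have mq: "m < q" by simp
  have lw: "2 * q * p^2 \<le> l * w" using assms(6) w unfolding w_def[symmetric] by (simp add: pos_divide_le_eq)
  have pp: "p \<le> p^2" using assms(3) by (simp add: power2_eq_square)
  have lqm: "p * q \<le> l * (q - m)"
  proof -
    have "p * q \<le> p^2 * q" using pp assms(5) by (intro mult_right_mono) auto
    then show ?thesis using lw unfolding qm by (simp add: mult.commute)
  qed
  have l1: "l > 1"
  proof (rule ccontr)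
    assume "\<not> l > 1"
    then have "l * w \<le> 1 * w" using w by (intro mult_right_mono) auto
    also have "w < q" using assms(3) by (simp add: w_def)
    finally have "p * q + p * q < q" using lqm unfolding qm by simp
    moreover have "q \<le> p * q" using assms(3,5) by simp
    ultimately show False using assms(3,5) by (smt (verit) mult_pos_pos)
  qed
  define C1 where "C1 = (K2 + 2) / (K1 * (b * 2 powr (- b / 2 - 1)))"
  have C1: "C1 > 0" using assms b0 by (simp add: C1_def)
  have l0: "l > 0" using l1 by simp
  obtain \<gamma> where \<gamma>: "\<gamma> > 0" and H:
    "\<And>\<delta> \<sigma> r \<kappa> S N Y. \<lbrakk>0 < \<delta>; \<delta> < 1; 0 < \<sigma>; \<sigma> < 1; 0 < r; 0 < \<kappa>; 0 \<le> S; 0 \<le> N;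
      \<And>\<delta>1 \<beta>2. 0 < \<delta>1 \<Longrightarrow> \<delta>1 \<le> 1 / 2 \<Longrightarrow> 0 < \<beta>2 \<Longrightarrow>
        Y \<le> 2 * \<delta>1 * S * N + 2 * (\<delta>1 * \<kappa> powr b / C1) powr (1 - p) * (l * c / (\<sigma> * r)) powr p * (r powr p * \<kappa> powr (q - p + 1)) * N *
          (\<beta>2 * 4 powr q * (S + \<kappa> powr q) + \<beta>2 powr (- (m / (q - m))))\<rbrakk>
     \<Longrightarrow> K2 * Y \<le> N * (\<delta> * S + \<gamma> / (\<delta> powr \<gamma> * \<sigma> powr \<gamma>) * \<kappa> powr q)"
    using absorb_parameters[OF assms(1-3) b0 m_def mq C1 l0 assms(7)] by blast
  show ?thesis
  proof (intro exI[of _ \<gamma>] conjI \<gamma> allI impI ballI)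
    fix \<Omega> :: "(real^'n) set" and T J A u y \<zeta> and r s t \<mu>m \<mu>p \<delta> \<sigma> :: real and e\<mu> :: "real \<times> real"
    assume h: "open \<Omega> \<and> T > 0 \<and> (J = {0<..<T} \<or> J = {0<..T}) \<and>
      structure_conditions K1 K2 p \<Omega> T A \<and>
      weak_solution p q \<Omega> J A u \<and> locally_bounded (\<Omega> \<times> {0<..<T}) u \<and>
      r > 0 \<and> s < t \<and> ball y r \<times> {s<..<t} \<subseteq> \<Omega> \<times> {0<..<T} \<and>
      (AE z in lebesgue_on (ball y r \<times> {s<..<t}). \<mu>m \<le> u z \<and> u z \<le> \<mu>p) \<and>
      \<delta> \<in> {0<..<1} \<and> \<sigma> \<in> {0<..<1} \<and> cutoff c y r \<sigma> \<zeta>"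
      and e\<mu>: "e\<mu> \<in> {(1, \<mu>p), (- 1, \<mu>m)}"
    (* The scale at which t - s = r^p kappa^(q - p + 1): all error terms become multiples of kappa^q. *)
    define \<kappa> where "\<kappa> = ((t - s) / r powr p) powr (1 / w)"
    have r: "r > 0" "s < t" using h by auto
    have \<kappa>: "\<kappa> > 0" using r by (simp add: \<kappa>_def)
    have \<kappa>w: "r powr p * \<kappa> powr (q - p + 1) = t - s"
      unfolding w_def[symmetric] using r w by (simp add: \<kappa>_def powr_powr)
    have \<kappa>q: "\<kappa> powr q = ((t - s) / r powr p) powr (q / (q - p + 1))"
      unfolding w_def[symmetric] by (simp add: \<kappa>_def powr_powr)
    have sub: "ball y r \<subseteq> \<Omega>" "{s<..<t} \<subseteq> {0<..<T}"
    proof -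
      have ne: "(s + t) / 2 \<in> {s<..<t}" "y \<in> ball y r" using r by auto
      show "ball y r \<subseteq> \<Omega>" using h ne(1) by blast
      show "{s<..<t} \<subseteq> {0<..<T}" using h ne(2) by blast
    qed
    have bd: "AE z in lebesgue_on (ball y r \<times> {s<..<t}). \<mu>m \<le> u z \<and> u z \<le> \<mu>p" using h by blast
    (* The bounds hold at some point of the cylinder, which has positive measure. *)
    have lohi: "\<mu>m \<le> \<mu>p"
    proof (rule ccontr)
      assume "\<not> \<mu>m \<le> \<mu>p"
      have Q: "ball y r \<times> {s<..<t} \<in> sets (lebesgue :: ((real^'n) \<times> real) measure)"
        by (intro borel_open[THEN sets_completionI_sets[of _ lborel, unfolded sets_lborel]] open_Times) auto
      have "AE z in lborel. z \<in> ball y r \<times> {s<..<t} \<longrightarrow> \<mu>m \<le> u z \<and> u z \<le> \<mu>p"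
        by (rule AE_lebesgue_on_lborel[OF bd Q])
      from AE_slices[OF this]
      have "AE \<sigma> in lborel. \<sigma> \<notin> {s<..<t}"
      proof eventually_elim
        fix \<sigma> assume a: "AE x in lborel. (x, \<sigma>) \<in> ball y r \<times> {s<..<t} \<longrightarrow> \<mu>m \<le> u (x, \<sigma>) \<and> u (x, \<sigma>) \<le> \<mu>p"
        show "\<sigma> \<notin> {s<..<t}"
        proof
          assume \<sigma>: "\<sigma> \<in> {s<..<t}"
          from a have "AE x in lborel. x \<notin> ball y r"
            by eventually_elim (use \<sigma> \<open>\<not> \<mu>m \<le> \<mu>p\<close> in auto)
          then have "ball y r \<in> null_sets lborel"
            by (subst AE_iff_null_sets) auto
          then have "emeasure lborel (ball y r) = 0" by blast
          moreover have "emeasure lborel (ball y r) = ennreal (measure lborel (ball y r))"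
            by (intro emeasure_eq_ennreal_measure) (use emeasure_lborel_ball_finite[of y r] in auto)
          ultimately show False using content_ball_pos[OF r(1), of y] by simp
        qed
      qed
      then show False using AE_point_in_interval[OF _ r(2)] by blast
    qed
    obtain e \<mu> where em: "e\<mu> = (e, \<mu>)" and e: "e = 1 \<or> e = - 1" and \<mu>: "\<mu> = (if e = 1 then \<mu>p else \<mu>m)"
      using e\<mu> by auto
    have \<delta>: "0 < \<delta>" "\<delta> < 1" and \<sigma>: "0 < \<sigma>" "\<sigma> < 1" using h by auto
    define \<Gamma> where "\<Gamma> = \<gamma> / (\<delta> powr \<gamma> * \<sigma> powr \<gamma>) * \<kappa> powr q"
    have \<Gamma>: "\<Gamma> \<ge> 0" using \<gamma> by (simp add: \<Gamma>_def)
    have "(SUP \<tau>\<in>{s..t} \<inter> J. slice_mean q l u y r \<zeta> e \<mu> \<tau>)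
      \<le> 1 / (1 - \<delta>) * (INF \<tau>\<in>{s..t} \<inter> J. slice_mean q l u y r \<zeta> e \<mu> \<tau>) + \<Gamma> / (1 - \<delta>)"
    proof (rule slice_comparison[where \<kappa>=\<kappa> and b=b and m=m and c=c and \<sigma>=\<sigma>, OF assms(1,2,3,5) _ _ _ _ r sub bd lohi e \<mu> _ assms(7) \<sigma>(1) \<kappa> b0 m_def mq lqm l1 C1_def \<delta> \<Gamma>])
      fix S N Y :: real
      assume S: "0 \<le> S" and N: "0 \<le> N" and Y: "\<And>\<delta>1 \<beta>2. 0 < \<delta>1 \<Longrightarrow> \<delta>1 \<le> 1 / 2 \<Longrightarrow> 0 < \<beta>2 \<Longrightarrow>
        Y \<le> 2 * \<delta>1 * S * N + 2 * (\<delta>1 * \<kappa> powr b / C1) powr (1 - p) * (l * c / (\<sigma> * r)) powr p * (t - s) * N *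
          (\<beta>2 * 4 powr q * (S + \<kappa> powr q) + \<beta>2 powr (- (m / (q - m))))"
      show "K2 * Y \<le> N * (\<delta> * S + \<Gamma>)"
        unfolding \<Gamma>_def by (rule H[OF \<delta> \<sigma> r(1) \<kappa> S N]) (unfold \<kappa>w, rule Y)
    qed (use h in auto)
    moreover have "\<Gamma> / (1 - \<delta>) = \<gamma> / ((1 - \<delta>) * \<delta> powr \<gamma> * \<sigma> powr \<gamma>) * ((t - s) / r powr p) powr (q / (q - p + 1))"
      unfolding \<Gamma>_def \<kappa>q by (simp add: mult_ac)
    ultimately show "case e\<mu> of (e, \<mu>) \<Rightarrow> (SUP \<tau>\<in>{s..t} \<inter> J. slice_mean q l u y r \<zeta> e \<mu> \<tau>)
      \<le> 1 / (1 - \<delta>) * (INF \<tau>\<in>{s..t} \<inter> J. slice_mean q l u y r \<zeta> e \<mu> \<tau>)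
        + \<gamma> / ((1 - \<delta>) * \<delta> powr \<gamma> * \<sigma> powr \<gamma>) * ((t - s) / r powr p) powr (q / (q - p + 1))"
      unfolding em by simp
  qed
qed

end
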